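(* Let $\mathbb C$ be any VC class and let $\mathcal A_p$ be any passive learning algorithm achieving a label complexity $\Lambda_p$. Then the active learning algorithm obtained by running Meta-Algorithm 3 with $\mathcal A_p$ as its passive-algorithm input achieves a label complexity $\Lambda_a$ that, for every distribution $\mathcal P$ on $\mathcal X$ and every classifier $f\in\mathbb C$, satisfies (as $\varepsilon\to0^+$) $$\Lambda_a(\varepsilon,f,\mathcal P)=O\left(\tilde\theta_f\left(\Lambda_p(\varepsilon/4,f,\mathcal P)^{-1}\right)\log^2\frac{\Lambda_p(\varepsilon/4,f,\mathcal P)}{\varepsilon}\right).$$
   Context: Setting. $(\mathcal X,\mathcal F)$ is a standard Borel space; a classifier is a measurable $h:\mathcal X\to\{-1,+1\}$; a concept space $\mathbb C$ is a set of classifiers; a VC class is a concept space whose VC dimension $d$ satisfies $0<d<\infty$. All sets arising are implicitly assumed measurable. For a probability measure ("distribution") $\mathcal P$ on $\mathcal X$ and a target function $f\in\mathbb C$: $X_1,X_2,\ldots$ are i.i.d. $\mathcal P$, $Y_i=f(X_i)$, $\mathcal Z_m=((X_1,Y_1),\ldots,(X_m,Y_m))$, and $\mathrm{er}(h)=\mathcal P(x:h(x)\ne f(x))$. A passive learning algorithm is a (possibly randomized) map $\mathcal A$ from finite sequences $\mathcal L\in\bigcup_n(\mathcal X\times\{-1,+1\})^n$ to classifiers. An active learning algorithm (possibly randomized) gets a label budget $n\in\mathbb N$ and access to the unlabeled data; it sequentially requests labels $Y_i$ of indices of its choice (choices may depend on labels already seen), at most $n$ in total, and returns a classifier $\mathcal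 A(n)$. A passive (resp. active) algorithm achieves label complexity $\Lambda$ if for every $f\in\mathbb C$, distribution $\mathcal P$, $\varepsilon\in(0,1)$ and integer $n\ge\Lambda(\varepsilon,f,\mathcal P)$, $\mathbb E[\mathrm{er}(\mathcal A(\mathcal Z_n))]\le\varepsilon$ (resp. $\mathbb E[\mathrm{er}(\mathcal A(n))]\le\varepsilon$). Label complexities take values in $\{1,2,\ldots\}\cup\{\infty\}$; the claimed bound is vacuous where $\Lambda_p=\infty$. Shattering. $\mathcal H$ shatters $S=(x_1,\ldots,x_k)\in\mathcal X^k$ if for all $(y_1,\ldots,y_k)\in\{-1,+1\}^k$ some $h\in\mathcal H$ has $h(x_i)=y_i$ for all $i$. $\mathcal X^0=\{\varnothing\}$, $\mathcal P^0(\mathcal X^0)=1$, and $\mathcal H$ shatters $\varnothing$ iff $\mathcal H\neq\emptyset$. $S\cup\{x\}$ denotes the tuple $S$ extended by $x$. $\mathcal H[(x,y)]=\{h\in\mathcal H:h(x)=y\}$. $\mathrm{DIS}(\mathcal H)=\{x:\exists h_1,h_2\in\mathcal H,h_1(x)\neq h_2(x)\}$. For a finite labeled sequence $Q$, $\mathrm{er}_Q(h)$ is the fraction of $(x,y)\in Q$ with $h(x)\neq y$, and $\mathrm{er}_\emptyset(h)=0$. The quantity $\tilde\theta_f$ (with respect to $\mathbb C,\mathcal P$). $\mathrm B(f,r)=\{g\in\mathbb C:\mathcal P(x:g(x)\ne f(x))\le r\}$. The $k$-dimensional shatter core is $\partial^kf=\lim_{r\to0^+}\{S\in\mathcal X^k:\mathrm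 B(f,r)\text{ shatters }S\}$ (decreasing limit). For $k\in\mathbb N$, $\varepsilon\ge0$, $\theta_f^{(k)}(\varepsilon)=1\vee\sup_{r>\varepsilon}\mathcal P^k(S\in\mathcal X^k:\mathrm B(f,r)\text{ shatters }S)/r$. $\tilde d_f=\min\{k\in\mathbb N:\mathcal P^k(\partial^kf)=0\}$ (at most $d+1$), and $\tilde\theta_f(\varepsilon)=\theta_f^{(\tilde d_f)}(\varepsilon)$. Estimators. The algorithm also has access to two further unlabeled i.i.d.-$\mathcal P$ sequences $W_1=(w_1,w_2,\ldots)$ and $W_2=(w_1',w_2',\ldots)$, independent of each other and of $X_1,X_2,\ldots$ (e.g. obtained by splitting the unlabeled data stream in three). For $k\ge2$ let $S_i^{(k)}=(w'_{1+(i-1)(k-1)},\ldots,w'_{i(k-1)})\in\mathcal X^{k-1}$. For $\mathcal H\subseteq\mathbb C$, $x\in\mathcal X$, $y\in\{-1,+1\}$, $m\in\mathbb N$: for $k=1$, $\hat\Gamma_m^{(1)}(x,y,\mathcal H)=\mathbb 1[\forall h\in\mathcal H,\ h(x)=y]$ and $\hat\Delta_m^{(1)}(x,\mathcal H)=\mathbb 1[x\in\mathrm{DIS}(\mathcal H)]$; for $k\ge2$, $M_m^{(k)}(\mathcal H)=\max\{1,\#\{i\le m^3:\mathcal H\text{ shatters }S_i^{(k)}\}\}$, $\hat\Gamma_m^{(k)}(x,y,\mathcal H)=\frac{1}{M_m^{(k)}(\mathcal H)}\#\{i\le m^3:\mathcal H\text{ shatters }S_i^{(k)},\ \mathcal H[(x,-y)]\text{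 does not shatter }S_i^{(k)}\}$, $\hat\Delta_m^{(k)}(x,\mathcal H)=\frac{1}{M_m^{(k)}(\mathcal H)}\#\{i\le m^3:\mathcal H\text{ shatters }S_i^{(k)}\cup\{x\}\}$; and for all $k\geq 1$, $\hat\Delta_m^{(k)}(\mathcal H)=\frac2m+\frac1{m^3}\#\{i\le m^3:\hat\Delta_m^{(k)}(w_i,\mathcal H)\ge 1/8\}$. Meta-Algorithm 3 (input: passive algorithm $\mathcal A_p$, budget $n$). 0. $V\gets V_0=\mathbb C$, $T_0\gets\lceil2n/3\rceil$, $t\gets0$, $m\gets0$. 1. For $k=1,\ldots,d+1$: 2. $\mathcal L_k\gets()$, $T_k\gets T_{k-1}-t$, then $t\gets0$. 3. While $t<\lceil T_k/4\rceil$ and $m\le k\cdot2^n$: 4. $m\gets m+1$; 5. if $\hat\Delta_m^{(k)}(X_m,V)\ge1/2$, 6. request $Y_m$, let $\hat y\gets Y_m$, $t\gets t+1$; 7. else $\hat y\gets\arg\max_{y\in\{-1,+1\}}\hat\Gamma_m^{(k)}(X_m,y,V)$; 8. $V\gets V_m=V_{m-1}[(X_m,\hat y)]$. 9. (after the while loop) $\hat\Delta^{(k)}\gets\hat\Delta_m^{(k)}(V)$. 10. Do $\lfloor T_k/(3\hat\Delta^{(k)})\rfloor$ times: 11. $m\gets m+1$; 12. if $\hat\Delta_m^{(k)}(X_m,V)\ge1/2$ and $t<\lfloor3T_k/4\rfloor$, 13. request $Y_m$, let $\hat y\gets Y_m$, $t\gets t+1$; 14. else $\hat y\gets\arg\max_{y}\hat\Gamma_m^{(k)}(X_m,y,V)$;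 15. append $(X_m,\hat y)$ to $\mathcal L_k$ and let $V\gets V_m=V_{m-1}[(X_m,\hat y)]$. 16. Return $\mathrm{ActiveSelect}(\{\mathcal A_p(\mathcal L_1),\ldots,\mathcal A_p(\mathcal L_{d+1})\},\lfloor n/3\rfloor,\{X_{m+1},X_{m+2},\ldots\})$. ActiveSelect (input: classifiers $h_1,\ldots,h_N$, budget $m$, unlabeled sequence $\mathcal U$): for each $1\le j<k\le N$, let $R_{jk}$ be the first $\lfloor\frac{m}{j(N-j)\ln(eN)}\rfloor$ points of $\mathcal U$ in $\{x:h_j(x)\ne h_k(x)\}$ (if they exist), request their labels, let $Q_{jk}$ be the resulting labeled set, and let $m_{kj}=\mathrm{er}_{Q_{jk}}(h_k)$. Return $h_{\hat k}$ with $\hat k=\max\{k\in\{1,\ldots,N\}:\max_{j<k}m_{kj}\le7/12\}$ (the condition is vacuous for $k=1$). *)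

theory Defs
  imports "HOL-Probability.Probability"
begin

text \<open>
  The instance space is a Polish type with its Borel sigma-algebra. The label \<open>+1\<close> is \<^term>\<open>True\<close>
  and \<open>-1\<close> is \<^term>\<open>False\<close>, so the label \<open>-y\<close> is \<open>\<not> y\<close>. Tuples of points are lists where the
  algorithm handles them, and points of the product space over \<open>{..<k}\<close> where they are measured.
  Data sequences are indexed from 1; the component with index 0 is never used.
\<close>

type_synonym 'a classifier = "'a \<Rightarrow> bool"
type_synonym 'a label_complexity = "real \<Rightarrow> 'a classifier \<Rightarrow> 'a measure \<Rightarrow> enat"

definition classifiers :: "('a::polish_space) classifier set" where
  "classifiers = borel \<rightarrow>\<^sub>M count_space UNIV"

definition distribution :: "('a::polish_space) measure \<Rightarrow> bool" where
  "distribution P \<longleftrightarrow> prob_space P \<and> sets P = sets borel"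

definition err :: "('a::polish_space) measure \<Rightarrow> 'a classifier \<Rightarrow> 'a classifier \<Rightarrow> real" where
  "err P f h = measure P {x. h x \<noteq> f x}"

section \<open>Shattering and VC dimension\<close>

definition shatters :: "'a classifier set \<Rightarrow> 'a list \<Rightarrow> bool" where
  "shatters H S \<longleftrightarrow> (\<forall>ys. length ys = length S \<longrightarrow> (\<exists>h\<in>H. map h S = ys))"

definition vc_dim :: "'a classifier set \<Rightarrow> enat" where
  "vc_dim H = (SUP S\<in>{S. shatters H S}. enat (length S))"

definition vc_class :: "('a::polish_space) classifier set \<Rightarrow> bool" where
  "vc_class C \<longleftrightarrow> C \<subseteq> classifiers \<and> 0 < vc_dim C \<and> vc_dim C < \<infinity>"

definition restr :: "'a classifier set \<Rightarrow> 'a \<Rightarrow> bool \<Rightarrow> 'a classifier set" where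
  "restr H x y = {h \<in> H. h x = y}"

definition DIS :: "'a classifier set \<Rightarrow> 'a set" where
  "DIS H = {x. \<exists>h1\<in>H. \<exists>h2\<in>H. h1 x \<noteq> h2 x}"

text \<open>
  The measurability convention for a set \<open>H\<close> of classifiers. Events such as ``the classifiers of
  \<open>H\<close> consistent with a labelled sequence shatter \<open>S\<close>'' are finite Boolean combinations of the sets
  below, because shattering quantifies over finitely many label patterns.
\<close>

definition class_measurable :: "('a::polish_space) classifier set \<Rightarrow> bool" where
  "class_measurable H \<longleftrightarrow>
     (\<forall>(n::nat) (ys :: nat \<Rightarrow> bool).
        {x \<in> space (\<Pi>\<^sub>M i\<in>{..<n}. borel). \<exists>h\<in>H. \<forall>i<n. h (x i) = ys i}
          \<in> sets (\<Pi>\<^sub>M i\<in>{..<n}. (borel :: 'a measure)))"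

section \<open>The generalized disagreement coefficient\<close>

definition concept_ball ::
  "('a::polish_space) classifier set \<Rightarrow> 'a measure \<Rightarrow> 'a classifier \<Rightarrow> real \<Rightarrow> 'a classifier set" where
  "concept_ball C P f r = {g \<in> C. measure P {x. g x \<noteq> f x} \<le> r}"

definition shattered_tuples ::
  "('a::polish_space) measure \<Rightarrow> nat \<Rightarrow> 'a classifier set \<Rightarrow> (nat \<Rightarrow> 'a) set" where
  "shattered_tuples P k H = {x \<in> space (\<Pi>\<^sub>M i\<in>{..<k}. P). shatters H (map x [0..<k])}"

text \<open>The balls grow with \<open>r\<close>, so the limit as \<open>r\<close> tends to \<open>0\<close> from above is an intersection.\<close>

definition shatter_core ::
  "('a::polish_space) classifier set \<Rightarrow> 'a measure \<Rightarrow> 'a classifier \<Rightarrow> nat \<Rightarrow> (nat \<Rightarrow> 'a) set" where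
  "shatter_core C P f k = (\<Inter>r\<in>{0<..}. shattered_tuples P k (concept_ball C P f r))"

definition theta ::
  "('a::polish_space) classifier set \<Rightarrow> 'a measure \<Rightarrow> 'a classifier \<Rightarrow> nat \<Rightarrow> real \<Rightarrow> ereal" where
  "theta C P f k \<epsilon> =
     max 1 (SUP r\<in>{\<epsilon><..}.
       ereal (measure (\<Pi>\<^sub>M i\<in>{..<k}. P) (shattered_tuples P k (concept_ball C P f r)) / r))"

text \<open>For \<open>f \<in> C\<close> the index \<open>k = 0\<close> is never selected: every ball contains \<open>f\<close>.\<close>

definition d_tilde ::
  "('a::polish_space) classifier set \<Rightarrow> 'a measure \<Rightarrow> 'a classifier \<Rightarrow> nat" where
  "d_tilde C P f = (LEAST k. measure (\<Pi>\<^sub>M i\<in>{..<k}. P) (shatter_core C P f k) = 0)"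

definition theta_tilde ::
  "('a::polish_space) classifier set \<Rightarrow> 'a measure \<Rightarrow> 'a classifier \<Rightarrow> real \<Rightarrow> ereal" where
  "theta_tilde C P f \<epsilon> = theta C P f (d_tilde C P f) \<epsilon>"

section \<open>Passive learning\<close>

text \<open>
  A randomized algorithm takes a random seed drawn from the probability space \<open>R\<close>. Joint
  measurability makes each output a classifier and its error a random variable.
\<close>

definition passive_algorithm ::
  "'r measure \<Rightarrow> ('r \<Rightarrow> ('a::polish_space \<times> bool) list \<Rightarrow> 'a classifier) \<Rightarrow> bool" where
  "passive_algorithm R A \<longleftrightarrow>
     prob_space R \<and>
     (\<forall>n. (\<lambda>(\<rho>, z, x). A \<rho> (map z [0..<n]) x)
        \<in> R \<Otimes>\<^sub>M (\<Pi>\<^sub>M i\<in>{..<n}. borel \<Otimes>\<^sub>M count_space UNIV) \<Otimes>\<^sub>M borel \<rightarrow>\<^sub>M count_space UNIV)"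

definition iid :: "'b measure \<Rightarrow> (nat \<Rightarrow> 'b) measure" where
  "iid M = (\<Pi>\<^sub>M i\<in>UNIV. M)"

definition sample :: "'a classifier \<Rightarrow> (nat \<Rightarrow> 'a) \<Rightarrow> nat \<Rightarrow> ('a \<times> bool) list" where
  "sample f X n = map (\<lambda>i. (X i, f (X i))) [1..<n + 1]"

text \<open>Integrability is required because the integral of a non-integrable function is \<open>0\<close>.\<close>

definition expectation_le :: "'w measure \<Rightarrow> ('w \<Rightarrow> real) \<Rightarrow> real \<Rightarrow> bool" where
  "expectation_le M e b \<longleftrightarrow> integrable M e \<and> (\<integral>\<omega>. e \<omega> \<partial>M) \<le> b"

definition passive_achieves ::
  "('a::polish_space) classifier set \<Rightarrow> 'r measure \<Rightarrow>
   ('r \<Rightarrow> ('a \<times> bool) list \<Rightarrow> 'a classifier) \<Rightarrow> 'a label_complexity \<Rightarrow> bool" where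
  "passive_achieves C R A \<Lambda> \<longleftrightarrow>
     (\<forall>f\<in>C. \<forall>P. distribution P \<longrightarrow> (\<forall>\<epsilon>\<in>{0<..<1}.
        1 \<le> \<Lambda> \<epsilon> f P \<and>
        (\<forall>n. \<Lambda> \<epsilon> f P \<le> enat n \<longrightarrow>
           expectation_le (iid P \<Otimes>\<^sub>M R) (\<lambda>(X, \<rho>). err P f (A \<rho> (sample f X n))) \<epsilon>)))"

section \<open>Active learning\<close>

text \<open>
  An interactive computation either returns a result or requests the label of the data point with
  a given index and continues depending on the answer.
\<close>

datatype 'b query = Return 'b | Request nat "bool \<Rightarrow> 'b query"

primrec bindq :: "'b query \<Rightarrow> ('b \<Rightarrow> 'c query) \<Rightarrow> 'c query" (infixl "\<bind>q" 54) where
  "(Return b) \<bind>q g = g b"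
| "(Request i q) \<bind>q g = Request i (\<lambda>y. q y \<bind>q g)"

primrec run :: "(nat \<Rightarrow> bool) \<Rightarrow> 'b query \<Rightarrow> 'b" where
  "run Y (Return b) = b"
| "run Y (Request i q) = run Y (q (Y i))"

primrec within_budget :: "'b query \<Rightarrow> nat \<Rightarrow> bool" where
  "within_budget (Return b) n \<longleftrightarrow> True"
| "within_budget (Request i q) n \<longleftrightarrow> 0 < n \<and> (\<forall>y. within_budget (q y) (n - 1))"

text \<open>
  The unlabelled data \<open>X\<close>, the two auxiliary unlabelled sequences \<open>W1\<close> and \<open>W2\<close>, and a sequence of
  random seeds.
\<close>

type_synonym ('a, 'r) active_data = "(nat \<Rightarrow> 'a) \<times> (nat \<Rightarrow> 'a) \<times> (nat \<Rightarrow> 'a) \<times> (nat \<Rightarrow> 'r)"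

definition active_space ::
  "('a::polish_space) measure \<Rightarrow> 'r measure \<Rightarrow> ('a, 'r) active_data measure" where
  "active_space P R = iid P \<Otimes>\<^sub>M iid P \<Otimes>\<^sub>M iid P \<Otimes>\<^sub>M iid R"

definition active_algorithm ::
  "(nat \<Rightarrow> ('a, 'r) active_data \<Rightarrow> 'a classifier query) \<Rightarrow> bool" where
  "active_algorithm A \<longleftrightarrow> (\<forall>n \<omega>. within_budget (A n \<omega>) n)"

definition active_achieves ::
  "('a::polish_space) classifier set \<Rightarrow> 'r measure \<Rightarrow>
   (nat \<Rightarrow> ('a, 'r) active_data \<Rightarrow> 'a classifier query) \<Rightarrow> 'a label_complexity \<Rightarrow> bool" where
  "active_achieves C R A \<Lambda> \<longleftrightarrow>
     active_algorithm A \<and>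
     (\<forall>f\<in>C. \<forall>P. distribution P \<longrightarrow> (\<forall>\<epsilon>\<in>{0<..<1}.
        1 \<le> \<Lambda> \<epsilon> f P \<and>
        (\<forall>n. \<Lambda> \<epsilon> f P \<le> enat n \<longrightarrow>
           expectation_le (active_space P R)
             (\<lambda>\<omega>. err P f (run (\<lambda>i. f (fst \<omega> i)) (A n \<omega>))) \<epsilon>)))"

section \<open>The estimators\<close>

definition block :: "(nat \<Rightarrow> 'a) \<Rightarrow> nat \<Rightarrow> nat \<Rightarrow> 'a list" where
  "block W k i = map W [1 + (i - 1) * (k - 1)..<i * (k - 1) + 1]"

definition M_hat :: "(nat \<Rightarrow> 'a) \<Rightarrow> nat \<Rightarrow> nat \<Rightarrow> 'a classifier set \<Rightarrow> nat" where
  "M_hat W2 k m H = max 1 (card {i \<in> {1..m ^ 3}. shatters H (block W2 k i)})"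

definition Gamma_hat ::
  "(nat \<Rightarrow> 'a) \<Rightarrow> nat \<Rightarrow> nat \<Rightarrow> 'a \<Rightarrow> bool \<Rightarrow> 'a classifier set \<Rightarrow> real" where
  "Gamma_hat W2 k m x y H =
     (if k = 1 then of_bool (\<forall>h\<in>H. h x = y)
      else real (card {i \<in> {1..m ^ 3}. shatters H (block W2 k i) \<and>
             \<not> shatters (restr H x (\<not> y)) (block W2 k i)}) / real (M_hat W2 k m H))"

definition Delta_hat ::
  "(nat \<Rightarrow> 'a) \<Rightarrow> nat \<Rightarrow> nat \<Rightarrow> 'a \<Rightarrow> 'a classifier set \<Rightarrow> real" where
  "Delta_hat W2 k m x H =
     (if k = 1 then of_bool (x \<in> DIS H)
      else real (card {i \<in> {1..m ^ 3}. shatters H (block W2 k i @ [x])}) / real (M_hat W2 k m H))"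

text \<open>In the meta-algorithm \<open>m = 0\<close> occurs here only for the label budget \<open>0\<close>.\<close>

definition Delta_hat_total ::
  "(nat \<Rightarrow> 'a) \<Rightarrow> (nat \<Rightarrow> 'a) \<Rightarrow> nat \<Rightarrow> nat \<Rightarrow> 'a classifier set \<Rightarrow> real" where
  "Delta_hat_total W1 W2 k m H =
     2 / real m + real (card {i \<in> {1..m ^ 3}. Delta_hat W2 k m (W1 i) H \<ge> 1 / 8}) / real (m ^ 3)"

text \<open>The maximizing label; \<open>tie\<close> decides when both labels attain the maximum.\<close>

definition infer ::
  "(nat \<Rightarrow> 'a classifier) \<Rightarrow> (nat \<Rightarrow> 'a) \<Rightarrow> nat \<Rightarrow> nat \<Rightarrow> 'a \<Rightarrow> 'a classifier set \<Rightarrow> bool" where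
  "infer tie W2 k m x H =
     (if Gamma_hat W2 k m x True H > Gamma_hat W2 k m x False H then True
      else if Gamma_hat W2 k m x True H < Gamma_hat W2 k m x False H then False
      else tie m x)"

section \<open>ActiveSelect\<close>

primrec request_labels :: "(nat \<Rightarrow> 'a) \<Rightarrow> nat list \<Rightarrow> ('a \<times> bool) list query" where
  "request_labels X [] = Return []"
| "request_labels X (i # is) =
     Request i (\<lambda>y. request_labels X is \<bind>q (\<lambda>Q. Return ((X i, y) # Q)))"

primrec request_tables ::
  "(nat \<Rightarrow> 'a) \<Rightarrow> (nat \<times> nat \<Rightarrow> nat list) \<Rightarrow> (nat \<times> nat) list \<Rightarrow>
   (nat \<times> nat \<Rightarrow> ('a \<times> bool) list) query" where
  "request_tables X I [] = Return (\<lambda>_. [])"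
| "request_tables X I (p # ps) =
     request_labels X (I p) \<bind>q (\<lambda>Q.
     request_tables X I ps \<bind>q (\<lambda>F. Return (F(p := Q))))"

definition emp_err :: "('a \<times> bool) list \<Rightarrow> 'a classifier \<Rightarrow> real" where
  "emp_err Q h = (if Q = [] then 0 else real (length (filter (\<lambda>(x, y). h x \<noteq> y) Q)) / real (length Q))"

text \<open>Indices of the first \<open>c\<close> points of \<open>X (m0 + 1), X (m0 + 2), \<dots>\<close> in \<open>D\<close>, or of all if there are fewer.\<close>

definition first_indices :: "(nat \<Rightarrow> 'a) \<Rightarrow> nat \<Rightarrow> 'a set \<Rightarrow> nat \<Rightarrow> nat list" where
  "first_indices X m0 D c =
     sorted_list_of_set {i. m0 < i \<and> X i \<in> D \<and> card {i' \<in> {m0<..i}. X i' \<in> D} \<le> c}"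

definition active_select ::
  "(nat \<Rightarrow> 'a classifier) \<Rightarrow> nat \<Rightarrow> nat \<Rightarrow> (nat \<Rightarrow> 'a) \<Rightarrow> nat \<Rightarrow> 'a classifier query" where
  "active_select h N b X m0 =
     request_tables X
       (\<lambda>(j, k). first_indices X m0 {x. h j x \<noteq> h k x}
          (nat \<lfloor>real b / (real j * real (N - j) * ln (exp 1 * real N))\<rfloor>))
       [(j, k). k \<leftarrow> [1..<N + 1], j \<leftarrow> [1..<k]]
     \<bind>q (\<lambda>Q. Return (h (Max {k \<in> {1..N}. \<forall>j\<in>{1..<k}. emp_err (Q (j, k)) (h k) \<le> 7 / 12})))"

section \<open>The meta-algorithm\<close>

text \<open>\<open>T\<close> is the label budget of round \<open>k\<close>.\<close>

function while_loop ::
  "(nat \<Rightarrow> 'a classifier) \<Rightarrow> (nat \<Rightarrow> 'a) \<Rightarrow> (nat \<Rightarrow> 'a) \<Rightarrow> nat \<Rightarrow> nat \<Rightarrow> nat \<Rightarrow>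
   nat \<Rightarrow> nat \<Rightarrow> 'a classifier set \<Rightarrow> (nat \<times> nat \<times> 'a classifier set) query" where
  "while_loop tie X W2 n k T t m V =
     (if t < nat \<lceil>real T / 4\<rceil> \<and> m \<le> k * 2 ^ n then
        (if Delta_hat W2 k (m + 1) (X (m + 1)) V \<ge> 1 / 2
         then Request (m + 1) (\<lambda>y.
           while_loop tie X W2 n k T (t + 1) (m + 1) (restr V (X (m + 1)) y))
         else while_loop tie X W2 n k T t (m + 1)
           (restr V (X (m + 1)) (infer tie W2 k (m + 1) (X (m + 1)) V)))
      else Return (t, m, V))"
  by pat_completeness auto
termination
  by (relation "Wellfounded.measure (\<lambda>(tie, X, W2, n, k, T, t, m, V). Suc (k * 2 ^ n) - m)") auto

declare while_loop.simps [simp del]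

primrec do_loop ::
  "(nat \<Rightarrow> 'a classifier) \<Rightarrow> (nat \<Rightarrow> 'a) \<Rightarrow> (nat \<Rightarrow> 'a) \<Rightarrow> nat \<Rightarrow> nat \<Rightarrow> nat \<Rightarrow>
   ('a \<times> bool) list \<Rightarrow> nat \<Rightarrow> nat \<Rightarrow> 'a classifier set \<Rightarrow>
   (('a \<times> bool) list \<times> nat \<times> nat \<times> 'a classifier set) query" where
  "do_loop tie X W2 k T 0 L t m V = Return (L, t, m, V)"
| "do_loop tie X W2 k T (Suc r) L t m V =
     (if Delta_hat W2 k (m + 1) (X (m + 1)) V \<ge> 1 / 2 \<and> t < nat \<lfloor>3 * real T / 4\<rfloor>
      then Request (m + 1) (\<lambda>y.
        do_loop tie X W2 k T r (L @ [(X (m + 1), y)]) (t + 1) (m + 1) (restr V (X (m + 1)) y))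
      else let y = infer tie W2 k (m + 1) (X (m + 1)) V in
        do_loop tie X W2 k T r (L @ [(X (m + 1), y)]) t (m + 1) (restr V (X (m + 1)) y))"

text \<open>
  The first \<open>k\<close> rounds, resulting in \<open>([L_1, \<dots>, L_k], T_k, t, m, V)\<close>, where \<open>t\<close> counts the labels
  requested in round \<open>k\<close>. Always \<open>t \<le> T_k\<close>, so the subtraction does not truncate.
\<close>

primrec rounds ::
  "'a classifier set \<Rightarrow> (nat \<Rightarrow> 'a classifier) \<Rightarrow> (nat \<Rightarrow> 'a) \<Rightarrow> (nat \<Rightarrow> 'a) \<Rightarrow> (nat \<Rightarrow> 'a) \<Rightarrow>
   nat \<Rightarrow> nat \<Rightarrow> (('a \<times> bool) list list \<times> nat \<times> nat \<times> nat \<times> 'a classifier set) query" where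
  "rounds C tie X W1 W2 n 0 = Return ([], nat \<lceil>2 * real n / 3\<rceil>, 0, 0, C)"
| "rounds C tie X W1 W2 n (Suc k) =
     rounds C tie X W1 W2 n k \<bind>q (\<lambda>(Ls, T, t, m, V).
     while_loop tie X W2 n (Suc k) (T - t) 0 m V \<bind>q (\<lambda>(t', m', V').
     do_loop tie X W2 (Suc k) (T - t)
       (nat \<lfloor>real (T - t) / (3 * Delta_hat_total W1 W2 (Suc k) m' V')\<rfloor>) [] t' m' V'
     \<bind>q (\<lambda>(L, t'', m'', V''). Return (Ls @ [L], T - t, t'', m'', V''))))"

text \<open>The calls of the passive algorithm use independent seeds.\<close>

definition meta_algorithm ::
  "'a classifier set \<Rightarrow> (nat \<Rightarrow> 'a classifier) \<Rightarrow> ('r \<Rightarrow> ('a \<times> bool) list \<Rightarrow> 'a classifier) \<Rightarrow>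
   nat \<Rightarrow> ('a, 'r) active_data \<Rightarrow> 'a classifier query" where
  "meta_algorithm C tie A n = (\<lambda>(X, W1, W2, \<rho>).
     let d = the_enat (vc_dim C) in
     rounds C tie X W1 W2 n (d + 1) \<bind>q (\<lambda>(Ls, T, t, m, V).
     active_select (\<lambda>k. A (\<rho> k) (Ls ! (k - 1))) (d + 1) (n div 3) X m))"

end

theory Submission
  imports Defs
begin

text \<open>
  Let \<open>K\<close> be the first order at which the shatter core has probability 0, so that the cores of the
  orders below \<open>K\<close> have positive probability. In a round \<open>k \<le> K\<close>, once enough points are seen, the
  version space shatters almost every tuple of the core of order \<open>k - 1\<close> and few other tuples; hence the
  estimators concentrate, the inferred labels are correct, and only points \<open>x\<close> such that the version
  space shatters \<open>S @ [x]\<close> for a constant fraction of the core tuples \<open>S\<close> are requested. In round \<open>K\<close> the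
  probability of such points after \<open>m\<close> steps is at most a constant times \<open>\<theta> r\<close>, where the radius \<open>r\<close> of the
  version space is of order \<open>ln (l / \<epsilon>) / m\<close>. Summing over \<open>m \<le> l\<close> shows that a budget of order
  \<open>\<theta> (ln (l / \<epsilon>))\<^sup>2\<close> is not exhausted before \<open>l\<close> points are processed, and that the sample of round \<open>K\<close>
  then has at least \<open>l\<close> correctly labelled points. The sample begins at a stopping time, so by the strong
  Markov property the passive algorithm run on it has expected error at most \<open>\<epsilon> / 4\<close>. The final selection
  loses a factor 2 up to an exponentially small probability, as the labels requested in it come from
  points that are independent of the hypotheses.
\<close>

text \<open>The labels inferred in one round shape the version space of all later ones, so a single
  early mistake would be fatal, while the estimators of an order above 1 become reliable only after
  a number of points that depends on the target and the distribution. Two facts resolve this. For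
  \<open>k = 1\<close> inference is exact and needs no estimate; and the first round reads at least
  \<open>n / 6\<close> points, so every later round starts beyond a burn-in time that is itself
  proportional to \<open>n\<close>.

  One of the two logarithms is the confidence in the radius of the version space, the other is the
  harmonic sum of these radii. The passive accuracy \<open>\<epsilon> / 4\<close> becomes
  \<open>\<epsilon> / 2\<close> through the selection; the other half pays for the failure events,
  whose probability is of the order of the square of \<open>\<epsilon>\<close>.

  Whether a version space shatters a tuple is a question about possibly uncountably many concepts.
  Fixed label patterns keep each single estimate measurable, whereas a bad event concerning all
  concepts or a whole run is merely enclosed in a measurable set.\<close>

section \<open>The Sauer--Shelah lemma\<close>

text \<open>This is Pajor's form of the lemma.\<close>

lemma card_le_card_shattered:
  fixes A :: "'a set"
  assumes "finite A" "F \<subseteq> Pow A"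
  shows "card F \<le> card {S. S \<subseteq> A \<and> (\<forall>T\<subseteq>S. \<exists>B\<in>F. B \<inter> S = T)}"
  using assms
proof (induction A arbitrary: F rule: finite_induct)
  case empty
  show ?case
  proof (cases "F = {}")
    case False
    hence "F = {{}}" using empty by auto
    moreover have "{S. S \<subseteq> {} \<and> (\<forall>T\<subseteq>S. \<exists>B\<in>{{}}. B \<inter> S = T)} = {{}::'a set}" by auto
    ultimately show ?thesis by simp
  qed simp
next
  case (insert a A)
  \<comment> \<open>Deleting \<open>a\<close> identifies exactly the pairs \<open>B\<close>,
    \<open>insert a B\<close> that both lie in \<open>F\<close>; \<open>I\<close> keeps one set for
    each such pair, so the cardinalities add up. Sets shattered by \<open>U\<close> avoid
    \<open>a\<close>, and sets shattered by \<open>I\<close> stay shattered by \<open>F\<close>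
    after adding \<open>a\<close>.\<close>
  define U where "U = (\<lambda>B. B - {a}) ` F"
  define I where "I = {B. B \<subseteq> A \<and> B \<in> F \<and> insert a B \<in> F}"
  let ?sh = "\<lambda>F A. {S. S \<subseteq> A \<and> (\<forall>T\<subseteq>S. \<exists>B\<in>F. B \<inter> S = T)}"
  have fF: "finite F" using insert.prems insert.hyps by (meson finite_Pow_iff finite_insert finite_subset)
  have "U \<subseteq> Pow A" "I \<subseteq> Pow A" using insert.prems unfolding U_def I_def by auto
  hence IH: "card U \<le> card (?sh U A)" "card I \<le> card (?sh I A)" using insert.IH by auto
  define F0 where "F0 = {B\<in>F. a \<notin> B}"
  define F1 where "F1 = {B\<in>F. a \<in> B}"
  have F: "F = F0 \<union> F1" "F0 \<inter> F1 = {}" unfolding F0_def F1_def by auto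
  have fin: "finite F0" "finite F1" using fF unfolding F0_def F1_def by auto
  have i1: "inj_on (\<lambda>B. B - {a}) F1" unfolding F1_def inj_on_def by auto
  have "U = F0 \<union> (\<lambda>B. B - {a}) ` F1"
  proof -
    have "(\<lambda>B. B - {a}) ` F0 = (\<lambda>B. B) ` F0" by (rule image_cong) (auto simp: F0_def)
    thus ?thesis unfolding U_def F(1) image_Un by simp
  qed
  moreover have "I = F0 \<inter> (\<lambda>B. B - {a}) ` F1"
  proof
    show "I \<subseteq> F0 \<inter> (\<lambda>B. B - {a}) ` F1"
    proof
      fix B assume B: "B \<in> I"
      hence "a \<notin> B" using insert.hyps unfolding I_def by auto
      moreover have "insert a B \<in> F1" "insert a B - {a} = B" using B \<open>a \<notin> B\<close> unfolding I_def F1_def by auto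
      ultimately show "B \<in> F0 \<inter> (\<lambda>B. B - {a}) ` F1" using B unfolding I_def F0_def by (auto intro!: image_eqI[of _ _ "insert a B"])
    qed
    show "F0 \<inter> (\<lambda>B. B - {a}) ` F1 \<subseteq> I"
      using insert.prems unfolding I_def F0_def F1_def by (auto simp: insert_absorb)
  qed
  moreover have "card F = card F0 + card ((\<lambda>B. B - {a}) ` F1)"
    unfolding F(1) using card_Un_disjoint[OF fin F(2)] card_image[OF i1] by simp
  ultimately have cF: "card F = card U + card I"
    using card_Un_Int[OF fin(1), of "(\<lambda>B. B - {a}) ` F1"] fin by simp
  have fsh: "finite (?sh F (insert a A))" "finite (?sh U A)" "finite (?sh I A)" for F
    using insert.hyps by (auto intro: finite_subset[of _ "Pow (insert a A)"])
  have s1: "?sh U A \<subseteq> {S \<in> ?sh F (insert a A). a \<notin> S}"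
  proof
    fix S assume S: "S \<in> ?sh U A"
    hence aS: "a \<notin> S" using insert.hyps by auto
    have "\<exists>B\<in>F. B \<inter> S = T" if T: "T \<subseteq> S" for T
    proof -
      obtain B where "B \<in> F" "(B - {a}) \<inter> S = T" using S T unfolding U_def by blast
      thus ?thesis using aS by (intro bexI[of _ B]) auto
    qed
    thus "S \<in> {S \<in> ?sh F (insert a A). a \<notin> S}" using S aS by auto
  qed
  have s2: "insert a ` ?sh I A \<subseteq> {S \<in> ?sh F (insert a A). a \<in> S}"
  proof
    fix S' assume "S' \<in> insert a ` ?sh I A"
    then obtain S where S: "S \<in> ?sh I A" "S' = insert a S" by auto
    hence aS: "a \<notin> S" using insert.hyps by auto
    have "\<exists>B\<in>F. B \<inter> S' = T" if T: "T \<subseteq> S'" for T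
    proof -
      obtain B where B: "B \<in> I" "B \<inter> S = T - {a}" using S T by (auto dest!: spec[of _ "T - {a}"])
      have aB: "a \<notin> B" using B insert.hyps unfolding I_def by auto
      show ?thesis
      proof (cases "a \<in> T")
        case True
        have "insert a B \<inter> S' = T" using B(2) S(2) True by auto
        thus ?thesis using B(1) unfolding I_def by auto
      next
        case False
        have "B \<inter> S' = T" using B(2) S(2) False aB by auto
        thus ?thesis using B(1) unfolding I_def by auto
      qed
    qed
    thus "S' \<in> {S \<in> ?sh F (insert a A). a \<in> S}" using S by auto
  qed
  have "inj_on (insert a) (?sh I A)" 
  proof (rule inj_onI)
    fix S S' assume S: "S \<in> ?sh I A" "S' \<in> ?sh I A" and e: "insert a S = insert a S'"
    have "a \<notin> S" "a \<notin> S'" using S insert.hyps(2) by blast+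
    thus "S = S'" using e insert_ident by metis
  qed
  hence "card F \<le> card (?sh U A) + card (insert a ` ?sh I A)"
    using IH cF card_image[of "insert a" "?sh I A"] by linarith
  also have "\<dots> \<le> card {S \<in> ?sh F (insert a A). a \<notin> S} + card {S \<in> ?sh F (insert a A). a \<in> S}"
    by (intro add_mono card_mono s1 s2 finite_subset[OF _ fsh(1)[of F]]) blast+
  also have "\<dots> = card ({S \<in> ?sh F (insert a A). a \<notin> S} \<union> {S \<in> ?sh F (insert a A). a \<in> S})"
    by (intro card_Un_disjoint[symmetric] finite_subset[OF _ fsh(1)[of F]]) blast+
  also have "{S \<in> ?sh F (insert a A). a \<notin> S} \<union> {S \<in> ?sh F (insert a A). a \<in> S} = ?sh F (insert a A)" by auto
  finally show ?case .
qed

text \<open>A list of length \<open>d\<close> over \<open>A\<close> and one padding symbol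
  \<open>None\<close> enumerates such a subset, and these lists are easy to count.\<close>

lemma card_small_subsets_le:
  assumes "finite A"
  shows "card {S. S \<subseteq> A \<and> card S \<le> d} \<le> (card A + 1) ^ d"
proof -
  let ?X = "insert None (Some ` A)"
  let ?L = "{xs. set xs \<subseteq> ?X \<and> length xs = d}"
  have fin: "finite ?X" using assms by simp
  have "{S. S \<subseteq> A \<and> card S \<le> d} \<subseteq> (\<lambda>xs. {x. Some x \<in> set xs}) ` ?L"
  proof
    fix S assume "S \<in> {S. S \<subseteq> A \<and> card S \<le> d}"
    hence S: "S \<subseteq> A" "card S \<le> d" by auto
    obtain ys where ys: "set ys = S" "distinct ys" using finite_distinct_list[of S] S(1) assms finite_subset by blast
    hence ly: "length ys \<le> d" using S(2) distinct_card[of ys] by simp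
    let ?xs = "map Some ys @ replicate (d - length ys) None"
    have "?xs \<in> ?L" using ys(1) S ly by auto
    moreover have "S = {x. Some x \<in> set ?xs}" using ys(1) by auto
    ultimately show "S \<in> (\<lambda>xs. {x. Some x \<in> set xs}) ` ?L" by blast
  qed
  hence "card {S. S \<subseteq> A \<and> card S \<le> d} \<le> card ((\<lambda>xs. {x. Some x \<in> set xs}) ` ?L)"
    using finite_lists_length_eq[OF fin, of d] by (intro card_mono) auto
  also have "\<dots> \<le> card ?L" using finite_lists_length_eq[OF fin, of d] by (rule card_image_le)
  also have "\<dots> = (card A + 1) ^ d" using card_lists_length_eq[OF fin, of d] assms by (simp add: card_image)
  finally show ?thesis .
qed

lemma length_le_vc_dim:
  assumes "shatters H S" "vc_dim H = enat d"
  shows "length S \<le> d"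
proof -
  have "enat (length S) \<le> vc_dim H" unfolding vc_dim_def using assms(1) by (intro SUP_upper) auto
  thus ?thesis using assms(2) by simp
qed

text \<open>Pajor's inequality bounds the traces on \<open>A\<close> by the shattered subsets of
  \<open>A\<close>; enumerated without repetition, such a subset is a shattered tuple, so it has at
  most \<open>d\<close> points.\<close>

lemma card_patterns_le:
  assumes "vc_dim H = enat d" "finite A"
  shows "card ((\<lambda>h. {x\<in>A. h x}) ` H) \<le> (card A + 1) ^ d"
proof -
  let ?F = "(\<lambda>h. {x\<in>A. h x}) ` H"
  have "card ?F \<le> card {S. S \<subseteq> A \<and> (\<forall>T\<subseteq>S. \<exists>B\<in>?F. B \<inter> S = T)}"
    using assms(2) by (intro card_le_card_shattered) auto
  also have "\<dots> \<le> card {S. S \<subseteq> A \<and> card S \<le> d}"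
  proof (intro card_mono)
    show "finite {S. S \<subseteq> A \<and> card S \<le> d}" using assms(2) by simp
    show "{S. S \<subseteq> A \<and> (\<forall>T\<subseteq>S. \<exists>B\<in>?F. B \<inter> S = T)} \<subseteq> {S. S \<subseteq> A \<and> card S \<le> d}"
    proof
      fix S assume "S \<in> {S. S \<subseteq> A \<and> (\<forall>T\<subseteq>S. \<exists>B\<in>?F. B \<inter> S = T)}"
      hence S: "S \<subseteq> A" "\<And>T. T \<subseteq> S \<Longrightarrow> \<exists>h\<in>H. {x\<in>A. h x} \<inter> S = T" by auto
      obtain xs where xs: "set xs = S" "distinct xs" using finite_distinct_list[of S] S(1) assms(2) finite_subset by blast
      have "shatters H xs" unfolding shatters_def
      proof (intro allI impI)
        fix ys :: "bool list" assume ly: "length ys = length xs"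
        define T where "T = {xs ! i | i. i < length xs \<and> ys ! i}"
        have "T \<subseteq> S" unfolding T_def using xs(1) by auto
        then obtain h where h: "h \<in> H" "{x\<in>A. h x} \<inter> S = T" using S(2) by blast
        have "map h xs = ys"
        proof (rule nth_equalityI)
          fix i assume i: "i < length (map h xs)"
          hence "xs ! i \<in> S" using xs(1) by auto
          hence "h (xs ! i) \<longleftrightarrow> xs ! i \<in> T" using h(2) S(1) by auto
          also have "\<dots> \<longleftrightarrow> ys ! i" unfolding T_def using xs(2) i nth_eq_iff_index_eq by fastforce
          finally show "map h xs ! i = ys ! i" using i by simp
        qed (use ly in auto)
        thus "\<exists>h\<in>H. map h xs = ys" using h by blast
      qed
      from length_le_vc_dim[OF this assms(1)] have "card S \<le> d" using xs distinct_card by fastforce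
      thus "S \<in> {S. S \<subseteq> A \<and> card S \<le> d}" using S by auto
    qed
  qed
  also have "\<dots> \<le> (card A + 1) ^ d" using card_small_subsets_le[OF assms(2)] .
  finally show ?thesis .
qed

section \<open>Shattering\<close>

lemma shatters_mono: "shatters H S \<Longrightarrow> H \<subseteq> H' \<Longrightarrow> shatters H' S"
  unfolding shatters_def by (meson subsetD)

lemma shatters_Nil: "shatters H [] \<longleftrightarrow> H \<noteq> {}"
  unfolding shatters_def by auto

text \<open>The link between the estimators: a block shattered by \<open>H\<close> either is counted
  by \<open>Delta_hat\<close> at \<open>x\<close>, or stops being shattered under one label of
  \<open>x\<close> and then is counted by \<open>Gamma_hat\<close> for the opposite label.\<close>

lemma shatters_snoc:
  "shatters H (S @ [x]) \<longleftrightarrow> (\<forall>y. shatters (restr H x y) S)"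
proof
  assume L: "shatters H (S @ [x])"
  show "\<forall>y. shatters (restr H x y) S"
    unfolding shatters_def
  proof (intro allI impI)
    fix y and ys :: "bool list" assume "length ys = length S"
    hence "length (ys @ [y]) = length (S @ [x])" by simp
    then obtain h where "h \<in> H" "map h (S @ [x]) = ys @ [y]" using L unfolding shatters_def by blast
    thus "\<exists>h\<in>restr H x y. map h S = ys" unfolding restr_def by auto
  qed
next
  assume R: "\<forall>y. shatters (restr H x y) S"
  show "shatters H (S @ [x])"
    unfolding shatters_def
  proof (intro allI impI)
    fix ys :: "bool list" assume l: "length ys = length (S @ [x])"
    then obtain zs z where z: "ys = zs @ [z]" "length zs = length S" by (cases ys rule: rev_cases) auto
    then obtain h where "h \<in> restr H x z" "map h S = zs" using R unfolding shatters_def by blast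
    thus "\<exists>h\<in>H. map h (S @ [x]) = ys" using z unfolding restr_def by auto
  qed
qed

lemma shatters_single: "shatters H [x] \<longleftrightarrow> x \<in> DIS H"
  using shatters_snoc[of H "[]" x] unfolding shatters_Nil DIS_def restr_def
  by (auto simp: all_bool_eq)

section \<open>Sequences of independent points\<close>

locale full_prob_space = prob_space M for M :: "'a measure" +
  assumes space_full [simp]: "space M = UNIV"
begin

lemma space_iid [simp]: "space (iid M) = UNIV"
  by (simp add: iid_def space_PiM)

lemma prob_space_iid: "prob_space (iid M)"
  unfolding iid_def by (intro prob_space_PiM prob_space_axioms)

sublocale iid: prob_space "iid M" by (rule prob_space_iid)

lemma measurable_iid_component [measurable]: "(\<lambda>X. X i) \<in> iid M \<rightarrow>\<^sub>M M"
  unfolding iid_def by measurable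

lemma measurable_iidI: "(\<And>i. (\<lambda>x. f x i) \<in> N \<rightarrow>\<^sub>M M) \<Longrightarrow> f \<in> N \<rightarrow>\<^sub>M iid M"
  unfolding iid_def by (rule measurable_PiM_single') auto

lemma emeasure_iid_cylinder:
  assumes "finite J" "\<And>j. j \<in> J \<Longrightarrow> F j \<in> sets M"
  shows "emeasure (iid M) {X. \<forall>j\<in>J. X j \<in> F j} = (\<Prod>j\<in>J. emeasure M (F j))"
proof -
  interpret product_prob_space "\<lambda>_. M" UNIV by unfold_locales
  show ?thesis using emeasure_PiM_Collect[of J F] assms by (simp add: iid_def space_PiM)
qed

lemma iid_eqI:
  assumes "sets N = sets (iid M)"
    and "\<And>J F. finite J \<Longrightarrow> (\<And>j. j \<in> J \<Longrightarrow> F j \<in> sets M) \<Longrightarrow>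
      emeasure N {X. \<forall>j\<in>J. X j \<in> F j} = (\<Prod>j\<in>J. emeasure M (F j))"
  shows "N = iid M"
proof -
  interpret product_prob_space "\<lambda>_. M" UNIV by unfold_locales
  have "prod_emb UNIV (\<lambda>_. M) J (Pi\<^sub>E J F) = {X. \<forall>j\<in>J. X j \<in> F j}" for J :: "nat set" and F
    by (auto simp: prod_emb_def space_PiM Pi_iff)
  thus ?thesis using assms unfolding iid_def by (intro PiM_eq) simp_all
qed

lemma measurable_iid_mix [measurable]:
  "(\<lambda>(X, X') j. if j \<in> J then X j else X' (\<phi> j)) \<in> iid M \<Otimes>\<^sub>M iid M \<rightarrow>\<^sub>M iid M"
proof (rule measurable_iidI)
  fix i
  show "(\<lambda>x. (case x of (X, X') \<Rightarrow> \<lambda>j. if j \<in> J then X j else X' (\<phi> j)) i) \<in> iid M \<Otimes>\<^sub>M iid M \<rightarrow>\<^sub>M M"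
    by (cases "i \<in> J") (simp_all add: case_prod_unfold)
qed

text \<open>Coordinates outside \<open>J\<close> may be replaced by injectively chosen coordinates
  of an independent copy. Restarting after a time, resampling one coordinate and permuting
  coordinates are all instances.\<close>

lemma distr_iid_mix:
  assumes "inj_on \<phi> (- J)"
  shows "distr (iid M \<Otimes>\<^sub>M iid M) (iid M) (\<lambda>(X, X') j. if j \<in> J then X j else X' (\<phi> j)) = iid M"
    (is "distr _ _ ?t = _")
proof (rule iid_eqI)
  fix K F assume K: "finite (K :: nat set)" and F: "\<And>j. j \<in> K \<Longrightarrow> F j \<in> sets M"
  have inj: "inj_on \<phi> (K - J)" using assms by (rule inj_on_subset) auto
  define G where "G = (\<lambda>i. F (inv_into (K - J) \<phi> i))"
  have G: "G (\<phi> j) = F j" if "j \<in> K - J" for j using that inj by (simp add: G_def)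
  let ?A = "{X. \<forall>j\<in>K \<inter> J. X j \<in> F j}" and ?B = "{X. \<forall>i\<in>\<phi> ` (K - J). X i \<in> G i}"
  have Ks: "{X. \<forall>j\<in>L. X j \<in> H j} \<in> sets (iid M)" if "finite L" "\<And>j. j \<in> L \<Longrightarrow> H j \<in> sets M" for L H
  proof -
    have "{X\<in>space (iid M). \<forall>j\<in>L. X j \<in> H j} \<in> sets (iid M)"
    proof (rule sets.sets_Collect_finite_All[OF _ that(1)])
      fix j assume "j \<in> L"
      from measurable_sets[OF measurable_iid_component that(2)[OF this]]
      show "{X\<in>space (iid M). X j \<in> H j} \<in> sets (iid M)" by (simp add: vimage_def)
    qed
    thus ?thesis by (cases "L = {}") simp_all
  qed
  have *: "?t -` {X. \<forall>j\<in>K. X j \<in> F j} \<inter> space (iid M \<Otimes>\<^sub>M iid M) = ?A \<times> ?B"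
    using G by (auto simp: space_pair_measure)
  have A: "?A \<in> sets (iid M)" using K F by (intro Ks) auto
  have B: "?B \<in> sets (iid M)" using K F G by (intro Ks) auto
  have "emeasure (distr (iid M \<Otimes>\<^sub>M iid M) (iid M) ?t) {X. \<forall>j\<in>K. X j \<in> F j} = emeasure (iid M \<Otimes>\<^sub>M iid M) (?A \<times> ?B)"
    unfolding *[symmetric] by (rule emeasure_distr) (use K F in \<open>auto intro!: Ks\<close>)
  also have "\<dots> = emeasure (iid M) ?A * emeasure (iid M) ?B"
    using A B by (rule iid.emeasure_pair_measure_Times)
  also have "emeasure (iid M) ?A = (\<Prod>j\<in>K \<inter> J. emeasure M (F j))"
    using K F by (intro emeasure_iid_cylinder) auto
  also have "emeasure (iid M) ?B = (\<Prod>i\<in>\<phi> ` (K - J). emeasure M (G i))"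
    using K F G by (intro emeasure_iid_cylinder) auto
  also have "\<dots> = (\<Prod>j\<in>K - J. emeasure M (F j))"
    using G by (subst prod.reindex[OF inj]) (auto intro!: prod.cong)
  also have "(\<Prod>j\<in>K \<inter> J. emeasure M (F j)) * (\<Prod>j\<in>K - J. emeasure M (F j)) = (\<Prod>j\<in>K. emeasure M (F j))"
    using prod.Int_Diff[OF K, of "\<lambda>j. emeasure M (F j)" J] by simp
  finally show "emeasure (distr (iid M \<Otimes>\<^sub>M iid M) (iid M) ?t) {X. \<forall>j\<in>K. X j \<in> F j} = (\<Prod>j\<in>K. emeasure M (F j))" .
qed simp

lemma nn_integral_iid_mix:
  assumes "inj_on \<phi> (- J)" and G [measurable]: "G \<in> borel_measurable (iid M)"
  shows "(\<integral>\<^sup>+X. G X \<partial>iid M) = (\<integral>\<^sup>+X. \<integral>\<^sup>+X'. G (\<lambda>j. if j \<in> J then X j else X' (\<phi> j)) \<partial>iid M \<partial>iid M)"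
proof -
  have "(\<integral>\<^sup>+X. G X \<partial>iid M) = (\<integral>\<^sup>+X. G X \<partial>distr (iid M \<Otimes>\<^sub>M iid M) (iid M) (\<lambda>(X, X') j. if j \<in> J then X j else X' (\<phi> j)))"
    unfolding distr_iid_mix[OF assms(1)] ..
  also have "\<dots> = (\<integral>\<^sup>+z. G ((\<lambda>(X, X') j. if j \<in> J then X j else X' (\<phi> j)) z) \<partial>(iid M \<Otimes>\<^sub>M iid M))"
    by (rule nn_integral_distr) measurable
  also have "\<dots> = (\<integral>\<^sup>+X. \<integral>\<^sup>+X'. G ((\<lambda>(X, X') j. if j \<in> J then X j else X' (\<phi> j)) (X, X')) \<partial>iid M \<partial>iid M)"
    by (rule iid.nn_integral_fst[symmetric]) measurable
  finally show ?thesis by simp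
qed

text \<open>The copy is read from its index 1 on, in accordance with data indexed from 1.\<close>

definition restart :: "nat \<Rightarrow> (nat \<Rightarrow> 'a) \<Rightarrow> (nat \<Rightarrow> 'a) \<Rightarrow> nat \<Rightarrow> 'a" where
  "restart m X X' = (\<lambda>j. if j \<le> m then X j else X' (j - m))"

lemma restart_simps [simp]:
  "j \<le> m \<Longrightarrow> restart m X X' j = X j"
  "m < j \<Longrightarrow> restart m X X' j = X' (j - m)"
  by (auto simp: restart_def)

lemma measurable_restart [measurable]: "restart m X \<in> iid M \<rightarrow>\<^sub>M iid M"
proof (rule measurable_iidI)
  show "(\<lambda>x. restart m X x i) \<in> iid M \<rightarrow>\<^sub>M M" for i by (cases "i \<le> m") simp_all
qed

lemma nn_integral_restart:
  assumes "G \<in> borel_measurable (iid M)"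
  shows "(\<integral>\<^sup>+X. G X \<partial>iid M) = (\<integral>\<^sup>+X. \<integral>\<^sup>+X'. G (restart m X X') \<partial>iid M \<partial>iid M)"
proof -
  have "inj_on (\<lambda>j. j - m) (- {..m})" by (auto simp: inj_on_def)
  from nn_integral_iid_mix[OF this assms] show ?thesis by (simp add: restart_def)
qed

lemma nn_integral_iid_component:
  assumes [measurable]: "g \<in> borel_measurable M"
  shows "(\<integral>\<^sup>+X. g (X i) \<partial>iid M) = (\<integral>\<^sup>+x. g x \<partial>M)"
proof -
  have "distr (iid M) M (\<lambda>X. X i) = M"
    unfolding iid_def by (rule distr_PiM_component) (auto intro: prob_space_axioms)
  hence "(\<integral>\<^sup>+x. g x \<partial>M) = (\<integral>\<^sup>+x. g x \<partial>distr (iid M) M (\<lambda>X. X i))" by simp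
  thus ?thesis by (simp add: nn_integral_distr)
qed

lemma measurable_iid_update [measurable]: "(\<lambda>x. X(i := x)) \<in> M \<rightarrow>\<^sub>M iid M"
proof (rule measurable_iidI)
  show "(\<lambda>x. (X(i := x)) j) \<in> M \<rightarrow>\<^sub>M M" for j by (cases "i = j") simp_all
qed

lemma nn_integral_iid_update:
  assumes [measurable]: "G \<in> borel_measurable (iid M)"
  shows "(\<integral>\<^sup>+X. G X \<partial>iid M) = (\<integral>\<^sup>+X. \<integral>\<^sup>+x. G (X(i := x)) \<partial>M \<partial>iid M)"
proof -
  have "inj_on id (- (- {i}))" by simp
  from nn_integral_iid_mix[OF this assms]
  have "(\<integral>\<^sup>+X. G X \<partial>iid M) = (\<integral>\<^sup>+X. \<integral>\<^sup>+X'. G (\<lambda>j. if j \<in> - {i} then X j else X' (id j)) \<partial>iid M \<partial>iid M)" .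
  also have "\<dots> = (\<integral>\<^sup>+X. \<integral>\<^sup>+X'. G (X(i := X' i)) \<partial>iid M \<partial>iid M)"
    by (intro nn_integral_cong arg_cong[where f = G]) auto
  also have "\<dots> = (\<integral>\<^sup>+X. \<integral>\<^sup>+x. G (X(i := x)) \<partial>M \<partial>iid M)"
    by (intro nn_integral_cong nn_integral_iid_component) measurable
  finally show ?thesis .
qed

text \<open>A product of nonnegative factors whose conditional expectations are at most 1 is a supermartingale.\<close>

lemma nn_integral_predictable_prod_le_1:
  assumes meas [measurable]: "\<And>i. g i \<in> borel_measurable (iid M)"
    and past: "\<And>i X X'. (\<forall>j\<le>i. X j = X' j) \<Longrightarrow> g i X = g i X'"
    and le: "\<And>i X. (\<integral>\<^sup>+x. g i (X(i := x)) \<partial>M) \<le> (1::ennreal)"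
  shows "(\<integral>\<^sup>+X. (\<Prod>i<n. g i X) \<partial>iid M) \<le> 1"
proof (induction n)
  case (Suc n)
  have "(\<integral>\<^sup>+X. (\<Prod>i<Suc n. g i X) \<partial>iid M)
    = (\<integral>\<^sup>+X. \<integral>\<^sup>+x. (\<Prod>i<n. g i (X(n := x))) * g n (X(n := x)) \<partial>M \<partial>iid M)"
    by (subst nn_integral_iid_update[of _ n]) simp_all
  also have "\<dots> = (\<integral>\<^sup>+X. \<integral>\<^sup>+x. (\<Prod>i<n. g i X) * g n (X(n := x)) \<partial>M \<partial>iid M)"
    by (intro nn_integral_cong arg_cong2[where f = "(*)"] prod.cong past) auto
  also have "\<dots> = (\<integral>\<^sup>+X. (\<Prod>i<n. g i X) * (\<integral>\<^sup>+x. g n (X(n := x)) \<partial>M) \<partial>iid M)"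
    by (intro nn_integral_cong nn_integral_cmult) measurable
  also have "\<dots> \<le> (\<integral>\<^sup>+X. (\<Prod>i<n. g i X) * 1 \<partial>iid M)"
    by (intro nn_integral_mono mult_left_mono le) auto
  also have "\<dots> \<le> 1" using Suc by simp
  finally show ?case .
qed (simp add: iid.emeasure_space_1[simplified])

text \<open>Split by the value \<open>m\<close> of \<open>\<tau>\<close>. As \<open>\<tau>\<close>
  does not look beyond itself, the event that it equals \<open>m\<close> is unaffected by restarting
  after \<open>m\<close>, so its indicator leaves the inner integral and the bound for a fixed past
  applies.\<close>

lemma strong_markov:
  fixes F :: "(nat \<Rightarrow> 'a) \<Rightarrow> ennreal" and \<tau> :: "(nat \<Rightarrow> 'a) \<Rightarrow> nat"
  assumes F [measurable]: "F \<in> borel_measurable (iid M)"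
    and \<tau> [measurable]: "\<tau> \<in> iid M \<rightarrow>\<^sub>M count_space UNIV"
    and past: "\<And>X X'. (\<forall>j\<le>\<tau> X. X j = X' j) \<Longrightarrow> \<tau> X' = \<tau> X"
    and le: "\<And>X. (\<integral>\<^sup>+X'. F (restart (\<tau> X) X X') \<partial>iid M) \<le> \<eta>"
  shows "(\<integral>\<^sup>+X. F X \<partial>iid M) \<le> \<eta>"
proof -
  have r: "\<tau> (restart m X X') = m \<longleftrightarrow> \<tau> X = m" for m X X'
    using past[of X "restart m X X'"] past[of "restart m X X'" X] by auto
  have one: "(\<Sum>m. indicator {X. \<tau> X = m} X * c) = c" for c :: ennreal and X
  proof -
    have "(\<lambda>m. indicator {X. \<tau> X = m} X * c) sums (\<Sum>m\<in>{\<tau> X}. indicator {X. \<tau> X = m} X * c)"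
      by (rule sums_finite) auto
    thus ?thesis by (simp add: sums_iff)
  qed
  have s [measurable]: "{X. \<tau> X = m} \<in> sets (iid M)" for m
    using measurable_sets[OF \<tau>, of "{m}"] by (simp add: vimage_def)
  have "(\<integral>\<^sup>+X. F X \<partial>iid M) = (\<integral>\<^sup>+X. (\<Sum>m. indicator {X. \<tau> X = m} X * F X) \<partial>iid M)"
    by (simp only: one)
  also have "\<dots> = (\<Sum>m. \<integral>\<^sup>+X. indicator {X. \<tau> X = m} X * F X \<partial>iid M)"
    by (rule nn_integral_suminf) measurable
  also have "\<dots> \<le> (\<Sum>m. \<integral>\<^sup>+X. indicator {X. \<tau> X = m} X * \<eta> \<partial>iid M)"
  proof (intro suminf_le allI)
    fix m
    have "(\<integral>\<^sup>+X. indicator {X. \<tau> X = m} X * F X \<partial>iid M)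
      = (\<integral>\<^sup>+X. \<integral>\<^sup>+X'. indicator {X. \<tau> X = m} (restart m X X') * F (restart m X X') \<partial>iid M \<partial>iid M)"
      by (rule nn_integral_restart) measurable
    also have "\<dots> = (\<integral>\<^sup>+X. \<integral>\<^sup>+X'. indicator {X. \<tau> X = m} X * F (restart m X X') \<partial>iid M \<partial>iid M)"
      by (intro nn_integral_cong) (auto simp: indicator_def r)
    also have "\<dots> = (\<integral>\<^sup>+X. indicator {X. \<tau> X = m} X * (\<integral>\<^sup>+X'. F (restart m X X') \<partial>iid M) \<partial>iid M)"
      by (intro nn_integral_cong nn_integral_cmult) measurable
    also have "\<dots> \<le> (\<integral>\<^sup>+X. indicator {X. \<tau> X = m} X * \<eta> \<partial>iid M)"
      using le by (intro nn_integral_mono) (auto simp: indicator_def)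
    finally show "(\<integral>\<^sup>+X. indicator {X. \<tau> X = m} X * F X \<partial>iid M)
      \<le> (\<integral>\<^sup>+X. indicator {X. \<tau> X = m} X * \<eta> \<partial>iid M)" .
  qed auto
  also have "\<dots> = (\<integral>\<^sup>+X. (\<Sum>m. indicator {X. \<tau> X = m} X * \<eta>) \<partial>iid M)"
    by (rule nn_integral_suminf[symmetric]) measurable
  also have "\<dots> = \<eta>" by (simp only: one) (simp add: iid.emeasure_space_1[simplified])
  finally show ?thesis .
qed

subsection \<open>Exponential tail bounds\<close>

text \<open>The factor \<open>b - 1\<close> on both sides of the hypothesis carries its sign: for
  \<open>b > 1\<close> it asks for upper bounds \<open>q i\<close> on the conditional probabilities,
  for \<open>b < 1\<close> for lower bounds.\<close>

lemma predictable_count_mgf: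
  fixes Z :: "nat \<Rightarrow> (nat \<Rightarrow> 'a) \<Rightarrow> bool" and b :: real
  assumes meas [measurable]: "\<And>i. Measurable.pred (iid M) (Z i)"
    and past: "\<And>i X X'. (\<forall>j\<le>i. X j = X' j) \<Longrightarrow> Z i X = Z i X'"
    and le: "\<And>i X. (b - 1) * measure M {x. Z i (X(i := x))} \<le> (b - 1) * q i"
    and b: "0 < b"
  shows "(\<integral>\<^sup>+X. ennreal (b ^ card {i. i < n \<and> Z i X}) \<partial>iid M) \<le> ennreal (exp ((b - 1) * (\<Sum>i<n. q i)))"
proof -
  \<comment> \<open>The normalization makes the conditional expectation of each factor at most 1, by
    \<open>1 + x \<le> exp x\<close> with \<open>x = (b - 1) * q i\<close>.\<close>
  define g where "g = (\<lambda>i X. ennreal ((if Z i X then b else 1) * exp (- ((b - 1) * q i))))"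
  have gm: "g i \<in> borel_measurable (iid M)" for i unfolding g_def by measurable
  have "(\<integral>\<^sup>+x. g i (X(i := x)) \<partial>M) \<le> 1" for i X
  proof -
    let ?A = "{x. Z i (X(i := x))}"
    have "Measurable.pred M (\<lambda>x. Z i (X(i := x)))"
      using measurable_comp[OF measurable_iid_update meas] by (simp add: comp_def)
    hence A: "?A \<in> sets M" unfolding pred_def by simp
    have "(\<integral>\<^sup>+x. g i (X(i := x)) \<partial>M) = (\<integral>\<^sup>+x. ennreal ((if x \<in> ?A then b else 1) * exp (- ((b - 1) * q i))) \<partial>M)"
      unfolding g_def by simp
    also have "\<dots> = ennreal (\<integral>x. (1 + (b - 1) * indicator ?A x) * exp (- ((b - 1) * q i)) \<partial>M)"
    proof (subst nn_integral_eq_integral[symmetric])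
      show "integrable M (\<lambda>x. (1 + (b - 1) * indicat_real ?A x) * exp (- ((b - 1) * q i)))"
        using A by (intro integrable_mult_left integrable_add integrable_mult_right) (auto simp: emeasure_eq_measure)
      show "AE x in M. 0 \<le> (1 + (b - 1) * indicat_real ?A x) * exp (- ((b - 1) * q i))"
        using b by (intro AE_I2) (auto simp: indicator_def)
    qed (auto intro!: nn_integral_cong simp: indicator_def)
    also have "\<dots> \<le> ennreal 1"
    proof (rule ennreal_leI)
      have "(\<integral>x. (1 + (b - 1) * indicator ?A x) * exp (- ((b - 1) * q i)) \<partial>M)
        = (1 + (b - 1) * measure M ?A) * exp (- ((b - 1) * q i))"
        using A by (simp add: emeasure_eq_measure prob_space[simplified])
      also have "\<dots> \<le> exp ((b - 1) * q i) * exp (- ((b - 1) * q i))"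
      proof (rule mult_right_mono)
        have "1 + (b - 1) * measure M ?A \<le> 1 + (b - 1) * q i" using le by simp
        also have "\<dots> \<le> exp ((b - 1) * q i)" by (rule exp_ge_add_one_self)
        finally show "1 + (b - 1) * measure M ?A \<le> exp ((b - 1) * q i)" .
      qed simp
      also have "\<dots> = 1" by (simp add: exp_minus)
      finally show "(\<integral>x. (1 + (b - 1) * indicator ?A x) * exp (- ((b - 1) * q i)) \<partial>M) \<le> 1" .
    qed
    finally show ?thesis by simp
  qed
  moreover have "g i X = g i X'" if "\<forall>j\<le>i. X j = X' j" for i X X'
    using past[OF that] by (simp add: g_def)
  ultimately have *: "(\<integral>\<^sup>+X. (\<Prod>i<n. g i X) \<partial>iid M) \<le> 1"
    using gm by (intro nn_integral_predictable_prod_le_1) auto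
  have eq: "ennreal (b ^ card {i. i < n \<and> Z i X}) = ennreal (exp ((b - 1) * (\<Sum>i<n. q i))) * (\<Prod>i<n. g i X)" for X
  proof -
    have "b ^ card {i. i < n \<and> Z i X} = (\<Prod>i<n. if Z i X then b else 1)"
      by (subst prod.If_cases) (auto intro!: arg_cong[where f = "\<lambda>S. b ^ card S"])
    moreover have "(\<Prod>i<n. g i X) = ennreal ((\<Prod>i<n. if Z i X then b else 1) * (\<Prod>i<n. exp (- ((b - 1) * q i))))"
      unfolding g_def using b by (subst prod_ennreal) (auto simp: prod.distrib)
    moreover have "(\<Prod>i<n. exp (- ((b - 1) * q i))) = exp (- ((b - 1) * (\<Sum>i<n. q i)))"
      by (simp add: exp_sum[symmetric] sum_negf sum_distrib_left)
    ultimately show ?thesis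
      using b by (simp add: ennreal_mult[symmetric] prod_nonneg exp_minus)
  qed
  have "(\<integral>\<^sup>+X. ennreal (b ^ card {i. i < n \<and> Z i X}) \<partial>iid M)
    = ennreal (exp ((b - 1) * (\<Sum>i<n. q i))) * (\<integral>\<^sup>+X. (\<Prod>i<n. g i X) \<partial>iid M)"
    unfolding eq using gm by (intro nn_integral_cmult) measurable
  also have "\<dots> \<le> ennreal (exp ((b - 1) * (\<Sum>i<n. q i))) * 1"
    using * by (rule mult_left_mono) simp
  finally show ?thesis by simp
qed

text \<open>Markov's inequality for the moment generating function. Comparing powers of
  \<open>b\<close> instead of exponents gives the upper tail for \<open>b > 1\<close> and the lower
  tail for \<open>b < 1\<close> in one statement.\<close>

lemma predictable_count_tail:
  fixes Z :: "nat \<Rightarrow> (nat \<Rightarrow> 'a) \<Rightarrow> bool" and b :: real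
  assumes meas [measurable]: "\<And>i. Measurable.pred (iid M) (Z i)"
    and past: "\<And>i X X'. (\<forall>j\<le>i. X j = X' j) \<Longrightarrow> Z i X = Z i X'"
    and le: "\<And>i X. (b - 1) * measure M {x. Z i (X(i := x))} \<le> (b - 1) * q i"
    and b: "0 < b"
  shows "measure (iid M) {X. b powr a \<le> b ^ card {i. i < n \<and> Z i X}}
    \<le> exp ((b - 1) * (\<Sum>i<n. q i) - a * ln b)"
proof -
  have [measurable]: "(\<lambda>X. card {i. i < n \<and> Z i X}) \<in> iid M \<rightarrow>\<^sub>M count_space UNIV"
  proof (rule measurable_card)
    show "{X \<in> space (iid M). i \<in> {i. i < n \<and> Z i X}} \<in> sets (iid M)" for i
      using meas[of i] by (cases "i < n") (simp_all add: pred_def)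
  qed
  have [measurable]: "{X. b powr a \<le> b ^ card {i. i < n \<and> Z i X}} \<in> sets (iid M)"
    using measurable_sets_Collect[of "\<lambda>X. card {i. i < n \<and> Z i X}" "iid M" "count_space UNIV" "\<lambda>c. b powr a \<le> b ^ c"] by simp
  have "emeasure (iid M) {X. b powr a \<le> b ^ card {i. i < n \<and> Z i X}}
    \<le> (\<integral>\<^sup>+X. ennreal (b ^ card {i. i < n \<and> Z i X}) * ennreal (1 / b powr a) \<partial>iid M)"
  proof (subst nn_integral_indicator[symmetric])
    show "(\<integral>\<^sup>+X. indicator {X. b powr a \<le> b ^ card {i. i < n \<and> Z i X}} X \<partial>iid M)
      \<le> (\<integral>\<^sup>+X. ennreal (b ^ card {i. i < n \<and> Z i X}) * ennreal (1 / b powr a) \<partial>iid M)"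
      using b by (intro nn_integral_mono) (auto simp: indicator_def ennreal_mult[symmetric] ennreal_1[symmetric] simp del: ennreal_1 intro!: ennreal_leI)
  qed measurable
  also have "\<dots> = (\<integral>\<^sup>+X. ennreal (b ^ card {i. i < n \<and> Z i X}) \<partial>iid M) * ennreal (1 / b powr a)"
    by (rule nn_integral_multc) measurable
  also have "\<dots> \<le> ennreal (exp ((b - 1) * (\<Sum>i<n. q i))) * ennreal (1 / b powr a)"
    by (intro mult_right_mono predictable_count_mgf assms) auto
  also have "\<dots> = ennreal (exp ((b - 1) * (\<Sum>i<n. q i) - a * ln b))"
    using b by (simp add: ennreal_mult[symmetric] powr_def exp_diff)
  finally show ?thesis by (simp add: iid.emeasure_eq_measure)
qed

end

text \<open>The bound on the moment generating function holds for the binomial distribution with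
  parameters \<open>N\<close> and \<open>p\<close>; optimizing over \<open>b\<close> gives Hoeffding's inequality up to a constant.\<close>

lemma (in prob_space) count_deviation_le:
  fixes c :: "'a \<Rightarrow> nat" and p \<eta> :: real
  assumes c [measurable]: "c \<in> M \<rightarrow>\<^sub>M count_space UNIV"
    and mgf: "\<And>b::real. 0 < b \<Longrightarrow> (\<integral>\<^sup>+x. ennreal (b ^ c x) \<partial>M) \<le> ennreal (exp ((b - 1) * (p * real N)))"
    and p: "0 \<le> p" "p \<le> 1" and \<eta>: "0 < \<eta>" "\<eta> \<le> 1"
  shows "measure M {x\<in>space M. \<eta> * real N < \<bar>real (c x) - p * real N\<bar>} \<le> 2 * exp (- (\<eta>\<^sup>2 / 8) * real N)"
proof -
  have tail: "measure M {x\<in>space M. b powr a \<le> b ^ c x} \<le> exp ((b - 1) * (p * real N) - a * ln b)" if b: "0 < b" for a b :: real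
  proof -
    have "emeasure M {x\<in>space M. b powr a \<le> b ^ c x} \<le> (\<integral>\<^sup>+x. ennreal (b ^ c x) * ennreal (1 / b powr a) \<partial>M)"
    proof (subst nn_integral_indicator[symmetric])
      show "(\<integral>\<^sup>+x. indicator {x\<in>space M. b powr a \<le> b ^ c x} x \<partial>M) \<le> (\<integral>\<^sup>+x. ennreal (b ^ c x) * ennreal (1 / b powr a) \<partial>M)"
        using b by (intro nn_integral_mono) (auto simp: indicator_def ennreal_mult[symmetric] ennreal_1[symmetric] simp del: ennreal_1 intro!: ennreal_leI)
    qed measurable
    also have "\<dots> = (\<integral>\<^sup>+x. ennreal (b ^ c x) \<partial>M) * ennreal (1 / b powr a)"
      by (rule nn_integral_multc) measurable
    also have "\<dots> \<le> ennreal (exp ((b - 1) * (p * real N))) * ennreal (1 / b powr a)"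
      by (intro mult_right_mono mgf that) auto
    also have "\<dots> = ennreal (exp ((b - 1) * (p * real N) - a * ln b))"
      using b by (simp add: ennreal_mult[symmetric] powr_def exp_diff)
    finally show ?thesis by (simp add: emeasure_eq_measure)
  qed
  \<comment> \<open>This is the minimizer of \<open>- \<eta> * s + 2 * s\<^sup>2\<close>, the
    exponent per trial left in both tails once the logarithm is bounded to second order; the minimum
    is \<open>- \<eta>\<^sup>2 / 8\<close>.\<close>
  define s where "s = \<eta> / 4"
  have s: "0 < s" "s \<le> 1 / 2" using \<eta> by (auto simp: s_def)
  let ?U = "{x\<in>space M. (1 + s) powr ((p + \<eta>) * real N) \<le> (1 + s) ^ c x}"
  let ?L = "{x\<in>space M. (1 - s) powr ((p - \<eta>) * real N) \<le> (1 - s) ^ c x}"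
  have sub: "{x\<in>space M. \<eta> * real N < \<bar>real (c x) - p * real N\<bar>} \<subseteq> ?U \<union> {x\<in>space M. real (c x) < (p - \<eta>) * real N}"
  proof
    fix x assume "x \<in> {x\<in>space M. \<eta> * real N < \<bar>real (c x) - p * real N\<bar>}"
    hence x: "x \<in> space M" "(p + \<eta>) * real N \<le> real (c x) \<or> real (c x) < (p - \<eta>) * real N"
      by (auto simp: algebra_simps abs_if split: if_splits)
    show "x \<in> ?U \<union> {x\<in>space M. real (c x) < (p - \<eta>) * real N}"
      using x s by (auto simp: powr_realpow[symmetric] intro!: powr_mono)
  qed
  have U: "measure M ?U \<le> exp (- (\<eta>\<^sup>2 / 8) * real N)"
  proof -
    have "measure M ?U \<le> exp (s * (p * real N) - (p + \<eta>) * real N * ln (1 + s))"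
      using tail[of "1 + s" "(p + \<eta>) * real N"] s by simp
    also have "s * (p * real N) - (p + \<eta>) * real N * ln (1 + s) = real N * (s * p - (p + \<eta>) * ln (1 + s))"
      by (simp add: algebra_simps)
    also have "\<dots> \<le> real N * (- (\<eta>\<^sup>2 / 8))"
    proof (rule mult_left_mono)
      have "s - s\<^sup>2 \<le> ln (1 + s)" using ln_one_plus_pos_lower_bound[of s] s by simp
      hence "s * p - (p + \<eta>) * ln (1 + s) \<le> s * p - (p + \<eta>) * (s - s\<^sup>2)"
        using p \<eta> by (intro diff_left_mono mult_left_mono) auto
      also have "\<dots> = - \<eta> * s + (p + \<eta>) * s\<^sup>2" by (simp add: algebra_simps)
      also have "\<dots> \<le> - \<eta> * s + 2 * s\<^sup>2"
        using p \<eta> by (intro add_left_mono mult_right_mono) auto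
      also have "\<dots> = - (\<eta>\<^sup>2 / 8)" by (simp add: s_def power2_eq_square field_simps)
      finally show "s * p - (p + \<eta>) * ln (1 + s) \<le> - (\<eta>\<^sup>2 / 8)" .
    qed simp
    finally show ?thesis by (simp add: mult.commute)
  qed
  have L: "measure M {x\<in>space M. real (c x) < (p - \<eta>) * real N} \<le> exp (- (\<eta>\<^sup>2 / 8) * real N)"
  proof (cases "\<eta> \<le> p")
    case False
    hence "(p - \<eta>) * real N \<le> 0" by (intro mult_nonpos_nonneg) auto
    hence "{x\<in>space M. real (c x) < (p - \<eta>) * real N} = {}" by (auto simp: not_less intro: order_trans)
    thus ?thesis by (simp only: measure_empty exp_ge_zero)
  next
    case True
    have "{x\<in>space M. real (c x) < (p - \<eta>) * real N} \<subseteq> ?L"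
      using s by (auto simp: powr_realpow[symmetric] intro!: powr_mono')
    hence "measure M {x\<in>space M. real (c x) < (p - \<eta>) * real N} \<le> measure M ?L"
      by (intro finite_measure_mono) measurable
    also have "\<dots> \<le> exp (- s * (p * real N) - (p - \<eta>) * real N * ln (1 - s))"
      using tail[of "1 - s" "(p - \<eta>) * real N"] s by simp
    also have "- s * (p * real N) - (p - \<eta>) * real N * ln (1 - s) = real N * (- s * p + (p - \<eta>) * (- ln (1 - s)))"
      by (simp add: algebra_simps)
    also have "\<dots> \<le> real N * (- (\<eta>\<^sup>2 / 8))"
    proof (rule mult_left_mono)
      have "- ln (1 - s) \<le> s + 2 * s\<^sup>2"
        using ln_one_minus_pos_lower_bound[of s] s by (simp add: power2_eq_square)
      hence "- s * p + (p - \<eta>) * (- ln (1 - s)) \<le> - s * p + (p - \<eta>) * (s + 2 * s\<^sup>2)"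
        using True by (intro add_left_mono mult_left_mono) auto
      also have "\<dots> = - \<eta> * s + (p - \<eta>) * (2 * s\<^sup>2)" by (simp add: algebra_simps)
      also have "\<dots> \<le> - \<eta> * s + 1 * (2 * s\<^sup>2)"
        using p \<eta> by (intro add_left_mono mult_right_mono) auto
      also have "\<dots> \<le> - (\<eta>\<^sup>2 / 8)" by (simp add: s_def power2_eq_square field_simps)
      finally show "- s * p + (p - \<eta>) * (- ln (1 - s)) \<le> - (\<eta>\<^sup>2 / 8)" .
    qed simp
    finally show ?thesis by (simp add: mult.commute)
  qed
  have "measure M {x\<in>space M. \<eta> * real N < \<bar>real (c x) - p * real N\<bar>}
    \<le> measure M (?U \<union> {x\<in>space M. real (c x) < (p - \<eta>) * real N})"
    using sub by (rule finite_measure_mono) measurable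
  also have "\<dots> \<le> measure M ?U + measure M {x\<in>space M. real (c x) < (p - \<eta>) * real N}"
    by (rule measure_Un_le) measurable
  finally show ?thesis using U L by linarith
qed

subsection \<open>Blocks of consecutive points\<close>

lemma block_eq_map_restrict:
  assumes "i \<ge> 1"
  shows "block W k i = map (\<lambda>j\<in>{..<k - 1}. W (1 + (i - 1) * (k - 1) + j)) [0..<k - 1]"
proof -
  obtain i' where "i = Suc i'" using assms by (cases i) auto
  moreover define r where "r = k - 1"
  ultimately have "block W k i = map W [1 + i' * r..<1 + i' * r + r]" by (simp add: block_def add.commute)
  thus ?thesis using \<open>i = Suc i'\<close>
    by (auto simp: r_def simp del: upt_Suc intro!: nth_equalityI)
qed

lemma length_block [simp]: "i \<ge> 1 \<Longrightarrow> length (block W k i) = k - 1"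
  by (simp add: block_eq_map_restrict)

lemma block_1 [simp]: "i \<ge> 1 \<Longrightarrow> block W (Suc 0) i = []"
  by (simp add: block_eq_map_restrict)

lemma block_2: "i \<ge> 1 \<Longrightarrow> block W 2 i = [W i]"
  by (simp add: block_eq_map_restrict upt_rec)

context full_prob_space
begin

definition block_pred :: "nat \<Rightarrow> ('a list \<Rightarrow> bool) \<Rightarrow> bool" where
  "block_pred r \<Phi> \<longleftrightarrow> {x \<in> space (\<Pi>\<^sub>M j\<in>{..<r}. M). \<Phi> (map x [0..<r])} \<in> sets (\<Pi>\<^sub>M j\<in>{..<r}. M)"

definition block_prob :: "nat \<Rightarrow> ('a list \<Rightarrow> bool) \<Rightarrow> real" where
  "block_prob r \<Phi> = measure (\<Pi>\<^sub>M j\<in>{..<r}. M) {x \<in> space (\<Pi>\<^sub>M j\<in>{..<r}. M). \<Phi> (map x [0..<r])}"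

lemma prob_space_PiM_const: "prob_space (\<Pi>\<^sub>M j\<in>I. M)"
  by (intro prob_space_PiM prob_space_axioms)

lemma block_prob_nonneg [simp]: "0 \<le> block_prob r \<Phi>"
  by (simp add: block_prob_def)

lemma block_prob_le_1 [simp]: "block_prob r \<Phi> \<le> 1"
  unfolding block_prob_def using prob_space.prob_le_1[OF prob_space_PiM_const] .

lemma measurable_block_restrict [measurable]:
  "(\<lambda>W. \<lambda>j\<in>{..<r}. W (f j)) \<in> iid M \<rightarrow>\<^sub>M (\<Pi>\<^sub>M j\<in>{..<r}. M)"
  by (rule measurable_restrict) measurable

lemma nn_integral_block:
  assumes i: "i \<ge> 1" and "(\<lambda>x. g (map x [0..<k - 1])) \<in> borel_measurable (\<Pi>\<^sub>M j\<in>{..<k - 1}. M)"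
  shows "(\<integral>\<^sup>+W. g (block W k i) \<partial>iid M) = (\<integral>\<^sup>+x. g (map x [0..<k - 1]) \<partial>(\<Pi>\<^sub>M j\<in>{..<k - 1}. M))"
proof -
  let ?f = "\<lambda>j. 1 + (i - 1) * (k - 1) + j"
  let ?t = "\<lambda>W. \<lambda>j\<in>{..<k - 1}. W (?f j)"
  have "distr (iid M) (\<Pi>\<^sub>M j\<in>{..<k - 1}. M) ?t = (\<Pi>\<^sub>M j\<in>{..<k - 1}. M)"
    unfolding iid_def by (rule distr_PiM_reindex) (auto intro: prob_space_axioms simp: inj_on_def)
  hence "(\<integral>\<^sup>+x. g (map x [0..<k - 1]) \<partial>(\<Pi>\<^sub>M j\<in>{..<k - 1}. M))
    = (\<integral>\<^sup>+x. g (map x [0..<k - 1]) \<partial>distr (iid M) (\<Pi>\<^sub>M j\<in>{..<k - 1}. M) ?t)" by simp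
  also have "\<dots> = (\<integral>\<^sup>+W. g (map (?t W) [0..<k - 1]) \<partial>iid M)"
    using assms by (intro nn_integral_distr) measurable
  finally show ?thesis by (simp only: block_eq_map_restrict[OF i])
qed

lemma pred_block:
  assumes i: "i \<ge> 1" and "block_pred (k - 1) \<Phi>"
  shows "Measurable.pred (iid M) (\<lambda>W. \<Phi> (block W k i))"
proof -
  have "Measurable.pred (\<Pi>\<^sub>M j\<in>{..<k - 1}. M) (\<lambda>x. \<Phi> (map x [0..<k - 1]))"
    using assms by (simp add: block_pred_def pred_def)
  from measurable_compose[OF measurable_block_restrict this]
  show ?thesis by (simp only: block_eq_map_restrict[OF i])
qed

lemma measure_block_eq:
  assumes i: "i \<ge> 1" and "block_pred (k - 1) \<Phi>"
  shows "measure (iid M) {W. \<Phi> (block W k i)} = block_prob (k - 1) \<Phi>"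
proof -
  interpret B: prob_space "\<Pi>\<^sub>M j\<in>{..<k - 1}. M" by (rule prob_space_PiM_const)
  let ?g = "\<lambda>xs. of_bool (\<Phi> xs) :: ennreal"
  have B [measurable]: "Measurable.pred (\<Pi>\<^sub>M j\<in>{..<k - 1}. M) (\<lambda>x. \<Phi> (map x [0..<k - 1]))"
    using assms(2) by (simp add: block_pred_def pred_def)
  have A [measurable]: "{W. \<Phi> (block W k i)} \<in> sets (iid M)" using pred_block[OF assms] by (simp add: pred_def)
  have "emeasure (iid M) {W. \<Phi> (block W k i)} = (\<integral>\<^sup>+W. ?g (block W k i) \<partial>iid M)"
  proof (subst nn_integral_indicator[symmetric])
    show "(\<integral>\<^sup>+W. indicator {W. \<Phi> (block W k i)} W \<partial>iid M) = (\<integral>\<^sup>+W. ?g (block W k i) \<partial>iid M)"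
      by (intro nn_integral_cong) (auto simp: indicator_def)
  qed (rule A)
  also have "\<dots> = (\<integral>\<^sup>+x. ?g (map x [0..<k - 1]) \<partial>(\<Pi>\<^sub>M j\<in>{..<k - 1}. M))"
    by (rule nn_integral_block[OF i]) measurable
  also have "\<dots> = (\<integral>\<^sup>+x. indicator {x \<in> space (\<Pi>\<^sub>M j\<in>{..<k - 1}. M). \<Phi> (map x [0..<k - 1])} x \<partial>(\<Pi>\<^sub>M j\<in>{..<k - 1}. M))"
    by (intro nn_integral_cong) (auto simp: indicator_def)
  also have "\<dots> = ennreal (block_prob (k - 1) \<Phi>)"
    using assms(2) by (subst nn_integral_indicator) (simp_all only: block_pred_def block_prob_def B.emeasure_eq_measure)
  finally show ?thesis by (simp add: iid.emeasure_eq_measure)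
qed

lemma measurable_block_count [measurable]:
  assumes "block_pred (k - 1) \<Phi>"
  shows "(\<lambda>W. card {i \<in> {1..N}. \<Phi> (block W k i)}) \<in> iid M \<rightarrow>\<^sub>M count_space UNIV"
proof (rule measurable_card)
  show "{W \<in> space (iid M). i \<in> {i \<in> {1..N}. \<Phi> (block W k i)}} \<in> sets (iid M)" for i
  proof (cases "i \<in> {1..N}")
    case True
    thus ?thesis using pred_block[OF _ assms, of i] by (simp add: pred_def)
  next
    case False
    hence "{W \<in> space (iid M). i \<in> {i \<in> {1..N}. \<Phi> (block W k i)}} = {}" by auto
    thus ?thesis by (simp only: sets.empty_sets)
  qed
qed

text \<open>Blocks occupy disjoint stretches, so restarting after the first \<open>N\<close> of them
  turns the next one into the first block of an independent copy. For \<open>k = 1\<close> all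
  blocks are empty and the argument degenerates harmlessly.\<close>

lemma block_count_mgf:
  assumes \<Phi>: "block_pred (k - 1) \<Phi>" and b: "0 < (b :: real)"
  shows "(\<integral>\<^sup>+W. ennreal (b ^ card {i \<in> {1..N}. \<Phi> (block W k i)}) \<partial>iid M)
    \<le> ennreal (exp ((b - 1) * (block_prob (k - 1) \<Phi> * real N)))"
proof (induction N)
  case 0
  show ?case by (simp add: iid.emeasure_space_1[simplified])
next
  case (Suc N)
  let ?c = "\<lambda>N W. card {i \<in> {1..N}. \<Phi> (block W k i)}" and ?m = "N * (k - 1)"
  let ?p = "block_prob (k - 1) \<Phi>"
  note [measurable] = pred_block[OF _ \<Phi>] measurable_block_count[OF \<Phi>]
  have old: "block (restart ?m W W') k i = block W k i" if "i \<in> {1..N}" for W W' i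
  proof -
    have "(i - 1) * (k - 1) + (k - 1) \<le> ?m"
    proof -
      have "(i - 1) * (k - 1) + (k - 1) = Suc (i - 1) * (k - 1)" by simp
      also have "\<dots> \<le> ?m" using that by (intro mult_le_mono1) auto
      finally show ?thesis .
    qed
    thus ?thesis using that by (auto simp: block_eq_map_restrict intro!: nth_equalityI)
  qed
  have new: "block (restart ?m W W') k (Suc N) = block W' k 1" for W W'
    by (auto simp: block_eq_map_restrict intro!: nth_equalityI)
  have c: "?c (Suc N) W = ?c N W + (if \<Phi> (block W k (Suc N)) then 1 else 0)" for W
  proof -
    have "{i \<in> {1..Suc N}. \<Phi> (block W k i)} = {i \<in> {1..N}. \<Phi> (block W k i)} \<union> (if \<Phi> (block W k (Suc N)) then {Suc N} else {})"
      by (auto simp: le_Suc_eq)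
    thus ?thesis by (auto intro: card_Un_disjoint)
  qed
  have c': "?c N (restart ?m W W') = ?c N W" for W W'
    using old by (intro arg_cong[where f = card]) auto
  have "(\<integral>\<^sup>+W. ennreal (b ^ ?c (Suc N) W) \<partial>iid M)
    = (\<integral>\<^sup>+W. \<integral>\<^sup>+W'. ennreal (b ^ ?c (Suc N) (restart ?m W W')) \<partial>iid M \<partial>iid M)"
    by (rule nn_integral_restart) measurable
  also have "\<dots> = (\<integral>\<^sup>+W. \<integral>\<^sup>+W'. ennreal (b ^ ?c N W) * ennreal (if \<Phi> (block W' k 1) then b else 1) \<partial>iid M \<partial>iid M)"
  proof (intro nn_integral_cong)
    fix W W'
    have e: "b ^ ?c (Suc N) (restart ?m W W') = b ^ ?c N W * (if \<Phi> (block W' k 1) then b else 1)"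
      unfolding c c' new by simp
    show "ennreal (b ^ ?c (Suc N) (restart ?m W W')) = ennreal (b ^ ?c N W) * ennreal (if \<Phi> (block W' k 1) then b else 1)"
      unfolding e using b by (intro ennreal_mult) auto
  qed
  also have "\<dots> = (\<integral>\<^sup>+W. ennreal (b ^ ?c N W) * (\<integral>\<^sup>+W'. ennreal (if \<Phi> (block W' k 1) then b else 1) \<partial>iid M) \<partial>iid M)"
    by (intro nn_integral_cong nn_integral_cmult) measurable
  also have "(\<integral>\<^sup>+W'. ennreal (if \<Phi> (block W' k 1) then b else 1) \<partial>iid M) = ennreal (1 + (b - 1) * ?p)"
  proof -
    let ?A = "{W. \<Phi> (block W k 1)}"
    have A: "?A \<in> sets (iid M)" using pred_block[OF _ \<Phi>, of 1] by (simp add: pred_def)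
    have "(\<integral>\<^sup>+W'. ennreal (if \<Phi> (block W' k 1) then b else 1) \<partial>iid M) = (\<integral>\<^sup>+W. ennreal (1 + (b - 1) * indicator ?A W) \<partial>iid M)"
      by (intro nn_integral_cong) (auto simp: indicator_def)
    also have "\<dots> = ennreal (\<integral>W. 1 + (b - 1) * indicator ?A W \<partial>iid M)"
    proof (rule nn_integral_eq_integral)
      show "integrable (iid M) (\<lambda>W. 1 + (b - 1) * indicat_real ?A W)"
      proof -
        have "integrable (iid M) (indicat_real ?A)" using A by (simp add: iid.emeasure_eq_measure)
        thus ?thesis by (intro Bochner_Integration.integrable_add integrable_mult_right) simp_all
      qed
    qed (use b in \<open>auto simp: indicator_def\<close>)
    also have "(\<integral>W. 1 + (b - 1) * indicator ?A W \<partial>iid M) = 1 + (b - 1) * measure (iid M) ?A"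
      using A by (simp add: iid.emeasure_eq_measure iid.prob_space[simplified])
    finally show ?thesis by (simp only: measure_block_eq[OF order_refl \<Phi>])
  qed
  also have "(\<integral>\<^sup>+W. ennreal (b ^ ?c N W) * ennreal (1 + (b - 1) * ?p) \<partial>iid M)
    = (\<integral>\<^sup>+W. ennreal (b ^ ?c N W) \<partial>iid M) * ennreal (1 + (b - 1) * ?p)"
    by (rule nn_integral_multc) measurable
  also have "\<dots> \<le> ennreal (exp ((b - 1) * (?p * real N))) * ennreal (exp ((b - 1) * ?p))"
    by (intro mult_mono Suc ennreal_leI exp_ge_add_one_self) auto
  also have "\<dots> = ennreal (exp ((b - 1) * (?p * real (Suc N))))"
    by (simp add: ennreal_mult[symmetric] exp_add[symmetric] algebra_simps)
  finally show ?case .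
qed

lemma block_count_deviation_le:
  assumes "block_pred (k - 1) \<Phi>" "0 < \<eta>" "\<eta> \<le> 1"
  shows "measure (iid M) {W. \<eta> * real N < \<bar>real (card {i \<in> {1..N}. \<Phi> (block W k i)}) - block_prob (k - 1) \<Phi> * real N\<bar>}
    \<le> 2 * exp (- (\<eta>\<^sup>2 / 8) * real N)"
  using iid.count_deviation_le[OF measurable_block_count[OF assms(1)] block_count_mgf[OF assms(1)] block_prob_nonneg block_prob_le_1 assms(2,3), of N]
  by simp

lemma block_pred_1:
  assumes "D \<in> sets M"
  shows "block_pred 1 (\<lambda>S. hd S \<in> D)" "block_prob 1 (\<lambda>S. hd S \<in> D) = measure M D"
proof -
  interpret product_prob_space "\<lambda>_. M" "{..<1::nat}" by unfold_locales
  let ?A = "{x \<in> space (\<Pi>\<^sub>M j\<in>{..<1::nat}. M). x 0 \<in> D}"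
  have "?A \<in> sets (\<Pi>\<^sub>M j\<in>{..<1::nat}. M)" using assms by measurable
  thus "block_pred 1 (\<lambda>S. hd S \<in> D)" by (simp add: block_pred_def)
  have "emeasure (\<Pi>\<^sub>M j\<in>{..<1::nat}. M) ?A = emeasure M D"
    using emeasure_PiM_Collect_single[of 0 D] assms by simp
  thus "block_prob 1 (\<lambda>S. hd S \<in> D) = measure M D" by (simp add: block_prob_def measure_def)
qed

text \<open>Single points are the blocks of order 2, which have length 1.\<close>

lemma point_count_deviation_le:
  assumes "D \<in> sets M" "0 < \<eta>" "\<eta> \<le> 1"
  shows "measure (iid M) {W. \<eta> * real N < \<bar>real (card {i \<in> {1..N}. W i \<in> D}) - measure M D * real N\<bar>}
    \<le> 2 * exp (- (\<eta>\<^sup>2 / 8) * real N)"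
proof -
  have "{i \<in> {1..N}. hd (block W 2 i) \<in> D} = {i \<in> {1..N}. W i \<in> D}" for W
    by (auto simp: block_2)
  thus ?thesis
    using block_count_deviation_le[of 2 "\<lambda>S. hd S \<in> D" \<eta> N] block_pred_1[OF assms(1)] assms by simp
qed

end

section \<open>The radius of the version space\<close>

locale realizable = full_prob_space P for P :: "('a::polish_space) measure" +
  fixes C :: "'a classifier set" and f :: "'a classifier" and d :: nat
  assumes sets_P [measurable_cong]: "sets P = sets borel"
    and C_sub: "C \<subseteq> classifiers"
    and vc_dim: "vc_dim C = enat d"
    and class_meas: "class_measurable C"
    and f_in_C: "f \<in> C"
begin

lemma measurable_classifier: "h \<in> C \<Longrightarrow> h \<in> P \<rightarrow>\<^sub>M count_space UNIV"
  using C_sub sets_P by (auto simp: classifiers_def cong: measurable_cong_sets)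

lemma measurable_f [measurable]: "f \<in> P \<rightarrow>\<^sub>M count_space UNIV"
  by (rule measurable_classifier[OF f_in_C])

lemma measurable_iid_component_borel [measurable]: "(\<lambda>X. X i) \<in> iid P \<rightarrow>\<^sub>M borel"
  using measurable_iid_component[of i] sets_P by (simp cong: measurable_cong_sets)

lemma measurable_f_component [measurable]: "Measurable.pred (iid P) (\<lambda>X. f (X i))"
  by (rule measurable_compose[OF measurable_iid_component measurable_f])

lemma disagreement_sets:
  assumes "h \<in> C"
  shows "{x. h x \<noteq> f x} \<in> sets P"
proof -
  have [measurable]: "Measurable.pred P h" by (rule measurable_classifier[OF assms])
  have "Measurable.pred P (\<lambda>x. h x \<noteq> f x)" by measurable
  thus ?thesis by (simp add: pred_def)
qed

definition version_space :: "nat \<Rightarrow> (nat \<Rightarrow> 'a) \<Rightarrow> 'a classifier set" where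
  "version_space m X = {h \<in> C. \<forall>i\<in>{1..m}. h (X i) = f (X i)}"

lemma version_space_0 [simp]: "version_space 0 X = C"
  by (simp add: version_space_def)

lemma version_space_Suc:
  "version_space (Suc m) X = restr (version_space m X) (X (Suc m)) (f (X (Suc m)))"
  by (auto simp: version_space_def restr_def atLeastAtMostSuc_conv)

lemma f_in_version_space: "f \<in> version_space m X"
  by (simp add: version_space_def f_in_C)

lemma version_space_antimono: "m \<le> m' \<Longrightarrow> version_space m' X \<subseteq> version_space m X"
  by (auto simp: version_space_def)

lemma version_space_past: "(\<And>j. j \<le> m \<Longrightarrow> X j = X' j) \<Longrightarrow> version_space m X = version_space m X'"
  by (simp add: version_space_def)

end

text \<open>The measurability convention concerns fixed label patterns only. Labels that depend on
  the outcome are handled by splitting the event according to the finitely many patterns they can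
  form.\<close>

lemma pred_ex_consistent:
  fixes C :: "('a::polish_space) classifier set" and n :: nat
  assumes C: "class_measurable C"
    and u: "\<And>i. i < n \<Longrightarrow> u i \<in> N \<rightarrow>\<^sub>M borel"
    and b: "\<And>i. i < n \<Longrightarrow> Measurable.pred N (b i)"
  shows "Measurable.pred N (\<lambda>\<omega>. \<exists>h\<in>C. \<forall>i<n. h (u i \<omega>) = b i \<omega>)"
proof -
  have const: "Measurable.pred N (\<lambda>\<omega>. \<exists>h\<in>C. \<forall>i<n. h (u i \<omega>) = ys i)" for ys
  proof -
    have "(\<lambda>\<omega>. \<lambda>i\<in>{..<n}. u i \<omega>) \<in> N \<rightarrow>\<^sub>M (\<Pi>\<^sub>M i\<in>{..<n}. borel)"
      using u by (intro measurable_restrict) auto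
    moreover have "Measurable.pred (\<Pi>\<^sub>M i\<in>{..<n}. borel :: 'a measure) (\<lambda>x. \<exists>h\<in>C. \<forall>i<n. h (x i) = ys i)"
      using C[unfolded class_measurable_def, rule_format, of n ys] by (simp add: pred_def)
    ultimately have "Measurable.pred N (\<lambda>\<omega>. \<exists>h\<in>C. \<forall>i<n. h ((\<lambda>i\<in>{..<n}. u i \<omega>) i) = ys i)"
      by (rule measurable_compose)
    thus ?thesis by (simp cong: conj_cong)
  qed
  let ?Y = "{..<n} \<rightarrow>\<^sub>E (UNIV :: bool set)"
  have "(\<exists>h\<in>C. \<forall>i<n. h (u i \<omega>) = b i \<omega>) \<longleftrightarrow>
    (\<exists>ys\<in>?Y. (\<forall>i\<in>{..<n}. b i \<omega> = ys i) \<and> (\<exists>h\<in>C. \<forall>i<n. h (u i \<omega>) = ys i))" for \<omega>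
  proof
    assume "\<exists>h\<in>C. \<forall>i<n. h (u i \<omega>) = b i \<omega>"
    thus "\<exists>ys\<in>?Y. (\<forall>i\<in>{..<n}. b i \<omega> = ys i) \<and> (\<exists>h\<in>C. \<forall>i<n. h (u i \<omega>) = ys i)"
      by (intro bexI[of _ "\<lambda>i\<in>{..<n}. b i \<omega>"]) auto
  qed auto
  moreover have "Measurable.pred N (\<lambda>\<omega>. \<exists>ys\<in>?Y. (\<forall>i\<in>{..<n}. b i \<omega> = ys i) \<and> (\<exists>h\<in>C. \<forall>i<n. h (u i \<omega>) = ys i))"
  proof (rule pred_intros_finite(4), goal_cases)
    case 1
    show "finite ?Y" by (intro finite_PiE) auto
  next
    case (2 ys)
    show ?case
    proof (rule pred_intros_logic(3))
    show "Measurable.pred N (\<lambda>\<omega>. \<exists>h\<in>C. \<forall>i<n. h (u i \<omega>) = ys i)" by (rule const)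
    show "Measurable.pred N (\<lambda>\<omega>. \<forall>i\<in>{..<n}. b i \<omega> = ys i)"
    proof (rule pred_intros_finite(3))
      fix i assume "i \<in> {..<n}"
      hence "Measurable.pred N (b i)" by (intro b) auto
      thus "Measurable.pred N (\<lambda>\<omega>. b i \<omega> = ys i)" by (cases "ys i") (simp_all add: pred_intros_logic(2))
    qed simp
    qed
  qed
  ultimately show ?thesis by simp
qed

section \<open>Symmetrization with a ghost sample\<close>

context realizable
begin

text \<open>The double-sample event of Vapnik and Chervonenkis in the realizable case; the second
  half is the ghost sample.\<close>

definition ghost_event :: "nat \<Rightarrow> real \<Rightarrow> (nat \<Rightarrow> 'a) \<Rightarrow> bool" where
  "ghost_event m a X \<longleftrightarrow> (\<exists>h\<in>C. (\<forall>i\<in>{1..m}. h (X i) = f (X i)) \<and>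
     a \<le> real (card {i \<in> {1..m}. h (X (m + i)) \<noteq> f (X (m + i))}))"

lemma pred_ghost_event [measurable]: "Measurable.pred (iid P) (ghost_event m a)"
proof -
  \<comment> \<open>Here \<open>e\<close> is the pattern of errors of a concept on the double
    sample. Both requirements depend on \<open>e\<close> alone, which leaves a finite union of
    events of the form treated in \<open>pred_ex_consistent\<close>.\<close>
  let ?E = "{e \<in> {1..2 * m} \<rightarrow>\<^sub>E (UNIV :: bool set). (\<forall>i\<in>{1..m}. \<not> e i) \<and> a \<le> real (card {i \<in> {1..m}. e (m + i)})}"
  have "ghost_event m a X \<longleftrightarrow> (\<exists>e\<in>?E. \<exists>h\<in>C. \<forall>i<2 * m. h (X (i + 1)) = (f (X (i + 1)) \<noteq> e (i + 1)))" for X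
  proof
    assume "ghost_event m a X"
    then obtain h where h: "h \<in> C" "\<forall>i\<in>{1..m}. h (X i) = f (X i)"
      "a \<le> real (card {i \<in> {1..m}. h (X (m + i)) \<noteq> f (X (m + i))})" unfolding ghost_event_def by blast
    define e where "e = (\<lambda>i\<in>{1..2 * m}. h (X i) \<noteq> f (X i))"
    have "{i \<in> {1..m}. e (m + i)} = {i \<in> {1..m}. h (X (m + i)) \<noteq> f (X (m + i))}" by (auto simp: e_def)
    hence "e \<in> ?E" using h by (auto simp: e_def)
    moreover have "\<forall>i<2 * m. h (X (i + 1)) = (f (X (i + 1)) \<noteq> e (i + 1))" by (auto simp: e_def)
    ultimately show "\<exists>e\<in>?E. \<exists>h\<in>C. \<forall>i<2 * m. h (X (i + 1)) = (f (X (i + 1)) \<noteq> e (i + 1))" using h(1) by blast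
  next
    assume "\<exists>e\<in>?E. \<exists>h\<in>C. \<forall>i<2 * m. h (X (i + 1)) = (f (X (i + 1)) \<noteq> e (i + 1))"
    then obtain e h where e: "e \<in> ?E" "h \<in> C" and eq: "\<forall>i<2 * m. h (X (i + 1)) = (f (X (i + 1)) \<noteq> e (i + 1))" by blast
    have eq': "h (X i) = (f (X i) \<noteq> e i)" if "i \<in> {1..2 * m}" for i
    proof -
      have "i - 1 < 2 * m" "i - 1 + 1 = i" using that by auto
      thus ?thesis using eq by metis
    qed
    have "{i \<in> {1..m}. h (X (m + i)) \<noteq> f (X (m + i))} = {i \<in> {1..m}. e (m + i)}"
      using eq' by (intro Collect_cong conj_cong) auto
    moreover have "\<forall>i\<in>{1..m}. h (X i) = f (X i)" using eq' e(1) by auto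
    ultimately show "ghost_event m a X" unfolding ghost_event_def using e by (intro bexI[of _ h]) auto
  qed
  moreover have "Measurable.pred (iid P) (\<lambda>X. \<exists>e\<in>?E. \<exists>h\<in>C. \<forall>i<2 * m. h (X (i + 1)) = (f (X (i + 1)) \<noteq> e (i + 1)))"
  proof (rule pred_intros_finite(4))
    show "finite ?E" by (rule finite_subset[of _ "{1..2 * m} \<rightarrow>\<^sub>E UNIV"]) (auto intro: finite_PiE)
    show "Measurable.pred (iid P) (\<lambda>X. \<exists>h\<in>C. \<forall>i<2 * m. h (X (i + 1)) = (f (X (i + 1)) \<noteq> e (i + 1)))" for e
      by (intro pred_ex_consistent class_meas) measurable
  qed
  ultimately show ?thesis by (simp cong: measurable_cong)
qed

text \<open>Exchanging the two samples of a pair leaves the distribution invariant, but at most one of the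
  two positions of an erring pair is compatible with consistency on the first sample.\<close>

definition swap_pairs :: "nat \<Rightarrow> nat set \<Rightarrow> nat \<Rightarrow> nat" where
  "swap_pairs m \<sigma> j = (if j \<in> \<sigma> then j + m else if m < j \<and> j - m \<in> \<sigma> then j - m else j)"

lemma inj_swap_pairs: "\<sigma> \<subseteq> {1..m} \<Longrightarrow> inj (swap_pairs m \<sigma>)"
  by (rule inj_on_inverseI[of _ "swap_pairs m \<sigma>"]) (auto simp: swap_pairs_def)

text \<open>For fixed data a concept matters only through its trace on the \<open>2 * m\<close>
  points, and there are polynomially many traces. For one trace the exchanges are forced on the set
  \<open>E\<close> of erring pairs and free elsewhere, and \<open>E\<close> has at least
  \<open>a\<close> elements.\<close>

lemma card_ghost_swaps:
  "real (card {\<sigma> \<in> Pow {1..m}. ghost_event m a (\<lambda>j. X (swap_pairs m \<sigma> j))})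
    \<le> real ((2 * m + 1) ^ d) * (2 ^ m * 2 powr (- a))"
proof -
  define A where "A = X ` {1..2 * m}"
  define F where "F = (\<lambda>h. {x\<in>A. h x}) ` C"
  define ok where "ok = (\<lambda>p \<sigma>. (\<forall>i\<in>{1..m}. (X (swap_pairs m \<sigma> i) \<in> p) = f (X (swap_pairs m \<sigma> i))) \<and>
     a \<le> real (card {i \<in> {1..m}. (X (swap_pairs m \<sigma> (m + i)) \<in> p) \<noteq> f (X (swap_pairs m \<sigma> (m + i)))}))"
  have finA: "finite A" by (simp add: A_def)
  have finF: "finite F" unfolding F_def by (rule finite_subset[of _ "Pow A"]) (use finA in auto)
  have "card A \<le> 2 * m" unfolding A_def using card_image_le[of "{1..2 * m}" X] by simp
  hence cF: "card F \<le> (2 * m + 1) ^ d"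
    using card_patterns_le[OF vc_dim finA] power_mono[of "card A + 1" "2 * m + 1" d] unfolding F_def by linarith
  have swA: "X (swap_pairs m \<sigma> i) \<in> A" if "\<sigma> \<subseteq> {1..m}" "i \<in> {1..2 * m}" for \<sigma> i
    using that unfolding A_def swap_pairs_def by (auto split: if_splits)
  have sub: "{\<sigma> \<in> Pow {1..m}. ghost_event m a (\<lambda>j. X (swap_pairs m \<sigma> j))} \<subseteq> (\<Union>p\<in>F. {\<sigma> \<in> Pow {1..m}. ok p \<sigma>})"
  proof
    fix \<sigma> assume "\<sigma> \<in> {\<sigma> \<in> Pow {1..m}. ghost_event m a (\<lambda>j. X (swap_pairs m \<sigma> j))}"
    then obtain h where \<sigma>: "\<sigma> \<subseteq> {1..m}" and h: "h \<in> C" "\<forall>i\<in>{1..m}. h (X (swap_pairs m \<sigma> i)) = f (X (swap_pairs m \<sigma> i))"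
      "a \<le> real (card {i \<in> {1..m}. h (X (swap_pairs m \<sigma> (m + i))) \<noteq> f (X (swap_pairs m \<sigma> (m + i)))})"
      unfolding ghost_event_def by blast
    have in_p: "X (swap_pairs m \<sigma> i) \<in> {x\<in>A. h x} \<longleftrightarrow> h (X (swap_pairs m \<sigma> i))" if "i \<in> {1..2 * m}" for i
      using swA[OF \<sigma> that] by simp
    have "{i \<in> {1..m}. (X (swap_pairs m \<sigma> (m + i)) \<in> {x\<in>A. h x}) \<noteq> f (X (swap_pairs m \<sigma> (m + i)))}
      = {i \<in> {1..m}. h (X (swap_pairs m \<sigma> (m + i))) \<noteq> f (X (swap_pairs m \<sigma> (m + i)))}"
      using in_p by (intro Collect_cong conj_cong refl) auto
    moreover have "\<forall>i\<in>{1..m}. (X (swap_pairs m \<sigma> i) \<in> {x\<in>A. h x}) = f (X (swap_pairs m \<sigma> i))"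
    proof
      fix i assume i: "i \<in> {1..m}"
      hence "i \<in> {1..2 * m}" by auto
      from in_p[OF this] show "(X (swap_pairs m \<sigma> i) \<in> {x\<in>A. h x}) = f (X (swap_pairs m \<sigma> i))" using h(2) i by blast
    qed
    ultimately have "ok {x\<in>A. h x} \<sigma>" unfolding ok_def using h(3) by simp
    thus "\<sigma> \<in> (\<Union>p\<in>F. {\<sigma> \<in> Pow {1..m}. ok p \<sigma>})" using h(1) \<sigma> unfolding F_def by blast
  qed
  have one: "real (card {\<sigma> \<in> Pow {1..m}. ok p \<sigma>}) \<le> 2 ^ m * 2 powr (- a)" for p
  proof (cases "{\<sigma> \<in> Pow {1..m}. ok p \<sigma>} = {}")
    case False
    define e where "e = (\<lambda>j. (X j \<in> p) \<noteq> f (X j))"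
    define E where "E = {i \<in> {1..m}. e i \<or> e (m + i)}"
    have okD: "\<not> e (swap_pairs m \<sigma> i)" if "ok p \<sigma>" "i \<in> {1..m}" for \<sigma> i
      using that unfolding ok_def e_def by auto
    \<comment> \<open>A pair in \<open>E\<close> must be exchanged exactly if its first member is an
      error; otherwise an error would stand in the consistent half.\<close>
    have on_E: "\<sigma> \<inter> E = {i \<in> E. e i}" if "ok p \<sigma>" "\<sigma> \<subseteq> {1..m}" for \<sigma>
    proof -
      have "i \<in> \<sigma> \<longleftrightarrow> e i" if i: "i \<in> E" for i
      proof -
        have "\<not> e (if i \<in> \<sigma> then i + m else i)"
          using okD[OF \<open>ok p \<sigma>\<close>, of i] i unfolding E_def swap_pairs_def by (auto split: if_splits)
        thus ?thesis using i unfolding E_def by (auto simp: add.commute split: if_splits)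
      qed
      thus ?thesis by blast
    qed
    obtain \<sigma>0 where \<sigma>0: "\<sigma>0 \<subseteq> {1..m}" "ok p \<sigma>0" using False by auto
    have "{i \<in> {1..m}. e (swap_pairs m \<sigma>0 (m + i))} \<subseteq> E"
      unfolding E_def using \<sigma>0(1) by (auto simp: swap_pairs_def split: if_splits)
    hence "card {i \<in> {1..m}. e (swap_pairs m \<sigma>0 (m + i))} \<le> card E"
      by (intro card_mono) (auto simp: E_def)
    hence aE: "a \<le> real (card E)" using \<sigma>0(2) unfolding ok_def e_def by linarith
    have "card {\<sigma> \<in> Pow {1..m}. ok p \<sigma>} \<le> card (Pow ({1..m} - E))"
    proof (rule card_inj_on_le[of "\<lambda>\<sigma>. \<sigma> - E"])
      show "inj_on (\<lambda>\<sigma>. \<sigma> - E) {\<sigma> \<in> Pow {1..m}. ok p \<sigma>}"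
      proof (rule inj_onI)
        fix \<sigma> \<sigma>' assume "\<sigma> \<in> {\<sigma> \<in> Pow {1..m}. ok p \<sigma>}" "\<sigma>' \<in> {\<sigma> \<in> Pow {1..m}. ok p \<sigma>}" and d: "\<sigma> - E = \<sigma>' - E"
        hence "\<sigma> \<inter> E = \<sigma>' \<inter> E" using on_E by auto
        thus "\<sigma> = \<sigma>'" using d by blast
      qed
    qed auto
    also have "\<dots> = 2 ^ (m - card E)"
    proof -
      have "E \<subseteq> {1..m}" by (auto simp: E_def)
      hence "card ({1..m} - E) = m - card E" by (subst card_Diff_subset) (auto intro: finite_subset)
      thus ?thesis by (simp add: card_Pow)
    qed
    finally have "real (card {\<sigma> \<in> Pow {1..m}. ok p \<sigma>}) \<le> real (2 ^ (m - card E))"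
      by (rule of_nat_mono)
    hence "real (card {\<sigma> \<in> Pow {1..m}. ok p \<sigma>}) \<le> 2 ^ (m - card E)" by simp
    also have "card E \<le> m"
    proof -
      have "E \<subseteq> {1..m}" by (auto simp: E_def)
      hence "card E \<le> card {1..m}" by (intro card_mono) auto
      thus ?thesis by simp
    qed
    hence "(2::real) ^ (m - card E) = 2 ^ m * 2 powr (- real (card E))"
      by (simp add: power_diff powr_minus powr_realpow divide_inverse)
    also have "\<dots> \<le> 2 ^ m * 2 powr (- a)" using aE by (intro mult_left_mono powr_mono) auto
    finally show ?thesis .
  next
    case True
    show ?thesis unfolding True by simp
  qed
  have "finite {\<sigma> \<in> Pow {1..m}. ok p \<sigma>}" for p by (rule finite_subset[of _ "Pow {1..m}"]) auto
  hence fin: "finite (\<Union>p\<in>F. {\<sigma> \<in> Pow {1..m}. ok p \<sigma>})" using finF by (intro finite_UN_I)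
  have "card {\<sigma> \<in> Pow {1..m}. ghost_event m a (\<lambda>j. X (swap_pairs m \<sigma> j))} \<le> card (\<Union>p\<in>F. {\<sigma> \<in> Pow {1..m}. ok p \<sigma>})"
    by (rule card_mono[OF fin sub])
  also have "\<dots> \<le> (\<Sum>p\<in>F. card {\<sigma> \<in> Pow {1..m}. ok p \<sigma>})" using finF by (rule card_UN_le)
  finally have "real (card {\<sigma> \<in> Pow {1..m}. ghost_event m a (\<lambda>j. X (swap_pairs m \<sigma> j))})
    \<le> real (\<Sum>p\<in>F. card {\<sigma> \<in> Pow {1..m}. ok p \<sigma>})" by (rule of_nat_mono)
  also have "\<dots> = (\<Sum>p\<in>F. real (card {\<sigma> \<in> Pow {1..m}. ok p \<sigma>}))" by simp
  also have "\<dots> \<le> (\<Sum>p\<in>F. 2 ^ m * 2 powr (- a))" by (intro sum_mono one)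
  also have "\<dots> = real (card F) * (2 ^ m * 2 powr (- a))" by simp
  also have "\<dots> \<le> real ((2 * m + 1) ^ d) * (2 ^ m * 2 powr (- a))"
    using cF by (intro mult_right_mono of_nat_mono) auto
  finally show ?thesis .
qed

text \<open>Averaging over all \<open>2 ^ m\<close> exchanges, each of which preserves the
  distribution, replaces the probability by a count for fixed data.\<close>

lemma ghost_event_le:
  "emeasure (iid P) {X. ghost_event m a X} \<le> ennreal (real ((2 * m + 1) ^ d) * 2 powr (- a))"
proof -
  let ?I = "\<lambda>X. indicator {X. ghost_event m a X} X :: ennreal"
  have Gs [measurable]: "{X. ghost_event m a X} \<in> sets (iid P)" using pred_ghost_event by (simp add: pred_def)
  have sw: "(\<integral>\<^sup>+X. ?I (\<lambda>j. X (swap_pairs m \<sigma> j)) \<partial>iid P) = emeasure (iid P) {X. ghost_event m a X}" if "\<sigma> \<subseteq> {1..m}" for \<sigma>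
  proof -
    have "(\<integral>\<^sup>+X. ?I X \<partial>iid P) = (\<integral>\<^sup>+X. \<integral>\<^sup>+X'. ?I (\<lambda>j. if j \<in> {} then X j else X' (swap_pairs m \<sigma> j)) \<partial>iid P \<partial>iid P)"
      using inj_swap_pairs[OF that] by (intro nn_integral_iid_mix) (auto intro: inj_on_subset)
    also have "\<dots> = (\<integral>\<^sup>+X. ?I (\<lambda>j. X (swap_pairs m \<sigma> j)) \<partial>iid P)"
      by (simp add: iid.emeasure_space_1[simplified])
    finally show ?thesis by (simp only: nn_integral_indicator[OF Gs, symmetric])
  qed
  have "ennreal (2 ^ m) * emeasure (iid P) {X. ghost_event m a X} = (\<Sum>\<sigma>\<in>Pow {1..m}. emeasure (iid P) {X. ghost_event m a X})"
    by (simp add: card_Pow ennreal_power[symmetric])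
  also have "\<dots> = (\<Sum>\<sigma>\<in>Pow {1..m}. \<integral>\<^sup>+X. ?I (\<lambda>j. X (swap_pairs m \<sigma> j)) \<partial>iid P)"
    using sw by (intro sum.cong) auto
  also have "\<dots> = (\<integral>\<^sup>+X. (\<Sum>\<sigma>\<in>Pow {1..m}. ?I (\<lambda>j. X (swap_pairs m \<sigma> j))) \<partial>iid P)"
  proof (rule nn_integral_sum[symmetric])
    fix \<sigma>
    have [measurable]: "(\<lambda>X j. X (swap_pairs m \<sigma> j)) \<in> iid P \<rightarrow>\<^sub>M iid P"
      by (rule measurable_iidI) measurable
    show "(\<lambda>X. ?I (\<lambda>j. X (swap_pairs m \<sigma> j))) \<in> borel_measurable (iid P)" by measurable
  qed
  also have "\<dots> \<le> (\<integral>\<^sup>+X. ennreal (real ((2 * m + 1) ^ d) * (2 ^ m * 2 powr (- a))) \<partial>iid P)"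
  proof (rule nn_integral_mono)
    fix X
    have "(\<Sum>\<sigma>\<in>Pow {1..m}. ?I (\<lambda>j. X (swap_pairs m \<sigma> j)))
      = (\<Sum>\<sigma>\<in>Pow {1..m}. if ghost_event m a (\<lambda>j. X (swap_pairs m \<sigma> j)) then 1 else 0)"
      by (intro sum.cong) (auto simp: indicator_def)
    also have "\<dots> = of_nat (card {\<sigma> \<in> Pow {1..m}. ghost_event m a (\<lambda>j. X (swap_pairs m \<sigma> j))})"
      by (subst sum.If_cases) (auto intro!: arg_cong[where f = card])
    also have "\<dots> \<le> ennreal (real ((2 * m + 1) ^ d) * (2 ^ m * 2 powr (- a)))"
      using card_ghost_swaps[of m a X] by (simp add: ennreal_of_nat_eq_real_of_nat ennreal_leI)
    finally show "(\<Sum>\<sigma>\<in>Pow {1..m}. ?I (\<lambda>j. X (swap_pairs m \<sigma> j))) \<le> ennreal (real ((2 * m + 1) ^ d) * (2 ^ m * 2 powr (- a)))" .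
  qed
  also have "\<dots> = ennreal (real ((2 * m + 1) ^ d) * (2 ^ m * 2 powr (- a)))"
    by (simp add: iid.emeasure_space_1[simplified])
  finally have "measure (iid P) {X. ghost_event m a X} * 2 ^ m \<le> (real ((2 * m + 1) ^ d) * 2 powr (- a)) * 2 ^ m"
    by (subst (asm) iid.emeasure_eq_measure, subst (asm) ennreal_mult[symmetric]) (auto simp: mult_ac ennreal_le_iff)
  hence "measure (iid P) {X. ghost_event m a X} \<le> real ((2 * m + 1) ^ d) * 2 powr (- a)"
    by (rule mult_right_le_imp_le) simp
  thus ?thesis by (simp add: iid.emeasure_eq_measure ennreal_leI)
qed

text \<open>The lower tail with weight \<open>1 / 2\<close>: a fresh sample shows at least half of
  the expected errors with probability at least \<open>1 / 2\<close>.\<close>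

lemma ghost_sample_errs:
  assumes h: "h \<in> C" and r: "r < err P f h" and m: "8 \<le> r * real m"
  shows "1 / 2 \<le> measure (iid P) {X. r * real m / 2 \<le> real (card {i \<in> {1..m}. h (X i) \<noteq> f (X i)})}"
proof -
  let ?D = "{x. h x \<noteq> f x}" and ?a = "r * real m / 2"
  define Z where "Z = (\<lambda>i (X :: nat \<Rightarrow> 'a). 1 \<le> i \<and> h (X i) \<noteq> f (X i))"
  have D [measurable]: "?D \<in> sets P" by (rule disagreement_sets[OF h])
  have Zm: "Measurable.pred (iid P) (Z i)" for i
  proof -
    have "Measurable.pred P (\<lambda>x. h x \<noteq> f x)" using D by (simp add: pred_def)
    from measurable_compose[OF measurable_iid_component this]
    show ?thesis unfolding Z_def by measurable
  qed
  have set: "{i. i < Suc m \<and> Z i X} = {i \<in> {1..m}. h (X i) \<noteq> f (X i)}" for X by (auto simp: Z_def)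
  have "measure (iid P) {X. (1 / 2) powr ?a \<le> (1 / 2) ^ card {i. i < Suc m \<and> Z i X}}
    \<le> exp ((1 / 2 - 1) * (\<Sum>i<Suc m. if i = 0 then 0 else err P f h) - ?a * ln (1 / 2))"
  proof (rule predictable_count_tail[OF Zm])
    fix i X show "(1 / 2 - 1) * measure P {x. Z i (X(i := x))} \<le> (1 / 2 - 1) * (if i = 0 then 0 else err P f h)"
      by (cases "i = 0") (auto simp: Z_def err_def)
  qed (auto simp: Z_def)
  also have "(\<Sum>i<Suc m. if i = 0 then 0 else err P f h) = real m * err P f h"
    by (subst sum.lessThan_Suc_shift) simp
  \<comment> \<open>With \<open>ln 2 \<le> 3 / 4\<close> the exponent is at most
    \<open>- r * real m / 8\<close>, hence at most \<open>- 1\<close> by the hypothesis on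
    \<open>r * real m\<close>.\<close>
  also have "exp ((1 / 2 - 1) * (real m * err P f h) - ?a * ln (1 / 2)) \<le> exp (- 1)"
  proof -
    have "r * real m \<le> err P f h * real m" using r by (intro mult_right_mono) auto
    moreover have "ln 2 \<le> (3 / 4 :: real)"
      using ln2_le_25_over_36 by simp
    hence "r * real m * ln 2 \<le> r * real m * (3 / 4)" using m by (intro mult_left_mono) auto
    ultimately show ?thesis using m by (simp add: ln_div field_simps)
  qed
  also have "exp (- 1) \<le> (1 / 2 :: real)"
    using exp_ge_add_one_self[of 1] by (simp add: exp_minus field_simps)
  finally have le: "measure (iid P) {X. (1 / 2) powr ?a \<le> (1 / 2) ^ card {i \<in> {1..m}. h (X i) \<noteq> f (X i)}} \<le> 1 / 2"
    unfolding set .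
  have cm [measurable]: "(\<lambda>X. card {i. i < Suc m \<and> Z i X}) \<in> iid P \<rightarrow>\<^sub>M count_space UNIV"
  proof (rule measurable_card)
    show "{X \<in> space (iid P). i \<in> {i. i < Suc m \<and> Z i X}} \<in> sets (iid P)" for i
      using Zm[of i] by (cases "i < Suc m") (simp_all add: pred_def)
  qed
  let ?G = "{X. ?a \<le> real (card {i \<in> {1..m}. h (X i) \<noteq> f (X i)})}"
  have G: "{X. Q (card {i \<in> {1..m}. h (X i) \<noteq> f (X i)})} \<in> sets (iid P)" for Q
    using measurable_sets[OF cm[unfolded set], of "{c. Q c}"] by (simp add: vimage_def)
  have "1 - measure (iid P) ?G = measure (iid P) (UNIV - ?G)"
    using iid.prob_compl[OF G[of "\<lambda>c. ?a \<le> real c"]] by simp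
  also have "\<dots> \<le> measure (iid P) {X. (1 / 2) powr ?a \<le> (1 / 2) ^ card {i \<in> {1..m}. h (X i) \<noteq> f (X i)}}"
  proof (rule iid.finite_measure_mono)
    show "UNIV - ?G \<subseteq> {X. (1 / 2) powr ?a \<le> (1 / 2) ^ card {i \<in> {1..m}. h (X i) \<noteq> f (X i)}}"
      by (auto simp: powr_realpow[symmetric] not_le intro!: powr_mono')
  qed (rule G)
  finally show ?thesis using le by linarith
qed

text \<open>A surviving concept of error above \<open>r\<close> is exposed by a ghost sample with
  probability at least \<open>1 / 2\<close>. Taking for \<open>B\<close> the first samples whose
  conditional ghost probability is that large gives a measurable set, without asking whether the
  samples with a bad survivor form one; Markov's inequality costs the factor 2.\<close>

lemma radius_tail:
  assumes m: "8 \<le> r * real m"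
  obtains B where "B \<in> sets (iid P)" "measure (iid P) B \<le> 2 * (real ((2 * m + 1) ^ d) * 2 powr (- (r * real m / 2)))"
    "\<And>X. X \<notin> B \<Longrightarrow> version_space m X \<subseteq> concept_ball C P f r"
proof
  let ?a = "r * real m / 2"
  let ?I = "\<lambda>X. indicator {X. ghost_event m ?a X} X :: ennreal"
  let ?g = "\<lambda>X. \<integral>\<^sup>+X'. ?I (restart m X X') \<partial>iid P"
  let ?B = "{X. 1 / 2 \<le> ?g X}"
  have Gs [measurable]: "{X. ghost_event m ?a X} \<in> sets (iid P)" using pred_ghost_event by (simp add: pred_def)
  have rm [measurable]: "(\<lambda>(X, X'). restart m X X') \<in> iid P \<Otimes>\<^sub>M iid P \<rightarrow>\<^sub>M iid P"
    using measurable_iid_mix[of "{..m}" "\<lambda>j. j - m"] by (simp add: restart_def)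
  have gm [measurable]: "?g \<in> borel_measurable (iid P)" by measurable
  show B: "?B \<in> sets (iid P)"
    using measurable_sets[OF gm, of "{1 / 2..}"] by (simp add: vimage_def)
  have half: "(2 :: ennreal) * (1 / 2) = 1"
    by (simp add: ennreal_times_divide ennreal_divide_self)
  have "emeasure (iid P) ?B \<le> (\<integral>\<^sup>+X. 2 * ?g X \<partial>iid P)"
  proof (subst nn_integral_indicator[OF B, symmetric], rule nn_integral_mono)
    fix X
    show "indicator ?B X \<le> 2 * ?g X"
    proof (cases "1 / 2 \<le> ?g X")
      case True
      hence "2 * (1 / 2) \<le> 2 * ?g X" by (intro mult_left_mono) auto
      thus ?thesis using True half by simp
    qed simp
  qed
  also have "\<dots> = 2 * (\<integral>\<^sup>+X. ?g X \<partial>iid P)" by (rule nn_integral_cmult) measurable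
  also have "(\<integral>\<^sup>+X. ?g X \<partial>iid P) = emeasure (iid P) {X. ghost_event m ?a X}"
    by (subst nn_integral_restart[symmetric]) (auto simp: Gs)
  also have "2 * \<dots> \<le> 2 * ennreal (real ((2 * m + 1) ^ d) * 2 powr (- ?a))"
    by (intro mult_left_mono ghost_event_le) auto
  also have "\<dots> = ennreal (2 * (real ((2 * m + 1) ^ d) * 2 powr (- ?a)))"
    by (simp add: ennreal_mult)
  finally show "measure (iid P) ?B \<le> 2 * (real ((2 * m + 1) ^ d) * 2 powr (- ?a))"
    by (simp add: iid.emeasure_eq_measure ennreal_le_iff)
  fix X assume X: "X \<notin> ?B"
  show "version_space m X \<subseteq> concept_ball C P f r"
  proof
    fix h assume h: "h \<in> version_space m X"
    hence hC: "h \<in> C" by (simp add: version_space_def)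
    have "err P f h \<le> r"
    proof (rule ccontr)
      assume "\<not> err P f h \<le> r"
      hence "1 / 2 \<le> measure (iid P) {X'. ?a \<le> real (card {i \<in> {1..m}. h (X' i) \<noteq> f (X' i)})}" (is "_ \<le> measure _ ?G")
        using m by (intro ghost_sample_errs hC) auto
      moreover have "X' \<in> ?G \<Longrightarrow> ghost_event m ?a (restart m X X')" for X'
      proof -
        assume "X' \<in> ?G"
        moreover have "{i \<in> {1..m}. h (restart m X X' (m + i)) \<noteq> f (restart m X X' (m + i))} = {i \<in> {1..m}. h (X' i) \<noteq> f (X' i)}"
          by auto
        moreover have "\<forall>i\<in>{1..m}. h (restart m X X' i) = f (restart m X X' i)" using h by (simp add: version_space_def)
        ultimately show ?thesis unfolding ghost_event_def using hC by (intro bexI[of _ h] conjI) simp_all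
      qed
      hence "?G \<subseteq> {X'. ghost_event m ?a (restart m X X')}" by blast
      moreover have "{X'. ghost_event m ?a (restart m X X')} \<in> sets (iid P)"
        using measurable_sets[OF measurable_restart Gs, of m X] by (simp add: vimage_def)
      ultimately have "1 / 2 \<le> measure (iid P) {X'. ghost_event m ?a (restart m X X')}"
        using iid.finite_measure_mono by (metis (no_types, lifting) order_trans)
      hence "ennreal (1 / 2) \<le> ennreal (measure (iid P) {X'. ghost_event m ?a (restart m X X')})" by (rule ennreal_leI)
      also have "\<dots> = emeasure (iid P) {X'. ghost_event m ?a (restart m X X')}"
        by (simp add: iid.emeasure_eq_measure)
      also have "\<dots> = (\<integral>\<^sup>+X'. indicator {X'. ghost_event m ?a (restart m X X')} X' \<partial>iid P)"
        using \<open>{X'. ghost_event m ?a (restart m X X')} \<in> sets (iid P)\<close> by simp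
      also have "\<dots> = ?g X" by (intro nn_integral_cong) (auto simp: indicator_def)
      finally have "ennreal (1 / 2) \<le> ?g X" .
      moreover have "ennreal (1 / 2) = 1 / 2" using divide_ennreal[of 1 2] by simp
      ultimately have "1 / 2 \<le> ?g X" by (simp only:)
      thus False using X by blast
    qed
    thus "h \<in> concept_ball C P f r" using hC by (simp add: concept_ball_def err_def)
  qed
qed

end

section \<open>Outer bounds on probabilities\<close>

text \<open>Events about all concepts or about whole runs are not shown to be measurable; a
  measurable superset of small measure is all that the final estimate needs.\<close>

definition outer_le :: "'w measure \<Rightarrow> 'w set \<Rightarrow> real \<Rightarrow> bool" where
  "outer_le M E b \<longleftrightarrow> (\<exists>B\<in>sets M. E \<subseteq> B \<and> measure M B \<le> b)"

lemma outer_leI: "E \<in> sets M \<Longrightarrow> measure M E \<le> b \<Longrightarrow> outer_le M E b"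
  by (auto simp: outer_le_def)

lemma outer_le_mono: "outer_le M E b \<Longrightarrow> E' \<subseteq> E \<Longrightarrow> b \<le> b' \<Longrightarrow> outer_le M E' b'"
  unfolding outer_le_def by (meson order_trans)

lemma outer_le_empty: "outer_le M {} 0"
  by (rule outer_leI) auto

lemma (in prob_space) outer_le_Un:
  assumes "outer_le M E a" "outer_le M F b"
  shows "outer_le M (E \<union> F) (a + b)"
proof -
  obtain A B where "A \<in> sets M" "E \<subseteq> A" "measure M A \<le> a" "B \<in> sets M" "F \<subseteq> B" "measure M B \<le> b"
    using assms unfolding outer_le_def by blast
  moreover from this have "measure M (A \<union> B) \<le> a + b" using measure_Un_le[of A M B] by simp
  ultimately show ?thesis unfolding outer_le_def by (intro bexI[of _ "A \<union> B"]) auto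
qed

lemma (in prob_space) outer_le_UN_finite:
  assumes "finite I" "\<And>i. i \<in> I \<Longrightarrow> outer_le M (E i) (b i)"
  shows "outer_le M (\<Union>i\<in>I. E i) (\<Sum>i\<in>I. b i)"
  using assms
proof (induction I rule: finite_induct)
  case empty
  show ?case using outer_le_empty by simp
next
  case (insert i I)
  thus ?case using outer_le_Un[of "E i" "b i" "\<Union>i\<in>I. E i" "\<Sum>i\<in>I. b i"] by simp
qed

lemma (in prob_space) outer_le_UN:
  assumes "\<And>i::nat. outer_le M (E i) (b i)" "b sums s"
  shows "outer_le M (\<Union>i. E i) s"
proof -
  obtain B where B: "\<And>i. B i \<in> sets M" "\<And>i. E i \<subseteq> B i" "\<And>i. measure M (B i) \<le> b i"
    using assms(1) unfolding outer_le_def by metis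
  have b: "summable b" "s = suminf b" using assms(2) by (auto simp: sums_iff)
  have sm: "summable (\<lambda>i. measure M (B i))"
    using B(3) by (intro summable_comparison_test'[OF b(1)]) auto
  have "measure M (\<Union>i. B i) \<le> (\<Sum>i. measure M (B i))"
    using B(1) sm by (intro finite_measure_subadditive_countably) auto
  also have "\<dots> \<le> s" unfolding b(2) using B(3) sm b(1) by (intro suminf_le)
  finally show ?thesis unfolding outer_le_def using B by (intro bexI[of _ "\<Union>i. B i"]) auto
qed

lemma (in prob_space) outer_le_UN_exp:
  assumes "\<And>m. n \<le> m \<Longrightarrow> outer_le M (E m) (K * exp (- c * real m))" "0 < c" "0 \<le> K"
  shows "outer_le M (\<Union>m\<in>{n..}. E m) (K / (1 - exp (- c)) * exp (- c * real n))"
proof -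
  have "outer_le M (\<Union>i. E (n + i)) (K * exp (- c * real n) * (1 / (1 - exp (- c))))"
  proof (rule outer_le_UN)
    show "outer_le M (E (n + i)) (K * exp (- c * real n) * exp (- c) ^ i)" for i
      using assms(1)[of "n + i"] by (simp add: exp_of_nat_mult[symmetric] exp_add[symmetric] algebra_simps)
    show "(\<lambda>i. K * exp (- c * real n) * exp (- c) ^ i) sums (K * exp (- c * real n) * (1 / (1 - exp (- c))))"
      using assms(2) by (intro sums_mult geometric_sums) auto
  qed
  moreover have "(\<Union>i. E (n + i)) = (\<Union>m\<in>{n..}. E m)"
  proof (intro set_eqI iffI)
    fix x assume "x \<in> (\<Union>m\<in>{n..}. E m)"
    then obtain m where "m \<ge> n" "x \<in> E m" by auto
    thus "x \<in> (\<Union>i. E (n + i))" by (intro UN_I[of "m - n"]) auto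
  qed auto
  ultimately show ?thesis by (simp add: mult_ac)
qed

lemma measure_pair_le:
  assumes "prob_space A" "prob_space B" "E \<in> sets (A \<Otimes>\<^sub>M B)"
    and le: "\<And>x. x \<in> space A \<Longrightarrow> measure B (Pair x -` E) \<le> b"
  shows "measure (A \<Otimes>\<^sub>M B) E \<le> b"
proof -
  interpret A: prob_space A by fact
  interpret B: prob_space B by fact
  interpret AB: pair_prob_space A B ..
  obtain x where "x \<in> space A" using A.not_empty by blast
  hence b: "0 \<le> b" using le[of x] by (meson measure_nonneg order_trans)
  have "emeasure (A \<Otimes>\<^sub>M B) E = (\<integral>\<^sup>+x. emeasure B (Pair x -` E) \<partial>A)"
    using assms(3) by (rule B.emeasure_pair_measure_alt)
  also have "\<dots> \<le> (\<integral>\<^sup>+x. ennreal b \<partial>A)"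
    using le by (intro nn_integral_mono) (simp add: B.emeasure_eq_measure ennreal_leI)
  also have "\<dots> = ennreal b" by (simp add: A.emeasure_space_1)
  finally show ?thesis using b by (simp add: AB.emeasure_eq_measure)
qed

lemma measure_pair_fst:
  assumes "prob_space A" "prob_space B" "E \<in> sets A"
  shows "measure (A \<Otimes>\<^sub>M B) (E \<times> space B) = measure A E"
proof -
  interpret A: prob_space A by fact
  interpret B: prob_space B by fact
  interpret AB: pair_prob_space A B ..
  have "emeasure (A \<Otimes>\<^sub>M B) (E \<times> space B) = emeasure A E"
    using assms by (subst B.emeasure_pair_measure_Times) (auto simp: B.emeasure_space_1)
  thus ?thesis by (simp add: measure_def)
qed

lemma outer_le_fst:
  assumes "prob_space A" "prob_space B" "outer_le A E b"
  shows "outer_le (A \<Otimes>\<^sub>M B) (E \<times> space B) b"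
proof -
  obtain F where F: "F \<in> sets A" "E \<subseteq> F" "measure A F \<le> b" using assms(3) unfolding outer_le_def by blast
  show ?thesis unfolding outer_le_def
    using F measure_pair_fst[OF assms(1,2) F(1)] by (intro bexI[of _ "F \<times> space B"]) auto
qed

section \<open>Measurability of shattering\<close>

lemma shatters_map_iff:
  "shatters H (map v [0..<k]) \<longleftrightarrow>
    (\<forall>ys\<in>{ys. set ys \<subseteq> UNIV \<and> length ys = k}. \<exists>h\<in>H. \<forall>j<k. h (v j) = ys ! j)"
  unfolding shatters_def by (auto simp: list_eq_iff_nth_eq)

text \<open>For each of the finitely many patterns of the tuple, its labels are appended as
  \<open>k\<close> further constraints to the \<open>n\<close> given ones, so shattering becomes a
  finite conjunction of existence statements.\<close>

lemma pred_shatters_consistent: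
  fixes C :: "('a::polish_space) classifier set" and n k :: nat
  assumes C: "class_measurable C"
    and u: "\<And>i. i < n \<Longrightarrow> u i \<in> N \<rightarrow>\<^sub>M borel"
    and b: "\<And>i. i < n \<Longrightarrow> Measurable.pred N (b i)"
    and v: "\<And>j. j < k \<Longrightarrow> v j \<in> N \<rightarrow>\<^sub>M borel"
  shows "Measurable.pred N (\<lambda>\<omega>. shatters {h \<in> C. \<forall>i<n. h (u i \<omega>) = b i \<omega>} (map (\<lambda>j. v j \<omega>) [0..<k]))"
  unfolding shatters_map_iff
proof (rule pred_intros_finite(3))
  show "finite {ys :: bool list. set ys \<subseteq> UNIV \<and> length ys = k}" by (rule finite_lists_length_eq) simp
  fix ys :: "bool list"
  let ?u = "\<lambda>i. if i < n then u i else v (i - n)" and ?b = "\<lambda>i. if i < n then b i else (\<lambda>_. ys ! (i - n))"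
  have "Measurable.pred N (\<lambda>\<omega>. \<exists>h\<in>C. \<forall>i<n + k. h (?u i \<omega>) = ?b i \<omega>)"
    using u v b by (intro pred_ex_consistent C) auto
  moreover have "(\<exists>h\<in>C. \<forall>i<n + k. h (?u i \<omega>) = ?b i \<omega>) \<longleftrightarrow>
    (\<exists>h\<in>{h \<in> C. \<forall>i<n. h (u i \<omega>) = b i \<omega>}. \<forall>j<k. h (v j \<omega>) = ys ! j)" for \<omega>
  proof -
    have "(\<forall>i<n + k. h (?u i \<omega>) = ?b i \<omega>) \<longleftrightarrow> (\<forall>i<n. h (u i \<omega>) = b i \<omega>) \<and> (\<forall>j<k. h (v j \<omega>) = ys ! j)" for h
    proof
      assume L: "\<forall>i<n + k. h (?u i \<omega>) = ?b i \<omega>"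
      have "h (u i \<omega>) = b i \<omega>" if "i < n" for i using L[rule_format, of i] that by simp
      moreover have "h (v i \<omega>) = ys ! i" if "i < k" for i using L[rule_format, of "n + i"] that by simp
      ultimately show "(\<forall>i<n. h (u i \<omega>) = b i \<omega>) \<and> (\<forall>j<k. h (v j \<omega>) = ys ! j)" by blast
    next
      assume R: "(\<forall>i<n. h (u i \<omega>) = b i \<omega>) \<and> (\<forall>j<k. h (v j \<omega>) = ys ! j)"
      have "h (?u i \<omega>) = ?b i \<omega>" if "i < n + k" for i using R that by (cases "i < n") simp_all
      thus "\<forall>i<n + k. h (?u i \<omega>) = ?b i \<omega>" by blast
    qed
    thus ?thesis by auto
  qed
  ultimately show "Measurable.pred N (\<lambda>\<omega>. \<exists>h\<in>{h \<in> C. \<forall>i<n. h (u i \<omega>) = b i \<omega>}. \<forall>j<k. h (v j \<omega>) = ys ! j)"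
    by simp
qed

context full_prob_space
begin

text \<open>Fubini in the last coordinate. For shattering it expresses the probability of order
  \<open>Suc r\<close> as the mean over \<open>x\<close> of the probability that
  \<open>S @ [x]\<close> is shattered.\<close>

lemma emeasure_block_Suc:
  assumes "block_pred (Suc r) \<Phi>"
  shows "ennreal (block_prob (Suc r) \<Phi>) = (\<integral>\<^sup>+x. ennreal (block_prob r (\<lambda>S. \<Phi> (S @ [x]))) \<partial>M)"
    and "block_pred r (\<lambda>S. \<Phi> (S @ [x]))"
proof -
  interpret product_sigma_finite "\<lambda>_::nat. M" by unfold_locales
  interpret B: prob_space "\<Pi>\<^sub>M j\<in>I. M" for I by (rule prob_space_PiM_const)
  let ?A = "{x \<in> space (\<Pi>\<^sub>M j\<in>{..<Suc r}. M). \<Phi> (map x [0..<Suc r])}"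
  have A: "?A \<in> sets (\<Pi>\<^sub>M j\<in>{..<Suc r}. M)" using assms unfolding block_pred_def .
  have up: "(\<lambda>y. y(r := x)) \<in> (\<Pi>\<^sub>M j\<in>{..<r}. M) \<rightarrow>\<^sub>M (\<Pi>\<^sub>M j\<in>{..<Suc r}. M)" for x
  proof -
    have "(\<lambda>y. y(r := x)) \<in> (\<Pi>\<^sub>M j\<in>{..<r}. M) \<rightarrow>\<^sub>M (\<Pi>\<^sub>M j\<in>insert r {..<r}. M)"
      by (rule measurable_fun_upd) auto
    thus ?thesis by (simp only: lessThan_Suc)
  qed
  have eq: "(\<lambda>y. y(r := x)) -` ?A \<inter> space (\<Pi>\<^sub>M j\<in>{..<r}. M) = {y \<in> space (\<Pi>\<^sub>M j\<in>{..<r}. M). \<Phi> (map y [0..<r] @ [x])}" for x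
  proof -
    have "map (y(r := x)) [0..<Suc r] = map y [0..<r] @ [x]" for y :: "nat \<Rightarrow> 'a" by simp
    moreover have "y(r := x) \<in> space (\<Pi>\<^sub>M j\<in>{..<Suc r}. M)" if "y \<in> space (\<Pi>\<^sub>M j\<in>{..<r}. M)" for y
      using measurable_space[OF up that] .
    ultimately show ?thesis by auto
  qed
  show P: "block_pred r (\<lambda>S. \<Phi> (S @ [x]))" for x
    using measurable_sets[OF up A, of x] unfolding eq block_pred_def .
  have "ennreal (block_prob (Suc r) \<Phi>) = (\<integral>\<^sup>+z. indicator ?A z \<partial>(\<Pi>\<^sub>M j\<in>insert r {..<r}. M))"
    using A by (simp add: block_prob_def B.emeasure_eq_measure lessThan_Suc[symmetric])
  also have "\<dots> = (\<integral>\<^sup>+x. \<integral>\<^sup>+y. indicator ?A (y(r := x)) \<partial>(\<Pi>\<^sub>M j\<in>{..<r}. M) \<partial>M)"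
    using A by (intro product_nn_integral_insert_rev) (auto simp: lessThan_Suc[symmetric])
  also have "\<dots> = (\<integral>\<^sup>+x. \<integral>\<^sup>+y. indicator {y \<in> space (\<Pi>\<^sub>M j\<in>{..<r}. M). \<Phi> (map y [0..<r] @ [x])} y \<partial>(\<Pi>\<^sub>M j\<in>{..<r}. M) \<partial>M)"
    unfolding eq[symmetric] by (intro nn_integral_cong) (auto simp: indicator_def)
  also have "\<dots> = (\<integral>\<^sup>+x. ennreal (block_prob r (\<lambda>S. \<Phi> (S @ [x]))) \<partial>M)"
    using P by (intro nn_integral_cong) (simp add: block_prob_def block_pred_def B.emeasure_eq_measure)
  finally show "ennreal (block_prob (Suc r) \<Phi>) = (\<integral>\<^sup>+x. ennreal (block_prob r (\<lambda>S. \<Phi> (S @ [x]))) \<partial>M)" .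
qed

lemma block_prob_mono:
  assumes "block_pred r \<Psi>" "\<And>S. length S = r \<Longrightarrow> \<Phi> S \<Longrightarrow> \<Psi> S"
  shows "block_prob r \<Phi> \<le> block_prob r \<Psi>"
proof -
  interpret B: prob_space "\<Pi>\<^sub>M j\<in>{..<r}. M" by (rule prob_space_PiM_const)
  show ?thesis unfolding block_prob_def
    using assms by (intro B.finite_measure_mono) (auto simp: block_pred_def)
qed

end

section \<open>The shatter core and the version space\<close>

locale target = realizable +
  assumes ball_meas: "\<And>r. 0 < r \<Longrightarrow> class_measurable (concept_ball C P f r)"
begin

abbreviation ball_at :: "real \<Rightarrow> 'a classifier set" where
  "ball_at r \<equiv> concept_ball C P f r"

lemma block_pred_shatters: "class_measurable H \<Longrightarrow> block_pred k (shatters H)"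
proof -
  assume H: "class_measurable H"
  have "Measurable.pred (\<Pi>\<^sub>M j\<in>{..<k}. P) (\<lambda>x. shatters {h \<in> H. \<forall>i<(0::nat). h undefined = True} (map (\<lambda>j. x j) [0..<k]))"
  proof (rule pred_shatters_consistent[where n = 0 and u = "\<lambda>_ _. undefined" and b = "\<lambda>_ _. True" and v = "\<lambda>j x. x j", OF H])
    fix j assume "j < k"
    thus "(\<lambda>x. x j) \<in> (\<Pi>\<^sub>M j\<in>{..<k}. P) \<rightarrow>\<^sub>M borel"
      unfolding measurable_cong_sets[OF refl sets_P[symmetric]] by (intro measurable_component_singleton) simp
  qed simp_all
  thus ?thesis by (simp add: block_pred_def pred_def)
qed

definition core :: "'a list \<Rightarrow> bool" where
  "core S \<longleftrightarrow> (\<forall>r>0. shatters (ball_at r) S)"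

lemma ball_mono: "r \<le> r' \<Longrightarrow> ball_at r \<subseteq> ball_at r'"
  by (auto simp: concept_ball_def)

text \<open>Balls are monotone in the radius, so countably many radii suffice; this makes the core
  measurable.\<close>

lemma core_iff: "core S \<longleftrightarrow> (\<forall>n::nat. shatters (ball_at (1 / (real n + 1))) S)"
proof
  assume R: "\<forall>n::nat. shatters (ball_at (1 / (real n + 1))) S"
  show "core S" unfolding core_def
  proof (intro allI impI)
    fix r :: real assume "0 < r"
    then obtain n where "inverse (real (Suc n)) < r" using reals_Archimedean by blast
    thus "shatters (ball_at r) S" using R shatters_mono[OF _ ball_mono[of "1 / (real n + 1)" r]]
      by (simp add: inverse_eq_divide add.commute)
  qed
qed (auto simp: core_def)

lemma shatter_core_eq: "shatter_core C P f k = {x \<in> space (\<Pi>\<^sub>M j\<in>{..<k}. P). core (map x [0..<k])}"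
proof -
  have "(\<forall>r\<in>{0<..}. x \<in> A \<and> Q r) \<longleftrightarrow> x \<in> A \<and> (\<forall>r>0. Q r)" for x :: "nat \<Rightarrow> 'a" and A and Q :: "real \<Rightarrow> bool"
    using zero_less_one by blast
  thus ?thesis by (auto simp: shatter_core_def shattered_tuples_def core_def)
qed

lemma shattered_tuples_eq: "measure (\<Pi>\<^sub>M j\<in>{..<k}. P) (shattered_tuples P k H) = block_prob k (shatters H)"
  by (simp add: shattered_tuples_def block_prob_def)

lemma block_pred_core: "block_pred k core"
proof -
  have "Measurable.pred (\<Pi>\<^sub>M j\<in>{..<k}. P) (\<lambda>x. \<forall>n::nat. shatters (ball_at (1 / (real n + 1))) (map x [0..<k]))"
  proof (rule pred_intros_countable(1))
    fix n :: nat
    have "block_pred k (shatters (ball_at (1 / (real n + 1))))"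
      by (intro block_pred_shatters ball_meas) auto
    thus "Measurable.pred (\<Pi>\<^sub>M j\<in>{..<k}. P) (\<lambda>x. shatters (ball_at (1 / (real n + 1))) (map x [0..<k]))"
      by (simp add: block_pred_def pred_def)
  qed
  thus ?thesis by (simp add: block_pred_def pred_def core_iff)
qed

text \<open>Continuity from above. It supplies a radius at which the ball shatters few tuples
  outside the core.\<close>

lemma block_prob_ball_near_core:
  assumes "block_prob k core < b"
  obtains r where "0 < r" "block_prob k (shatters (ball_at r)) < b"
proof -
  interpret B: prob_space "\<Pi>\<^sub>M j\<in>{..<k}. P" by (rule prob_space_PiM_const)
  let ?A = "\<lambda>n::nat. {x \<in> space (\<Pi>\<^sub>M j\<in>{..<k}. P). shatters (ball_at (1 / (real n + 1))) (map x [0..<k])}"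
  have "(\<lambda>n. measure (\<Pi>\<^sub>M j\<in>{..<k}. P) (?A n)) \<longlonglongrightarrow> measure (\<Pi>\<^sub>M j\<in>{..<k}. P) (\<Inter>n. ?A n)"
  proof (rule B.finite_Lim_measure_decseq)
    show "range ?A \<subseteq> sets (\<Pi>\<^sub>M j\<in>{..<k}. P)"
      using block_pred_shatters[OF ball_meas] by (auto simp: block_pred_def)
    show "decseq ?A" unfolding decseq_def
    proof (intro allI impI subsetI)
      fix m n :: nat and x assume "m \<le> n" "x \<in> ?A n"
      thus "x \<in> ?A m" using shatters_mono[OF _ ball_mono[of "1 / (real n + 1)" "1 / (real m + 1)"]]
        by (simp add: frac_le)
    qed
  qed
  also have "(\<Inter>n. ?A n) = {x \<in> space (\<Pi>\<^sub>M j\<in>{..<k}. P). core (map x [0..<k])}"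
    by (auto simp: core_iff)
  finally have "(\<lambda>n. block_prob k (shatters (ball_at (1 / (real n + 1))))) \<longlonglongrightarrow> block_prob k core"
    by (simp add: block_prob_def)
  hence "\<forall>\<^sub>F n in sequentially. block_prob k (shatters (ball_at (1 / (real n + 1)))) < b"
    using assms by (rule order_tendstoD(2))
  then obtain n where "block_prob k (shatters (ball_at (1 / (real n + 1)))) < b"
    unfolding eventually_sequentially by auto
  thus ?thesis by (intro that[of "1 / (real n + 1)"]) auto
qed

lemma version_space_eq:
  "version_space m X = {h \<in> C. \<forall>i<m. h (X (i + 1)) = f (X (i + 1))}"
proof -
  have "(\<forall>i\<in>{1..m}. h (X i) = f (X i)) \<longleftrightarrow> (\<forall>i<m. h (X (i + 1)) = f (X (i + 1)))" for h
  proof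
    assume R: "\<forall>i<m. h (X (i + 1)) = f (X (i + 1))"
    show "\<forall>i\<in>{1..m}. h (X i) = f (X i)"
    proof
      fix i assume "i \<in> {1..m}"
      thus "h (X i) = f (X i)" using R[rule_format, of "i - 1"] by auto
    qed
  qed auto
  thus ?thesis by (simp add: version_space_def)
qed

lemma pred_shatters_version_space:
  assumes X: "X \<in> N \<rightarrow>\<^sub>M iid P" and v: "\<And>j. j < k \<Longrightarrow> v j \<in> N \<rightarrow>\<^sub>M borel"
  shows "Measurable.pred N (\<lambda>\<omega>. shatters (version_space m (X \<omega>)) (map (\<lambda>j. v j \<omega>) [0..<k]))"
  unfolding version_space_eq
proof (rule pred_shatters_consistent[OF class_meas])
  show "(\<lambda>\<omega>. X \<omega> (i + 1)) \<in> N \<rightarrow>\<^sub>M borel" for i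
    by (rule measurable_compose[OF X measurable_iid_component_borel])
  show "Measurable.pred N (\<lambda>\<omega>. f (X \<omega> (i + 1)))" for i
    by (rule measurable_compose[OF X measurable_f_component])
qed (rule v)

text \<open>Every labelling of a core tuple is realized by concepts of arbitrarily small error. A
  concept of error at most \<open>r\<close> is removed by \<open>m\<close> points with probability
  at most \<open>m * r\<close>; sum over the labellings and let \<open>r\<close> tend to 0.\<close>

lemma AE_shatters_version_space:
  assumes "core S"
  shows "AE X in iid P. \<forall>m. shatters (version_space m X) S"
  unfolding AE_all_countable
proof
  fix m
  have Sv: "S = map (\<lambda>j. S ! j) [0..<length S]" by (rule map_nth[symmetric])
  have pr: "Measurable.pred (iid P) (\<lambda>X. shatters (version_space m X) S)"
    by (subst Sv, rule pred_shatters_version_space) auto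
  hence B: "{X. \<not> shatters (version_space m X) S} \<in> sets (iid P)" (is "?B \<in> _")
    using pred_intros_logic(2)[OF pr] by (simp add: pred_def)
  let ?Y = "{ys :: bool list. set ys \<subseteq> UNIV \<and> length ys = length S}"
  have fY: "finite ?Y" by (rule finite_lists_length_eq) simp
  have le: "measure (iid P) ?B \<le> real (card ?Y) * real m * r" if r: "0 < r" for r
  proof -
    have "\<forall>ys\<in>?Y. \<exists>h\<in>ball_at r. map h S = ys" using assms r unfolding core_def shatters_def by auto
    then obtain H where H: "\<And>ys. ys \<in> ?Y \<Longrightarrow> H ys \<in> ball_at r \<and> map (H ys) S = ys" by metis
    let ?E = "\<lambda>ys i. {X. H ys (X i) \<noteq> f (X i)}"
    have HC: "H ys \<in> C" if "ys \<in> ?Y" for ys using H[OF that] by (simp add: concept_ball_def)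
    have Es: "?E ys i \<in> sets (iid P)" and Em: "measure (iid P) (?E ys i) \<le> r" if "ys \<in> ?Y" for ys i
    proof -
      have D: "{x. H ys x \<noteq> f x} \<in> sets P" by (rule disagreement_sets[OF HC[OF that]])
      from measurable_sets[OF measurable_iid_component this, of i] show E: "?E ys i \<in> sets (iid P)"
        by (simp add: vimage_def)
      have "emeasure (iid P) (?E ys i) = (\<integral>\<^sup>+X. indicator {x. H ys x \<noteq> f x} (X i) \<partial>iid P)"
      proof (subst nn_integral_indicator[symmetric])
        show "(\<integral>\<^sup>+X. indicator (?E ys i) X \<partial>iid P) = (\<integral>\<^sup>+X. indicator {x. H ys x \<noteq> f x} (X i) \<partial>iid P)"
          by (intro nn_integral_cong) (simp add: indicator_def)
      qed (rule E)
      also have "\<dots> = emeasure P {x. H ys x \<noteq> f x}"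
        using D by (subst nn_integral_iid_component) auto
      finally show "measure (iid P) (?E ys i) \<le> r"
        using H[OF that] by (simp add: measure_def concept_ball_def)
    qed
    have "?B \<subseteq> (\<Union>ys\<in>?Y. \<Union>i\<in>{1..m}. ?E ys i)"
    proof
      fix X assume "X \<in> ?B"
      then obtain ys where ys: "length ys = length S" "\<forall>h\<in>version_space m X. map h S \<noteq> ys"
        unfolding shatters_def by blast
      hence yY: "ys \<in> ?Y" by simp
      hence "H ys \<notin> version_space m X" using ys(2) H by blast
      then obtain i where "i \<in> {1..m}" "H ys (X i) \<noteq> f (X i)" using HC[OF yY] unfolding version_space_def by blast
      thus "X \<in> (\<Union>ys\<in>?Y. \<Union>i\<in>{1..m}. ?E ys i)" using yY by blast
    qed
    hence "measure (iid P) ?B \<le> measure (iid P) (\<Union>ys\<in>?Y. \<Union>i\<in>{1..m}. ?E ys i)"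
      using fY Es by (intro iid.finite_measure_mono sets.finite_UN) auto
    also have "\<dots> \<le> (\<Sum>ys\<in>?Y. measure (iid P) (\<Union>i\<in>{1..m}. ?E ys i))"
      using fY Es by (intro measure_UNION_le sets.finite_UN) auto
    also have "\<dots> \<le> (\<Sum>ys\<in>?Y. real m * r)"
    proof (rule sum_mono)
      fix ys assume ys: "ys \<in> ?Y"
      have "measure (iid P) (\<Union>i\<in>{1..m}. ?E ys i) \<le> (\<Sum>i\<in>{1..m}. measure (iid P) (?E ys i))"
        using Es[OF ys] by (intro measure_UNION_le) auto
      also have "\<dots> \<le> (\<Sum>i\<in>{1..m}. r)" using Em[OF ys] by (intro sum_mono)
      finally show "measure (iid P) (\<Union>i\<in>{1..m}. ?E ys i) \<le> real m * r" by simp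
    qed
    finally show ?thesis by simp
  qed
  have "measure (iid P) ?B \<le> 0"
  proof (rule field_le_epsilon)
    fix e :: real assume e: "0 < e"
    let ?K = "real (card ?Y) * real m + 1"
    have K: "0 < ?K" by (intro add_nonneg_pos) auto
    have "measure (iid P) ?B \<le> real (card ?Y) * real m * (e / ?K)" using e K by (intro le) auto
    also have "\<dots> \<le> ?K * (e / ?K)" using e K by (intro mult_right_mono) auto
    finally show "measure (iid P) ?B \<le> 0 + e" using K by simp
  qed
  hence "measure (iid P) ?B = 0" by (simp add: measure_le_0_iff)
  hence "?B \<in> null_sets (iid P)" using B by (simp add: null_sets_def iid.emeasure_eq_measure)
  thus "AE X in iid P. shatters (version_space m X) S" by (rule AE_I') auto
qed

lemma f_in_ball: "0 \<le> r \<Longrightarrow> f \<in> ball_at r"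
  by (simp add: concept_ball_def f_in_C)

subsection \<open>The region of disagreement of order k\<close>

text \<open>The population counterpart of the numerator of \<open>Delta_hat\<close>. It is
  normalized by the number of blocks rather than by \<open>M_hat\<close>, so estimates and
  \<open>ext_prob\<close> differ by a factor of about the core probability.\<close>

definition ext_prob :: "nat \<Rightarrow> nat \<Rightarrow> (nat \<Rightarrow> 'a) \<Rightarrow> 'a \<Rightarrow> real" where
  "ext_prob k m X x = block_prob (k - 1) (\<lambda>S. shatters (version_space m X) (S @ [x]))"

definition region :: "nat \<Rightarrow> real \<Rightarrow> nat \<Rightarrow> (nat \<Rightarrow> 'a) \<Rightarrow> 'a set" where
  "region k c m X = {x. c \<le> ext_prob k m X x}"

lemma map_snoc: "map (\<lambda>j. if j < k then y j else x) [0..<Suc k] = map y [0..<k] @ [x]"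
  by (auto intro: nth_equalityI simp: nth_append)

lemma measurable_ext_prob_aux:
  "Measurable.pred ((iid P \<Otimes>\<^sub>M P) \<Otimes>\<^sub>M (\<Pi>\<^sub>M j\<in>{..<r}. P))
     (\<lambda>z. shatters (version_space m (fst (fst z))) (map (snd z) [0..<r] @ [snd (fst z)]))"
proof -
  have [measurable]: "(\<lambda>z. snd z j) \<in> ((iid P \<Otimes>\<^sub>M P) \<Otimes>\<^sub>M (\<Pi>\<^sub>M j\<in>{..<r}. P)) \<rightarrow>\<^sub>M P" if "j < r" for j
    using that by (intro measurable_compose[OF measurable_snd measurable_component_singleton]) auto
  have "Measurable.pred ((iid P \<Otimes>\<^sub>M P) \<Otimes>\<^sub>M (\<Pi>\<^sub>M j\<in>{..<r}. P))
     (\<lambda>z. shatters (version_space m (fst (fst z))) (map (\<lambda>j. (if j < r then snd z j else snd (fst z))) [0..<Suc r]))"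
  proof (rule pred_shatters_version_space)
    fix j
    show "(\<lambda>z. if j < r then snd z j else snd (fst z)) \<in> ((iid P \<Otimes>\<^sub>M P) \<Otimes>\<^sub>M (\<Pi>\<^sub>M j\<in>{..<r}. P)) \<rightarrow>\<^sub>M borel"
      unfolding measurable_cong_sets[OF refl sets_P[symmetric]] by (cases "j < r") simp_all
  qed measurable
  thus ?thesis by (simp only: map_snoc)
qed

lemma measurable_ext_prob [measurable]: "(\<lambda>(X, x). ext_prob k m X x) \<in> borel_measurable (iid P \<Otimes>\<^sub>M P)"
proof -
  interpret B: prob_space "\<Pi>\<^sub>M j\<in>{..<k - 1}. P" by (rule prob_space_PiM_const)
  let ?Q = "\<lambda>z. shatters (version_space m (fst (fst z))) (map (snd z) [0..<k - 1] @ [snd (fst z)])"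
  have S: "{z \<in> space ((iid P \<Otimes>\<^sub>M P) \<Otimes>\<^sub>M (\<Pi>\<^sub>M j\<in>{..<k - 1}. P)). ?Q z} \<in> sets ((iid P \<Otimes>\<^sub>M P) \<Otimes>\<^sub>M (\<Pi>\<^sub>M j\<in>{..<k - 1}. P))"
    using measurable_ext_prob_aux[of m "k - 1"] by (simp add: pred_def)
  have "(\<lambda>w. measure (\<Pi>\<^sub>M j\<in>{..<k - 1}. P) (Pair w -` {z \<in> space ((iid P \<Otimes>\<^sub>M P) \<Otimes>\<^sub>M (\<Pi>\<^sub>M j\<in>{..<k - 1}. P)). ?Q z}))
    \<in> borel_measurable (iid P \<Otimes>\<^sub>M P)"
    using B.measurable_emeasure_Pair[OF S] unfolding measure_def by measurable
  moreover have "Pair w -` {z \<in> space ((iid P \<Otimes>\<^sub>M P) \<Otimes>\<^sub>M (\<Pi>\<^sub>M j\<in>{..<k - 1}. P)). ?Q z}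
    = {y \<in> space (\<Pi>\<^sub>M j\<in>{..<k - 1}. P). shatters (version_space m (fst w)) (map y [0..<k - 1] @ [snd w])}" for w
    by (auto simp: space_pair_measure)
  ultimately show ?thesis by (simp add: ext_prob_def block_prob_def case_prod_unfold)
qed

lemma block_pred_version_space: "block_pred k (shatters (version_space m X))"
proof -
  have "Measurable.pred (\<Pi>\<^sub>M j\<in>{..<k}. P) (\<lambda>y. shatters (version_space m X) (map (\<lambda>j. y j) [0..<k]))"
    by (rule pred_shatters_version_space[of "\<lambda>_. X"]) (auto simp: sets_P[symmetric] cong: measurable_cong_sets)
  thus ?thesis by (simp add: block_pred_def pred_def)
qed

lemma block_pred_ext: "block_pred r (\<lambda>S. shatters (version_space m X) (S @ [x]))"
  by (rule emeasure_block_Suc(2)[OF block_pred_version_space])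

lemma measurable_ext_prob_fixed [measurable]: "ext_prob k m X \<in> borel_measurable P"
  using measurable_compose[OF measurable_Pair1'[of X "iid P" P] measurable_ext_prob] by simp

lemma region_sets [measurable]: "region k c m X \<in> sets P"
proof -
  have "{x \<in> space P. c \<le> ext_prob k m X x} \<in> sets P" by measurable
  thus ?thesis by (simp add: region_def)
qed

lemma ext_prob_antimono:
  assumes "m \<le> m'" shows "ext_prob k m' X x \<le> ext_prob k m X x"
  unfolding ext_prob_def
  by (rule block_prob_mono[OF block_pred_ext]) (erule shatters_mono, rule version_space_antimono[OF assms])

lemma region_antimono: "m \<le> m' \<Longrightarrow> region k c m' X \<subseteq> region k c m X"
  using ext_prob_antimono unfolding region_def by (auto intro: order_trans)

text \<open>Markov's inequality for \<open>ext_prob\<close>, whose mean over \<open>x\<close> is the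
  probability of shattering a tuple of order \<open>k\<close>. In the decisive round that
  probability is at most \<open>theta\<close> times the radius, which makes the region
  small.\<close>

lemma measure_region_le:
  assumes "1 \<le> k" "0 < c"
  shows "c * measure P (region k c m X) \<le> block_prob k (shatters (version_space m X))"
proof -
  have k: "Suc (k - 1) = k" using assms(1) by simp
  have "ennreal (c * measure P (region k c m X)) = (\<integral>\<^sup>+x. ennreal c * indicator (region k c m X) x \<partial>P)"
    using assms(2) by (simp add: nn_integral_cmult_indicator emeasure_eq_measure ennreal_mult)
  also have "\<dots> \<le> (\<integral>\<^sup>+x. ennreal (ext_prob k m X x) \<partial>P)"
    by (intro nn_integral_mono) (auto simp: indicator_def region_def intro: ennreal_leI)
  also have "\<dots> = ennreal (block_prob k (shatters (version_space m X)))"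
    unfolding ext_prob_def using emeasure_block_Suc(1)[OF block_pred_version_space, of "k - 1"] k by simp
  finally show ?thesis by (simp add: ennreal_le_iff)
qed

lemma block_prob_ball_le_theta:
  assumes "0 < e" "e < r" "theta C P f k e = ereal \<theta>"
  shows "block_prob k (shatters (ball_at r)) \<le> \<theta> * r"
proof -
  have "ereal (block_prob k (shatters (ball_at r)) / r) \<le> theta C P f k e"
    unfolding theta_def shattered_tuples_eq using assms(2)
    by (intro max.coboundedI2 SUP_upper2[of r]) auto
  thus ?thesis using assms by (simp add: pos_divide_le_eq)
qed

end

section \<open>Accuracy of the estimators\<close>

text \<open>For \<open>k = 1\<close> the blocks are empty, and the general formulas reduce to the special cases.\<close>

lemma Delta_hat_eq:
  assumes "H \<noteq> {}" "1 \<le> m" "1 \<le> k"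
  shows "Delta_hat W2 k m x H = real (card {i \<in> {1..m ^ 3}. shatters H (block W2 k i @ [x])}) / real (M_hat W2 k m H)"
proof (cases "k = 1")
  case True
  have m3: "0 < m ^ 3" using assms(2) by simp
  have e: "{i \<in> {1..m ^ 3}. shatters H (block W2 1 i @ [x])} = (if x \<in> DIS H then {1..m ^ 3} else {})"
    using shatters_single[of H x] by auto
  have "{i \<in> {1..m ^ 3}. shatters H (block W2 1 i)} = {1..m ^ 3}" using assms(1) by (auto simp: shatters_Nil)
  hence "M_hat W2 1 m H = m ^ 3" using m3 by (simp add: M_hat_def)
  thus ?thesis using m3 unfolding True e by (simp add: Delta_hat_def)
qed (simp add: Delta_hat_def)

lemma Gamma_hat_eq:
  assumes "H \<noteq> {}" "1 \<le> m" "1 \<le> k"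
  shows "Gamma_hat W2 k m x y H = real (card {i \<in> {1..m ^ 3}. shatters H (block W2 k i) \<and>
    \<not> shatters (restr H x (\<not> y)) (block W2 k i)}) / real (M_hat W2 k m H)"
proof (cases "k = 1")
  case True
  have m3: "0 < m ^ 3" using assms(2) by simp
  have "shatters H (block W2 1 i) \<and> \<not> shatters (restr H x (\<not> y)) (block W2 1 i) \<longleftrightarrow> (\<forall>h\<in>H. h x = y)"
    if "i \<in> {1..m ^ 3}" for i
  proof -
    have "block W2 1 i = []" using that by simp
    moreover have "restr H x (\<not> y) = {} \<longleftrightarrow> (\<forall>h\<in>H. h x = y)" unfolding restr_def by blast
    ultimately show ?thesis using assms(1) by (simp only: shatters_Nil) blast
  qed
  hence "{i \<in> {1..m ^ 3}. shatters H (block W2 1 i) \<and> \<not> shatters (restr H x (\<not> y)) (block W2 1 i)}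
    = {i \<in> {1..m ^ 3}. \<forall>h\<in>H. h x = y}" by blast
  moreover have "{i \<in> S. R} = (if R then S else {})" for S :: "nat set" and R by simp
  ultimately have e: "{i \<in> {1..m ^ 3}. shatters H (block W2 1 i) \<and> \<not> shatters (restr H x (\<not> y)) (block W2 1 i)}
    = (if \<forall>h\<in>H. h x = y then {1..m ^ 3} else {})"
    by (simp only:)
  have "{i \<in> {1..m ^ 3}. shatters H (block W2 1 i)} = {1..m ^ 3}" using assms(1) by (auto simp: shatters_Nil)
  hence "M_hat W2 1 m H = m ^ 3" using m3 by (simp add: M_hat_def)
  thus ?thesis using m3 unfolding True e by (simp add: Gamma_hat_def)
qed (simp add: Gamma_hat_def)

text \<open>In probability, the ball of radius \<open>r0\<close> shatters at most
  \<open>p / 16\<close> more tuples of order \<open>k - 1\<close> than the core has. A version space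
  inside this ball that keeps the core therefore shatters nearly the same tuples at all times, and
  \<open>M_hat\<close> stays close to \<open>p * m ^ 3\<close>.\<close>

locale order_k = target +
  fixes k :: nat and p r0 :: real
  assumes k: "1 \<le> k" and p_def: "p = block_prob (k - 1) core" and p_pos: "0 < p"
    and r0: "0 < r0" "block_prob (k - 1) (shatters (ball_at r0)) \<le> 17 / 16 * p"
begin

lemma p_le_1: "p \<le> 1" by (simp add: p_def)

definition ext_count :: "nat \<Rightarrow> 'a classifier set \<Rightarrow> 'a \<Rightarrow> (nat \<Rightarrow> 'a) \<Rightarrow> nat" where
  "ext_count m V x W2 = card {i \<in> {1..m ^ 3}. shatters V (block W2 k i @ [x])}"

text \<open>An almost sure event, so it adds nothing to the failure probability.\<close>

definition core_shattered :: "(nat \<Rightarrow> 'a) \<Rightarrow> (nat \<Rightarrow> 'a) \<Rightarrow> bool" where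
  "core_shattered X W2 \<longleftrightarrow> (\<forall>m i. 1 \<le> i \<longrightarrow> core (block W2 k i) \<longrightarrow> shatters (version_space m X) (block W2 k i))"

text \<open>The counts may deviate by \<open>p / 16\<close> per block from their means
  \<open>p\<close> and at most \<open>17 / 16 * p\<close>.\<close>

definition good_core :: "nat \<Rightarrow> (nat \<Rightarrow> 'a) \<Rightarrow> bool" where
  "good_core m W2 \<longleftrightarrow> 15 / 16 * p * real (m ^ 3) \<le> real (card {i \<in> {1..m ^ 3}. core (block W2 k i)}) \<and>
     real (card {i \<in> {1..m ^ 3}. shatters (ball_at r0) (block W2 k i)}) \<le> 18 / 16 * p * real (m ^ 3)"

text \<open>Step \<open>m\<close> of the algorithm uses \<open>m ^ 3\<close> blocks but the version
  space of the preceding \<open>m - 1\<close> points, hence the shift.\<close>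

definition good_point :: "nat \<Rightarrow> (nat \<Rightarrow> 'a) \<Rightarrow> (nat \<Rightarrow> 'a) \<Rightarrow> bool" where
  "good_point m X W2 \<longleftrightarrow> \<bar>real (ext_count m (version_space (m - 1) X) (X m) W2) - ext_prob k (m - 1) X (X m) * real (m ^ 3)\<bar>
     \<le> p / 16 * real (m ^ 3)"

definition good_pool :: "nat \<Rightarrow> (nat \<Rightarrow> 'a) \<Rightarrow> (nat \<Rightarrow> 'a) \<Rightarrow> (nat \<Rightarrow> 'a) \<Rightarrow> bool" where
  "good_pool m X W1 W2 \<longleftrightarrow> (\<forall>i\<in>{1..m ^ 3}.
     \<bar>real (ext_count m (version_space m X) (W1 i) W2) - ext_prob k m X (W1 i) * real (m ^ 3)\<bar> \<le> p / 16 * real (m ^ 3))"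

definition good_area :: "real \<Rightarrow> nat \<Rightarrow> (nat \<Rightarrow> 'a) \<Rightarrow> (nat \<Rightarrow> 'a) \<Rightarrow> bool" where
  "good_area c m X W1 \<longleftrightarrow> \<bar>real (card {i \<in> {1..m ^ 3}. W1 i \<in> region k c m X}) - measure P (region k c m X) * real (m ^ 3)\<bar>
     \<le> 1 / real m * real (m ^ 3)"

lemma shattered_count_bounds:
  assumes m: "1 \<le> m" and core: "\<And>i. 1 \<le> i \<Longrightarrow> core (block W2 k i) \<Longrightarrow> shatters V (block W2 k i)"
    and V: "V \<subseteq> ball_at r0" and g: "good_core m W2"
  shows "15 / 16 * p * real (m ^ 3) \<le> real (M_hat W2 k m V)" "real (M_hat W2 k m V) \<le> 18 / 16 * p * real (m ^ 3)"
    "0 < M_hat W2 k m V" "M_hat W2 k m V = card {i \<in> {1..m ^ 3}. shatters V (block W2 k i)}"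
proof -
  let ?N = "card {i \<in> {1..m ^ 3}. shatters V (block W2 k i)}"
  have "card {i \<in> {1..m ^ 3}. core (block W2 k i)} \<le> ?N" using core by (intro card_mono) auto
  hence l: "15 / 16 * p * real (m ^ 3) \<le> real ?N" using g unfolding good_core_def by linarith
  have "?N \<le> card {i \<in> {1..m ^ 3}. shatters (ball_at r0) (block W2 k i)}"
    using shatters_mono[OF _ V] by (intro card_mono) auto
  hence u: "real ?N \<le> 18 / 16 * p * real (m ^ 3)" using g unfolding good_core_def by linarith
  have "0 < 15 / 16 * p * real (m ^ 3)" using p_pos m by simp
  hence "0 < ?N" using l by linarith
  thus e: "M_hat W2 k m V = ?N" by (simp add: M_hat_def)
  show "0 < M_hat W2 k m V" by (simp add: M_hat_def)
  show "15 / 16 * p * real (m ^ 3) \<le> real (M_hat W2 k m V)" "real (M_hat W2 k m V) \<le> 18 / 16 * p * real (m ^ 3)"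
    unfolding e by (fact l, fact u)
qed

text \<open>A block speaks for the wrong label only if the true label of the point destroys its
  shattering; core blocks never do. So at most \<open>3 / 16 * p * m ^ 3\<close> blocks, less than a
  quarter of \<open>M_hat\<close>, speak for it. Since the three estimates sum to at least 1 and
  \<open>Delta_hat\<close> is below \<open>1 / 2\<close>, the true label gets more than a
  quarter.\<close>

lemma infer_correct:
  assumes m: "1 \<le> m" and cs: "core_shattered X W2" and V: "version_space (m - 1) X \<subseteq> ball_at r0" and g: "good_core m W2"
    and lt: "Delta_hat W2 k m (X m) (version_space (m - 1) X) < 1 / 2"
  shows "infer tie W2 k m (X m) (version_space (m - 1) X) = f (X m)"
proof -
  let ?V = "version_space (m - 1) X" and ?x = "X m"
  let ?M = "real (M_hat W2 k m ?V)"
  have ne: "?V \<noteq> {}" using f_in_version_space by blast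
  have cV: "shatters (version_space j X) (block W2 k i)" if "1 \<le> i" "core (block W2 k i)" for i j
    using cs that unfolding core_shattered_def by blast
  note b = shattered_count_bounds[OF m cV V g]
  have rf: "restr ?V ?x (f ?x) = version_space m X" using version_space_Suc[of "m - 1" X] m by simp
  let ?G = "\<lambda>y. {i \<in> {1..m ^ 3}. shatters ?V (block W2 k i) \<and> \<not> shatters (restr ?V ?x (\<not> y)) (block W2 k i)}"
  let ?c1 = "{i \<in> {1..m ^ 3}. core (block W2 k i)}" and ?c0 = "{i \<in> {1..m ^ 3}. shatters (ball_at r0) (block W2 k i)}"
  \<comment> \<open>Restricting to the true label gives the next version space, which still shatters
    every core block.\<close>
  have "?G (\<not> f ?x) \<subseteq> ?c0 - ?c1"
    using rf cV shatters_mono[OF _ V] by auto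
  hence "card (?G (\<not> f ?x)) \<le> card (?c0 - ?c1)" by (intro card_mono) auto
  also have "\<dots> = card ?c0 - card ?c1"
    using r0(1) by (intro card_Diff_subset) (auto simp: core_def)
  finally have "real (card (?G (\<not> f ?x))) \<le> 3 / 16 * p * real (m ^ 3)"
    using g p_pos unfolding good_core_def by (auto simp: of_nat_diff)
  also have "\<dots> < 1 / 4 * (15 / 16 * p * real (m ^ 3))" using p_pos m by (simp add: field_simps)
  also have "\<dots> \<le> 1 / 4 * ?M" using b(1) by (intro mult_left_mono) auto
  finally have low: "Gamma_hat W2 k m ?x (\<not> f ?x) ?V < 1 / 4"
    unfolding Gamma_hat_eq[OF ne m k] using b(3) by (simp add: pos_divide_less_eq)
  have "{i \<in> {1..m ^ 3}. shatters ?V (block W2 k i)} \<subseteq> {i \<in> {1..m ^ 3}. shatters ?V (block W2 k i @ [?x])} \<union> (?G (f ?x) \<union> ?G (\<not> f ?x))"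
  proof
    fix i assume i: "i \<in> {i \<in> {1..m ^ 3}. shatters ?V (block W2 k i)}"
    show "i \<in> {i \<in> {1..m ^ 3}. shatters ?V (block W2 k i @ [?x])} \<union> (?G (f ?x) \<union> ?G (\<not> f ?x))"
    proof (cases "shatters ?V (block W2 k i @ [?x])")
      case False
      then obtain y where "\<not> shatters (restr ?V ?x y) (block W2 k i)" unfolding shatters_snoc by blast
      thus ?thesis using i by (cases "y = f ?x") simp_all
    qed (use i in simp)
  qed
  hence "card {i \<in> {1..m ^ 3}. shatters ?V (block W2 k i)} \<le> card ({i \<in> {1..m ^ 3}. shatters ?V (block W2 k i @ [?x])} \<union> (?G (f ?x) \<union> ?G (\<not> f ?x)))"
    by (intro card_mono) simp_all
  also have "\<dots> \<le> card {i \<in> {1..m ^ 3}. shatters ?V (block W2 k i @ [?x])} + (card (?G (f ?x)) + card (?G (\<not> f ?x)))"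
    using card_Un_le[of "{i \<in> {1..m ^ 3}. shatters ?V (block W2 k i @ [?x])}" "?G (f ?x) \<union> ?G (\<not> f ?x)"]
      card_Un_le[of "?G (f ?x)" "?G (\<not> f ?x)"] by linarith
  finally have "M_hat W2 k m ?V \<le> card {i \<in> {1..m ^ 3}. shatters ?V (block W2 k i @ [?x])} + (card (?G (f ?x)) + card (?G (\<not> f ?x)))"
    using b(4) by (simp only:)
  hence "?M / ?M \<le> (real (card {i \<in> {1..m ^ 3}. shatters ?V (block W2 k i @ [?x])})
      + (real (card (?G (f ?x))) + real (card (?G (\<not> f ?x))))) / ?M"
    by (intro divide_right_mono) linarith+
  hence "1 \<le> Delta_hat W2 k m ?x ?V + (Gamma_hat W2 k m ?x (f ?x) ?V + Gamma_hat W2 k m ?x (\<not> f ?x) ?V)"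
    unfolding Gamma_hat_eq[OF ne m k] Delta_hat_eq[OF ne m k] using b(3) by (simp add: add_divide_distrib)
  hence "Gamma_hat W2 k m ?x (\<not> f ?x) ?V < Gamma_hat W2 k m ?x (f ?x) ?V" using low lt by linarith
  thus ?thesis by (cases "f ?x") (auto simp: infer_def)
qed

text \<open>Half of \<open>M_hat\<close> is at least \<open>15 / 32 * p * m ^ 3\<close>, and the
  deviation costs \<open>p / 16\<close>; the remaining \<open>13 / 32 * p\<close> is above
  \<open>p / 4\<close>.\<close>

lemma request_imp_region:
  assumes m: "1 \<le> m" and cs: "core_shattered X W2" and V: "version_space (m - 1) X \<subseteq> ball_at r0" and g: "good_core m W2"
    and gp: "good_point m X W2" and ge: "1 / 2 \<le> Delta_hat W2 k m (X m) (version_space (m - 1) X)"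
  shows "X m \<in> region k (p / 4) (m - 1) X"
proof -
  let ?V = "version_space (m - 1) X" and ?x = "X m"
  let ?M = "real (M_hat W2 k m ?V)"
  have ne: "?V \<noteq> {}" using f_in_version_space by blast
  have cV: "shatters ?V (block W2 k i)" if "1 \<le> i" "core (block W2 k i)" for i
    using cs that unfolding core_shattered_def by blast
  note b = shattered_count_bounds[OF m cV V g]
  have m3: "0 < real (m ^ 3)" using m by simp
  have "1 / 2 * ?M \<le> real (ext_count m ?V ?x W2)"
    using ge b(3) unfolding Delta_hat_eq[OF ne m k] ext_count_def by (simp add: field_simps)
  hence "15 / 32 * p * real (m ^ 3) \<le> (ext_prob k (m - 1) X ?x + p / 16) * real (m ^ 3)"
    using b(1) gp unfolding good_point_def distrib_right by linarith
  hence "15 / 32 * p \<le> ext_prob k (m - 1) X ?x + p / 16" using m3 by (rule mult_right_le_imp_le)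
  thus ?thesis using p_pos unfolding region_def by simp
qed

text \<open>The threshold \<open>1 / 8\<close> separates two levels. From \<open>p / 4\<close> on,
  the estimate is at least \<open>(3 / 16) / (18 / 16)\<close>, which is above \<open>1 / 8\<close>;
  conversely an estimate of \<open>1 / 8\<close> forces \<open>ext_prob\<close> to be at least
  \<open>3 / 32 * p - p / 16\<close>. The summand \<open>2 / m\<close> covers the sampling error
  \<open>1 / m\<close> and leaves \<open>1 / m\<close>, which keeps the estimate positive.\<close>

lemma Delta_hat_total_bounds:
  assumes m: "1 \<le> m" and cs: "core_shattered X W2" and V: "version_space m X \<subseteq> ball_at r0" and g: "good_core m W2"
    and gp: "good_pool m X W1 W2" and ga: "good_area (p / 4) m X W1" "good_area (p / 32) m X W1"
  shows "measure P (region k (p / 4) m X) + 1 / real m \<le> Delta_hat_total W1 W2 k m (version_space m X)"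
    and "Delta_hat_total W1 W2 k m (version_space m X) \<le> measure P (region k (p / 32) m X) + 3 / real m"
proof -
  let ?V = "version_space m X"
  let ?M = "real (M_hat W2 k m ?V)" and ?m3 = "real (m ^ 3)"
  have ne: "?V \<noteq> {}" using f_in_version_space by blast
  have cV: "shatters ?V (block W2 k i)" if "1 \<le> i" "core (block W2 k i)" for i
    using cs that unfolding core_shattered_def by blast
  note b = shattered_count_bounds[OF m cV V g]
  have m3: "0 < ?m3" using m by simp
  have pool: "real (ext_count m ?V (W1 i) W2) \<le> (ext_prob k m X (W1 i) + p / 16) * ?m3"
    "(ext_prob k m X (W1 i) - p / 16) * ?m3 \<le> real (ext_count m ?V (W1 i) W2)" if "i \<in> {1..m ^ 3}" for i
  proof -
    have "\<bar>real (ext_count m ?V (W1 i) W2) - ext_prob k m X (W1 i) * ?m3\<bar> \<le> p / 16 * ?m3"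
      using gp that unfolding good_pool_def by blast
    thus "real (ext_count m ?V (W1 i) W2) \<le> (ext_prob k m X (W1 i) + p / 16) * ?m3"
      "(ext_prob k m X (W1 i) - p / 16) * ?m3 \<le> real (ext_count m ?V (W1 i) W2)"
      unfolding distrib_right left_diff_distrib by linarith+
  qed
  let ?D = "{i \<in> {1..m ^ 3}. 1 / 8 \<le> Delta_hat W2 k m (W1 i) ?V}"
  have D: "1 / 8 \<le> Delta_hat W2 k m x ?V \<longleftrightarrow> 1 / 8 * ?M \<le> real (ext_count m ?V x W2)" for x
    using b(3) unfolding Delta_hat_eq[OF ne m k] ext_count_def by (simp add: field_simps)
  have s1: "{i \<in> {1..m ^ 3}. W1 i \<in> region k (p / 4) m X} \<subseteq> ?D"
  proof
    fix i assume "i \<in> {i \<in> {1..m ^ 3}. W1 i \<in> region k (p / 4) m X}"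
    hence i: "i \<in> {1..m ^ 3}" "p / 4 \<le> ext_prob k m X (W1 i)" by (auto simp: region_def)
    have "1 / 8 * ?M \<le> 1 / 8 * (18 / 16 * p * ?m3)" using b(2) by (intro mult_left_mono) auto
    also have "\<dots> \<le> (p / 4 - p / 16) * ?m3" using p_pos m3 by (simp add: field_simps)
    also have "\<dots> \<le> (ext_prob k m X (W1 i) - p / 16) * ?m3" using i(2) m3 by (intro mult_right_mono) auto
    also have "\<dots> \<le> real (ext_count m ?V (W1 i) W2)" by (rule pool(2)[OF i(1)])
    finally show "i \<in> ?D" using D i(1) by simp
  qed
  have s2: "?D \<subseteq> {i \<in> {1..m ^ 3}. W1 i \<in> region k (p / 32) m X}"
  proof
    fix i assume "i \<in> ?D"
    hence i: "i \<in> {1..m ^ 3}" "1 / 8 * ?M \<le> real (ext_count m ?V (W1 i) W2)" using D by auto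
    have "3 / 32 * p * ?m3 \<le> 1 / 8 * (15 / 16 * p * ?m3)" using p_pos m3 by (simp add: field_simps)
    also have "\<dots> \<le> 1 / 8 * ?M" using b(1) by (intro mult_left_mono) auto
    also have "\<dots> \<le> (ext_prob k m X (W1 i) + p / 16) * ?m3"
      using pool(1)[OF i(1)] i(2) by linarith
    finally have "3 / 32 * p \<le> ext_prob k m X (W1 i) + p / 16" using m3 by (rule mult_right_le_imp_le)
    thus "i \<in> {i \<in> {1..m ^ 3}. W1 i \<in> region k (p / 32) m X}" using i(1) by (simp add: region_def)
  qed
  have "(measure P (region k (p / 4) m X) - 1 / real m) * ?m3 \<le> real (card {i \<in> {1..m ^ 3}. W1 i \<in> region k (p / 4) m X})"
    using ga(1) unfolding good_area_def left_diff_distrib by linarith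
  also have "\<dots> \<le> real (card ?D)" using s1 by (intro of_nat_mono card_mono) auto
  finally have "measure P (region k (p / 4) m X) - 1 / real m \<le> real (card ?D) / ?m3" using m3 by (simp add: pos_le_divide_eq)
  thus "measure P (region k (p / 4) m X) + 1 / real m \<le> Delta_hat_total W1 W2 k m ?V"
    unfolding Delta_hat_total_def by simp
  have "real (card ?D) \<le> real (card {i \<in> {1..m ^ 3}. W1 i \<in> region k (p / 32) m X})"
    using s2 by (intro of_nat_mono card_mono) auto
  also have "\<dots> \<le> (measure P (region k (p / 32) m X) + 1 / real m) * ?m3"
    using ga(2) unfolding good_area_def distrib_right by linarith
  finally have "real (card ?D) / ?m3 \<le> measure P (region k (p / 32) m X) + 1 / real m" using m3 by (simp add: pos_divide_le_eq)
  thus "Delta_hat_total W1 W2 k m ?V \<le> measure P (region k (p / 32) m X) + 3 / real m"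
    unfolding Delta_hat_total_def by simp
qed

end

subsection \<open>Probability of inaccurate estimates\<close>

context full_prob_space
begin

abbreviation data_space :: "'k measure \<Rightarrow> ((nat \<Rightarrow> 'a) \<times> (nat \<Rightarrow> 'a) \<times> (nat \<Rightarrow> 'a) \<times> 'k) measure" where
  "data_space K \<equiv> iid M \<Otimes>\<^sub>M iid M \<Otimes>\<^sub>M iid M \<Otimes>\<^sub>M K"

lemma prob_space_pair': "prob_space A \<Longrightarrow> prob_space B \<Longrightarrow> prob_space (A \<Otimes>\<^sub>M B)"
proof -
  assume "prob_space A" "prob_space B"
  then interpret A: prob_space A + B: prob_space B .
  interpret pair_prob_space A B ..
  show ?thesis by (rule prob_space_axioms)
qed

text \<open>For fixed \<open>X\<close> the version space and its regions are fixed, so a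
  concentration bound for the independent sequence \<open>W1\<close> holds uniformly in
  \<open>X\<close> and survives integration.\<close>

lemma outer_le_W1:
  assumes K: "prob_space K" and Q: "Measurable.pred (data_space K) (\<lambda>\<omega>. Q (fst \<omega>) (fst (snd \<omega>)))"
    and le: "\<And>X. measure (iid M) {W1. Q X W1} \<le> b"
  shows "outer_le (data_space K) {\<omega>\<in>space (data_space K). Q (fst \<omega>) (fst (snd \<omega>))} b"
proof (rule outer_leI)
  let ?T = "iid M \<Otimes>\<^sub>M K"
  interpret K: prob_space K by fact
  have T: "prob_space ?T" by (intro prob_space_pair' prob_space_iid K)
  obtain t where t: "t \<in> space ?T" using prob_space.not_empty[OF T] by blast
  let ?E = "{\<omega>\<in>space (data_space K). Q (fst \<omega>) (fst (snd \<omega>))}"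
  show E: "?E \<in> sets (data_space K)" using Q by (simp add: pred_def)
  show "measure (data_space K) ?E \<le> b"
  proof (rule measure_pair_le[OF prob_space_iid prob_space_pair'[OF prob_space_iid T] E])
    fix X
    have s: "Pair X -` ?E = {W1. Q X W1} \<times> space ?T" by (auto simp: space_pair_measure)
    have "Pair X -` ?E \<in> sets (iid M \<Otimes>\<^sub>M ?T)" using E by (rule sets_Pair1)
    from sets_Pair2[OF this, of t] have "{W1. Q X W1} \<in> sets (iid M)" unfolding s using t by simp
    thus "measure (iid M \<Otimes>\<^sub>M ?T) (Pair X -` ?E) \<le> b"
      unfolding s by (subst measure_pair_fst[OF prob_space_iid T]) (auto intro: le)
  qed
qed

lemma outer_le_W2:
  assumes K: "prob_space K" and Q: "Measurable.pred (data_space K) (\<lambda>\<omega>. Q (fst \<omega>) (fst (snd \<omega>)) (fst (snd (snd \<omega>))))"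
    and le: "\<And>X W1. measure (iid M) {W2. Q X W1 W2} \<le> b"
  shows "outer_le (data_space K) {\<omega>\<in>space (data_space K). Q (fst \<omega>) (fst (snd \<omega>)) (fst (snd (snd \<omega>)))} b"
proof (rule outer_leI)
  let ?T = "iid M \<Otimes>\<^sub>M K"
  interpret K: prob_space K by fact
  have T: "prob_space ?T" by (intro prob_space_pair' prob_space_iid K)
  obtain t where t: "t \<in> space K" using K.not_empty by blast
  let ?E = "{\<omega>\<in>space (data_space K). Q (fst \<omega>) (fst (snd \<omega>)) (fst (snd (snd \<omega>)))}"
  show E: "?E \<in> sets (data_space K)" using Q by (simp add: pred_def)
  show "measure (data_space K) ?E \<le> b"
  proof (rule measure_pair_le[OF prob_space_iid prob_space_pair'[OF prob_space_iid T] E])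
    fix X
    have E1: "Pair X -` ?E \<in> sets (iid M \<Otimes>\<^sub>M ?T)" using E by (rule sets_Pair1)
    show "measure (iid M \<Otimes>\<^sub>M ?T) (Pair X -` ?E) \<le> b"
    proof (rule measure_pair_le[OF prob_space_iid T E1])
      fix W1
      have s: "Pair W1 -` (Pair X -` ?E) = {W2. Q X W1 W2} \<times> space K" by (auto simp: space_pair_measure)
      have "Pair W1 -` (Pair X -` ?E) \<in> sets ?T" using E1 by (rule sets_Pair1)
      from sets_Pair2[OF this, of t] have "{W2. Q X W1 W2} \<in> sets (iid M)" unfolding s using t by simp
      thus "measure ?T (Pair W1 -` (Pair X -` ?E)) \<le> b"
        unfolding s by (subst measure_pair_fst[OF prob_space_iid K]) (auto intro: le)
    qed
  qed
qed

lemma outer_le_X: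
  assumes K: "prob_space K" and "outer_le (iid M) E b"
  shows "outer_le (data_space K) {\<omega>\<in>space (data_space K). fst \<omega> \<in> E} b"
proof (rule outer_le_mono[OF outer_le_fst[OF prob_space_iid _ assms(2)] _ order_refl])
  show "prob_space (iid M \<Otimes>\<^sub>M iid M \<Otimes>\<^sub>M K)" by (intro prob_space_pair' prob_space_iid K)
qed (auto simp: space_pair_measure)

end

context order_k
begin

lemma pred_shatters_block:
  assumes X: "X \<in> N \<rightarrow>\<^sub>M iid P" and W2: "W2 \<in> N \<rightarrow>\<^sub>M iid P" and i: "1 \<le> i"
  shows "Measurable.pred N (\<lambda>\<omega>. shatters (version_space m (X \<omega>)) (block (W2 \<omega>) k i))"
proof -
  have "Measurable.pred N (\<lambda>\<omega>. shatters (version_space m (X \<omega>)) (map (\<lambda>j. W2 \<omega> (1 + (i - 1) * (k - 1) + j)) [0..<k - 1]))"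
    by (intro pred_shatters_version_space X measurable_compose[OF W2 measurable_iid_component_borel])
  moreover have "block W k i = map (\<lambda>j. W (1 + (i - 1) * (k - 1) + j)) [0..<k - 1]" for W :: "nat \<Rightarrow> 'a"
    unfolding block_eq_map_restrict[OF i] by simp
  ultimately show ?thesis by (simp only:)
qed

lemma pred_shatters_block_ext:
  assumes X: "X \<in> N \<rightarrow>\<^sub>M iid P" and W2: "W2 \<in> N \<rightarrow>\<^sub>M iid P" and x: "x \<in> N \<rightarrow>\<^sub>M P" and i: "1 \<le> i"
  shows "Measurable.pred N (\<lambda>\<omega>. shatters (version_space m (X \<omega>)) (block (W2 \<omega>) k i @ [x \<omega>]))"
proof -
  have x': "x \<in> N \<rightarrow>\<^sub>M borel" using x sets_P by (simp cong: measurable_cong_sets)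
  have "Measurable.pred N (\<lambda>\<omega>. shatters (version_space m (X \<omega>))
    (map (\<lambda>j. if j < k - 1 then W2 \<omega> (1 + (i - 1) * (k - 1) + j) else x \<omega>) [0..<Suc (k - 1)]))"
  proof (rule pred_shatters_version_space[OF X])
    show "(\<lambda>\<omega>. if j < k - 1 then W2 \<omega> (1 + (i - 1) * (k - 1) + j) else x \<omega>) \<in> N \<rightarrow>\<^sub>M borel" for j
      using x' measurable_compose[OF W2 measurable_iid_component_borel] by (cases "j < k - 1") simp_all
  qed
  moreover have "block W k i = map (\<lambda>j. W (1 + (i - 1) * (k - 1) + j)) [0..<k - 1]" for W :: "nat \<Rightarrow> 'a"
    unfolding block_eq_map_restrict[OF i] by simp
  ultimately show ?thesis by (simp only: map_snoc)
qed

lemma measurable_card_upto: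
  assumes "\<And>i. i \<in> {1..n} \<Longrightarrow> Measurable.pred N (\<lambda>\<omega>. Q i \<omega>)"
  shows "(\<lambda>\<omega>. card {i \<in> {1..n::nat}. Q i \<omega>}) \<in> N \<rightarrow>\<^sub>M count_space UNIV"
proof (rule measurable_card)
  fix i
  show "{\<omega> \<in> space N. i \<in> {i \<in> {1..n}. Q i \<omega>}} \<in> sets N"
  proof (cases "i \<in> {1..n}")
    case True
    thus ?thesis using assms[of i] by (simp add: pred_def)
  next
    case False
    hence "{\<omega> \<in> space N. i \<in> {i \<in> {1..n}. Q i \<omega>}} = {}" by auto
    thus ?thesis by (simp only: sets.empty_sets)
  qed
qed

lemma measurable_ext_count:
  assumes X: "X \<in> N \<rightarrow>\<^sub>M iid P" and W2: "W2 \<in> N \<rightarrow>\<^sub>M iid P" and x: "x \<in> N \<rightarrow>\<^sub>M P"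
  shows "(\<lambda>\<omega>. ext_count m (version_space j (X \<omega>)) (x \<omega>) (W2 \<omega>)) \<in> N \<rightarrow>\<^sub>M count_space UNIV"
  unfolding ext_count_def by (intro measurable_card_upto pred_shatters_block_ext X W2 x) auto

lemma measurable_ext_prob_compose:
  assumes X: "X \<in> N \<rightarrow>\<^sub>M iid P" and x: "x \<in> N \<rightarrow>\<^sub>M P"
  shows "(\<lambda>\<omega>. ext_prob k m (X \<omega>) (x \<omega>)) \<in> borel_measurable N"
  using measurable_compose[OF measurable_Pair[OF X x] measurable_ext_prob[of k m]] by simp

text \<open>The region varies with the data, so its measure is a section measure of a jointly
  measurable set.\<close>

lemma measurable_measure_region:
  assumes X: "X \<in> N \<rightarrow>\<^sub>M iid P"
  shows "(\<lambda>\<omega>. measure P (region k c m (X \<omega>))) \<in> borel_measurable N"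
proof -
  note [measurable] = measurable_ext_prob[of k m]
  have "Measurable.pred (iid P \<Otimes>\<^sub>M P) (\<lambda>z. c \<le> (case z of (X, x) \<Rightarrow> ext_prob k m X x))"
    by measurable
  hence S: "{z \<in> space (iid P \<Otimes>\<^sub>M P). c \<le> ext_prob k m (fst z) (snd z)} \<in> sets (iid P \<Otimes>\<^sub>M P)"
    by (simp add: pred_def case_prod_unfold)
  have "(\<lambda>X. measure P (Pair X -` {z \<in> space (iid P \<Otimes>\<^sub>M P). c \<le> ext_prob k m (fst z) (snd z)})) \<in> borel_measurable (iid P)"
    using measurable_emeasure_Pair[OF S] unfolding measure_def by measurable
  hence "(\<lambda>X. measure P (region k c m X)) \<in> borel_measurable (iid P)"
    by (simp add: region_def space_pair_measure)
  from measurable_compose[OF X this] show ?thesis .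
qed

lemma pred_in_region:
  assumes X: "X \<in> N \<rightarrow>\<^sub>M iid P" and x: "x \<in> N \<rightarrow>\<^sub>M P"
  shows "Measurable.pred N (\<lambda>\<omega>. x \<omega> \<in> region k c m (X \<omega>))"
proof -
  note [measurable] = measurable_ext_prob_compose[OF X x, of m]
  have "Measurable.pred N (\<lambda>\<omega>. c \<le> ext_prob k m (X \<omega>) (x \<omega>))" by measurable
  thus ?thesis by (simp add: region_def)
qed

definition inaccurate :: "nat \<Rightarrow> (nat \<Rightarrow> 'a) \<Rightarrow> (nat \<Rightarrow> 'a) \<Rightarrow> (nat \<Rightarrow> 'a) \<Rightarrow> bool" where
  "inaccurate m X W1 W2 \<longleftrightarrow> \<not> (good_core m W2 \<and> good_point m X W2 \<and> good_pool m X W1 W2 \<and>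
     good_area (p / 4) m X W1 \<and> good_area (p / 32) m X W1)"

lemma card_deviation_pred:
  fixes c :: "'w \<Rightarrow> nat" and q :: "'w \<Rightarrow> real"
  assumes [measurable]: "c \<in> N \<rightarrow>\<^sub>M count_space UNIV" "q \<in> borel_measurable N"
  shows "Measurable.pred N (\<lambda>\<omega>. a < \<bar>real (c \<omega>) - q \<omega> * b\<bar>)"
  by measurable

text \<open>The 10 consists of three deviations over \<open>W2\<close> and two over
  \<open>W1\<close>, each with the prefactor 2 of the two-sided bound; the term
  \<open>4 / c0\<close> comes from the union over the \<open>m ^ 3\<close> pool points.\<close>

lemma inaccurate_outer_le:
  assumes K: "prob_space K" and m: "1 \<le> m"
  defines "c0 \<equiv> (p / 16)\<^sup>2 / 8"
  shows "outer_le (data_space K) {\<omega>\<in>space (data_space K). inaccurate m (fst \<omega>) (fst (snd \<omega>)) (fst (snd (snd \<omega>)))}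
    ((10 + 4 / c0) * exp (- min (c0 / 2) (1 / 8) * real m))"
proof -
  let ?\<Omega> = "data_space K" and ?N = "m ^ 3" and ?\<eta> = "p / 16"
  interpret D: prob_space ?\<Omega> by (intro prob_space_pair' prob_space_iid K)
  have \<eta>: "0 < ?\<eta>" "?\<eta> \<le> 1" using p_pos p_le_1 by auto
  have c0: "0 < c0" unfolding c0_def using p_pos by simp
  have X: "fst \<in> ?\<Omega> \<rightarrow>\<^sub>M iid P" by simp
  have W1: "(\<lambda>\<omega>. fst (snd \<omega>)) \<in> ?\<Omega> \<rightarrow>\<^sub>M iid P" by simp
  have W2: "(\<lambda>\<omega>. fst (snd (snd \<omega>))) \<in> ?\<Omega> \<rightarrow>\<^sub>M iid P" by simp
  let ?S = "\<lambda>Q. {\<omega>\<in>space ?\<Omega>. Q (fst \<omega>) (fst (snd \<omega>)) (fst (snd (snd \<omega>)))}"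
  let ?e = "exp (- c0 * real ?N)"
  have blk: "outer_le ?\<Omega> (?S (\<lambda>X W1 W2. ?\<eta> * real ?N < \<bar>real (card {i \<in> {1..?N}. \<Phi> (block W2 k i)}) - block_prob (k - 1) \<Phi> * real ?N\<bar>)) (2 * ?e)"
    if \<Phi>: "block_pred (k - 1) \<Phi>" for \<Phi>
  proof (rule outer_le_W2[OF K])
    show "Measurable.pred ?\<Omega> (\<lambda>\<omega>. ?\<eta> * real ?N < \<bar>real (card {i \<in> {1..?N}. \<Phi> (block (fst (snd (snd \<omega>))) k i)}) - block_prob (k - 1) \<Phi> * real ?N\<bar>)"
      by (intro card_deviation_pred measurable_compose[OF W2 measurable_block_count[OF \<Phi>]]) simp
    show "measure (iid P) {W2. ?\<eta> * real ?N < \<bar>real (card {i \<in> {1..?N}. \<Phi> (block W2 k i)}) - block_prob (k - 1) \<Phi> * real ?N\<bar>} \<le> 2 * ?e"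
      using block_count_deviation_le[OF \<Phi> \<eta>, of ?N] unfolding c0_def by simp
  qed
  define E1 where "E1 = ?S (\<lambda>X W1 W2. ?\<eta> * real ?N < \<bar>real (card {i \<in> {1..?N}. core (block W2 k i)}) - block_prob (k - 1) core * real ?N\<bar>)"
  define E2 where "E2 = ?S (\<lambda>X W1 W2. ?\<eta> * real ?N < \<bar>real (card {i \<in> {1..?N}. shatters (ball_at r0) (block W2 k i)})
    - block_prob (k - 1) (shatters (ball_at r0)) * real ?N\<bar>)"
  have E1: "outer_le ?\<Omega> E1 (2 * ?e)" unfolding E1_def by (rule blk[OF block_pred_core])
  have E2: "outer_le ?\<Omega> E2 (2 * ?e)" unfolding E2_def by (rule blk[OF block_pred_shatters[OF ball_meas[OF r0(1)]]])
  have ext: "outer_le ?\<Omega> (?S (\<lambda>X W1 W2. ?\<eta> * real ?N < \<bar>real (ext_count m (version_space j X) (x X W1) W2) - ext_prob k j X (x X W1) * real ?N\<bar>)) (2 * ?e)"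
    if x: "(\<lambda>\<omega>. x (fst \<omega>) (fst (snd \<omega>))) \<in> ?\<Omega> \<rightarrow>\<^sub>M P" for j x
  proof (rule outer_le_W2[OF K])
    show "Measurable.pred ?\<Omega> (\<lambda>\<omega>. ?\<eta> * real ?N < \<bar>real (ext_count m (version_space j (fst \<omega>)) (x (fst \<omega>) (fst (snd \<omega>))) (fst (snd (snd \<omega>))))
        - ext_prob k j (fst \<omega>) (x (fst \<omega>) (fst (snd \<omega>))) * real ?N\<bar>)"
      by (intro card_deviation_pred measurable_ext_count measurable_ext_prob_compose X W2 x)
    show "measure (iid P) {W2. ?\<eta> * real ?N < \<bar>real (ext_count m (version_space j X) (x X W1) W2) - ext_prob k j X (x X W1) * real ?N\<bar>} \<le> 2 * ?e" for X W1
      using block_count_deviation_le[OF block_pred_ext[of "k - 1" j X "x X W1"] \<eta>, of ?N] unfolding c0_def ext_count_def ext_prob_def by simp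
  qed
  define E3 where "E3 = ?S (\<lambda>X W1 W2. ?\<eta> * real ?N < \<bar>real (ext_count m (version_space (m - 1) X) (X m) W2) - ext_prob k (m - 1) X (X m) * real ?N\<bar>)"
  have E3: "outer_le ?\<Omega> E3 (2 * ?e)" unfolding E3_def
    by (rule ext[of "\<lambda>X W1. X m"]) (rule measurable_compose[OF X measurable_iid_component])
  define E4 where "E4 = (\<Union>l\<in>{1..?N}. ?S (\<lambda>X W1 W2. ?\<eta> * real ?N < \<bar>real (ext_count m (version_space m X) (W1 l) W2) - ext_prob k m X (W1 l) * real ?N\<bar>))"
  have "outer_le ?\<Omega> E4 (\<Sum>l\<in>{1..?N}. 2 * ?e)" unfolding E4_def
    by (rule D.outer_le_UN_finite, simp, rule ext[of "\<lambda>X W1. W1 _"]) (rule measurable_compose[OF W1 measurable_iid_component])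
  hence E4: "outer_le ?\<Omega> E4 (real ?N * (2 * ?e))" by simp
  have area: "outer_le ?\<Omega> {\<omega>\<in>space ?\<Omega>. \<not> good_area c m (fst \<omega>) (fst (snd \<omega>))} (2 * exp (- 1 / 8 * real m))" for c
  proof (rule outer_le_W1[OF K])
    show "Measurable.pred ?\<Omega> (\<lambda>\<omega>. \<not> good_area c m (fst \<omega>) (fst (snd \<omega>)))"
      unfolding good_area_def not_le
    proof (intro card_deviation_pred measurable_measure_region X)
      show "(\<lambda>\<omega>. card {i \<in> {1..?N}. fst (snd \<omega>) i \<in> region k c m (fst \<omega>)}) \<in> ?\<Omega> \<rightarrow>\<^sub>M count_space UNIV"
        by (intro measurable_card_upto pred_in_region X measurable_compose[OF W1 measurable_iid_component])
    qed
    fix X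
    have m1: "0 < 1 / real m" "1 / real m \<le> 1" using m by auto
    \<comment> \<open>Accuracy \<open>1 / m\<close> with \<open>m ^ 3\<close> points still leaves an
      exponent linear in \<open>m\<close>; this is what the cube in the estimators achieves.\<close>
    have "(1 / real m)\<^sup>2 / 8 * real ?N = 1 / 8 * real m" using m by (simp add: power2_eq_square power3_eq_cube)
    thus "measure (iid P) {W1. \<not> good_area c m X W1} \<le> 2 * exp (- 1 / 8 * real m)"
      unfolding good_area_def not_le using point_count_deviation_le[OF region_sets[of k c m X] m1, of ?N] by simp
  qed
  define E5 where "E5 = {\<omega>\<in>space ?\<Omega>. \<not> good_area (p / 4) m (fst \<omega>) (fst (snd \<omega>))}"
  define E6 where "E6 = {\<omega>\<in>space ?\<Omega>. \<not> good_area (p / 32) m (fst \<omega>) (fst (snd \<omega>))}"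
  have U: "outer_le ?\<Omega> (E1 \<union> (E2 \<union> (E3 \<union> (E4 \<union> (E5 \<union> E6)))))
    (2 * ?e + (2 * ?e + (2 * ?e + (real ?N * (2 * ?e) + (2 * exp (- 1 / 8 * real m) + 2 * exp (- 1 / 8 * real m))))))"
    unfolding E5_def E6_def by (intro D.outer_le_Un E1 E2 E3 E4 area)
  have sub: "?S (inaccurate m) \<subseteq> E1 \<union> (E2 \<union> (E3 \<union> (E4 \<union> (E5 \<union> E6))))"
  proof
    fix \<omega> assume w: "\<omega> \<in> ?S (inaccurate m)"
    hence wo: "\<omega> \<in> space ?\<Omega>" by simp
    show "\<omega> \<in> E1 \<union> (E2 \<union> (E3 \<union> (E4 \<union> (E5 \<union> E6))))"
    proof (rule ccontr)
      assume n: "\<omega> \<notin> E1 \<union> (E2 \<union> (E3 \<union> (E4 \<union> (E5 \<union> E6))))"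
      let ?X = "fst \<omega>" and ?W1 = "fst (snd \<omega>)" and ?W2 = "fst (snd (snd \<omega>))"
      have n1: "\<bar>real (card {i \<in> {1..?N}. core (block ?W2 k i)}) - p * real ?N\<bar> \<le> ?\<eta> * real ?N"
        using n wo unfolding E1_def p_def[symmetric] by (simp add: not_less)
      have n2: "\<bar>real (card {i \<in> {1..?N}. shatters (ball_at r0) (block ?W2 k i)}) - block_prob (k - 1) (shatters (ball_at r0)) * real ?N\<bar> \<le> ?\<eta> * real ?N"
        using n wo unfolding E2_def by (simp add: not_less)
      have "block_prob (k - 1) (shatters (ball_at r0)) * real ?N \<le> 17 / 16 * p * real ?N"
        using r0(2) by (intro mult_right_mono) auto
      moreover have "p * real ?N - ?\<eta> * real ?N = 15 / 16 * p * real ?N" "17 / 16 * p * real ?N + ?\<eta> * real ?N = 18 / 16 * p * real ?N"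
        by (simp_all add: field_simps)
      ultimately have "good_core m ?W2" unfolding good_core_def using n1 n2 by linarith
      moreover have "good_point m ?X ?W2" using n wo unfolding E3_def good_point_def by (simp add: not_less)
      moreover have "good_pool m ?X ?W1 ?W2" using n wo unfolding E4_def good_pool_def by (simp add: not_less)
      moreover have "good_area (p / 4) m ?X ?W1" "good_area (p / 32) m ?X ?W1" using n wo unfolding E5_def E6_def by auto
      ultimately show False using w unfolding inaccurate_def by simp
    qed
  qed
  let ?c = "min (c0 / 2) (1 / 8)"
  have c: "0 < ?c" using c0 by simp
  have mN: "real m \<le> real ?N" using m self_le_power[of m 3] by (simp only: of_nat_le_iff)
  have e: "exp (- c0 / 2 * real ?N) \<le> exp (- ?c * real m)"
  proof -
    have "?c * real m \<le> c0 / 2 * real ?N" using c0 mN by (intro mult_mono) auto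
    thus ?thesis by simp
  qed
  have e1: "?e \<le> exp (- ?c * real m)"
  proof -
    have "c0 / 2 * real ?N \<le> c0 * real ?N" using c0 by (intro mult_right_mono) auto
    hence "?e \<le> exp (- c0 / 2 * real ?N)" by simp
    thus ?thesis using e by linarith
  qed
  \<comment> \<open>Half of the exponent is spent on absorbing the number \<open>m ^ 3\<close> of
    pool points.\<close>
  have e2: "real ?N * (2 * ?e) \<le> 4 / c0 * exp (- ?c * real m)"
  proof -
    have "c0 / 2 * real ?N \<le> exp (c0 / 2 * real ?N)" using exp_ge_add_one_self[of "c0 / 2 * real ?N"] by linarith
    hence "real ?N \<le> 2 / c0 * exp (c0 / 2 * real ?N)" using c0 by (simp add: field_simps)
    hence "real ?N * (2 * ?e) \<le> 2 / c0 * exp (c0 / 2 * real ?N) * (2 * ?e)" by (rule mult_right_mono) simp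
    also have "\<dots> = 4 / c0 * (exp (c0 / 2 * real ?N) * exp (- c0 * real ?N))" by simp
    also have "exp (c0 / 2 * real ?N) * exp (- c0 * real ?N) = exp (- c0 / 2 * real ?N)"
      unfolding exp_add[symmetric] by (simp add: field_simps)
    also have "4 / c0 * \<dots> \<le> 4 / c0 * exp (- ?c * real m)" using e c0 by (intro mult_left_mono) auto
    finally show ?thesis .
  qed
  have e3: "exp (- 1 / 8 * real m) \<le> exp (- ?c * real m)"
  proof -
    have "?c * real m \<le> 1 / 8 * real m" by (intro mult_right_mono) auto
    thus ?thesis by simp
  qed
  have "2 * ?e + (2 * ?e + (2 * ?e + (real ?N * (2 * ?e) + (2 * exp (- 1 / 8 * real m) + 2 * exp (- 1 / 8 * real m)))))
    \<le> (10 + 4 / c0) * exp (- ?c * real m)"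
    unfolding distrib_right using e1 e2 e3 by linarith
  from outer_le_mono[OF U sub this] show ?thesis .
qed

text \<open>For a fixed \<open>W2\<close> the blocks are fixed tuples and the exceptional sets of
  \<open>X\<close> are null; Fubini exchanges the two sequences, and only countably many times and
  blocks are united.\<close>

lemma AE_core_shattered:
  assumes K: "prob_space K"
  shows "outer_le (data_space K) {\<omega>\<in>space (data_space K). \<not> core_shattered (fst \<omega>) (fst (snd (snd \<omega>)))} 0"
proof -
  let ?\<Omega> = "data_space K"
  interpret D: prob_space ?\<Omega> by (intro prob_space_pair' prob_space_iid K)
  interpret I2: pair_prob_space "iid P" "iid P" ..
  define Q where "Q = (\<lambda>m i X W2. core (block W2 k i) \<and> \<not> shatters (version_space m X) (block W2 k i))"
  have predQ: "Measurable.pred N (\<lambda>\<omega>. Q m i (X \<omega>) (W \<omega>))" if "X \<in> N \<rightarrow>\<^sub>M iid P" "W \<in> N \<rightarrow>\<^sub>M iid P" "1 \<le> i" for N :: "'w measure" and X W m i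
    unfolding Q_def
    by (intro pred_intros_logic pred_shatters_block that measurable_compose[OF that(2) pred_block[OF that(3) block_pred_core]])
  have null: "outer_le ?\<Omega> {\<omega>\<in>space ?\<Omega>. Q m i (fst \<omega>) (fst (snd (snd \<omega>)))} 0" if i: "1 \<le> i" for m i
  proof -
    have Sm: "{x \<in> space (iid P \<Otimes>\<^sub>M iid P). \<not> Q m i (fst x) (snd x)} \<in> sets (iid P \<Otimes>\<^sub>M iid P)"
      using pred_intros_logic(2)[OF predQ[of fst "iid P \<Otimes>\<^sub>M iid P" snd i m]] i by (simp add: pred_def)
    have "AE W2 in iid P. AE X in iid P. \<not> Q m i X W2"
    proof (rule AE_I2)
      fix W2
      show "AE X in iid P. \<not> Q m i X W2"
      proof (cases "core (block W2 k i)")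
        case True
        from AE_shatters_version_space[OF this] show ?thesis by eventually_elim (simp add: Q_def)
      qed (simp add: Q_def)
    qed
    hence aeX: "AE X in iid P. AE W2 in iid P. \<not> Q m i X W2" using I2.AE_commute[OF Sm] by simp
    have S: "{\<omega>\<in>space ?\<Omega>. Q m i (fst \<omega>) (fst (snd (snd \<omega>)))} \<in> sets ?\<Omega>"
      using predQ[of fst ?\<Omega> "\<lambda>\<omega>. fst (snd (snd \<omega>))" i m] i by (simp add: pred_def)
    let ?E = "{x \<in> space (iid P \<Otimes>\<^sub>M iid P). Q m i (fst x) (snd x)}"
    have E: "?E \<in> sets (iid P \<Otimes>\<^sub>M iid P)"
      using predQ[of fst "iid P \<Otimes>\<^sub>M iid P" snd i m] i by (simp add: pred_def)
    have T: "prob_space (iid P \<Otimes>\<^sub>M K)" by (intro prob_space_pair' prob_space_iid K)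
    have U: "prob_space (iid P \<Otimes>\<^sub>M iid P \<Otimes>\<^sub>M K)" by (intro prob_space_pair' prob_space_iid T)
    interpret U: prob_space "iid P \<Otimes>\<^sub>M iid P \<Otimes>\<^sub>M K" by (rule U)
    define g where "g = (\<lambda>X. emeasure (iid P \<Otimes>\<^sub>M iid P \<Otimes>\<^sub>M K) (Pair X -` {\<omega>\<in>space ?\<Omega>. Q m i (fst \<omega>) (fst (snd (snd \<omega>)))}))"
    have key: "g X = 0" if ae: "AE W2 in iid P. \<not> Q m i X W2" for X
    proof -
      have QS: "{W2. Q m i X W2} \<in> sets (iid P)"
      proof -
        have "(\<lambda>_. X) \<in> iid P \<rightarrow>\<^sub>M iid P" by (rule measurable_const) simp
        moreover have "(\<lambda>x. x) \<in> iid P \<rightarrow>\<^sub>M iid P" by (rule measurable_ident_sets) (rule refl)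
        ultimately have "Measurable.pred (iid P) (\<lambda>x. Q m i X x)" using i by (rule predQ)
        thus ?thesis unfolding pred_def space_iid by simp
      qed
      have z: "measure (iid P) {W2. Q m i X W2} = 0"
        using ae QS AE_iff_measurable[of "{W2. Q m i X W2}" "iid P" "\<lambda>W2. \<not> Q m i X W2"] by (simp add: measure_def)
      have s: "Pair X -` {\<omega>\<in>space ?\<Omega>. Q m i (fst \<omega>) (fst (snd (snd \<omega>)))} = UNIV \<times> ({W2. Q m i X W2} \<times> space K)"
        by (auto simp: space_pair_measure)
      have "measure (iid P \<Otimes>\<^sub>M iid P \<Otimes>\<^sub>M K) (UNIV \<times> ({W2. Q m i X W2} \<times> space K)) \<le> 0"
      proof (rule measure_pair_le[OF prob_space_iid T])
        show "UNIV \<times> ({W2. Q m i X W2} \<times> space K) \<in> sets (iid P \<Otimes>\<^sub>M iid P \<Otimes>\<^sub>M K)"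
          using QS sets.top[of "iid P"] by (intro pair_measureI) auto
        show "measure (iid P \<Otimes>\<^sub>M K) (Pair x -` (UNIV \<times> ({W2. Q m i X W2} \<times> space K))) \<le> 0" for x
          using measure_pair_fst[OF prob_space_iid K QS] z by simp
      qed
      hence "measure (iid P \<Otimes>\<^sub>M iid P \<Otimes>\<^sub>M K) (UNIV \<times> ({W2. Q m i X W2} \<times> space K)) = 0"
        by (simp only: measure_le_0_iff)
      thus ?thesis
        unfolding g_def s by (simp add: U.emeasure_eq_measure)
    qed
    have g0: "AE X in iid P. g X = 0" using aeX by (rule eventually_mono) (rule key)
    have "emeasure ?\<Omega> {\<omega>\<in>space ?\<Omega>. Q m i (fst \<omega>) (fst (snd (snd \<omega>)))} = (\<integral>\<^sup>+X. g X \<partial>iid P)"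
      unfolding g_def using S by (rule U.emeasure_pair_measure_alt)
    also have "\<dots> = (\<integral>\<^sup>+X. 0 \<partial>iid P)" by (rule nn_integral_cong_AE[OF g0])
    finally have "emeasure ?\<Omega> {\<omega>\<in>space ?\<Omega>. Q m i (fst \<omega>) (fst (snd (snd \<omega>)))} = 0" by simp
    thus ?thesis using S by (intro outer_leI) (auto simp: measure_def)
  qed
  have "outer_le ?\<Omega> (\<Union>m. \<Union>i. {\<omega>\<in>space ?\<Omega>. Q m (Suc i) (fst \<omega>) (fst (snd (snd \<omega>)))}) 0"
    by (rule D.outer_le_UN[where b = "\<lambda>_. 0"], rule D.outer_le_UN[where b = "\<lambda>_. 0"]) (auto intro: null)
  moreover have "{\<omega>\<in>space ?\<Omega>. \<not> core_shattered (fst \<omega>) (fst (snd (snd \<omega>)))} \<subseteq> (\<Union>m. \<Union>i. {\<omega>\<in>space ?\<Omega>. Q m (Suc i) (fst \<omega>) (fst (snd (snd \<omega>)))})"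
  proof
    fix \<omega> assume "\<omega> \<in> {\<omega>\<in>space ?\<Omega>. \<not> core_shattered (fst \<omega>) (fst (snd (snd \<omega>)))}"
    then obtain m i where w: "\<omega> \<in> space ?\<Omega>" "1 \<le> i" "Q m i (fst \<omega>) (fst (snd (snd \<omega>)))"
      unfolding core_shattered_def Q_def by blast
    hence "Suc (i - 1) = i" by simp
    thus "\<omega> \<in> (\<Union>m. \<Union>i. {\<omega>\<in>space ?\<Omega>. Q m (Suc i) (fst \<omega>) (fst (snd (snd \<omega>)))})"
      using w by (intro UN_I[of m] UN_I[of "i - 1"]) simp_all
  qed
  ultimately show ?thesis by (rule outer_le_mono) simp
qed

end

section \<open>The label budget\<close>

lemma run_bindq [simp]: "run Y (q \<bind>q g) = run Y (g (run Y q))"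
  by (induction q) auto

primrec budget_post :: "'b query \<Rightarrow> nat \<Rightarrow> (nat \<Rightarrow> 'b \<Rightarrow> bool) \<Rightarrow> bool" where
  "budget_post (Return b) n Q \<longleftrightarrow> Q n b"
| "budget_post (Request i q) n Q \<longleftrightarrow> 0 < n \<and> (\<forall>y. budget_post (q y) (n - 1) Q)"

lemma budget_post_imp_within_budget: "budget_post q n Q \<Longrightarrow> within_budget q n"
  by (induction q arbitrary: n) auto

lemma within_budget_imp_budget_post: "within_budget q n \<Longrightarrow> budget_post q n (\<lambda>_ _. True)"
  by (induction q arbitrary: n) auto

lemma within_budget_mono: "within_budget q n \<Longrightarrow> n \<le> n' \<Longrightarrow> within_budget q n'"
proof (induction q arbitrary: n n')
  case (Request i q)
  have "within_budget (q y) (n' - 1)" for y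
    by (rule Request.IH[of _ "n - 1"]) (use Request.prems in auto)
  thus ?case using Request.prems by auto
qed simp

lemma budget_le: "within_budget q b \<Longrightarrow> b \<le> r \<Longrightarrow> budget_post q r (\<lambda>_ _. True)"
  by (rule within_budget_imp_budget_post) (rule within_budget_mono)

lemma budget_post_mono: "budget_post q n Q \<Longrightarrow> (\<And>r b. Q r b \<Longrightarrow> Q' r b) \<Longrightarrow> budget_post q n Q'"
  by (induction q arbitrary: n) auto

lemma budget_post_bind: "budget_post q n (\<lambda>r b. budget_post (g b) r Q) \<Longrightarrow> budget_post (q \<bind>q g) n Q"
  by (induction q arbitrary: n) auto

lemma budget_post_while:
  assumes "nat \<lceil>real T / 4\<rceil> \<le> r + t"
  shows "budget_post (while_loop tie X W2 n k T t m V) r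
    (\<lambda>r' (t', m', V'). r' + t' = r + t \<and> t' \<le> max t (nat \<lceil>real T / 4\<rceil>))"
  using assms
proof (induction tie X W2 n k T t m V arbitrary: r rule: while_loop.induct)
  case (1 tie X W2 n k T t m V)
  note IH = "1.IH" and r = "1.prems"
  show ?case
  proof (cases "t < nat \<lceil>real T / 4\<rceil> \<and> m \<le> k * 2 ^ n")
    case cond: True
    show ?thesis
    proof (cases "1 / 2 \<le> Delta_hat W2 k (m + 1) (X (m + 1)) V")
      case True
      have "budget_post (while_loop tie X W2 n k T (t + 1) (m + 1) (restr V (X (m + 1)) y)) (r - 1)
        (\<lambda>r' (t', m', V'). r' + t' = r + t \<and> t' \<le> max t (nat \<lceil>real T / 4\<rceil>))" for y
        by (rule budget_post_mono[OF IH(1)[OF cond True]]) (use r cond in auto)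
      moreover have "0 < r" using cond r by linarith
      ultimately show ?thesis using cond True by (subst while_loop.simps) auto
    next
      case False
      from IH(2)[OF cond False r] show ?thesis using cond False by (subst while_loop.simps) auto
    qed
  next
    case False
    thus ?thesis by (subst while_loop.simps) auto
  qed
qed

lemma budget_post_do:
  assumes "nat \<lfloor>3 * real T / 4\<rfloor> \<le> r + t"
  shows "budget_post (do_loop tie X W2 k T s L t m V) r
    (\<lambda>r' (L', t', m', V'). r' + t' = r + t \<and> t' \<le> max t (nat \<lfloor>3 * real T / 4\<rfloor>))"
  using assms
proof (induction s arbitrary: r L t m V)
  case (Suc s)
  show ?case
  proof (cases "1 / 2 \<le> Delta_hat W2 k (m + 1) (X (m + 1)) V \<and> t < nat \<lfloor>3 * real T / 4\<rfloor>")
    case True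
    have "budget_post (do_loop tie X W2 k T s (L @ [(X (m + 1), y)]) (t + 1) (m + 1) (restr V (X (m + 1)) y)) (r - 1)
      (\<lambda>r' (L', t', m', V'). r' + t' = r + t \<and> t' \<le> max t (nat \<lfloor>3 * real T / 4\<rfloor>))" for y
      by (rule budget_post_mono[OF Suc.IH]) (use Suc.prems True in auto)
    thus ?thesis using True Suc.prems by auto
  next
    case False
    thus ?thesis using Suc.IH[OF Suc.prems] by (auto simp: Let_def)
  qed
qed auto

text \<open>The surplus \<open>b\<close> passes through all rounds unchanged and is what the
  selection may spend. The invariant keeps \<open>T - t\<close>, the budget of the next round,
  available.\<close>

lemma budget_post_rounds:
  "budget_post (rounds C tie X W1 W2 n k) (nat \<lceil>2 * real n / 3\<rceil> + b)
    (\<lambda>r (Ls, T, t, m, V). t \<le> T \<and> r + t = T + b)"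
proof (induction k)
  case (Suc k)
  have "budget_post (while_loop tie X W2 n (Suc k) (T - t) 0 m V \<bind>q (\<lambda>(t', m', V').
     do_loop tie X W2 (Suc k) (T - t)
       (nat \<lfloor>real (T - t) / (3 * Delta_hat_total W1 W2 (Suc k) m' V')\<rfloor>) [] t' m' V'
     \<bind>q (\<lambda>(L, t'', m'', V''). Return (Ls @ [L], T - t, t'', m'', V'')))) r
    (\<lambda>r (Ls, T, t, m, V). t \<le> T \<and> r + t = T + b)" if "t \<le> T" "r + t = T + b" for r Ls T t m V
  proof -
    have r: "r = T - t + b" using that by simp
    have c: "nat \<lceil>real (T - t) / 4\<rceil> \<le> T - t" "nat \<lfloor>3 * real (T - t) / 4\<rfloor> \<le> T - t" by linarith+
    have dd: "budget_post (do_loop tie X W2 (Suc k) (T - t) s [] t' m' V' \<bind>q (\<lambda>(L, t'', m'', V''). Return (Ls @ [L], T - t, t'', m'', V''))) r'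
      (\<lambda>r (Ls, T, t, m, V). t \<le> T \<and> r + t = T + b)" if "r' + t' = r + 0" "t' \<le> max 0 (nat \<lceil>real (T - t) / 4\<rceil>)" for r' t' m' V' s
    proof (rule budget_post_bind, rule budget_post_mono[OF budget_post_do], goal_cases)
      case 1
      show ?case using that c r by linarith
    next
      case (2 r'' b')
      obtain L' t'' m' V' where b': "b' = (L', t'', m', V')" by (cases b')
      have "t' \<le> nat \<lceil>real (T - t) / 4\<rceil>" using that(2) by simp
      hence t': "t' \<le> T - t" using c(1) by (rule order_trans)
      have a: "r'' + t'' = r' + t'" "t'' \<le> max t' (nat \<lfloor>3 * real (T - t) / 4\<rfloor>)" using 2 unfolding b' by simp_all
      have "max t' (nat \<lfloor>3 * real (T - t) / 4\<rfloor>) \<le> T - t" using t' c(2) by (rule max.boundedI)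
      hence "t'' \<le> T - t" using a(2) by (rule order_trans[rotated])
      moreover have "r'' + t'' = T - t + b" using a(1) that(1) r by simp
      ultimately show ?case unfolding b' by simp
    qed
    show ?thesis
    proof (rule budget_post_bind, rule budget_post_mono[OF budget_post_while], goal_cases)
      case 1
      show ?case using c r by linarith
    next
      case (2 r' b')
      obtain t' m' V' where b': "b' = (t', m', V')" by (cases b')
      show ?case unfolding b' prod.case by (rule dd) (use 2 b' in auto)
    qed
  qed
  hence "budget_post (case x of (Ls, T, t, m, V) \<Rightarrow> while_loop tie X W2 n (Suc k) (T - t) 0 m V \<bind>q (\<lambda>(t', m', V').
     do_loop tie X W2 (Suc k) (T - t)
       (nat \<lfloor>real (T - t) / (3 * Delta_hat_total W1 W2 (Suc k) m' V')\<rfloor>) [] t' m' V'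
     \<bind>q (\<lambda>(L, t'', m'', V''). Return (Ls @ [L], T - t, t'', m'', V'')))) r
    (\<lambda>r (Ls, T, t, m, V). t \<le> T \<and> r + t = T + b)" if "case x of (Ls, T, t, m, V) \<Rightarrow> t \<le> T \<and> r + t = T + b" for r x
    using that by (cases x) (simp only: prod.case)
  thus ?case unfolding rounds.simps by (intro budget_post_bind budget_post_mono[OF Suc])
qed auto

section \<open>Labels spent by the selection\<close>

lemma within_budget_request_labels: "budget_post (request_labels X is) (length is + r) (\<lambda>r' _. r' = r)"
  by (induction "is") (auto intro!: budget_post_bind elim: budget_post_mono)

lemma within_budget_request_tables:
  "budget_post (request_tables X I ps) (sum_list (map (\<lambda>p. length (I p)) ps) + r) (\<lambda>r' _. r' = r)"
proof (induction ps)
  case (Cons p ps)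
  have "budget_post (request_labels X (I p)) (length (I p) + (sum_list (map (\<lambda>p. length (I p)) ps) + r))
    (\<lambda>r' _. r' = sum_list (map (\<lambda>p. length (I p)) ps) + r)" by (rule within_budget_request_labels)
  thus ?case using Cons by (auto simp: add.assoc intro!: budget_post_bind elim!: budget_post_mono)
qed auto

lemma finite_first_indices: "finite {i::nat. m0 < i \<and> X i \<in> D \<and> card {i' \<in> {m0<..i}. X i' \<in> D} \<le> c}"
  and card_first_indices_le: "card {i. m0 < i \<and> X i \<in> D \<and> card {i' \<in> {m0<..i}. X i' \<in> D} \<le> c} \<le> c"
proof -
  let ?S = "{i::nat. m0 < i \<and> X i \<in> D \<and> card {i' \<in> {m0<..i}. X i' \<in> D} \<le> c}"
  have le: "card F \<le> c" if F: "finite F" "F \<subseteq> ?S" for F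
  proof (cases "F = {}")
    case False
    hence M: "Max F \<in> F" using F by simp
    have "F \<subseteq> {i' \<in> {m0<..Max F}. X i' \<in> D}" using F by auto
    hence "card F \<le> card {i' \<in> {m0<..Max F}. X i' \<in> D}" by (intro card_mono) auto
    also have "\<dots> \<le> c" using M F by auto
    finally show ?thesis .
  qed simp
  show "finite ?S"
  proof (rule ccontr)
    assume "infinite ?S"
    then obtain F where "F \<subseteq> ?S" "finite F" "card F = Suc c" using infinite_arbitrarily_large by blast
    thus False using le by fastforce
  qed
  thus "card ?S \<le> c" using le by blast
qed

lemma length_first_indices_le: "length (first_indices X m0 D c) \<le> c"
  unfolding first_indices_def length_sorted_list_of_set by (rule card_first_indices_le)

lemma sum_list_pairs:
  "sum_list (map g [(j, k). k \<leftarrow> [1..<N + 1], j \<leftarrow> [1..<k]]) = (\<Sum>k\<in>{1..N}. \<Sum>j\<in>{1..<k}. g (j, k))"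
proof -
  have "sum_list (map g [(j, k). k \<leftarrow> [1..<N + 1], j \<leftarrow> [1..<k]]) = sum_list (map (\<lambda>k. sum_list (map (\<lambda>j. g (j, k)) [1..<k])) [1..<N + 1])"
    by (induction N) (auto simp: comp_def)
  also have "\<dots> = (\<Sum>k\<in>{1..<N + 1}. \<Sum>j\<in>{1..<k}. g (j, k))"
    by (simp add: sum_set_upt_conv_sum_list_nat[symmetric] del: upt_Suc)
  finally show ?thesis by (simp add: atLeastLessThanSuc_atLeastAtMost)
qed

definition select_size :: "nat \<Rightarrow> nat \<Rightarrow> nat \<Rightarrow> nat" where
  "select_size b N j = nat \<lfloor>real b / (real j * real (N - j) * ln (exp 1 * real N))\<rfloor>"

lemma sum_inverse_le_ln: "1 \<le> N \<Longrightarrow> (\<Sum>j\<in>{1..N}. 1 / real j) \<le> 1 + ln (real N)"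
proof (induction N rule: dec_induct)
  case (step N)
  have "ln (real N / (real N + 1)) \<le> real N / (real N + 1) - 1"
    using step.hyps by (intro ln_le_minus_one) auto
  also have "\<dots> = - (1 / real (Suc N))" by (simp add: field_simps)
  finally have "1 / real (Suc N) \<le> ln (real (Suc N)) - ln (real N)"
    using step.hyps by (simp add: ln_div add.commute)
  thus ?case using step.IH by simp
qed simp

lemma sum_pairs_eq: "(\<Sum>k\<in>{1..N}. \<Sum>j\<in>{1..<k}. g j) = (\<Sum>j\<in>{1..N}. real (N - j) * g j)"
proof (induction N)
  case (Suc N)
  have "(\<Sum>j\<in>{1..N}. real (Suc N - j) * g j) = (\<Sum>j\<in>{1..N}. real (N - j) * g j + g j)"
    by (intro sum.cong) (auto simp: Suc_diff_le algebra_simps)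
  thus ?case using Suc by (simp add: sum.distrib atLeastLessThanSuc_atLeastAtMost)
qed simp

text \<open>An index \<open>j\<close> is compared with \<open>N - j\<close> larger ones, which
  cancels that factor of the test size; the rest is a harmonic sum, bounded by
  \<open>ln (exp 1 * real N)\<close>.\<close>

lemma select_size_sum_le:
  assumes "1 \<le> N"
  shows "(\<Sum>k\<in>{1..N}. \<Sum>j\<in>{1..<k}. select_size b N j) \<le> b"
proof -
  let ?L = "ln (exp 1 * real N)"
  have L: "?L = 1 + ln (real N)" "0 < ?L" using assms by (auto simp: ln_mult intro: add_pos_nonneg)
  have "real (\<Sum>k\<in>{1..N}. \<Sum>j\<in>{1..<k}. select_size b N j) = (\<Sum>j\<in>{1..N}. real (N - j) * real (select_size b N j))"
    unfolding of_nat_sum by (rule sum_pairs_eq)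
  also have "\<dots> \<le> (\<Sum>j\<in>{1..N}. real b / ?L * (1 / real j))"
  proof (rule sum_mono)
    fix j assume j: "j \<in> {1..N}"
    show "real (N - j) * real (select_size b N j) \<le> real b / ?L * (1 / real j)"
    proof (cases "j = N")
      case False
      hence Nj: "0 < real (N - j)" using j by auto
      have "0 \<le> real b / (real j * real (N - j) * ?L)" using L by (intro divide_nonneg_nonneg mult_nonneg_nonneg) auto
      hence "real (select_size b N j) \<le> real b / (real j * real (N - j) * ?L)" unfolding select_size_def by (rule of_nat_floor)
      hence "real (N - j) * real (select_size b N j) \<le> real (N - j) * (real b / (real j * real (N - j) * ?L))"
        by (intro mult_left_mono) auto
      also have "\<dots> = real b / ?L * (1 / real j)" using Nj by simp
      finally show ?thesis .
    qed (use L in simp)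
  qed
  also have "\<dots> = real b / ?L * (\<Sum>j\<in>{1..N}. 1 / real j)" by (simp add: sum_distrib_left)
  also have "\<dots> \<le> real b / ?L * ?L"
    using L sum_inverse_le_ln[OF assms] by (intro mult_left_mono) auto
  also have "\<dots> = real b" using L by simp
  finally show ?thesis by (simp only: of_nat_le_iff)
qed

lemma budget_active_select:
  assumes "1 \<le> N"
  shows "within_budget (active_select h N b X m0) b"
proof -
  let ?I = "\<lambda>(j, k). first_indices X m0 {x. h j x \<noteq> h k x} (select_size b N j)"
  let ?ps = "[(j, k). k \<leftarrow> [1..<N + 1], j \<leftarrow> [1..<k]]"
  have "sum_list (map (\<lambda>p. length (?I p)) ?ps) \<le> (\<Sum>k\<in>{1..N}. \<Sum>j\<in>{1..<k}. select_size b N j)"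
    unfolding sum_list_pairs by (intro sum_mono) (simp add: length_first_indices_le)
  also have "\<dots> \<le> b" by (rule select_size_sum_le[OF assms])
  finally obtain r where "b = sum_list (map (\<lambda>p. length (?I p)) ?ps) + r" using le_Suc_ex by blast
  hence "budget_post (request_tables X ?I ?ps) b (\<lambda>r' _. r' = r)" using within_budget_request_tables[of X ?I ?ps r] by simp
  thus ?thesis unfolding active_select_def select_size_def[symmetric]
    by (intro budget_post_imp_within_budget[where Q = "\<lambda>_ _. True"] budget_post_bind) (erule budget_post_mono, simp)
qed

lemma active_algorithm_meta: "active_algorithm (meta_algorithm C tie A)"
  unfolding active_algorithm_def
proof (intro allI)
  fix n and \<omega> :: "('a, 'b) active_data"
  obtain X W1 W2 \<rho> where w: "\<omega> = (X, W1, W2, \<rho>)" by (cases \<omega>)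
  let ?N = "the_enat (vc_dim C) + 1"
  have n: "nat \<lceil>2 * real n / 3\<rceil> + n div 3 \<le> n" by linarith
  have "budget_post (rounds C tie X W1 W2 n ?N) (nat \<lceil>2 * real n / 3\<rceil> + n div 3) (\<lambda>r (Ls, T, t, m, V). n div 3 \<le> r)"
    by (rule budget_post_mono[OF budget_post_rounds]) auto
  hence "budget_post (meta_algorithm C tie A n \<omega>) (nat \<lceil>2 * real n / 3\<rceil> + n div 3) (\<lambda>_ _. True)"
    unfolding w meta_algorithm_def Let_def prod.case
  proof (intro budget_post_bind, elim budget_post_mono)
    fix r :: nat and x :: "('a \<times> bool) list list \<times> nat \<times> nat \<times> nat \<times> 'a classifier set"
    assume "case x of (Ls, T, t, m, V) \<Rightarrow> n div 3 \<le> r"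
    thus "budget_post (case x of (Ls, T, t, m, V) \<Rightarrow> active_select (\<lambda>k. A (\<rho> k) (Ls ! (k - 1))) ?N (n div 3) X m) r (\<lambda>_ _. True)"
      by (cases x) (auto intro!: budget_le budget_active_select)
  qed
  thus "within_budget (meta_algorithm C tie A n \<omega>) n"
    using within_budget_mono[OF budget_post_imp_within_budget n] by blast
qed

section \<open>Runs of the meta-algorithm\<close>

text \<open>Given the data, a run is determined by the labels \<open>ys\<close> assigned so far, so that its state ranges over a countable type.\<close>

lemma take_length_trans:
  assumes "take (length a) b = a" "take (length b) c = b"
  shows "take (length a) c = a"
proof -
  have "length a \<le> length b" using assms(1) by (metis length_take min.cobounded1)
  hence "take (length a) c = take (length a) (take (length b) c)" by (simp add: min.absorb1)
  thus ?thesis using assms by simp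
qed

locale learner = target +
  fixes tie :: "nat \<Rightarrow> 'a classifier"
  assumes tie: "\<And>m. tie m \<in> classifiers"
begin

definition consistent :: "(nat \<Rightarrow> 'a) \<Rightarrow> bool list \<Rightarrow> 'a classifier set" where
  "consistent X ys = {h \<in> C. \<forall>i<length ys. h (X (i + 1)) = ys ! i}"

definition asks :: "nat \<Rightarrow> (nat \<Rightarrow> 'a) \<Rightarrow> (nat \<Rightarrow> 'a) \<Rightarrow> bool list \<Rightarrow> bool" where
  "asks k X W2 ys \<longleftrightarrow> 1 / 2 \<le> Delta_hat W2 k (Suc (length ys)) (X (Suc (length ys))) (consistent X ys)"

definition guess :: "nat \<Rightarrow> (nat \<Rightarrow> 'a) \<Rightarrow> (nat \<Rightarrow> 'a) \<Rightarrow> bool list \<Rightarrow> bool" where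
  "guess k X W2 ys = infer tie W2 k (Suc (length ys)) (X (Suc (length ys))) (consistent X ys)"

definition advance :: "bool \<Rightarrow> nat \<Rightarrow> (nat \<Rightarrow> 'a) \<Rightarrow> (nat \<Rightarrow> 'a) \<Rightarrow> nat \<times> bool list \<Rightarrow> nat \<times> bool list" where
  "advance req k X W2 = (\<lambda>(t, ys). if req then (Suc t, ys @ [f (X (Suc (length ys)))]) else (t, ys @ [guess k X W2 ys]))"

definition wstep :: "nat \<Rightarrow> nat \<Rightarrow> nat \<Rightarrow> (nat \<Rightarrow> 'a) \<Rightarrow> (nat \<Rightarrow> 'a) \<Rightarrow> nat \<times> bool list \<Rightarrow> nat \<times> bool list" where
  "wstep n k T X W2 s = (if fst s < nat \<lceil>real T / 4\<rceil> \<and> length (snd s) \<le> k * 2 ^ n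
     then advance (asks k X W2 (snd s)) k X W2 s else s)"

definition dstep :: "nat \<Rightarrow> nat \<Rightarrow> (nat \<Rightarrow> 'a) \<Rightarrow> (nat \<Rightarrow> 'a) \<Rightarrow> nat \<times> bool list \<Rightarrow> nat \<times> bool list" where
  "dstep k T X W2 s = advance (asks k X W2 (snd s) \<and> fst s < nat \<lfloor>3 * real T / 4\<rfloor>) k X W2 s"

text \<open>The guard admits at most \<open>Suc (k * 2 ^ n)\<close> effective passes, and
  \<open>wstep\<close> is the identity once it fails, so a fixed number of iterations replaces the
  loop.\<close>

definition while_end :: "nat \<Rightarrow> nat \<Rightarrow> nat \<Rightarrow> (nat \<Rightarrow> 'a) \<Rightarrow> (nat \<Rightarrow> 'a) \<Rightarrow> bool list \<Rightarrow> nat \<times> bool list" where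
  "while_end n k T X W2 ys = (wstep n k T X W2 ^^ Suc (k * 2 ^ n)) (0, ys)"

definition do_steps :: "nat \<Rightarrow> nat \<Rightarrow> (nat \<Rightarrow> 'a) \<Rightarrow> (nat \<Rightarrow> 'a) \<Rightarrow> (nat \<Rightarrow> 'a) \<Rightarrow> bool list \<Rightarrow> nat" where
  "do_steps k T X W1 W2 ys = nat \<lfloor>real T / (3 * Delta_hat_total W1 W2 k (length ys) (consistent X ys))\<rfloor>"

text \<open>A trace records only start and length of each sample, not the points, and so stays in a
  countable type. The label of point \<open>i\<close> sits at list position
  \<open>i - 1\<close>.\<close>

definition segment :: "(nat \<Rightarrow> 'a) \<Rightarrow> bool list \<Rightarrow> nat \<times> nat \<Rightarrow> ('a \<times> bool) list" where
  "segment X ys = (\<lambda>(a, r). map (\<lambda>i. (X i, ys ! (i - 1))) [a + 1..<a + r + 1])"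

definition next_round :: "nat \<Rightarrow> nat \<Rightarrow> (nat \<Rightarrow> 'a) \<Rightarrow> (nat \<Rightarrow> 'a) \<Rightarrow> (nat \<Rightarrow> 'a) \<Rightarrow>
    (nat \<times> nat) list \<times> nat \<times> nat \<times> bool list \<Rightarrow> (nat \<times> nat) list \<times> nat \<times> nat \<times> bool list" where
  "next_round n k X W1 W2 = (\<lambda>(segs, T, t, ys).
     let s1 = while_end n k (T - t) X W2 ys;
         r = do_steps k (T - t) X W1 W2 (snd s1);
         s2 = (dstep k (T - t) X W2 ^^ r) s1
     in (segs @ [(length (snd s1), r)], T - t, s2))"

primrec trace :: "nat \<Rightarrow> (nat \<Rightarrow> 'a) \<Rightarrow> (nat \<Rightarrow> 'a) \<Rightarrow> (nat \<Rightarrow> 'a) \<Rightarrow> nat \<Rightarrow> (nat \<times> nat) list \<times> nat \<times> nat \<times> bool list" where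
  "trace n X W1 W2 0 = ([], nat \<lceil>2 * real n / 3\<rceil>, 0, [])"
| "trace n X W1 W2 (Suc k) = next_round n (Suc k) X W1 W2 (trace n X W1 W2 k)"

lemma consistent_Nil [simp]: "consistent X [] = C"
  by (simp add: consistent_def)

lemma consistent_snoc: "consistent X (ys @ [y]) = restr (consistent X ys) (X (Suc (length ys))) y"
  by (auto simp: consistent_def restr_def nth_append less_Suc_eq)

lemma length_advance [simp]: "length (snd (advance req k X W2 s)) = Suc (length (snd s))"
  by (simp add: advance_def case_prod_unfold)

lemma take_advance: "take (length (snd s)) (snd (advance req k X W2 s)) = snd s"
  by (simp add: advance_def case_prod_unfold)

lemma run_while_loop:
  assumes "Suc (k * 2 ^ n) \<le> j + length ys"
  shows "run (\<lambda>i. f (X i)) (while_loop tie X W2 n k T t (length ys) (consistent X ys))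
    = (case (wstep n k T X W2 ^^ j) (t, ys) of (t', ys') \<Rightarrow> (t', length ys', consistent X ys'))"
  using assms
proof (induction j arbitrary: t ys)
  case 0
  thus ?case by (subst while_loop.simps) auto
next
  case (Suc j)
  let ?m = "Suc (length ys)"
  show ?case
  proof (cases "t < nat \<lceil>real T / 4\<rceil> \<and> length ys \<le> k * 2 ^ n")
    case False
    hence "wstep n k T X W2 (t, ys) = (t, ys)" by (auto simp: wstep_def)
    hence "(wstep n k T X W2 ^^ i) (t, ys) = (t, ys)" for i by (induction i) auto
    from this[of "Suc j"] show ?thesis using False by (subst while_loop.simps) (auto simp del: funpow.simps)
  next
    case True
    have IH: "run (\<lambda>i. f (X i)) (while_loop tie X W2 n k T t' ?m (restr (consistent X ys) (X ?m) y))
      = (case (wstep n k T X W2 ^^ j) (t', ys @ [y]) of (t', ys') \<Rightarrow> (t', length ys', consistent X ys'))" for t' y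
      using Suc.IH[of "ys @ [y]" t'] Suc.prems by (simp add: consistent_snoc)
    have w: "(wstep n k T X W2 ^^ Suc j) (t, ys) = (wstep n k T X W2 ^^ j) (advance (asks k X W2 ys) k X W2 (t, ys))"
      using True by (simp add: funpow_Suc_right wstep_def del: funpow.simps)
    show ?thesis
    proof (cases "asks k X W2 ys")
      case a: True
      hence "run (\<lambda>i. f (X i)) (while_loop tie X W2 n k T t (length ys) (consistent X ys))
        = run (\<lambda>i. f (X i)) (while_loop tie X W2 n k T (Suc t) ?m (restr (consistent X ys) (X ?m) (f (X ?m))))"
        using True by (subst while_loop.simps) (simp add: asks_def)
      thus ?thesis unfolding w IH using a by (simp add: advance_def)
    next
      case a: False
      hence "run (\<lambda>i. f (X i)) (while_loop tie X W2 n k T t (length ys) (consistent X ys))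
        = run (\<lambda>i. f (X i)) (while_loop tie X W2 n k T t ?m (restr (consistent X ys) (X ?m) (guess k X W2 ys)))"
        using True by (subst while_loop.simps) (simp add: asks_def guess_def)
      thus ?thesis unfolding w IH using a by (simp add: advance_def)
    qed
  qed
qed

lemma length_dstep [simp]: "length (snd (dstep k T X W2 s)) = Suc (length (snd s))"
  by (simp add: dstep_def)

lemma length_dsteps [simp]: "length (snd ((dstep k T X W2 ^^ r) s)) = length (snd s) + r"
  by (induction r) auto

lemma take_dsteps: "take (length (snd s)) (snd ((dstep k T X W2 ^^ r) s)) = snd s"
proof (induction r)
  case (Suc r)
  let ?s = "(dstep k T X W2 ^^ r) s"
  have "take (length (snd ?s)) (snd (dstep k T X W2 ?s)) = snd ?s" unfolding dstep_def by (rule take_advance)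
  hence "take (length (snd s)) (take (length (snd ?s)) (snd (dstep k T X W2 ?s))) = snd s" using Suc by simp
  thus ?case by (simp add: take_take min_def split: if_splits)
qed simp

lemma run_do_loop:
  "run (\<lambda>i. f (X i)) (do_loop tie X W2 k T r L t (length ys) (consistent X ys))
    = (case (dstep k T X W2 ^^ r) (t, ys) of (t', ys') \<Rightarrow> (L @ segment X ys' (length ys, r), t', length ys', consistent X ys'))"
proof (induction r arbitrary: L t ys)
  case 0
  show ?case by (simp add: segment_def)
next
  case (Suc r)
  let ?m = "Suc (length ys)"
  let ?a = "asks k X W2 ys \<and> t < nat \<lfloor>3 * real T / 4\<rfloor>"
  let ?y = "if ?a then f (X ?m) else guess k X W2 ys" and ?t = "if ?a then Suc t else t"
  let ?s = "(dstep k T X W2 ^^ r) (?t, ys @ [?y])"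
  have d: "(dstep k T X W2 ^^ Suc r) (t, ys) = ?s"
    by (simp add: funpow_Suc_right dstep_def advance_def del: funpow.simps)
  have pre: "take ?m (snd ?s) = ys @ [?y]" using take_dsteps[of "(?t, ys @ [?y])"] by simp
  hence y: "snd ?s ! length ys = ?y" by (metis nth_append_length nth_take lessI)
  have "run (\<lambda>i. f (X i)) (do_loop tie X W2 k T (Suc r) L t (length ys) (consistent X ys))
    = run (\<lambda>i. f (X i)) (do_loop tie X W2 k T r (L @ [(X ?m, ?y)]) ?t (length (ys @ [?y])) (consistent X (ys @ [?y])))"
    by (auto simp: asks_def guess_def consistent_snoc Let_def)
  also have "\<dots> = (case ?s of (t', ys') \<Rightarrow> ((L @ [(X ?m, ?y)]) @ segment X ys' (?m, r), t', length ys', consistent X ys'))"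
    unfolding Suc.IH by simp
  also have "\<dots> = (case ?s of (t', ys') \<Rightarrow> (L @ segment X ys' (length ys, Suc r), t', length ys', consistent X ys'))"
  proof -
    have "[length ys + 1..<length ys + Suc r + 1] = ?m # [?m + 1..<?m + r + 1]"
      by (subst upt_conv_Cons) auto
    hence "segment X (snd ?s) (length ys, Suc r) = (X ?m, ?y) # segment X (snd ?s) (?m, r)"
      unfolding segment_def prod.case using y by simp
    thus ?thesis by (simp add: case_prod_unfold)
  qed
  finally show ?case unfolding d .
qed

lemma take_wsteps: "take (length (snd s)) (snd ((wstep n k T X W2 ^^ j) s)) = snd s \<and> length (snd s) \<le> length (snd ((wstep n k T X W2 ^^ j) s))"
proof (induction j)
  case (Suc j)
  let ?s = "(wstep n k T X W2 ^^ j) s"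
  have "take (length (snd ?s)) (snd (wstep n k T X W2 ?s)) = snd ?s" "length (snd ?s) \<le> length (snd (wstep n k T X W2 ?s))"
    unfolding wstep_def[of n k T X W2 ?s] by (auto simp: take_advance)
  thus ?case using Suc take_length_trans[of "snd s" "snd ?s" "snd (wstep n k T X W2 ?s)"] by simp
qed simp

lemma segment_cong:
  assumes "take (length ys) ys' = ys" "a + r \<le> length ys"
  shows "segment X ys' (a, r) = segment X ys (a, r)"
proof -
  have "ys' ! (i - 1) = ys ! (i - 1)" if "i \<in> set [a + 1..<a + r + 1]" for i
    using that assms by (metis One_nat_def Suc_eq_plus1 atLeastLessThan_iff diff_Suc_1 less_Suc_eq_le nth_take order_trans set_upt Suc_le_lessD Suc_pred' add_gr_0 le_add2 less_le_trans zero_less_one)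
  thus ?thesis unfolding segment_def by simp
qed

text \<open>Later rounds only append labels, so the samples of earlier rounds can be read off the
  longer list as well; the second conjunct keeps their positions within range.\<close>

lemma run_rounds:
  "run (\<lambda>i. f (X i)) (rounds C tie X W1 W2 n k)
      = (case trace n X W1 W2 k of (segs, T, t, ys) \<Rightarrow> (map (segment X ys) segs, T, t, length ys, consistent X ys))
    \<and> (case trace n X W1 W2 k of (segs, T, t, ys) \<Rightarrow> length segs = k \<and> (\<forall>(a, r)\<in>set segs. a + r \<le> length ys))"
proof (induction k)
  case (Suc k)
  obtain segs T t ys where tr: "trace n X W1 W2 k = (segs, T, t, ys)" by (cases "trace n X W1 W2 k")
  let ?s1 = "while_end n (Suc k) (T - t) X W2 ys"
  obtain t1 ys1 where s1: "?s1 = (t1, ys1)" by (cases ?s1)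
  let ?r = "do_steps (Suc k) (T - t) X W1 W2 ys1"
  let ?s2 = "(dstep (Suc k) (T - t) X W2 ^^ ?r) (t1, ys1)"
  obtain t2 ys2 where s2: "?s2 = (t2, ys2)" by (cases ?s2)
  have tr': "trace n X W1 W2 (Suc k) = (segs @ [(length ys1, ?r)], T - t, t2, ys2)"
    by (simp add: tr next_round_def s1 s2 Let_def)
  have pre1: "take (length ys) ys1 = ys" "length ys \<le> length ys1"
    using take_wsteps[where s = "(0, ys)" and n = n and k = "Suc k" and T = "T - t" and X = X and ?W2.0 = W2 and j = "Suc (Suc k * 2 ^ n)"] s1 unfolding while_end_def by (simp_all del: funpow.simps mult_Suc)
  have pre2: "take (length ys1) ys2 = ys1" "length ys2 = length ys1 + ?r"
    using take_dsteps[where s = "(t1, ys1)" and k = "Suc k" and T = "T - t" and X = X and ?W2.0 = W2 and r = ?r] length_dsteps[where s = "(t1, ys1)" and k = "Suc k" and T = "T - t" and X = X and ?W2.0 = W2 and r = ?r] s2 by simp_all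
  have pre: "take (length ys) ys2 = ys" using pre1 pre2 by (metis min.absorb1 take_take)
  have segs: "length segs = k" "\<forall>(a, r)\<in>set segs. a + r \<le> length ys"
    and run: "run (\<lambda>i. f (X i)) (rounds C tie X W1 W2 n k) = (map (segment X ys) segs, T, t, length ys, consistent X ys)"
    using Suc tr by auto
  have w: "run (\<lambda>i. f (X i)) (while_loop tie X W2 n (Suc k) (T - t) 0 (length ys) (consistent X ys)) = (t1, length ys1, consistent X ys1)"
    using run_while_loop[where k = "Suc k" and n = n and j = "Suc (Suc k * 2 ^ n)" and ys = ys and X = X and ?W2.0 = W2 and T = "T - t" and t = 0] s1 unfolding while_end_def by (simp del: funpow.simps mult_Suc)
  have "run (\<lambda>i. f (X i)) (rounds C tie X W1 W2 n (Suc k))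
    = (map (segment X ys) segs @ [segment X ys2 (length ys1, ?r)], T - t, t2, length ys2, consistent X ys2)"
    by (simp add: run w run_do_loop do_steps_def[symmetric] s2)
  moreover have "map (segment X ys) segs = map (segment X ys2) segs"
    using segs(2) segment_cong[OF pre] by auto
  ultimately show ?case using segs pre1 pre2 unfolding tr' by fastforce
qed simp

subsection \<open>Runs do not anticipate\<close>

lemma consistent_past: "(\<And>j. j \<le> length ys \<Longrightarrow> X j = X' j) \<Longrightarrow> consistent X ys = consistent X' ys"
  by (auto simp: consistent_def)

lemma advance_past:
  assumes "\<And>j. j \<le> Suc (length (snd s)) \<Longrightarrow> X j = X' j"
  shows "advance req k X W2 s = advance req k X' W2 s" "asks k X W2 (snd s) = asks k X' W2 (snd s)"
proof -
  have "consistent X (snd s) = consistent X' (snd s)" by (rule consistent_past) (simp add: assms)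
  moreover have "X (Suc (length (snd s))) = X' (Suc (length (snd s)))" by (simp add: assms)
  ultimately show "advance req k X W2 s = advance req k X' W2 s" "asks k X W2 (snd s) = asks k X' W2 (snd s)"
    by (simp_all add: advance_def case_prod_unfold guess_def asks_def)
qed

lemma dsteps_past:
  assumes "\<And>j. j \<le> length (snd ((dstep k T X W2 ^^ r) s)) \<Longrightarrow> X j = X' j"
  shows "(dstep k T X' W2 ^^ r) s = (dstep k T X W2 ^^ r) s"
  using assms
proof (induction r)
  case (Suc r)
  let ?s = "(dstep k T X W2 ^^ r) s"
  have "(dstep k T X' W2 ^^ r) s = ?s" using Suc.prems by (intro Suc.IH) simp
  moreover have "dstep k T X W2 u = dstep k T X' W2 u" if "\<And>j. j \<le> Suc (length (snd u)) \<Longrightarrow> X j = X' j" for u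
    unfolding dstep_def using advance_past[OF that] by simp
  from this[of ?s] have "dstep k T X W2 ?s = dstep k T X' W2 ?s" using Suc.prems by simp
  ultimately show ?case by simp
qed simp

lemma wsteps_past:
  assumes "\<And>j. j \<le> length (snd ((wstep n k T X W2 ^^ i) s)) \<Longrightarrow> X j = X' j"
  shows "(wstep n k T X' W2 ^^ i) s = (wstep n k T X W2 ^^ i) s"
  using assms
proof (induction i)
  case (Suc i)
  let ?s = "(wstep n k T X W2 ^^ i) s"
  have le: "length (snd ?s) \<le> length (snd (wstep n k T X W2 ?s))" by (simp add: wstep_def)
  have "(wstep n k T X' W2 ^^ i) s = ?s" using Suc.prems le by (intro Suc.IH) simp
  moreover have "wstep n k T X W2 u = wstep n k T X' W2 u" if u: "\<And>j. j \<le> length (snd (wstep n k T X W2 u)) \<Longrightarrow> X j = X' j" for u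
  proof (cases "fst u < nat \<lceil>real T / 4\<rceil> \<and> length (snd u) \<le> k * 2 ^ n")
    case True
    hence "length (snd (wstep n k T X W2 u)) = Suc (length (snd u))" by (simp add: wstep_def)
    hence "X j = X' j" if "j \<le> Suc (length (snd u))" for j using u[of j] that by simp
    thus ?thesis unfolding wstep_def using advance_past[of u X X'] by simp
  next
    case False
    thus ?thesis unfolding wstep_def by (simp only: if_False)
  qed
  from this[of ?s] have "wstep n k T X W2 ?s = wstep n k T X' W2 ?s" using Suc.prems by simp
  ultimately show ?case by simp
qed simp

lemma while_end_past:
  assumes "\<And>j. j \<le> length (snd (while_end n k T X W2 ys)) \<Longrightarrow> X j = X' j"
  shows "while_end n k T X' W2 ys = while_end n k T X W2 ys"
  using assms unfolding while_end_def by (rule wsteps_past)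

lemma length_while_end: "length ys \<le> length (snd (while_end n k T X W2 ys))"
  using take_wsteps[where s = "(0, ys)" and n = n and k = k and T = T and X = X and ?W2.0 = W2 and j = "Suc (k * 2 ^ n)"]
  unfolding while_end_def by (simp del: funpow.simps)

lemma do_steps_past:
  assumes "\<And>j. j \<le> length ys \<Longrightarrow> X j = X' j"
  shows "do_steps k T X' W1 W2 ys = do_steps k T X W1 W2 ys"
  unfolding do_steps_def using consistent_past[OF assms, of ys] by simp

definition final :: "(nat \<times> nat) list \<times> nat \<times> nat \<times> bool list \<Rightarrow> bool list" where
  "final = (\<lambda>(segs, T, t, ys). ys)"

lemma next_round_past:
  assumes "\<And>j. j \<le> length (final (next_round n k X W1 W2 st)) \<Longrightarrow> X j = X' j"
  shows "next_round n k X' W1 W2 st = next_round n k X W1 W2 st"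
    and "length (final st) \<le> length (final (next_round n k X W1 W2 st))"
proof -
  obtain segs T t ys where st: "st = (segs, T, t, ys)" by (cases st)
  define s1 where "s1 = while_end n k (T - t) X W2 ys"
  define r where "r = do_steps k (T - t) X W1 W2 (snd s1)"
  define s2 where "s2 = (dstep k (T - t) X W2 ^^ r) s1"
  have nr: "next_round n k X W1 W2 st = (segs @ [(length (snd s1), r)], T - t, s2)"
    by (simp add: next_round_def st Let_def s1_def r_def s2_def)
  have fin: "final (next_round n k X W1 W2 st) = snd s2" by (simp add: nr final_def case_prod_unfold)
  have l: "length (snd s2) = length (snd s1) + r" unfolding s2_def by simp
  have "while_end n k (T - t) X' W2 ys = s1"
    unfolding s1_def by (rule while_end_past) (use assms l fin in \<open>simp add: s1_def\<close>)
  moreover have "do_steps k (T - t) X' W1 W2 (snd s1) = r"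
    unfolding r_def by (rule do_steps_past) (use assms l fin in simp)
  moreover have "(dstep k (T - t) X' W2 ^^ r) s1 = s2"
    unfolding s2_def by (rule dsteps_past) (use assms fin in \<open>simp add: s2_def\<close>)
  ultimately show "next_round n k X' W1 W2 st = next_round n k X W1 W2 st"
    unfolding nr by (simp add: next_round_def st Let_def)
  show "length (final st) \<le> length (final (next_round n k X W1 W2 st))"
    unfolding fin l using length_while_end[of ys n k "T - t" X W2] by (simp add: st final_def s1_def)
qed

text \<open>This makes the number of points read up to the end of a round a stopping time.\<close>

lemma trace_past:
  assumes "\<And>j. j \<le> length (final (trace n X W1 W2 k)) \<Longrightarrow> X j = X' j"
  shows "trace n X' W1 W2 k = trace n X W1 W2 k"
  using assms
proof (induction k)
  case (Suc k)
  have le: "length (final (trace n X W1 W2 k)) \<le> length (final (trace n X W1 W2 (Suc k)))"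
    using next_round_past(2)[of n "Suc k" X W1 W2 "trace n X W1 W2 k" X] by simp
  have "trace n X' W1 W2 k = trace n X W1 W2 k" using Suc.prems le by (intro Suc.IH) simp
  moreover have "next_round n (Suc k) X' W1 W2 (trace n X W1 W2 k) = next_round n (Suc k) X W1 W2 (trace n X W1 W2 k)"
    using Suc.prems by (intro next_round_past(1)) simp
  ultimately show ?case by simp
qed simp

end

subsection \<open>Measurability of runs\<close>

context learner
begin

context
  fixes N :: "'w measure" and X W1 W2 :: "'w \<Rightarrow> nat \<Rightarrow> 'a"
  assumes X [measurable]: "X \<in> N \<rightarrow>\<^sub>M iid P" and W1 [measurable]: "W1 \<in> N \<rightarrow>\<^sub>M iid P" and W2 [measurable]: "W2 \<in> N \<rightarrow>\<^sub>M iid P"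
begin

lemma point_X: "(\<lambda>\<omega>. X \<omega> i) \<in> N \<rightarrow>\<^sub>M borel"
  by (rule measurable_compose[OF X measurable_iid_component_borel])

lemma point_W1: "(\<lambda>\<omega>. W1 \<omega> i) \<in> N \<rightarrow>\<^sub>M borel"
  by (rule measurable_compose[OF W1 measurable_iid_component_borel])

lemma point_W2: "(\<lambda>\<omega>. W2 \<omega> i) \<in> N \<rightarrow>\<^sub>M borel"
  by (rule measurable_compose[OF W2 measurable_iid_component_borel])

lemma label_X: "Measurable.pred N (\<lambda>\<omega>. f (X \<omega> i))"
  by (rule measurable_compose[OF X measurable_f_component])

lemma pred_consistent_shatters:
  assumes "\<And>j. j < k \<Longrightarrow> v j \<in> N \<rightarrow>\<^sub>M borel"
  shows "Measurable.pred N (\<lambda>\<omega>. shatters (consistent (X \<omega>) ys) (map (\<lambda>j. v j \<omega>) [0..<k]))"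
  unfolding consistent_def by (intro pred_shatters_consistent class_meas point_X assms) simp_all

lemma pred_consistent_block:
  assumes i: "1 \<le> i"
  shows "Measurable.pred N (\<lambda>\<omega>. shatters (consistent (X \<omega>) ys) (block (W2 \<omega>) k i))"
proof -
  have "Measurable.pred N (\<lambda>\<omega>. shatters (consistent (X \<omega>) ys) (map (\<lambda>j. W2 \<omega> (1 + (i - 1) * (k - 1) + j)) [0..<k - 1]))"
    by (intro pred_consistent_shatters point_W2)
  moreover have "block W k i = map (\<lambda>j. W (1 + (i - 1) * (k - 1) + j)) [0..<k - 1]" for W :: "nat \<Rightarrow> 'a"
    unfolding block_eq_map_restrict[OF i] by simp
  ultimately show ?thesis by (simp only:)
qed

lemma pred_consistent_block_ext:
  assumes x: "x \<in> N \<rightarrow>\<^sub>M borel" and i: "1 \<le> i"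
  shows "Measurable.pred N (\<lambda>\<omega>. shatters (consistent (X \<omega>) ys) (block (W2 \<omega>) k i @ [x \<omega>]))"
proof -
  have "Measurable.pred N (\<lambda>\<omega>. shatters (consistent (X \<omega>) ys)
    (map (\<lambda>j. if j < k - 1 then W2 \<omega> (1 + (i - 1) * (k - 1) + j) else x \<omega>) [0..<Suc (k - 1)]))"
  proof (rule pred_consistent_shatters)
    show "(\<lambda>\<omega>. if j < k - 1 then W2 \<omega> (1 + (i - 1) * (k - 1) + j) else x \<omega>) \<in> N \<rightarrow>\<^sub>M borel" for j
      using x point_W2 by (cases "j < k - 1") simp_all
  qed
  moreover have "block W k i = map (\<lambda>j. W (1 + (i - 1) * (k - 1) + j)) [0..<k - 1]" for W :: "nat \<Rightarrow> 'a"
    unfolding block_eq_map_restrict[OF i] by simp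
  ultimately show ?thesis by (simp only: map_snoc)
qed

lemma pred_consistent_DIS:
  assumes x: "x \<in> N \<rightarrow>\<^sub>M borel"
  shows "Measurable.pred N (\<lambda>\<omega>. x \<omega> \<in> DIS (consistent (X \<omega>) ys))"
proof -
  have "Measurable.pred N (\<lambda>\<omega>. shatters (consistent (X \<omega>) ys) (map (\<lambda>j. x \<omega>) [0..<Suc 0]))"
    by (rule pred_consistent_shatters) (rule x)
  thus ?thesis by (simp add: shatters_single)
qed

lemma card_upto_meas:
  assumes "\<And>i. i \<in> {1..n} \<Longrightarrow> Measurable.pred N (\<lambda>\<omega>. Q i \<omega>)"
  shows "(\<lambda>\<omega>. card {i \<in> {1..n::nat}. Q i \<omega>}) \<in> N \<rightarrow>\<^sub>M count_space UNIV"
proof (rule measurable_card)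
  fix i
  show "{\<omega> \<in> space N. i \<in> {i \<in> {1..n}. Q i \<omega>}} \<in> sets N"
  proof (cases "i \<in> {1..n}")
    case True
    thus ?thesis using assms[of i] by (simp add: pred_def)
  next
    case False
    hence "{\<omega> \<in> space N. i \<in> {i \<in> {1..n}. Q i \<omega>}} = {}" by auto
    thus ?thesis by (simp only: sets.empty_sets)
  qed
qed

lemma of_nat_meas: "c \<in> N \<rightarrow>\<^sub>M count_space UNIV \<Longrightarrow> (\<lambda>\<omega>. real (c \<omega>)) \<in> borel_measurable N"
  by measurable

lemma measurable_M_hat: "(\<lambda>\<omega>. real (M_hat (W2 \<omega>) k m (consistent (X \<omega>) ys))) \<in> borel_measurable N"
proof -
  have "(\<lambda>\<omega>. real (card {i \<in> {1..m ^ 3}. shatters (consistent (X \<omega>) ys) (block (W2 \<omega>) k i)})) \<in> borel_measurable N"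
    by (intro of_nat_meas card_upto_meas pred_consistent_block) simp
  thus ?thesis unfolding M_hat_def of_nat_max by measurable
qed

lemma measurable_Delta_hat:
  assumes x: "x \<in> N \<rightarrow>\<^sub>M borel"
  shows "(\<lambda>\<omega>. Delta_hat (W2 \<omega>) k m (x \<omega>) (consistent (X \<omega>) ys)) \<in> borel_measurable N"
proof (cases "k = 1")
  case True
  note [measurable] = pred_consistent_DIS[OF x]
  show ?thesis unfolding True Delta_hat_def by (simp add: of_bool_def)
next
  case False
  have "(\<lambda>\<omega>. real (card {i \<in> {1..m ^ 3}. shatters (consistent (X \<omega>) ys) (block (W2 \<omega>) k i @ [x \<omega>])})) \<in> borel_measurable N"
    by (intro of_nat_meas card_upto_meas pred_consistent_block_ext x) simp
  from borel_measurable_divide[OF this measurable_M_hat] show ?thesis unfolding Delta_hat_def if_not_P[OF False] .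
qed

text \<open>Restricting by the opposite label is consistency with a list longer by one, so both
  conditions in the count are of a form already known to be measurable. For \<open>k = 1\<close>
  unanimity means that no concept is consistent with that longer list.\<close>

lemma measurable_Gamma_hat:
  "(\<lambda>\<omega>. Gamma_hat (W2 \<omega>) k m (X \<omega> (Suc (length ys))) y (consistent (X \<omega>) ys)) \<in> borel_measurable N"
proof (cases "k = 1")
  case True
  have "(\<forall>h\<in>consistent X' ys. h (X' (Suc (length ys))) = y) \<longleftrightarrow> \<not> shatters (consistent X' (ys @ [\<not> y])) []" for X'
    unfolding consistent_snoc shatters_Nil restr_def by auto
  moreover have "Measurable.pred N (\<lambda>\<omega>. \<not> shatters (consistent (X \<omega>) (ys @ [\<not> y])) (map (\<lambda>j. undefined) [0..<0]))"
    by (intro pred_intros_logic pred_consistent_shatters) simp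
  ultimately have [measurable]: "Measurable.pred N (\<lambda>\<omega>. \<forall>h\<in>consistent (X \<omega>) ys. h (X \<omega> (Suc (length ys))) = y)" by simp
  show ?thesis unfolding True Gamma_hat_def by (simp add: of_bool_def)
next
  case False
  have "(\<lambda>\<omega>. real (card {i \<in> {1..m ^ 3}. shatters (consistent (X \<omega>) ys) (block (W2 \<omega>) k i) \<and>
      \<not> shatters (consistent (X \<omega>) (ys @ [\<not> y])) (block (W2 \<omega>) k i)})) \<in> borel_measurable N"
    by (intro of_nat_meas card_upto_meas pred_intros_logic pred_consistent_block) auto
  from borel_measurable_divide[OF this measurable_M_hat] show ?thesis unfolding Gamma_hat_def if_not_P[OF False] consistent_snoc .
qed

lemma pred_asks: "Measurable.pred N (\<lambda>\<omega>. asks k (X \<omega>) (W2 \<omega>) ys)"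
proof -
  note [measurable] = measurable_Delta_hat[OF point_X[of "Suc (length ys)"]]
  show ?thesis unfolding asks_def by measurable
qed

lemma pred_guess: "Measurable.pred N (\<lambda>\<omega>. guess k (X \<omega>) (W2 \<omega>) ys)"
proof -
  note [measurable] = measurable_Gamma_hat
  have [measurable]: "Measurable.pred N (\<lambda>\<omega>. tie m (X \<omega> i))" for m i
    using measurable_compose[OF point_X, of "tie m" "count_space UNIV"] tie[of m] by (simp add: classifiers_def)
  show ?thesis unfolding guess_def infer_def by measurable
qed

lemma if_meas: "Measurable.pred N Q \<Longrightarrow> g \<in> N \<rightarrow>\<^sub>M K \<Longrightarrow> h \<in> N \<rightarrow>\<^sub>M K \<Longrightarrow> (\<lambda>\<omega>. if Q \<omega> then g \<omega> else h \<omega>) \<in> N \<rightarrow>\<^sub>M K"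
  by (rule measurable_If) (simp_all add: pred_def)

lemma measurable_advance:
  assumes "Measurable.pred N Q"
  shows "(\<lambda>\<omega>. advance (Q \<omega>) k (X \<omega>) (W2 \<omega>) s) \<in> N \<rightarrow>\<^sub>M count_space UNIV"
proof -
  have e: "advance q k X' W' s = (if q then (if f (X' (Suc (length (snd s)))) then (Suc (fst s), snd s @ [True]) else (Suc (fst s), snd s @ [False]))
     else (if guess k X' W' (snd s) then (fst s, snd s @ [True]) else (fst s, snd s @ [False])))" for q X' W'
    by (auto simp: advance_def case_prod_unfold)
  show ?thesis unfolding e by (intro if_meas assms label_X pred_guess) simp_all
qed

lemma measurable_wstep: "(\<lambda>\<omega>. wstep n k T (X \<omega>) (W2 \<omega>) s) \<in> N \<rightarrow>\<^sub>M count_space UNIV"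
proof (cases "fst s < nat \<lceil>real T / 4\<rceil> \<and> length (snd s) \<le> k * 2 ^ n")
  case True
  show ?thesis unfolding wstep_def if_P[OF True] by (rule measurable_advance[OF pred_asks])
next
  case False
  show ?thesis unfolding wstep_def if_not_P[OF False] by simp
qed

lemma measurable_dstep: "(\<lambda>\<omega>. dstep k T (X \<omega>) (W2 \<omega>) s) \<in> N \<rightarrow>\<^sub>M count_space UNIV"
  unfolding dstep_def by (rule measurable_advance, rule pred_intros_logic(3)[OF pred_asks]) simp

text \<open>Countability of the state type pays off here: measurability of the step at each fixed
  state suffices for all iterates.\<close>

lemma measurable_funpow_countable:
  fixes g :: "'w \<Rightarrow> 's::countable \<Rightarrow> 's"
  assumes "\<And>s. (\<lambda>\<omega>. g \<omega> s) \<in> N \<rightarrow>\<^sub>M count_space UNIV"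
  shows "(\<lambda>\<omega>. (g \<omega> ^^ j) s) \<in> N \<rightarrow>\<^sub>M count_space UNIV"
proof (induction j)
  case (Suc j)
  show ?case using measurable_compose_countable[of "\<lambda>s \<omega>. g \<omega> s", OF assms Suc] by simp
qed simp

lemma measurable_while_end: "(\<lambda>\<omega>. while_end n k T (X \<omega>) (W2 \<omega>) ys) \<in> N \<rightarrow>\<^sub>M count_space UNIV"
  unfolding while_end_def by (rule measurable_funpow_countable[OF measurable_wstep])

lemma measurable_do_steps: "(\<lambda>\<omega>. do_steps k T (X \<omega>) (W1 \<omega>) (W2 \<omega>) ys) \<in> N \<rightarrow>\<^sub>M count_space UNIV"
proof -
  have D: "(\<lambda>\<omega>. Delta_hat (W2 \<omega>) k m (W1 \<omega> i) (consistent (X \<omega>) ys)) \<in> borel_measurable N" for m i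
    by (rule measurable_Delta_hat, rule point_W1)
  have Q: "Measurable.pred N (\<lambda>\<omega>. 1 / 8 \<le> Delta_hat (W2 \<omega>) k m (W1 \<omega> i) (consistent (X \<omega>) ys))" for m i
    using borel_measurable_le[OF borel_measurable_const D, of "1 / 8"] by (simp add: pred_def)
  have c: "(\<lambda>\<omega>. card {i \<in> {1..m ^ 3}. 1 / 8 \<le> Delta_hat (W2 \<omega>) k m (W1 \<omega> i) (consistent (X \<omega>) ys)}) \<in> N \<rightarrow>\<^sub>M count_space UNIV" for m
    by (rule card_upto_meas, rule Q)
  have r: "(\<lambda>\<omega>. real (card {i \<in> {1..m ^ 3}. 1 / 8 \<le> Delta_hat (W2 \<omega>) k m (W1 \<omega> i) (consistent (X \<omega>) ys)})) \<in> borel_measurable N" for m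
    by (rule of_nat_meas, rule c)
  have [measurable]: "(\<lambda>\<omega>. Delta_hat_total (W1 \<omega>) (W2 \<omega>) k m (consistent (X \<omega>) ys)) \<in> borel_measurable N" for m
    unfolding Delta_hat_total_def by (intro borel_measurable_add borel_measurable_divide borel_measurable_const r)
  show ?thesis unfolding do_steps_def by measurable
qed

lemma measurable_next_round: "(\<lambda>\<omega>. next_round n k (X \<omega>) (W1 \<omega>) (W2 \<omega>) st) \<in> N \<rightarrow>\<^sub>M count_space UNIV"
proof -
  obtain segs T t ys where st: "st = (segs, T, t, ys)" by (cases st)
  let ?G = "\<lambda>s1 r \<omega>. (segs @ [(length (snd s1), r)], T - t, (dstep k (T - t) (X \<omega>) (W2 \<omega>) ^^ r) s1)"
  have G: "?G s1 r \<in> N \<rightarrow>\<^sub>M count_space UNIV" for r s1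
    by (rule measurable_compose[where f = "\<lambda>\<omega>. (dstep k (T - t) (X \<omega>) (W2 \<omega>) ^^ r) s1" and g = "\<lambda>s2. (segs @ [(length (snd s1), r)], T - t, s2)",
        OF measurable_funpow_countable[OF measurable_dstep]]) simp
  let ?r = "\<lambda>s1 \<omega>. do_steps k (T - t) (X \<omega>) (W1 \<omega>) (W2 \<omega>) (snd s1)"
  have F: "(\<lambda>\<omega>. ?G s1 (?r s1 \<omega>) \<omega>) \<in> N \<rightarrow>\<^sub>M count_space UNIV" for s1
    by (rule measurable_compose_countable[where f = "?G s1" and g = "?r s1", OF G measurable_do_steps])
  have "(\<lambda>\<omega>. ?G (while_end n k (T - t) (X \<omega>) (W2 \<omega>) ys) (?r (while_end n k (T - t) (X \<omega>) (W2 \<omega>) ys) \<omega>) \<omega>) \<in> N \<rightarrow>\<^sub>M count_space UNIV"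
    by (rule measurable_compose_countable[where f = "\<lambda>s1 \<omega>. ?G s1 (?r s1 \<omega>) \<omega>"
        and g = "\<lambda>\<omega>. while_end n k (T - t) (X \<omega>) (W2 \<omega>) ys", OF F measurable_while_end])
  thus ?thesis unfolding next_round_def st Let_def prod.case .
qed

lemma measurable_trace: "(\<lambda>\<omega>. trace n (X \<omega>) (W1 \<omega>) (W2 \<omega>) k) \<in> N \<rightarrow>\<^sub>M count_space UNIV"
proof (induction k)
  case (Suc k)
  have "(\<lambda>\<omega>. next_round n (Suc k) (X \<omega>) (W1 \<omega>) (W2 \<omega>) (trace n (X \<omega>) (W1 \<omega>) (W2 \<omega>) k)) \<in> N \<rightarrow>\<^sub>M count_space UNIV"
    by (rule measurable_compose_countable[where f = "\<lambda>st \<omega>. next_round n (Suc k) (X \<omega>) (W1 \<omega>) (W2 \<omega>) st", OF measurable_next_round Suc])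
  thus ?case by (simp only: trace.simps)
qed simp

end

text \<open>The empty sample is a default for indices without a recorded round; it makes the
  hypothesis measurable for every \<open>k\<close> and every state.\<close>

definition hypothesis :: "('r \<Rightarrow> ('a \<times> bool) list \<Rightarrow> 'a classifier) \<Rightarrow> (nat \<Rightarrow> 'a) \<Rightarrow> 'r \<Rightarrow>
    (nat \<times> nat) list \<times> nat \<times> nat \<times> bool list \<Rightarrow> nat \<Rightarrow> 'a classifier" where
  "hypothesis A X \<rho> = (\<lambda>(segs, T, t, ys) k. A \<rho> (if k - 1 < length segs then segment X ys (segs ! (k - 1)) else []))"

definition chosen_index :: "nat \<Rightarrow> nat \<Rightarrow> (nat \<Rightarrow> 'a) \<Rightarrow> nat \<Rightarrow> (nat \<Rightarrow> 'a classifier) \<Rightarrow> nat" where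
  "chosen_index N b X m0 h = Max {k \<in> {1..N}. \<forall>j\<in>{1..<k}.
     emp_err (map (\<lambda>i. (X i, f (X i))) (first_indices X m0 {x. h j x \<noteq> h k x} (select_size b N j))) (h k) \<le> 7 / 12}"

lemma run_request_labels: "run (\<lambda>i. f (X i)) (request_labels X is) = map (\<lambda>i. (X i, f (X i))) is"
  by (induction "is") auto

lemma run_request_tables:
  "p \<in> set ps \<Longrightarrow> run (\<lambda>i. f (X i)) (request_tables X I ps) p = map (\<lambda>i. (X i, f (X i))) (I p)"
  by (induction ps) (auto simp: run_request_labels)

lemma run_active_select:
  "run (\<lambda>i. f (X i)) (active_select h N b X m0) = h (chosen_index N b X m0 h)"
proof -
  let ?Q = "run (\<lambda>i. f (X i)) (request_tables X (\<lambda>(j, k). first_indices X m0 {x. h j x \<noteq> h k x} (select_size b N j)) [(j, k). k \<leftarrow> [1..<N + 1], j \<leftarrow> [1..<k]])"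
  have "?Q (j, k) = map (\<lambda>i. (X i, f (X i))) (first_indices X m0 {x. h j x \<noteq> h k x} (select_size b N j))"
    if "k \<in> {1..N}" "j \<in> {1..<k}" for j k
    using that by (subst run_request_tables) (auto simp del: upt_Suc intro!: bexI[of _ k])
  hence "{k \<in> {1..N}. \<forall>j\<in>{1..<k}. emp_err (?Q (j, k)) (h k) \<le> 7 / 12}
    = {k \<in> {1..N}. \<forall>j\<in>{1..<k}. emp_err (map (\<lambda>i. (X i, f (X i))) (first_indices X m0 {x. h j x \<noteq> h k x} (select_size b N j))) (h k) \<le> 7 / 12}"
    by (intro Collect_cong conj_cong refl ball_cong) auto
  thus ?thesis unfolding active_select_def chosen_index_def select_size_def[symmetric] by simp
qed

lemma run_meta_algorithm:
  "run (\<lambda>i. f (X i)) (meta_algorithm C tie A n (X, W1, W2, \<rho>))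
    = (let st = trace n X W1 W2 (d + 1); h = (\<lambda>k. hypothesis A X (\<rho> k) st k)
       in h (chosen_index (d + 1) (n div 3) X (length (final st)) h))"
proof -
  obtain segs T t ys where tr: "trace n X W1 W2 (d + 1) = (segs, T, t, ys)" by (cases "trace n X W1 W2 (d + 1)")
  have r: "run (\<lambda>i. f (X i)) (rounds C tie X W1 W2 n (d + 1)) = (map (segment X ys) segs, T, t, length ys, consistent X ys)"
    and l: "length segs = d + 1"
    using run_rounds[of X W1 W2 n "d + 1"] unfolding tr by simp_all
  let ?h = "\<lambda>k. A (\<rho> k) (map (segment X ys) segs ! (k - 1))" and ?h' = "\<lambda>k. hypothesis A X (\<rho> k) (segs, T, t, ys) k"
  have eq: "?h k = ?h' k" if "k \<in> {1..d + 1}" for k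
  proof -
    have "k - 1 < length segs" using that l by auto
    thus ?thesis by (simp add: hypothesis_def)
  qed
  have "run (\<lambda>i. f (X i)) (meta_algorithm C tie A n (X, W1, W2, \<rho>)) = ?h (chosen_index (d + 1) (n div 3) X (length ys) ?h)"
    by (simp only: meta_algorithm_def Let_def prod.case vc_dim the_enat.simps run_bindq r run_active_select)
  also have "chosen_index (d + 1) (n div 3) X (length ys) ?h = chosen_index (d + 1) (n div 3) X (length ys) ?h'"
    unfolding chosen_index_def
  proof (intro arg_cong[where f = Max] Collect_cong conj_cong refl ball_cong)
    fix k j assume "k \<in> {1..d + 1}" "j \<in> {1..<k}"
    hence "?h k = ?h' k" "?h j = ?h' j" using eq by auto
    thus "(emp_err (map (\<lambda>i. (X i, f (X i))) (first_indices X (length ys) {x. ?h j x \<noteq> ?h k x} (select_size (n div 3) (d + 1) j))) (?h k) \<le> 7 / 12)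
      = (emp_err (map (\<lambda>i. (X i, f (X i))) (first_indices X (length ys) {x. ?h' j x \<noteq> ?h' k x} (select_size (n div 3) (d + 1) j))) (?h' k) \<le> 7 / 12)"
      by (simp only:)
  qed
  also have "?h (chosen_index (d + 1) (n div 3) X (length ys) ?h') = ?h' (chosen_index (d + 1) (n div 3) X (length ys) ?h')"
  proof (rule eq)
    let ?S = "{k \<in> {1..d + 1}. \<forall>j\<in>{1..<k}.
     emp_err (map (\<lambda>i. (X i, f (X i))) (first_indices X (length ys) {x. ?h' j x \<noteq> ?h' k x} (select_size (n div 3) (d + 1) j))) (?h' k) \<le> 7 / 12}"
    have "1 \<in> ?S" by simp
    hence "Max ?S \<in> ?S" by (intro Max_in) auto
    thus "chosen_index (d + 1) (n div 3) X (length ys) ?h' \<in> {1..d + 1}" unfolding chosen_index_def by blast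
  qed
  finally show ?thesis unfolding tr final_def Let_def prod.case .
qed

end

section \<open>Runs with correct labels\<close>

context learner
begin

definition truth :: "(nat \<Rightarrow> 'a) \<Rightarrow> nat \<Rightarrow> bool list" where
  "truth X m = map (\<lambda>i. f (X (Suc i))) [0..<m]"

lemma length_truth [simp]: "length (truth X m) = m"
  by (simp add: truth_def)

lemma truth_Suc: "truth X (Suc m) = truth X m @ [f (X (Suc m))]"
  by (simp add: truth_def)

lemma truth_0 [simp]: "truth X 0 = []"
  by (simp add: truth_def)

lemma consistent_truth: "consistent X (truth X m) = version_space m X"
  unfolding consistent_def version_space_eq truth_def by simp

text \<open>Outside the region of disagreement all of the version space agrees with the target,
  which it contains. No estimate is involved, so the first round is correct from its first point on,
  and the induction over the rounds can start.\<close>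

lemma guess_first_round:
  assumes "\<not> asks 1 X W2 (truth X m)"
  shows "guess 1 X W2 (truth X m) = f (X (Suc m))"
proof -
  let ?V = "version_space m X" and ?x = "X (Suc m)"
  have "?x \<notin> DIS ?V"
  proof
    assume "?x \<in> DIS ?V"
    hence "asks 1 X W2 (truth X m)" by (simp add: asks_def consistent_truth Delta_hat_def)
    thus False using assms by blast
  qed
  hence "\<forall>h\<in>?V. h ?x = f ?x" using f_in_version_space[of m X] unfolding DIS_def by blast
  hence "(\<forall>h\<in>?V. h ?x = y) \<longleftrightarrow> f ?x = y" for y using f_in_version_space[of m X] by blast
  hence "Gamma_hat W2 1 (Suc m) ?x y ?V = of_bool (f ?x = y)" for y
    unfolding Gamma_hat_def by simp
  thus ?thesis unfolding guess_def infer_def consistent_truth length_truth by (cases "f ?x") simp_all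
qed

lemma wstep_cases:
  assumes "\<not> asks k X W2 (truth X m) \<Longrightarrow> guess k X W2 (truth X m) = f (X (Suc m))"
  shows "wstep n k T X W2 (t, truth X m) =
    (if t < nat \<lceil>real T / 4\<rceil> \<and> m \<le> k * 2 ^ n then (t + of_bool (asks k X W2 (truth X m)), truth X (Suc m)) else (t, truth X m))"
  using assms by (simp add: wstep_def advance_def truth_Suc)

text \<open>Correct inference keeps the label list equal to the truth, so the state is described by
  one index and the number of requests by a count. The loop stops because its quota is used up or
  because it has read too many points.\<close>

lemma while_end_truth:
  assumes right: "\<And>i. m \<le> i \<Longrightarrow> \<not> asks k X W2 (truth X i) \<Longrightarrow> guess k X W2 (truth X i) = f (X (Suc i))"
  obtains m1 where "m \<le> m1"
    "while_end n k T X W2 (truth X m) = (card {i \<in> {m<..m1}. asks k X W2 (truth X (i - 1))}, truth X m1)"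
    "card {i \<in> {m<..m1}. asks k X W2 (truth X (i - 1))} \<le> nat \<lceil>real T / 4\<rceil>"
    "card {i \<in> {m<..m1}. asks k X W2 (truth X (i - 1))} = nat \<lceil>real T / 4\<rceil> \<or> k * 2 ^ n < m1"
proof -
  let ?c = "\<lambda>m1. card {i \<in> {m<..m1}. asks k X W2 (truth X (i - 1))}"
  have cS: "?c (Suc m1) = ?c m1 + of_bool (asks k X W2 (truth X m1))" if "m \<le> m1" for m1
  proof -
    have "{i \<in> {m<..Suc m1}. asks k X W2 (truth X (i - 1))} = {i \<in> {m<..m1}. asks k X W2 (truth X (i - 1))}
      \<union> (if asks k X W2 (truth X m1) then {Suc m1} else {})"
      using that by (auto simp: le_Suc_eq)
    thus ?thesis by (auto intro!: trans[OF card_Un_disjoint])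
  qed
  have "\<exists>m1\<ge>m. (wstep n k T X W2 ^^ j) (0, truth X m) = (?c m1, truth X m1) \<and> ?c m1 \<le> nat \<lceil>real T / 4\<rceil>
      \<and> (?c m1 = nat \<lceil>real T / 4\<rceil> \<or> k * 2 ^ n < m1 \<or> m1 = m + j)" for j
  proof (induction j)
    case 0
    show ?case by (intro exI[of _ m]) simp
  next
    case (Suc j)
    then obtain m1 where m1: "m \<le> m1" "(wstep n k T X W2 ^^ j) (0, truth X m) = (?c m1, truth X m1)"
      "?c m1 \<le> nat \<lceil>real T / 4\<rceil>" "?c m1 = nat \<lceil>real T / 4\<rceil> \<or> k * 2 ^ n < m1 \<or> m1 = m + j" by blast
    have w: "(wstep n k T X W2 ^^ Suc j) (0, truth X m) = wstep n k T X W2 (?c m1, truth X m1)" using m1(2) by simp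
    have wc: "wstep n k T X W2 (t, truth X m1) =
      (if t < nat \<lceil>real T / 4\<rceil> \<and> m1 \<le> k * 2 ^ n then (t + of_bool (asks k X W2 (truth X m1)), truth X (Suc m1)) else (t, truth X m1))" for t
      by (rule wstep_cases) (rule right[OF m1(1)])
    show ?case
    proof (cases "?c m1 < nat \<lceil>real T / 4\<rceil> \<and> m1 \<le> k * 2 ^ n")
      case True
      have "(wstep n k T X W2 ^^ Suc j) (0, truth X m) = (?c (Suc m1), truth X (Suc m1))"
        unfolding w wc if_P[OF True] cS[OF m1(1)] ..
      moreover have "?c (Suc m1) \<le> nat \<lceil>real T / 4\<rceil>" unfolding cS[OF m1(1)] using True by simp
      moreover have "Suc m1 = m + Suc j" using m1(4) True by auto
      ultimately show ?thesis using m1(1) by (intro exI[of _ "Suc m1"]) simp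
    next
      case False
      have "(wstep n k T X W2 ^^ Suc j) (0, truth X m) = (?c m1, truth X m1)"
        unfolding w wc if_not_P[OF False] ..
      thus ?thesis using m1 False by (intro exI[of _ m1]) auto
    qed
  qed
  from this[of "Suc (k * 2 ^ n)"] obtain m1 where "m \<le> m1" "while_end n k T X W2 (truth X m) = (?c m1, truth X m1)"
    "?c m1 \<le> nat \<lceil>real T / 4\<rceil>" "?c m1 = nat \<lceil>real T / 4\<rceil> \<or> k * 2 ^ n < m1 \<or> m1 = m + Suc (k * 2 ^ n)"
    unfolding while_end_def by blast
  thus ?thesis by (intro that[of m1]) auto
qed

text \<open>At most \<open>T / 4 + 1\<close> requests were made before the loop and at most
  \<open>T / 2 - 2\<close> follow, so the cap \<open>3 * T / 4\<close> never blocks a request; every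
  label is then either requested or inferred correctly. The 2 absorbs the rounding.\<close>

lemma dsteps_truth:
  assumes right: "\<And>i. m \<le> i \<Longrightarrow> \<not> asks k X W2 (truth X i) \<Longrightarrow> guess k X W2 (truth X i) = f (X (Suc i))"
    and reg: "\<And>i. m \<le> i \<Longrightarrow> asks k X W2 (truth X i) \<Longrightarrow> X (Suc i) \<in> D"
    and t1: "t1 \<le> nat \<lceil>real T / 4\<rceil>"
    and few: "real (card {i \<in> {1..r}. X (m + i) \<in> D}) \<le> real T / 2 - 2"
    and j: "j \<le> r"
  shows "snd ((dstep k T X W2 ^^ j) (t1, truth X m)) = truth X (m + j)"
    and "fst ((dstep k T X W2 ^^ j) (t1, truth X m)) \<le> nat \<lfloor>3 * real T / 4\<rfloor>"
proof -
  have "snd ((dstep k T X W2 ^^ j) (t1, truth X m)) = truth X (m + j) \<and>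
    fst ((dstep k T X W2 ^^ j) (t1, truth X m)) \<le> t1 + card {i \<in> {1..j}. X (m + i) \<in> D}"
    using j
  proof (induction j)
    case (Suc j)
    define s where "s = (dstep k T X W2 ^^ j) (t1, truth X m)"
    have s: "snd s = truth X (m + j)" "fst s \<le> t1 + card {i \<in> {1..j}. X (m + i) \<in> D}"
      using Suc unfolding s_def by simp_all
    have c: "card {i \<in> {1..Suc j}. X (m + i) \<in> D} = card {i \<in> {1..j}. X (m + i) \<in> D} + of_bool (X (m + Suc j) \<in> D)"
    proof -
      have "{i \<in> {1..Suc j}. X (m + i) \<in> D} = {i \<in> {1..j}. X (m + i) \<in> D} \<union> (if X (m + Suc j) \<in> D then {Suc j} else {})"
        by (auto simp: le_Suc_eq)
      thus ?thesis by (auto intro!: trans[OF card_Un_disjoint])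
    qed
    have d: "(dstep k T X W2 ^^ Suc j) (t1, truth X m) = dstep k T X W2 s" by (simp add: s_def)
    show ?case
    proof (cases "asks k X W2 (truth X (m + j))")
      case True
      hence inD: "X (m + Suc j) \<in> D" using reg[of "m + j"] by simp
      have "card {i \<in> {1..Suc j}. X (m + i) \<in> D} \<le> card {i \<in> {1..r}. X (m + i) \<in> D}"
        using Suc.prems by (intro card_mono) auto
      hence le: "real (card {i \<in> {1..j}. X (m + i) \<in> D} + 1) \<le> real T / 2 - 2" using few c inD by simp
      have "real (nat \<lceil>real T / 4\<rceil>) \<le> real T / 4 + 1" by linarith
      hence "real (fst s) \<le> 3 * real T / 4 - 2" using s(2) t1 le by linarith
      hence lt: "fst s < nat \<lfloor>3 * real T / 4\<rfloor>" by linarith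
      have "dstep k T X W2 s = (Suc (fst s), truth X (Suc (m + j)))"
        using True lt s(1) by (simp add: dstep_def advance_def case_prod_unfold truth_Suc)
      thus ?thesis unfolding d using s(2) c inD by simp
    next
      case False
      have "dstep k T X W2 s = (fst s, truth X (Suc (m + j)))"
        using False s(1) right[of "m + j"] by (simp add: dstep_def advance_def case_prod_unfold truth_Suc)
      thus ?thesis unfolding d using s(2) c by simp
    qed
  qed simp
  moreover have "t1 + card {i \<in> {1..j}. X (m + i) \<in> D} \<le> nat \<lfloor>3 * real T / 4\<rfloor>"
  proof -
    have "card {i \<in> {1..j}. X (m + i) \<in> D} \<le> card {i \<in> {1..r}. X (m + i) \<in> D}"
      using j by (intro card_mono) auto
    hence "real (card {i \<in> {1..j}. X (m + i) \<in> D}) \<le> real T / 2 - 2" using few by linarith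
    moreover have "real (nat \<lceil>real T / 4\<rceil>) \<le> real T / 4 + 1" by linarith
    ultimately have "real (t1 + card {i \<in> {1..j}. X (m + i) \<in> D}) \<le> 3 * real T / 4 - 1" using t1 by linarith
    thus ?thesis by linarith
  qed
  ultimately show "snd ((dstep k T X W2 ^^ j) (t1, truth X m)) = truth X (m + j)"
    "fst ((dstep k T X W2 ^^ j) (t1, truth X m)) \<le> nat \<lfloor>3 * real T / 4\<rfloor>" by auto
qed

section \<open>Induction over the rounds\<close>

definition budget_at :: "nat \<Rightarrow> (nat \<Rightarrow> 'a) \<Rightarrow> (nat \<Rightarrow> 'a) \<Rightarrow> (nat \<Rightarrow> 'a) \<Rightarrow> nat \<Rightarrow> nat" where
  "budget_at n X W1 W2 k = (case trace n X W1 W2 (k - 1) of (segs, T, t, ys) \<Rightarrow> T - t)"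

definition while_state :: "nat \<Rightarrow> (nat \<Rightarrow> 'a) \<Rightarrow> (nat \<Rightarrow> 'a) \<Rightarrow> (nat \<Rightarrow> 'a) \<Rightarrow> nat \<Rightarrow> nat \<times> bool list" where
  "while_state n X W1 W2 k = while_end n k (budget_at n X W1 W2 k) X W2 (final (trace n X W1 W2 (k - 1)))"

definition stop_time :: "nat \<Rightarrow> (nat \<Rightarrow> 'a) \<Rightarrow> (nat \<Rightarrow> 'a) \<Rightarrow> (nat \<Rightarrow> 'a) \<Rightarrow> nat \<Rightarrow> nat" where
  "stop_time n X W1 W2 k = length (snd (while_state n X W1 W2 k))"

definition sample_size :: "nat \<Rightarrow> (nat \<Rightarrow> 'a) \<Rightarrow> (nat \<Rightarrow> 'a) \<Rightarrow> (nat \<Rightarrow> 'a) \<Rightarrow> nat \<Rightarrow> nat" where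
  "sample_size n X W1 W2 k = do_steps k (budget_at n X W1 W2 k) X W1 W2 (snd (while_state n X W1 W2 k))"

lemma trace_unfold:
  assumes "1 \<le> k" "trace n X W1 W2 (k - 1) = (segs, T, t, ys)"
  shows "trace n X W1 W2 k = (segs @ [(stop_time n X W1 W2 k, sample_size n X W1 W2 k)], budget_at n X W1 W2 k,
    (dstep k (budget_at n X W1 W2 k) X W2 ^^ sample_size n X W1 W2 k) (while_state n X W1 W2 k))"
proof -
  obtain k' where k': "k = Suc k'" using assms(1) by (cases k) auto
  have b: "budget_at n X W1 W2 (Suc k') = T - t" "final (trace n X W1 W2 k') = ys"
    using assms(2) by (simp_all add: budget_at_def k' final_def)
  show ?thesis
    using assms(2) unfolding k' sample_size_def stop_time_def while_state_def
    by (simp add: next_round_def Let_def b final_def)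
qed

text \<open>A round spends at most three quarters of its budget, so the budgets decrease no faster
  than \<open>n / 8 ^ k\<close>. Round 1 infers correctly by itself and ends beyond
  \<open>i0\<close>; later rounds start there, where \<open>right\<close> and \<open>reg\<close>
  apply. The sets \<open>D k m\<close> stand for the regions, of which only the listed properties
  matter, and \<open>few\<close> is required only for a loop that ran correctly.\<close>

lemma trace_truth:
  assumes right: "\<And>k i. 1 \<le> k \<Longrightarrow> k \<le> K \<Longrightarrow> i0 \<le> i \<Longrightarrow> \<not> asks k X W2 (truth X i) \<Longrightarrow> guess k X W2 (truth X i) = f (X (Suc i))"
    and reg: "\<And>k m i. 1 \<le> k \<Longrightarrow> k \<le> K \<Longrightarrow> i0 \<le> m \<Longrightarrow> m \<le> i \<Longrightarrow> asks k X W2 (truth X i) \<Longrightarrow> X (Suc i) \<in> D k m"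
    and few: "\<And>k. 1 \<le> k \<Longrightarrow> k \<le> K \<Longrightarrow> snd (while_state n X W1 W2 k) = truth X (stop_time n X W1 W2 k) \<Longrightarrow>
        i0 \<le> stop_time n X W1 W2 k \<Longrightarrow> real n / 8 ^ k \<le> real (budget_at n X W1 W2 k) \<Longrightarrow>
        real (card {i \<in> {1..sample_size n X W1 W2 k}. X (stop_time n X W1 W2 k + i) \<in> D k (stop_time n X W1 W2 k)})
          \<le> real (budget_at n X W1 W2 k) / 2 - 2"
    and n: "8 * 8 ^ K \<le> real n" and i0: "real i0 \<le> real n / 32"
    and k: "1 \<le> k" "k \<le> K"
  shows "real n / 8 ^ k \<le> real (budget_at n X W1 W2 k) \<and> i0 \<le> stop_time n X W1 W2 k \<and>
    snd (while_state n X W1 W2 k) = truth X (stop_time n X W1 W2 k) \<and>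
    final (trace n X W1 W2 k) = truth X (stop_time n X W1 W2 k + sample_size n X W1 W2 k) \<and>
    (\<exists>m \<le> stop_time n X W1 W2 k.
      (let c = card {i \<in> {m<..stop_time n X W1 W2 k}. asks k X W2 (truth X (i - 1))}; u = nat \<lceil>real (budget_at n X W1 W2 k) / 4\<rceil> in
        c \<le> u \<and> (c = u \<or> k * 2 ^ n < stop_time n X W1 W2 k)) \<and> (k = 1 \<or> i0 \<le> m)) \<and>
    (case trace n X W1 W2 k of (segs, T, t, ys) \<Rightarrow> T = budget_at n X W1 W2 k \<and> t \<le> nat \<lfloor>3 * real T / 4\<rfloor>)"
  using k
proof (induction k rule: nat_induct_at_least)
  case base
  note One_nat_def [simp del]
  have K: "1 \<le> K" using base by simp
  have n1: "64 \<le> real n"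
  proof -
    have "(8::real) ^ 1 \<le> 8 ^ K" using K by (intro power_increasing) auto
    thus ?thesis using n by simp
  qed
  have tr0: "trace n X W1 W2 (1 - 1) = ([], nat \<lceil>2 * real n / 3\<rceil>, 0, [])" by simp
  have b: "budget_at n X W1 W2 1 = nat \<lceil>2 * real n / 3\<rceil>" by (simp add: budget_at_def)
  have fin: "final (trace n X W1 W2 (1 - 1)) = truth X 0" by (simp add: final_def)
  have r1: "\<not> asks 1 X W2 (truth X i) \<Longrightarrow> guess 1 X W2 (truth X i) = f (X (Suc i))" for i by (rule guess_first_round)
  let ?B = "budget_at n X W1 W2 1"
  have B: "2 * real n / 3 \<le> real ?B" unfolding b by linarith
  obtain m1 where m1: "while_end n 1 ?B X W2 (truth X 0) = (card {i \<in> {0<..m1}. asks 1 X W2 (truth X (i - 1))}, truth X m1)"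
    "card {i \<in> {0<..m1}. asks 1 X W2 (truth X (i - 1))} \<le> nat \<lceil>real ?B / 4\<rceil>"
    "card {i \<in> {0<..m1}. asks 1 X W2 (truth X (i - 1))} = nat \<lceil>real ?B / 4\<rceil> \<or> 1 * 2 ^ n < m1"
    using while_end_truth[of 0 1 X W2 n ?B] r1 by blast
  have ws: "while_state n X W1 W2 1 = (card {i \<in> {0<..m1}. asks 1 X W2 (truth X (i - 1))}, truth X m1)"
    unfolding while_state_def fin m1(1) ..
  have st: "stop_time n X W1 W2 1 = m1" by (simp add: stop_time_def ws)
  \<comment> \<open>Either the quota was used, at no fewer than \<open>n / 6\<close> distinct
    points, or more than \<open>2 ^ n\<close> points were read.\<close>
  have m1i0: "i0 \<le> m1"
    using m1(3)
  proof
    assume e: "card {i \<in> {0<..m1}. asks 1 X W2 (truth X (i - 1))} = nat \<lceil>real ?B / 4\<rceil>"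
    have "card {i \<in> {0<..m1}. asks 1 X W2 (truth X (i - 1))} \<le> card {0<..m1}" by (intro card_mono) auto
    hence "nat \<lceil>real ?B / 4\<rceil> \<le> m1" unfolding e card_greaterThanAtMost by simp
    hence "real (nat \<lceil>real ?B / 4\<rceil>) \<le> real m1" by (rule of_nat_mono)
    moreover have "real ?B / 4 \<le> real (nat \<lceil>real ?B / 4\<rceil>)" by linarith
    ultimately have "real i0 \<le> real m1" using B i0 by linarith
    thus ?thesis by simp
  next
    assume "1 * 2 ^ n < m1"
    hence "n < m1" using less_exp[of n] by linarith
    hence "real i0 \<le> real m1" using i0 by linarith
    thus ?thesis by simp
  qed
  have bn: "real n / 8 ^ 1 \<le> real ?B" using B n1 by simp
  have fw: "real (card {i \<in> {1..sample_size n X W1 W2 1}. X (m1 + i) \<in> D 1 m1}) \<le> real ?B / 2 - 2"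
    using few[of 1] K m1i0 bn st ws by simp
  have ds: "snd ((dstep 1 ?B X W2 ^^ sample_size n X W1 W2 1) (while_state n X W1 W2 1)) = truth X (m1 + sample_size n X W1 W2 1)"
    "fst ((dstep 1 ?B X W2 ^^ sample_size n X W1 W2 1) (while_state n X W1 W2 1)) \<le> nat \<lfloor>3 * real ?B / 4\<rfloor>"
    unfolding ws by (rule dsteps_truth[where D = "D 1 m1", OF r1 reg[OF order_refl K m1i0] m1(2) fw order_refl]; assumption)+
  have tr: "trace n X W1 W2 1 = ([] @ [(m1, sample_size n X W1 W2 1)], ?B, (dstep 1 ?B X W2 ^^ sample_size n X W1 W2 1) (while_state n X W1 W2 1))"
    using trace_unfold[OF order_refl tr0] st by (simp del: trace.simps)
  show ?case
    unfolding st tr using bn m1i0 ws ds m1(2,3)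
    by (simp add: final_def case_prod_unfold Let_def) (intro exI[of _ 0], auto)
next
  case (Suc k)
  have kK: "k \<le> K" "1 \<le> Suc k" "Suc k \<le> K" using Suc by auto
  obtain segs T t ys where tr: "trace n X W1 W2 k = (segs, T, t, ys)" by (cases "trace n X W1 W2 k")
  have IH: "real n / 8 ^ k \<le> real (budget_at n X W1 W2 k)" "i0 \<le> stop_time n X W1 W2 k"
    "ys = truth X (stop_time n X W1 W2 k + sample_size n X W1 W2 k)" "T = budget_at n X W1 W2 k" "t \<le> nat \<lfloor>3 * real T / 4\<rfloor>"
    using Suc.IH[OF kK(1)] unfolding tr by (auto simp: final_def)
  let ?m = "stop_time n X W1 W2 k + sample_size n X W1 W2 k"
  let ?k = "Suc k"
  have tr0: "trace n X W1 W2 (?k - 1) = (segs, T, t, truth X ?m)" using tr IH(3) by simp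
  have b: "budget_at n X W1 W2 ?k = T - t" using tr by (simp add: budget_at_def)
  have fin: "final (trace n X W1 W2 (?k - 1)) = truth X ?m" using tr IH(3) by (simp add: final_def)
  let ?B = "budget_at n X W1 W2 ?k"
  have n8: "8 \<le> real n / 8 ^ k"
  proof -
    have "(8::real) ^ k \<le> 8 ^ K" using kK by (intro power_increasing) auto
    hence "8 * 8 ^ k \<le> real n" using n by linarith
    thus ?thesis by (simp add: field_simps)
  qed
  have bn: "real n / 8 ^ ?k \<le> real ?B"
  proof -
    have "t \<le> T" using IH(5) by linarith
    hence "real ?B = real T - real t" unfolding b by simp
    moreover have "real t \<le> 3 * real T / 4" using IH(5) by linarith
    ultimately have "real T / 4 \<le> real ?B" by linarith
    moreover have "real n / 8 ^ k \<le> real T" using IH by simp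
    moreover have "a / 8 \<le> B" if "8 \<le> a" "a \<le> T'" "T' / 4 \<le> B" for a T' B :: real using that by linarith
    ultimately have "real n / 8 ^ k / 8 \<le> real ?B" using n8 by blast
    moreover have "real n / 8 ^ ?k = (real n / 8 ^ k) / 8" by simp
    ultimately show ?thesis by (simp only:)
  qed
  have r1: "\<not> asks ?k X W2 (truth X i) \<Longrightarrow> guess ?k X W2 (truth X i) = f (X (Suc i))" if "i0 \<le> i" for i
    using right[OF kK(2,3)] that by blast
  have mi0: "i0 \<le> ?m" using IH(2) by simp
  have r1': "\<not> asks ?k X W2 (truth X i) \<Longrightarrow> guess ?k X W2 (truth X i) = f (X (Suc i))" if "?m \<le> i" for i
    using r1[OF order_trans[OF mi0 that]] .
  obtain m1 where m1: "?m \<le> m1" "while_end n ?k ?B X W2 (truth X ?m) = (card {i \<in> {?m<..m1}. asks ?k X W2 (truth X (i - 1))}, truth X m1)"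
    "card {i \<in> {?m<..m1}. asks ?k X W2 (truth X (i - 1))} \<le> nat \<lceil>real ?B / 4\<rceil>"
    "card {i \<in> {?m<..m1}. asks ?k X W2 (truth X (i - 1))} = nat \<lceil>real ?B / 4\<rceil> \<or> ?k * 2 ^ n < m1"
    using while_end_truth[of ?m ?k X W2 n ?B, OF r1'] by blast
  have ws: "while_state n X W1 W2 ?k = (card {i \<in> {?m<..m1}. asks ?k X W2 (truth X (i - 1))}, truth X m1)"
    unfolding while_state_def fin m1(2) ..
  have st: "stop_time n X W1 W2 ?k = m1" by (simp add: stop_time_def ws)
  have m1i0: "i0 \<le> m1" using mi0 m1(1) by simp
  have fw: "real (card {i \<in> {1..sample_size n X W1 W2 ?k}. X (m1 + i) \<in> D ?k m1}) \<le> real ?B / 2 - 2"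
    using few[OF kK(2,3)] m1i0 bn st ws by simp
  have r2: "\<not> asks ?k X W2 (truth X i) \<Longrightarrow> guess ?k X W2 (truth X i) = f (X (Suc i))" if "m1 \<le> i" for i
    using r1[OF order_trans[OF m1i0 that]] .
  have ds: "snd ((dstep ?k ?B X W2 ^^ sample_size n X W1 W2 ?k) (while_state n X W1 W2 ?k)) = truth X (m1 + sample_size n X W1 W2 ?k)"
    "fst ((dstep ?k ?B X W2 ^^ sample_size n X W1 W2 ?k) (while_state n X W1 W2 ?k)) \<le> nat \<lfloor>3 * real ?B / 4\<rfloor>"
    unfolding ws by (rule dsteps_truth[where D = "D ?k m1", OF r2 reg[OF kK(2,3) m1i0] m1(3) fw order_refl]; assumption)+
  have tr2: "trace n X W1 W2 ?k = (segs @ [(m1, sample_size n X W1 W2 ?k)], ?B, (dstep ?k ?B X W2 ^^ sample_size n X W1 W2 ?k) (while_state n X W1 W2 ?k))"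
    using trace_unfold[OF kK(2) tr0] st by (simp del: trace.simps)
  have ex: "\<exists>m\<le>m1. (let c = card {i \<in> {m<..m1}. asks ?k X W2 (truth X (i - 1))}; u = nat \<lceil>real ?B / 4\<rceil> in
        c \<le> u \<and> (c = u \<or> ?k * 2 ^ n < m1)) \<and> (?k = 1 \<or> i0 \<le> m)"
    unfolding Let_def using m1 mi0 by (intro exI[of _ ?m]) blast
  show ?case
    unfolding st tr2 using bn m1i0 ws ds ex
    by (simp add: final_def case_prod_unfold)
qed

end

section \<open>Selection among the hypotheses\<close>

definition visits :: "(nat \<Rightarrow> 'a) \<Rightarrow> nat \<Rightarrow> 'a set \<Rightarrow> nat \<Rightarrow> nat set" where
  "visits X m0 D c = {i. m0 < i \<and> X i \<in> D \<and> card {i' \<in> {m0<..i}. X i' \<in> D} \<le> c}"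

lemma finite_visits [simp]: "finite (visits X m0 D c)"
  unfolding visits_def by (rule finite_first_indices)

lemma card_visits_le: "card (visits X m0 D c) \<le> c"
  unfolding visits_def by (rule card_first_indices_le)

lemma first_indices_eq: "first_indices X m0 D c = sorted_list_of_set (visits X m0 D c)"
  by (simp add: first_indices_def visits_def)

lemma emp_err_visits:
  "emp_err (map (\<lambda>i. (X i, f (X i))) (first_indices X m0 D c)) h =
    (if visits X m0 D c = {} then 0
     else real (card {i \<in> visits X m0 D c. h (X i) \<noteq> f (X i)}) / real (card (visits X m0 D c)))"
proof -
  let ?I = "visits X m0 D c"
  have "length (filter (\<lambda>i. h (X i) \<noteq> f (X i)) (sorted_list_of_set ?I)) = card ({i. h (X i) \<noteq> f (X i)} \<inter> ?I)"
    by (subst distinct_length_filter) auto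
  also have "{i. h (X i) \<noteq> f (X i)} \<inter> ?I = {i \<in> ?I. h (X i) \<noteq> f (X i)}" by auto
  finally show ?thesis
    unfolding emp_err_def first_indices_eq by (auto simp: filter_map comp_def)
qed

text \<open>The number of visits grows by at most one per point, so it passes through the value
  \<open>c\<close>.\<close>

lemma card_visits_eq:
  assumes "c \<le> card {i \<in> {m0<..<n}. X i \<in> D}"
  shows "card (visits X m0 D c) = c"
proof (rule antisym[OF card_visits_le])
  have "\<exists>n. card {i \<in> {m0<..<n}. X i \<in> D} = c"
    using assms
  proof (induction n)
    case (Suc n)
    have "{i \<in> {m0<..<Suc n}. X i \<in> D} = {i \<in> {m0<..<n}. X i \<in> D} \<union> (if m0 < n \<and> X n \<in> D then {n} else {})"
      by (auto simp: less_Suc_eq)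
    hence "card {i \<in> {m0<..<Suc n}. X i \<in> D} = card {i \<in> {m0<..<n}. X i \<in> D} + (if m0 < n \<and> X n \<in> D then 1 else 0)"
      by (auto intro!: trans[OF card_Un_disjoint])
    thus ?case using Suc by (cases "c \<le> card {i \<in> {m0<..<n}. X i \<in> D}") (auto intro!: exI[of _ "Suc n"] split: if_splits)
  qed (auto intro!: exI[of _ 0])
  then obtain n' where n': "card {i \<in> {m0<..<n'}. X i \<in> D} = c" by blast
  have "{i \<in> {m0<..<n'}. X i \<in> D} \<subseteq> visits X m0 D c"
  proof
    fix i assume i: "i \<in> {i \<in> {m0<..<n'}. X i \<in> D}"
    have "card {i' \<in> {m0<..i}. X i' \<in> D} \<le> card {i \<in> {m0<..<n'}. X i \<in> D}"
      using i by (intro card_mono) auto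
    thus "i \<in> visits X m0 D c" using i n' by (simp add: visits_def)
  qed
  hence "card {i \<in> {m0<..<n'}. X i \<in> D} \<le> card (visits X m0 D c)" by (intro card_mono) auto
  thus "c \<le> card (visits X m0 D c)" using n' by simp
qed

context full_prob_space
begin

lemma visits_restart: "visits (restart m0 X X') m0 D c = (\<lambda>i. m0 + i) ` visits X' 0 D c"
proof -
  have "card {i' \<in> {m0<..m0 + i}. restart m0 X X' i' \<in> D} = card {i' \<in> {0<..i}. X' i' \<in> D}" for i
  proof -
    have "{i' \<in> {m0<..m0 + i}. restart m0 X X' i' \<in> D} = (\<lambda>i. m0 + i) ` {i' \<in> {0<..i}. X' i' \<in> D}"
    proof (intro set_eqI iffI)
      fix j assume "j \<in> {i' \<in> {m0<..m0 + i}. restart m0 X X' i' \<in> D}"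
      thus "j \<in> (\<lambda>i. m0 + i) ` {i' \<in> {0<..i}. X' i' \<in> D}" by (intro image_eqI[of _ _ "j - m0"]) auto
    qed auto
    thus ?thesis by (simp add: card_image)
  qed
  note c = this
  show ?thesis
  proof (intro set_eqI iffI)
    fix j assume j: "j \<in> visits (restart m0 X X') m0 D c"
    hence "m0 + (j - m0) = j" by (simp add: visits_def)
    thus "j \<in> (\<lambda>i. m0 + i) ` visits X' 0 D c"
      using j c[of "j - m0"] by (intro image_eqI[of _ _ "j - m0"]) (auto simp: visits_def)
  next
    fix j assume "j \<in> (\<lambda>i. m0 + i) ` visits X' 0 D c"
    thus "j \<in> visits (restart m0 X X') m0 D c" using c by (auto simp: visits_def)
  qed
qed

text \<open>A test on the points after \<open>m0\<close> is a test of the independent copy from its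
  beginning, so the bounds below need only the start 0.\<close>

lemma emp_err_restart:
  "emp_err (map (\<lambda>i. (restart m0 X X' i, f (restart m0 X X' i))) (first_indices (restart m0 X X') m0 D c)) h
    = emp_err (map (\<lambda>i. (X' i, f (X' i))) (first_indices X' 0 D c)) h"
proof -
  have "{i \<in> (\<lambda>i. m0 + i) ` visits X' 0 D c. h (restart m0 X X' i) \<noteq> f (restart m0 X X' i)}
    = (\<lambda>i. m0 + i) ` {i \<in> visits X' 0 D c. h (X' i) \<noteq> f (X' i)}"
    by (auto simp: visits_def)
  thus ?thesis unfolding emp_err_visits visits_restart by (simp add: card_image)
qed

text \<open>The product over the visits is the limit of a supermartingale.\<close>

lemma nn_integral_visits_le_1:
  fixes a b :: real
  assumes D [measurable]: "D \<in> sets M" and E [measurable]: "E \<in> sets M" and ED: "E \<subseteq> D"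
    and ab: "0 \<le> a" "0 \<le> b" "a * measure M E + b * measure M (D - E) \<le> measure M D"
  shows "(\<integral>\<^sup>+X. ennreal (a ^ card {i \<in> visits X 0 D c. X i \<in> E} * b ^ card {i \<in> visits X 0 D c. X i \<notin> E}) \<partial>iid M) \<le> 1"
proof -
  define w where "w = (\<lambda>x. if x \<in> E then a else if x \<in> D then b else 1)"
  \<comment> \<open>Activity at \<open>i\<close> is decided before point \<open>i\<close> is read,
    and it ends with the \<open>c\<close>-th visit; from then on the product is frozen.\<close>
  define act where "act = (\<lambda>(i::nat) (X :: nat \<Rightarrow> 'a). 0 < i \<and> card {i' \<in> {0<..<i}. X i' \<in> D} < c)"
  define g where "g = (\<lambda>(i::nat) (X :: nat \<Rightarrow> 'a). ennreal (if act i X then w (X i) else 1))"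
  have wm: "w \<in> borel_measurable M" unfolding w_def by measurable
  have w0: "0 \<le> w x" for x using ab by (simp add: w_def)
  have actm: "Measurable.pred (iid M) (act i)" for i
  proof -
    have "(\<lambda>X. card {i' \<in> {0<..<i}. X i' \<in> D}) \<in> iid M \<rightarrow>\<^sub>M count_space UNIV"
    proof (rule measurable_card)
      fix i'
      have s: "{X \<in> space (iid M). X i' \<in> D} \<in> sets (iid M)"
        using measurable_sets[OF measurable_iid_component D, of i'] by (simp add: vimage_def Int_def conj_commute)
      show "{X \<in> space (iid M). i' \<in> {i' \<in> {0<..<i}. X i' \<in> D}} \<in> sets (iid M)"
        using s by (cases "i' \<in> {0<..<i}") auto
    qed
    thus ?thesis unfolding act_def by measurable
  qed
  have gm: "g i \<in> borel_measurable (iid M)" for i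
  proof -
    have "(\<lambda>X. w (X i)) \<in> borel_measurable (iid M)" by (rule measurable_compose[OF measurable_iid_component wm])
    thus ?thesis unfolding g_def using actm[of i] by measurable
  qed
  have wint: "(\<integral>\<^sup>+x. ennreal (w x) \<partial>M) \<le> 1"
  proof -
    have "(\<integral>\<^sup>+x. ennreal (w x) \<partial>M) = (\<integral>\<^sup>+x. ennreal a * indicator E x + (ennreal b * indicator (D - E) x + indicator (UNIV - D) x) \<partial>M)"
      using ED by (intro nn_integral_cong) (auto simp: w_def indicator_def)
    also have "\<dots> = ennreal a * emeasure M E + (ennreal b * emeasure M (D - E) + emeasure M (UNIV - D))"
      using D E by (subst nn_integral_add; (measurable)?)+ (simp_all add: nn_integral_cmult_indicator sets.compl_sets[of _ M, simplified])
    also have "\<dots> = ennreal (a * measure M E + (b * measure M (D - E) + (1 - measure M D)))"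
      using ab prob_compl[OF D] by (simp add: emeasure_eq_measure ennreal_mult)
    also have "\<dots> \<le> ennreal 1" using ab by (intro ennreal_leI) simp
    finally show ?thesis by simp
  qed
  have prod_le: "(\<integral>\<^sup>+X. (\<Prod>i<n. g i X) \<partial>iid M) \<le> 1" for n
  proof (rule nn_integral_predictable_prod_le_1[OF gm])
    fix i and X X' :: "nat \<Rightarrow> 'a" assume "\<forall>j\<le>i. X j = X' j"
    thus "g i X = g i X'" unfolding g_def act_def by (auto intro!: arg_cong[where f = ennreal] simp: conj_commute cong: conj_cong)
  next
    fix i X
    have act: "act i (X(i := x)) = act i X" for x unfolding act_def by (auto cong: conj_cong)
    show "(\<integral>\<^sup>+x. g i (X(i := x)) \<partial>M) \<le> 1"
      unfolding g_def act using wint by (cases "act i X") (simp_all add: emeasure_space_1[simplified])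
  qed
  have lim: "liminf (\<lambda>n. \<Prod>i<n. g i X) = ennreal (a ^ card {i \<in> visits X 0 D c. X i \<in> E} * b ^ card {i \<in> visits X 0 D c. X i \<notin> E})" for X
  proof -
    let ?I = "visits X 0 D c"
    have I: "i \<in> ?I \<longleftrightarrow> act i X \<and> X i \<in> D" for i
    proof -
      have *: "card {i' \<in> {0<..i}. X i' \<in> D} \<le> c \<longleftrightarrow> card {i' \<in> {0<..<i}. X i' \<in> D} < c" if "0 < i" "X i \<in> D"
      proof -
        have "{i' \<in> {0<..i}. X i' \<in> D} = insert i {i' \<in> {0<..<i}. X i' \<in> D}" using that by auto
        hence "card {i' \<in> {0<..i}. X i' \<in> D} = Suc (card {i' \<in> {0<..<i}. X i' \<in> D})"
          by (simp only:) (subst card_insert_disjoint; simp)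
        thus ?thesis by (simp only: Suc_le_eq)
      qed
      show ?thesis unfolding visits_def act_def mem_Collect_eq using * by blast
    qed
    have "\<exists>n0. \<forall>i\<in>?I. i < n0" using finite_visits unfolding finite_nat_set_iff_bounded .
    then obtain n0 where n0: "\<And>i. i \<in> ?I \<Longrightarrow> i < n0" by blast
    have "(\<Prod>i<n. g i X) = ennreal (a ^ card {i \<in> ?I. X i \<in> E} * b ^ card {i \<in> ?I. X i \<notin> E})" if "n0 \<le> n" for n
    proof -
      have "(\<Prod>i<n. g i X) = ennreal (\<Prod>i<n. if act i X then w (X i) else 1)"
        unfolding g_def using w0 by (intro prod_ennreal) auto
      also have "(\<Prod>i<n. if act i X then w (X i) else 1) = (\<Prod>i\<in>?I. w (X i))"
      proof (rule prod.mono_neutral_cong_right)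
        show "?I \<subseteq> {..<n}" using n0 that by fastforce
        show "\<forall>i\<in>{..<n} - ?I. (if act i X then w (X i) else 1) = 1" using I ED by (auto simp: w_def)
      qed (use I in auto)
      also have "\<dots> = (\<Prod>i\<in>?I. if X i \<in> E then a else b)"
        using I by (intro prod.cong) (auto simp: w_def)
      also have "\<dots> = a ^ card (?I \<inter> {i. X i \<in> E}) * b ^ card (?I \<inter> - {i. X i \<in> E})"
        by (subst prod.If_cases) auto
      also have "?I \<inter> {i. X i \<in> E} = {i \<in> ?I. X i \<in> E}" by auto
      also have "?I \<inter> - {i. X i \<in> E} = {i \<in> ?I. X i \<notin> E}" by auto
      finally show ?thesis .
    qed
    hence "(\<lambda>n. \<Prod>i<n. g i X) \<longlonglongrightarrow> ennreal (a ^ card {i \<in> ?I. X i \<in> E} * b ^ card {i \<in> ?I. X i \<notin> E})"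
      by (intro tendsto_eventually) (auto simp: eventually_sequentially)
    thus ?thesis by (intro lim_imp_Liminf) auto
  qed
  \<comment> \<open>Fatou's lemma: the time of the \<open>c\<close>-th visit is unbounded, so no
    finite product equals the limit for all data.\<close>
  have "(\<integral>\<^sup>+X. liminf (\<lambda>n. \<Prod>i<n. g i X) \<partial>iid M) \<le> liminf (\<lambda>n. \<integral>\<^sup>+X. (\<Prod>i<n. g i X) \<partial>iid M)"
    using gm by (intro nn_integral_liminf) measurable
  also have "\<dots> \<le> 1"
  proof -
    have "liminf (\<lambda>n. \<integral>\<^sup>+X. (\<Prod>i<n. g i X) \<partial>iid M) \<le> liminf (\<lambda>n. 1 :: ennreal)"
      using prod_le by (intro Liminf_mono) auto
    thus ?thesis by (simp add: Liminf_const)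
  qed
  finally show ?thesis unfolding lim .
qed

text \<open>By the lower tail with weight \<open>1 / 2\<close>, having at most \<open>c\<close>
  visits among the first \<open>n\<close> points has a probability that decays geometrically in
  \<open>n\<close>.\<close>

lemma outer_le_few_visits:
  assumes D: "D \<in> sets M" and pos: "0 < measure M D"
  shows "outer_le (iid M) {X. card (visits X 0 D c) \<noteq> c} 0"
proof -
  let ?B = "\<lambda>n. {X. (1 / 2) powr real c \<le> (1 / 2) ^ card {i. i < Suc n \<and> 1 \<le> i \<and> X i \<in> D}}"
  have Zm: "Measurable.pred (iid M) (\<lambda>X. 1 \<le> i \<and> X i \<in> D)" for i
    using measurable_sets[OF measurable_iid_component D, of i]
    by (cases "1 \<le> i") (simp_all add: pred_def vimage_def Int_def conj_commute)
  have B: "?B n \<in> sets (iid M)" for n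
  proof -
    have "(\<lambda>X. card {i. i < Suc n \<and> 1 \<le> i \<and> X i \<in> D}) \<in> iid M \<rightarrow>\<^sub>M count_space UNIV"
    proof (rule measurable_card)
      fix i show "{X \<in> space (iid M). i \<in> {i. i < Suc n \<and> 1 \<le> i \<and> X i \<in> D}} \<in> sets (iid M)"
        using Zm[of i] by (cases "i < Suc n") (simp_all add: pred_def)
    qed
    from measurable_sets[OF this, of "{k. (1 / 2) powr real c \<le> (1 / 2 :: real) ^ k}"] show ?thesis by (simp add: vimage_def)
  qed
  have le: "measure (iid M) (?B n) \<le> exp (real c * ln 2) * exp (- (measure M D / 2)) ^ n" for n
  proof -
    have "measure (iid M) (?B n) \<le> exp ((1 / 2 - 1) * (\<Sum>i<Suc n. if i = 0 then 0 else measure M D) - real c * ln (1 / 2))"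
    proof (rule predictable_count_tail[OF Zm])
      fix i and X :: "nat \<Rightarrow> 'a" show "(1 / 2 - 1) * measure M {x. 1 \<le> i \<and> (X(i := x)) i \<in> D} \<le> (1 / 2 - 1) * (if i = 0 then 0 else measure M D)"
        by (cases "i = 0") auto
    qed auto
    also have "(\<Sum>i<Suc n. if i = 0 then 0 else measure M D) = real n * measure M D" by (subst sum.lessThan_Suc_shift) simp
    also have "exp ((1 / 2 - 1) * (real n * measure M D) - real c * ln (1 / 2)) = exp (real c * ln 2) * exp (- (measure M D / 2)) ^ n"
      by (simp add: ln_div exp_add[symmetric] exp_of_nat_mult[symmetric] algebra_simps)
    finally show ?thesis .
  qed
  let ?N = "\<Inter>n. ?B n"
  have Ns: "?N \<in> sets (iid M)" by (rule sets.countable_INT) (use B in auto)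
  have "(\<lambda>n. exp (real c * ln 2) * exp (- (measure M D / 2)) ^ n) \<longlonglongrightarrow> exp (real c * ln 2) * 0"
    using pos by (intro tendsto_mult tendsto_const LIMSEQ_realpow_zero) auto
  moreover have "measure (iid M) ?N \<le> exp (real c * ln 2) * exp (- (measure M D / 2)) ^ n" for n
  proof -
    have "measure (iid M) ?N \<le> measure (iid M) (?B n)" using B by (intro iid.finite_measure_mono) auto
    thus ?thesis using le[of n] by linarith
  qed
  ultimately have "measure (iid M) ?N \<le> 0"
    by (intro LIMSEQ_le_const[where X = "\<lambda>n. exp (real c * ln 2) * exp (- (measure M D / 2)) ^ n"]) auto
  moreover have "{X. card (visits X 0 D c) \<noteq> c} \<subseteq> ?N"
  proof
    fix X assume X: "X \<in> {X. card (visits X 0 D c) \<noteq> c}"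
    show "X \<in> ?N"
    proof
      fix n
      have "{i \<in> {0<..<Suc n}. X i \<in> D} = {i. i < Suc n \<and> 1 \<le> i \<and> X i \<in> D}" by auto
      hence "\<not> c \<le> card {i. i < Suc n \<and> 1 \<le> i \<and> X i \<in> D}" using card_visits_eq[of c 0 "Suc n" X D] X by auto
      thus "X \<in> ?B n" by (auto simp: powr_realpow[symmetric] intro!: powr_mono')
    qed
  qed
  ultimately show ?thesis unfolding outer_le_def using Ns by blast
qed

text \<open>Exponential Markov inequality for the weighted product over the visits, with weight
  \<open>a\<close> on \<open>E\<close> and \<open>b\<close> on the rest of \<open>D\<close>. The
  implication in the event also admits data with fewer than \<open>c\<close> visits, which form a
  null set.\<close>

lemma visit_deviation:
  fixes a b \<gamma> :: real
  assumes D: "D \<in> sets M" and E: "E \<in> sets M" and ED: "E \<subseteq> D" and pos: "0 < measure M D"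
    and ab: "0 < a" "0 < b" "a * measure M E + b * measure M (D - E) \<le> measure M D"
    and Q: "\<And>u v. u + v = c \<Longrightarrow> Q u \<Longrightarrow> \<gamma> * real c \<le> real u * ln a + real v * ln b"
  shows "outer_le (iid M) {X. card (visits X 0 D c) = c \<longrightarrow> Q (card {i \<in> visits X 0 D c. X i \<in> E})} (exp (- \<gamma> * real c))"
proof -
  define h where "h = (\<lambda>X. ennreal (a ^ card {i \<in> visits X 0 D c. X i \<in> E} * b ^ card {i \<in> visits X 0 D c. X i \<notin> E}))"
  have vm: "Measurable.pred (iid M) (\<lambda>X. i \<in> visits X 0 D c \<and> R (X i))" if "Measurable.pred M R" for R i
  proof -
    have s: "Measurable.pred (iid M) (\<lambda>X. X i' \<in> D)" for i'
      using measurable_sets[OF measurable_iid_component D, of i'] by (simp add: pred_def vimage_def Int_def conj_commute)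
    have "(\<lambda>X. card {i' \<in> {0<..i}. X i' \<in> D}) \<in> iid M \<rightarrow>\<^sub>M count_space UNIV"
    proof (rule measurable_card)
      fix i' show "{X \<in> space (iid M). i' \<in> {i' \<in> {0<..i}. X i' \<in> D}} \<in> sets (iid M)"
        using s[of i'] by (cases "i' \<in> {0<..i}") (auto simp: pred_def)
    qed
    hence le: "Measurable.pred (iid M) (\<lambda>X. card {i' \<in> {0<..i}. X i' \<in> D} \<le> c)" by measurable
    have R: "Measurable.pred (iid M) (\<lambda>X. R (X i))" by (rule measurable_compose[OF measurable_iid_component that])
    have "Measurable.pred (iid M) (\<lambda>X. 0 < i)" by (rule measurable_const) simp
    from pred_intros_logic(3)[OF pred_intros_logic(3)[OF this pred_intros_logic(3)[OF s le]] R]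
    show ?thesis unfolding visits_def mem_Collect_eq .
  qed
  have cm: "(\<lambda>X. card {i \<in> visits X 0 D c. R (X i)}) \<in> iid M \<rightarrow>\<^sub>M count_space UNIV" if "Measurable.pred M R" for R
  proof (rule measurable_card)
    show "{X \<in> space (iid M). i \<in> {i \<in> visits X 0 D c. R (X i)}} \<in> sets (iid M)" for i
      using vm[OF that, of i] unfolding pred_def by (simp only: mem_Collect_eq)
  qed
  have PE: "Measurable.pred M (\<lambda>x. x \<in> E)" "Measurable.pred M (\<lambda>x. x \<notin> E)" using E by simp_all
  have hm [measurable]: "h \<in> borel_measurable (iid M)" unfolding h_def using cm[OF PE(1)] cm[OF PE(2)] by measurable
  let ?B = "{X. ennreal (exp (\<gamma> * real c)) \<le> h X}"
  have B: "?B \<in> sets (iid M)" using measurable_sets[OF hm, of "{ennreal (exp (\<gamma> * real c))..}"] by (simp add: vimage_def)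
  have "ennreal (exp (\<gamma> * real c)) * emeasure (iid M) ?B = (\<integral>\<^sup>+X. ennreal (exp (\<gamma> * real c)) * indicator ?B X \<partial>iid M)"
    using B by (simp add: nn_integral_cmult_indicator)
  also have "\<dots> \<le> (\<integral>\<^sup>+X. h X \<partial>iid M)" by (intro nn_integral_mono) (auto simp: indicator_def)
  also have "\<dots> \<le> 1" unfolding h_def using ab by (intro nn_integral_visits_le_1[OF D E ED]) auto
  finally have "ennreal (exp (\<gamma> * real c) * measure (iid M) ?B) \<le> ennreal 1"
    by (simp add: iid.emeasure_eq_measure ennreal_mult)
  hence "exp (\<gamma> * real c) * measure (iid M) ?B \<le> 1" by (simp only: ennreal_le_iff zero_le_one)
  hence "measure (iid M) ?B \<le> exp (- \<gamma> * real c)" by (simp add: exp_minus field_simps)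
  hence "outer_le (iid M) ?B (exp (- \<gamma> * real c))" using B by (intro outer_leI)
  from iid.outer_le_Un[OF this outer_le_few_visits[OF D pos, of c]]
  show ?thesis
  proof (rule outer_le_mono)
    show "{X. card (visits X 0 D c) = c \<longrightarrow> Q (card {i \<in> visits X 0 D c. X i \<in> E})} \<subseteq> ?B \<union> {X. card (visits X 0 D c) \<noteq> c}"
    proof
      fix X assume X: "X \<in> {X. card (visits X 0 D c) = c \<longrightarrow> Q (card {i \<in> visits X 0 D c. X i \<in> E})}"
      show "X \<in> ?B \<union> {X. card (visits X 0 D c) \<noteq> c}"
      proof (cases "card (visits X 0 D c) = c")
        case True
        let ?u = "card {i \<in> visits X 0 D c. X i \<in> E}" and ?v = "card {i \<in> visits X 0 D c. X i \<notin> E}"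
        have "visits X 0 D c = {i \<in> visits X 0 D c. X i \<in> E} \<union> {i \<in> visits X 0 D c. X i \<notin> E}" by auto
        hence "card (visits X 0 D c) = card ({i \<in> visits X 0 D c. X i \<in> E} \<union> {i \<in> visits X 0 D c. X i \<notin> E})" by simp
        also have "\<dots> = ?u + ?v" by (rule card_Un_disjoint) auto
        finally have uv: "?u + ?v = c" using True by simp
        have "\<gamma> * real c \<le> real ?u * ln a + real ?v * ln b" using Q[OF uv] X True by simp
        hence "exp (\<gamma> * real c) \<le> exp (real ?u * ln a + real ?v * ln b)" by simp
        also have "\<dots> = a ^ ?u * b ^ ?v" using ab by (simp add: exp_add exp_of_nat_mult)
        finally show ?thesis unfolding h_def by (auto intro: ennreal_leI)
      qed simp
    qed
  qed simp
qed

end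

lemma measure_pair_le2:
  assumes "prob_space A" "prob_space B" "E \<in> sets (A \<Otimes>\<^sub>M B)"
    and le: "\<And>y. y \<in> space B \<Longrightarrow> measure A ((\<lambda>x. (x, y)) -` E) \<le> b"
  shows "measure (A \<Otimes>\<^sub>M B) E \<le> b"
proof -
  interpret A: prob_space A by fact
  interpret B: prob_space B by fact
  interpret AB: pair_prob_space A B ..
  obtain y where "y \<in> space B" using B.not_empty by blast
  hence b: "0 \<le> b" using le[of y] by (meson measure_nonneg order_trans)
  have "emeasure (A \<Otimes>\<^sub>M B) E = (\<integral>\<^sup>+y. emeasure A ((\<lambda>x. (x, y)) -` E) \<partial>B)"
    using assms(3) by (rule AB.emeasure_pair_measure_alt2)
  also have "\<dots> \<le> (\<integral>\<^sup>+y. ennreal b \<partial>B)"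
    using le by (intro nn_integral_mono) (simp add: A.emeasure_eq_measure ennreal_leI)
  also have "\<dots> = ennreal b" by (simp add: B.emeasure_space_1)
  finally show ?thesis using b by (simp add: AB.emeasure_eq_measure)
qed

text \<open>The rate 1/100 is below the relative entropies of 7/12 with respect to 1/2 and 2/3, up to the
  choice of the weights in \<open>visit_deviation\<close>.\<close>

lemma select_rate_upper:
  fixes c u v :: nat
  assumes "u + v = c" "7 / 12 * real c \<le> real u"
  shows "1 / 100 * real c \<le> real u * ln (7 / 6) + real v * ln (5 / 6)"
proof -
  have "7 * ln (7 / 6 :: real) + 5 * ln (5 / 6) = ln ((7 / 6) ^ 7 * (5 / 6) ^ 5)"
    by (simp add: ln_mult ln_realpow)
  \<comment> \<open>The denominator is \<open>6 ^ 12\<close>, and \<open>7 ^ 7 * 5 ^ 5\<close>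
    exceeds it by the stated numerator. The exponents 7 and 5 come from the threshold
    \<open>7 / 12\<close>.\<close>
  also have "(7 / 6 :: real) ^ 7 * (5 / 6) ^ 5 = 1 + 396789539 / 2176782336" by (simp add: power_divide)
  also have "ln (1 + 396789539 / 2176782336 :: real) \<ge> 12 / 100"
    using ln_one_plus_pos_lower_bound[of "396789539 / 2176782336 :: real"] by (simp add: power2_eq_square)
  finally have k: "12 / 100 \<le> 7 * ln (7 / 6 :: real) + 5 * ln (5 / 6)" .
  have d: "0 \<le> ln (7 / 6 :: real) - ln (5 / 6)" by simp
  have v: "real v = real c - real u" using assms(1) by simp
  have "1 / 100 * real c \<le> real c / 12 * (7 * ln (7 / 6) + 5 * ln (5 / 6))"
    using mult_left_mono[OF k, of "real c / 12"] by simp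
  also have "\<dots> = 7 / 12 * real c * (ln (7 / 6) - ln (5 / 6)) + real c * ln (5 / 6)" by (simp add: algebra_simps)
  also have "\<dots> \<le> real u * (ln (7 / 6) - ln (5 / 6)) + real c * ln (5 / 6)"
    using assms(2) d by (intro add_right_mono mult_right_mono)
  also have "\<dots> = real u * ln (7 / 6) + real v * ln (5 / 6)" unfolding v by (simp add: algebra_simps)
  finally show ?thesis .
qed

lemma select_rate_lower:
  fixes c u v :: nat
  assumes "u + v = c" "real u \<le> 7 / 12 * real c"
  shows "1 / 100 * real c \<le> real u * ln (7 / 8) + real v * ln (5 / 4)"
proof -
  have "7 * ln (7 / 8 :: real) + 5 * ln (5 / 4) = ln ((7 / 8) ^ 7 * (5 / 4) ^ 5)"
    by (simp add: ln_mult ln_realpow)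
  also have "(7 / 8 :: real) ^ 7 * (5 / 4) ^ 5 = 1 + 426088227 / 2147483648" by (simp add: power_divide)
  also have "ln (1 + 426088227 / 2147483648 :: real) \<ge> 12 / 100"
    using ln_one_plus_pos_lower_bound[of "426088227 / 2147483648 :: real"] by (simp add: power2_eq_square)
  finally have k: "12 / 100 \<le> 7 * ln (7 / 8 :: real) + 5 * ln (5 / 4)" .
  have d: "ln (7 / 8 :: real) - ln (5 / 4) \<le> 0" by simp
  have v: "real v = real c - real u" using assms(1) by simp
  have "1 / 100 * real c \<le> real c / 12 * (7 * ln (7 / 8) + 5 * ln (5 / 4))"
    using mult_left_mono[OF k, of "real c / 12"] by simp
  also have "\<dots> = 7 / 12 * real c * (ln (7 / 8) - ln (5 / 4)) + real c * ln (5 / 4)" by (simp add: algebra_simps)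
  also have "\<dots> \<le> real u * (ln (7 / 8) - ln (5 / 4)) + real c * ln (5 / 4)"
    using assms(2) d by (intro add_right_mono mult_right_mono_neg)
  also have "\<dots> = real u * ln (7 / 8) + real v * ln (5 / 4)" unfolding v by (simp add: algebra_simps)
  finally show ?thesis .
qed

lemma select_size_ge:
  assumes "1 \<le> j" "j < N"
  shows "real b / (real N ^ 2 * ln (exp 1 * real N)) - 1 \<le> real (select_size b N j)"
proof -
  let ?L = "ln (exp 1 * real N)"
  have L: "1 \<le> ?L" using assms by (simp add: ln_mult)
  have "real j * real (N - j) \<le> real N * real N" using assms by (intro mult_mono) auto
  hence "real j * real (N - j) * ?L \<le> real N ^ 2 * ?L" using L by (intro mult_right_mono) (auto simp: power2_eq_square)
  moreover have "0 < real j * real (N - j) * ?L"   proof -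
    have "0 < real j" "0 < real (N - j)" "0 < ?L" using assms L by (simp, simp, linarith)
    thus ?thesis by (intro mult_pos_pos)
  qed
  ultimately have "real b / (real N ^ 2 * ?L) \<le> real b / (real j * real (N - j) * ?L)"
    by (intro frac_le[OF of_nat_0_le_iff order_refl])
  moreover have "y - 1 \<le> real (nat \<lfloor>y\<rfloor>)" for y :: real by linarith
  ultimately show ?thesis unfolding select_size_def by (meson diff_right_mono order_trans)
qed

lemma (in full_prob_space) outer_le_no_visits:
  assumes D: "D \<in> sets M" and z: "measure M D = 0"
  shows "outer_le (iid M) {X. visits X 0 D c \<noteq> {}} 0"
proof -
  have "outer_le (iid M) {X. X i \<in> D} 0" for i
  proof (rule outer_leI)
    have s: "(\<lambda>X. X i) -` D \<inter> space (iid M) \<in> sets (iid M)" by (rule measurable_sets[OF measurable_iid_component D])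
    thus S: "{X. X i \<in> D} \<in> sets (iid M)" by (simp add: vimage_def)
    have "emeasure (iid M) {X. X i \<in> D} = (\<integral>\<^sup>+X. indicator D (X i) \<partial>iid M)"
      unfolding nn_integral_indicator[OF S, symmetric] by (intro nn_integral_cong) (simp add: indicator_def)
    also have "\<dots> = emeasure M D" using D by (subst nn_integral_iid_component) simp_all
    finally show "measure (iid M) {X. X i \<in> D} \<le> 0" using z by (simp add: measure_def)
  qed
  hence "outer_le (iid M) (\<Union>i. {X. X i \<in> D}) 0" by (rule iid.outer_le_UN[where b = "\<lambda>_. 0"]) simp
  thus ?thesis by (rule outer_le_mono) (auto simp: visits_def)
qed

section \<open>Tests between two classifiers\<close>

context realizable
begin

text \<open>Labels are binary: where \<open>g\<close> and \<open>h\<close> disagree exactly one of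
  them errs, and elsewhere they err together. Hence the difference of the errors is decided on the
  region of disagreement.\<close>

lemma err_split:
  assumes g: "Measurable.pred P g" and h: "Measurable.pred P h"
  shows "err P f h - err P f g = measure P {x. g x \<noteq> h x \<and> h x \<noteq> f x} - measure P ({x. g x \<noteq> h x} - {x. g x \<noteq> h x \<and> h x \<noteq> f x})"
    and "measure P {x. g x \<noteq> h x} = measure P {x. g x \<noteq> h x \<and> h x \<noteq> f x} + measure P ({x. g x \<noteq> h x} - {x. g x \<noteq> h x \<and> h x \<noteq> f x})"
    and "{x. g x \<noteq> h x} \<in> sets P" "{x. g x \<noteq> h x \<and> h x \<noteq> f x} \<in> sets P"
    and "0 \<le> err P f g"
proof -
  have s: "{x. Q (g x) (h x) (f x)} \<in> sets P" for Q
  proof -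
    have "Measurable.pred P (\<lambda>x. Q (g x) (h x) (f x))" using g h measurable_f by measurable
    thus ?thesis by (simp add: pred_def)
  qed
  show D: "{x. g x \<noteq> h x} \<in> sets P" by (rule s[of "\<lambda>a b c. a \<noteq> b"])
  show E: "{x. g x \<noteq> h x \<and> h x \<noteq> f x} \<in> sets P" by (rule s[of "\<lambda>a b c. a \<noteq> b \<and> b \<noteq> c"])
  have B: "{x. g x = h x \<and> h x \<noteq> f x} \<in> sets P" by (rule s[of "\<lambda>a b c. a = b \<and> b \<noteq> c"])
  have F: "{x. g x \<noteq> h x} - {x. g x \<noteq> h x \<and> h x \<noteq> f x} \<in> sets P" using D E by (rule sets.Diff)
  have "err P f h = measure P ({x. g x \<noteq> h x \<and> h x \<noteq> f x} \<union> {x. g x = h x \<and> h x \<noteq> f x})"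
    unfolding err_def by (rule arg_cong[where f = "measure P"]) auto
  also have "\<dots> = measure P {x. g x \<noteq> h x \<and> h x \<noteq> f x} + measure P {x. g x = h x \<and> h x \<noteq> f x}"
    using E B by (rule finite_measure_Union) auto
  finally have 1: "err P f h = measure P {x. g x \<noteq> h x \<and> h x \<noteq> f x} + measure P {x. g x = h x \<and> h x \<noteq> f x}" .
  have "err P f g = measure P (({x. g x \<noteq> h x} - {x. g x \<noteq> h x \<and> h x \<noteq> f x}) \<union> {x. g x = h x \<and> h x \<noteq> f x})"
    unfolding err_def by (rule arg_cong[where f = "measure P"]) auto
  also have "\<dots> = measure P ({x. g x \<noteq> h x} - {x. g x \<noteq> h x \<and> h x \<noteq> f x}) + measure P {x. g x = h x \<and> h x \<noteq> f x}"
    using F B by (rule finite_measure_Union) auto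
  finally show "err P f h - err P f g = measure P {x. g x \<noteq> h x \<and> h x \<noteq> f x} - measure P ({x. g x \<noteq> h x} - {x. g x \<noteq> h x \<and> h x \<noteq> f x})"
    using 1 by simp
  have "{x. g x \<noteq> h x \<and> h x \<noteq> f x} \<subseteq> {x. g x \<noteq> h x}" by auto
  from finite_measure_Diff[OF D E this]
  show "measure P {x. g x \<noteq> h x} = measure P {x. g x \<noteq> h x \<and> h x \<noteq> f x} + measure P ({x. g x \<noteq> h x} - {x. g x \<noteq> h x \<and> h x \<noteq> f x})" by simp
  show "0 \<le> err P f g" by (simp add: err_def)
qed

text \<open>If \<open>h\<close> is not worse than \<open>g\<close>, it errs on at most half of their
  disagreement. When the disagreement has probability 0, almost surely no point is tested and the
  empirical error is 0 by default.\<close>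

lemma emp_err_not_large:
  assumes g: "Measurable.pred P g" and h: "Measurable.pred P h" and le: "err P f h \<le> err P f g"
  shows "outer_le (iid P) {X. \<not> emp_err (map (\<lambda>i. (X i, f (X i))) (first_indices X 0 {x. g x \<noteq> h x} c)) h \<le> 7 / 12} (exp (- (1 / 100) * real c))"
proof -
  let ?D = "{x. g x \<noteq> h x}" and ?E = "{x. g x \<noteq> h x \<and> h x \<noteq> f x}"
  note es = err_split[OF g h]
  have vE: "{i \<in> visits X 0 ?D c. h (X i) \<noteq> f (X i)} = {i \<in> visits X 0 ?D c. X i \<in> ?E}" for X by (auto simp: visits_def)
  show ?thesis
  proof (cases "measure P ?D = 0")
    case True
    show ?thesis
    proof (rule outer_le_mono[OF outer_le_no_visits[OF es(3) True, of c]])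
      show "{X. \<not> emp_err (map (\<lambda>i. (X i, f (X i))) (first_indices X 0 ?D c)) h \<le> 7 / 12} \<subseteq> {X. visits X 0 ?D c \<noteq> {}}"
        unfolding emp_err_visits by auto
    qed simp
  next
    case False
    hence pos: "0 < measure P ?D" by (simp add: zero_less_measure_iff)
    \<comment> \<open>The weights \<open>7 / 6\<close> and \<open>5 / 6\<close> are the likelihood
      ratios of a coin of bias \<open>7 / 12\<close> to a fair one, where half is the largest error
      rate possible here.\<close>
    have "outer_le (iid P) {X. card (visits X 0 ?D c) = c \<longrightarrow> 7 / 12 * real c \<le> real (card {i \<in> visits X 0 ?D c. X i \<in> ?E})} (exp (- (1 / 100) * real c))"
    proof (rule visit_deviation[where a = "7 / 6" and b = "5 / 6", OF es(3,4) _ pos])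
      show "7 / 6 * measure P ?E + 5 / 6 * measure P (?D - ?E) \<le> measure P ?D" using es(1,2) le by linarith
    qed (auto intro: select_rate_upper[simplified])
    thus ?thesis
    proof (rule outer_le_mono)
      show "{X. \<not> emp_err (map (\<lambda>i. (X i, f (X i))) (first_indices X 0 ?D c)) h \<le> 7 / 12}
        \<subseteq> {X. card (visits X 0 ?D c) = c \<longrightarrow> 7 / 12 * real c \<le> real (card {i \<in> visits X 0 ?D c. X i \<in> ?E})}"
      proof
        fix X assume "X \<in> {X. \<not> emp_err (map (\<lambda>i. (X i, f (X i))) (first_indices X 0 ?D c)) h \<le> 7 / 12}"
        hence ne: "visits X 0 ?D c \<noteq> {}" and gt: "7 / 12 < real (card {i \<in> visits X 0 ?D c. X i \<in> ?E}) / real (card (visits X 0 ?D c))"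
          unfolding emp_err_visits vE by (auto split: if_splits)
        have "0 < card (visits X 0 ?D c)" using ne by (simp add: card_gt_0_iff)
        thus "X \<in> {X. card (visits X 0 ?D c) = c \<longrightarrow> 7 / 12 * real c \<le> real (card {i \<in> visits X 0 ?D c. X i \<in> ?E})}"
          using gt by (simp add: pos_less_divide_eq)
      qed
    qed simp
  qed
qed

text \<open>The error of \<open>h\<close> exceeds that of \<open>g\<close> by more than the error of
  \<open>g\<close>, hence by more than the part of the disagreement where \<open>g\<close> errs. So
  \<open>h\<close> errs on more than two thirds of the disagreement.\<close>

lemma emp_err_not_small:
  assumes g: "Measurable.pred P g" and h: "Measurable.pred P h" and le: "2 * err P f g < err P f h"
  shows "outer_le (iid P) {X. emp_err (map (\<lambda>i. (X i, f (X i))) (first_indices X 0 {x. g x \<noteq> h x} c)) h \<le> 7 / 12} (exp (- (1 / 100) * real c))"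
proof -
  let ?D = "{x. g x \<noteq> h x}" and ?E = "{x. g x \<noteq> h x \<and> h x \<noteq> f x}"
  note es = err_split[OF g h]
  have vE: "{i \<in> visits X 0 ?D c. h (X i) \<noteq> f (X i)} = {i \<in> visits X 0 ?D c. X i \<in> ?E}" for X by (auto simp: visits_def)
  have gF: "measure P (?D - ?E) \<le> err P f g"
  proof -
    have s: "{x. g x \<noteq> f x} \<in> sets P"
    proof -
      have "Measurable.pred P (\<lambda>x. g x \<noteq> f x)" using g measurable_f by measurable
      thus ?thesis by (simp add: pred_def)
    qed
    show ?thesis unfolding err_def using s by (intro finite_measure_mono) auto
  qed
  have pos: "0 < measure P ?D" using es(1,2,5) le measure_nonneg[of P "?D - ?E"] by linarith
  \<comment> \<open>The weights \<open>7 / 8\<close> and \<open>5 / 4\<close> are the likelihood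
    ratios of a coin of bias \<open>7 / 12\<close> to one of bias \<open>2 / 3\<close>.\<close>
  have "outer_le (iid P) {X. card (visits X 0 ?D c) = c \<longrightarrow> real (card {i \<in> visits X 0 ?D c. X i \<in> ?E}) \<le> 7 / 12 * real c} (exp (- (1 / 100) * real c))"
  proof (rule visit_deviation[where a = "7 / 8" and b = "5 / 4", OF es(3,4) _ pos])
    show "7 / 8 * measure P ?E + 5 / 4 * measure P (?D - ?E) \<le> measure P ?D" using es(1,2) le gF by linarith
  qed (auto intro: select_rate_lower[simplified])
  thus ?thesis
  proof (rule outer_le_mono)
    show "{X. emp_err (map (\<lambda>i. (X i, f (X i))) (first_indices X 0 ?D c)) h \<le> 7 / 12}
      \<subseteq> {X. card (visits X 0 ?D c) = c \<longrightarrow> real (card {i \<in> visits X 0 ?D c. X i \<in> ?E}) \<le> 7 / 12 * real c}"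
    proof
      fix X assume X: "X \<in> {X. emp_err (map (\<lambda>i. (X i, f (X i))) (first_indices X 0 ?D c)) h \<le> 7 / 12}"
      show "X \<in> {X. card (visits X 0 ?D c) = c \<longrightarrow> real (card {i \<in> visits X 0 ?D c. X i \<in> ?E}) \<le> 7 / 12 * real c}"
      proof (cases "visits X 0 ?D c = {}")
        case False
        hence "0 < card (visits X 0 ?D c)" by (simp add: card_gt_0_iff)
        moreover have "real (card {i \<in> visits X 0 ?D c. X i \<in> ?E}) / real (card (visits X 0 ?D c)) \<le> 7 / 12"
          using X False unfolding emp_err_visits vE by simp
        ultimately show ?thesis by (simp add: pos_divide_le_eq)
      next
        \<comment> \<open>A test without points is passed by default; such data belong to the event
          because the count of errors is then 0.\<close>
        case True
        hence e: "{i \<in> visits X 0 ?D c. X i \<in> ?E} = {}" by blast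
        have "real (card {i \<in> visits X 0 ?D c. X i \<in> ?E}) \<le> 7 / 12 * real c" unfolding e by simp
        thus ?thesis by blast
      qed
    qed
  qed simp
qed

end

context learner
begin

lemma chosen_index_in:
  assumes "1 \<le> N" shows "chosen_index N b X m0 h \<in> {1..N}"
    "j \<in> {1..<chosen_index N b X m0 h} \<Longrightarrow>
      emp_err (map (\<lambda>i. (X i, f (X i))) (first_indices X m0 {x. h j x \<noteq> h (chosen_index N b X m0 h) x} (select_size b N j))) (h (chosen_index N b X m0 h)) \<le> 7 / 12"
proof -
  let ?S = "{k \<in> {1..N}. \<forall>j\<in>{1..<k}.
     emp_err (map (\<lambda>i. (X i, f (X i))) (first_indices X m0 {x. h j x \<noteq> h k x} (select_size b N j))) (h k) \<le> 7 / 12}"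
  have "1 \<in> ?S" using assms by simp
  hence "Max ?S \<in> ?S" by (intro Max_in) auto
  hence "chosen_index N b X m0 h \<in> ?S" unfolding chosen_index_def .
  thus "chosen_index N b X m0 h \<in> {1..N}" "j \<in> {1..<chosen_index N b X m0 h} \<Longrightarrow>
      emp_err (map (\<lambda>i. (X i, f (X i))) (first_indices X m0 {x. h j x \<noteq> h (chosen_index N b X m0 h) x} (select_size b N j))) (h (chosen_index N b X m0 h)) \<le> 7 / 12"
    by blast+
qed

text \<open>If the chosen index is below the best one \<open>\<kappa>\<close>, then
  \<open>\<kappa>\<close> failed a test against a classifier that is not better; if it is above and
  its error is more than twice the optimum, it passed a test against \<open>\<kappa>\<close>. Both
  are unlikely.\<close>

lemma chosen_index_outer_le:
  assumes h: "\<And>j. j \<in> {1..N} \<Longrightarrow> Measurable.pred P (h j)"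
    and \<kappa>: "\<kappa> \<in> {1..N}" "\<And>j. j \<in> {1..N} \<Longrightarrow> err P f (h \<kappa>) \<le> err P f (h j)"
  shows "outer_le (iid P) {X'. 2 * err P f (h \<kappa>) < err P f (h (chosen_index N b (restart m0 X X') m0 h))}
    (real N * exp (- (1 / 100) * (real b / (real N ^ 2 * ln (exp 1 * real N)) - 1)))"
proof -
  have N: "1 \<le> N" using \<kappa>(1) by auto
  let ?\<eta> = "exp (- (1 / 100) * (real b / (real N ^ 2 * ln (exp 1 * real N)) - 1))"
  let ?q = "\<lambda>X' j k. emp_err (map (\<lambda>i. (X' i, f (X' i))) (first_indices X' 0 {x. h j x \<noteq> h k x} (select_size b N j))) (h k)"
  \<comment> \<open>Only tests involving \<open>\<kappa>\<close> matter, one for each index, so the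
    union has \<open>N\<close> terms rather than one per pair.\<close>
  define E where "E = (\<lambda>j. if j = N then {} else if j < \<kappa> then {X'. \<not> ?q X' j \<kappa> \<le> 7 / 12} else {})"
  define G where "G = (\<lambda>k. if \<kappa> < k \<and> 2 * err P f (h \<kappa>) < err P f (h k) then {X'. ?q X' \<kappa> k \<le> 7 / 12} else {})"
  have rate: "exp (- (1 / 100) * real (select_size b N j)) \<le> ?\<eta>" if "1 \<le> j" "j < N" for j
    unfolding exp_le_cancel_iff by (rule mult_left_mono_neg[OF select_size_ge[OF that]]) simp
  have E: "outer_le (iid P) (if j < \<kappa> then E j else G j) ?\<eta>" if j: "j \<in> {1..N}" for j
  proof (cases "j < \<kappa>")
    case True
    have "outer_le (iid P) {X'. \<not> ?q X' j \<kappa> \<le> 7 / 12} (exp (- (1 / 100) * real (select_size b N j)))"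
      by (rule emp_err_not_large[OF h[OF j] h[OF \<kappa>(1)] \<kappa>(2)[OF j]])
    hence "outer_le (iid P) {X'. \<not> ?q X' j \<kappa> \<le> 7 / 12} ?\<eta>"
      by (rule outer_le_mono) (use rate[of j] j True \<kappa>(1) in auto)
    thus ?thesis using True \<kappa>(1) unfolding E_def by simp
  next
    case False
    show ?thesis
    proof (cases "\<kappa> < j \<and> 2 * err P f (h \<kappa>) < err P f (h j)")
      case True
      have "outer_le (iid P) {X'. ?q X' \<kappa> j \<le> 7 / 12} (exp (- (1 / 100) * real (select_size b N \<kappa>)))"
        by (rule emp_err_not_small[OF h[OF \<kappa>(1)] h[OF j]]) (use True in simp)
      hence "outer_le (iid P) {X'. ?q X' \<kappa> j \<le> 7 / 12} ?\<eta>"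
        by (rule outer_le_mono) (use rate[of \<kappa>] j True \<kappa>(1) in auto)
      thus ?thesis using False True unfolding G_def by simp
    next
      case F2: False
      have "outer_le (iid P) {} ?\<eta>" by (rule outer_le_mono[OF outer_le_empty]) auto
      moreover have "(if j < \<kappa> then E j else G j) = {}" unfolding G_def if_not_P[OF False] if_not_P[OF F2] ..
      ultimately show ?thesis by (simp only:)
    qed
  qed
  have "outer_le (iid P) (\<Union>j\<in>{1..N}. if j < \<kappa> then E j else G j) (\<Sum>j\<in>{1..N}. ?\<eta>)"
    by (rule iid.outer_le_UN_finite[OF _ E]) simp_all
  hence U: "outer_le (iid P) (\<Union>j\<in>{1..N}. if j < \<kappa> then E j else G j) (real N * ?\<eta>)" by simp
  show ?thesis
  proof (rule outer_le_mono[OF U])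
    show "{X'. 2 * err P f (h \<kappa>) < err P f (h (chosen_index N b (restart m0 X X') m0 h))} \<subseteq> (\<Union>j\<in>{1..N}. if j < \<kappa> then E j else G j)"
    proof
      fix X' assume "X' \<in> {X'. 2 * err P f (h \<kappa>) < err P f (h (chosen_index N b (restart m0 X X') m0 h))}"
      define kk where "kk = chosen_index N b (restart m0 X X') m0 h"
      have big: "2 * err P f (h \<kappa>) < err P f (h kk)" using \<open>X' \<in> _\<close> by (simp add: kk_def)
      have kk: "kk \<in> {1..N}" "\<And>j. j \<in> {1..<kk} \<Longrightarrow> ?q X' j kk \<le> 7 / 12"
        using chosen_index_in[OF N, where b = b and X = "restart m0 X X'" and ?m0.0 = m0 and h = h] unfolding kk_def emp_err_restart by blast+
      have "err P f (h \<kappa>) \<ge> 0" by (simp add: err_def)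
      hence ne: "kk \<noteq> \<kappa>" using big by auto
      show "X' \<in> (\<Union>j\<in>{1..N}. if j < \<kappa> then E j else G j)"
      proof (cases "kk < \<kappa>")
        case True
        let ?S = "{k \<in> {1..N}. \<forall>j\<in>{1..<k}. ?q X' j k \<le> 7 / 12}"
        have kkm: "kk = Max ?S" unfolding kk_def chosen_index_def emp_err_restart ..
        have fin: "finite ?S" by (rule finite_subset[of _ "{1..N}"]) auto
        have "\<kappa> \<notin> ?S"
        proof
          assume "\<kappa> \<in> ?S"
          from leD[OF Max_ge[OF fin this]] show False using True unfolding kkm by contradiction
        qed
        then obtain j where j: "j \<in> {1..<\<kappa>}" "\<not> ?q X' j \<kappa> \<le> 7 / 12" using \<kappa>(1) by blast
        thus ?thesis using \<kappa>(1) by (intro UN_I[of j]) (auto simp: E_def)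
      next
        case False
        hence "\<kappa> < kk" using ne by simp
        thus ?thesis using kk(2)[of \<kappa>] \<kappa>(1) big kk(1) by (intro UN_I[of kk]) (auto simp: G_def)
      qed
    qed
  qed simp
qed

end

subsection \<open>Measurability of the output\<close>

context learner
begin

context
  fixes N :: "'w measure" and X :: "'w \<Rightarrow> nat \<Rightarrow> 'a" and h :: "nat \<Rightarrow> 'w \<Rightarrow> 'a \<Rightarrow> bool"
  assumes X: "X \<in> N \<rightarrow>\<^sub>M iid P" and h: "\<And>k. Measurable.pred (N \<Otimes>\<^sub>M P) (\<lambda>z. h k (fst z) (snd z))"
begin

lemma pred_hyp_point: "Measurable.pred N (\<lambda>\<omega>. h k \<omega> (X \<omega> i))"
proof -
  have "(\<lambda>\<omega>. (\<omega>, X \<omega> i)) \<in> N \<rightarrow>\<^sub>M N \<Otimes>\<^sub>M P"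
    by (intro measurable_Pair measurable_ident_sets refl measurable_compose[OF X measurable_iid_component])
  from measurable_compose[OF this h[of k]] show ?thesis by simp
qed

lemma pred_hyp_fixed: "\<omega> \<in> space N \<Longrightarrow> Measurable.pred P (h k \<omega>)"
  using measurable_compose[OF measurable_Pair1' h[of k]] by simp

lemma measurable_hyp_err: "(\<lambda>\<omega>. err P f (h k \<omega>)) \<in> borel_measurable N"
proof -
  have "Measurable.pred (N \<Otimes>\<^sub>M P) (\<lambda>z. f (snd z))" by (rule measurable_compose[OF measurable_snd measurable_f])
  hence "Measurable.pred (N \<Otimes>\<^sub>M P) (\<lambda>z. h k (fst z) (snd z) \<noteq> f (snd z))"
    by (intro pred_intros_logic(2) pred_intros_logic(6) h)
  hence S: "{z \<in> space (N \<Otimes>\<^sub>M P). h k (fst z) (snd z) \<noteq> f (snd z)} \<in> sets (N \<Otimes>\<^sub>M P)" (is "?S \<in> _") by (simp add: pred_def)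
  have "(\<lambda>\<omega>. measure P (Pair \<omega> -` ?S)) \<in> borel_measurable N"
    using measurable_emeasure_Pair[OF S] unfolding measure_def by measurable
  moreover have "measure P (Pair \<omega> -` ?S) = err P f (h k \<omega>)" if "\<omega> \<in> space N" for \<omega>
    using that by (simp add: err_def space_pair_measure)
  ultimately show ?thesis by (subst (asm) measurable_cong) assumption+
qed

lemma pred_visits: "Measurable.pred N (\<lambda>\<omega>. i \<in> visits (X \<omega>) m0 {x. h j \<omega> x \<noteq> h k \<omega> x} c)"
proof -
  have s: "Measurable.pred N (\<lambda>\<omega>. X \<omega> i' \<in> {x. h j \<omega> x \<noteq> h k \<omega> x})" for i'
    unfolding mem_Collect_eq by (intro pred_intros_logic(2) pred_intros_logic(6) pred_hyp_point)
  have "(\<lambda>\<omega>. card {i' \<in> {m0<..i}. X \<omega> i' \<in> {x. h j \<omega> x \<noteq> h k \<omega> x}}) \<in> N \<rightarrow>\<^sub>M count_space UNIV"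
  proof (rule measurable_card)
    fix i'
    show "{\<omega> \<in> space N. i' \<in> {i' \<in> {m0<..i}. X \<omega> i' \<in> {x. h j \<omega> x \<noteq> h k \<omega> x}}} \<in> sets N"
      using s[of i'] by (cases "i' \<in> {m0<..i}") (auto simp: pred_def)
  qed
  hence le: "Measurable.pred N (\<lambda>\<omega>. card {i' \<in> {m0<..i}. X \<omega> i' \<in> {x. h j \<omega> x \<noteq> h k \<omega> x}} \<le> c)" by measurable
  have "Measurable.pred N (\<lambda>\<omega>. m0 < i)" by (rule measurable_const) simp
  from pred_intros_logic(3)[OF this pred_intros_logic(3)[OF s[of i] le]]
  show ?thesis unfolding visits_def[of _ m0] mem_Collect_eq[of i] .
qed

lemma pred_emp_err: "Measurable.pred N (\<lambda>\<omega>. emp_err (map (\<lambda>i. (X \<omega> i, f (X \<omega> i)))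
    (first_indices (X \<omega>) m0 {x. h j \<omega> x \<noteq> h k \<omega> x} c)) (h k \<omega>) \<le> 7 / 12)"
proof -
  let ?V = "\<lambda>\<omega>. visits (X \<omega>) m0 {x. h j \<omega> x \<noteq> h k \<omega> x} c"
  let ?U = "\<lambda>\<omega>. {i \<in> ?V \<omega>. h k \<omega> (X \<omega> i) \<noteq> f (X \<omega> i)}"
  have V: "(\<lambda>\<omega>. card (?V \<omega>)) \<in> N \<rightarrow>\<^sub>M count_space UNIV"
    by (rule measurable_card) (use pred_visits in \<open>simp add: pred_def\<close>)
  have fX: "Measurable.pred N (\<lambda>\<omega>. f (X \<omega> i))" for i by (rule measurable_compose[OF X measurable_f_component])
  have p: "Measurable.pred N (\<lambda>\<omega>. i \<in> ?V \<omega> \<and> h k \<omega> (X \<omega> i) \<noteq> f (X \<omega> i))" for i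
    by (intro pred_intros_logic(3) pred_visits pred_intros_logic(2) pred_intros_logic(6) pred_hyp_point fX)
  have U: "(\<lambda>\<omega>. card (?U \<omega>)) \<in> N \<rightarrow>\<^sub>M count_space UNIV"
  proof (rule measurable_card)
    show "{\<omega> \<in> space N. i \<in> ?U \<omega>} \<in> sets N" for i using p[of i] unfolding pred_def mem_Collect_eq[of i] .
  qed
  have e: "emp_err (map (\<lambda>i. (X \<omega> i, f (X \<omega> i))) (first_indices (X \<omega>) m0 {x. h j \<omega> x \<noteq> h k \<omega> x} c)) (h k \<omega>)
    = (if card (?V \<omega>) = 0 then 0 else real (card (?U \<omega>)) / real (card (?V \<omega>)))" for \<omega>
    unfolding emp_err_visits by simp
  define cv cu where "cv = (\<lambda>\<omega>. card (?V \<omega>))" and "cu = (\<lambda>\<omega>. card (?U \<omega>))"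
  have [measurable]: "cv \<in> N \<rightarrow>\<^sub>M count_space UNIV" "cu \<in> N \<rightarrow>\<^sub>M count_space UNIV" using V U by (simp_all add: cv_def cu_def)
  have "Measurable.pred N (\<lambda>\<omega>. (if cv \<omega> = 0 then 0 else real (cu \<omega>) / real (cv \<omega>)) \<le> 7 / 12)" by measurable
  thus ?thesis unfolding e cv_def cu_def .
qed

text \<open>The maximum is \<open>k\<close> exactly if \<open>k\<close> passes and no larger index
  does. Index 1 always passes, so the set is never empty.\<close>

lemma measurable_chosen_index:
  assumes n1: "1 \<le> n"
  shows "(\<lambda>\<omega>. chosen_index n b (X \<omega>) m0 (\<lambda>k. h k \<omega>)) \<in> N \<rightarrow>\<^sub>M count_space UNIV"
proof -
  define ok where "ok = (\<lambda>k \<omega>. \<forall>j\<in>{1..<k}. emp_err (map (\<lambda>i. (X \<omega> i, f (X \<omega> i)))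
    (first_indices (X \<omega>) m0 {x. h j \<omega> x \<noteq> h k \<omega> x} (select_size b n j))) (h k \<omega>) \<le> 7 / 12)"
  have okm: "Measurable.pred N (ok k)" for k
    unfolding ok_def by (rule pred_intros_finite(3)[OF finite_atLeastLessThan pred_emp_err])
  have ch: "chosen_index n b (X \<omega>) m0 (\<lambda>k. h k \<omega>) = Max {k \<in> {1..n}. ok k \<omega>}" for \<omega>
    unfolding chosen_index_def ok_def ..
  have iff: "Max {k \<in> {1..n}. ok k \<omega>} = k \<longleftrightarrow> k \<in> {1..n} \<and> ok k \<omega> \<and> (\<forall>k'\<in>{k<..n}. \<not> ok k' \<omega>)" for k \<omega>
  proof -
    have "1 \<in> {k \<in> {1..n}. ok k \<omega>}" using n1 by (simp add: ok_def)
    hence ne: "{k \<in> {1..n}. ok k \<omega>} \<noteq> {}" by blast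
    have "finite {k \<in> {1..n}. ok k \<omega>}" by (rule finite_subset[of _ "{1..n}"]) auto
    note M = Max_eq_iff[OF this ne]
    show ?thesis unfolding M
    proof (intro iffI conjI ballI notI; (elim conjE)?)
      show "False" if "k \<in> {k \<in> {1..n}. ok k \<omega>}" "\<forall>a\<in>{k \<in> {1..n}. ok k \<omega>}. a \<le> k" "k' \<in> {k<..n}" "ok k' \<omega>" for k'
        using that(1,3,4) bspec[OF that(2), of k'] by auto
      show "a \<le> k" if "k \<in> {1..n}" "ok k \<omega>" "\<forall>k'\<in>{k<..n}. \<not> ok k' \<omega>" "a \<in> {k \<in> {1..n}. ok k \<omega>}" for a
        using that(4) bspec[OF that(3), of a] by (cases "a \<le> k") auto
    qed auto
  qed
  show ?thesis unfolding ch
  proof (subst measurable_count_space_eq2_countable, intro conjI ballI)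
    fix k
    have "Measurable.pred N (\<lambda>\<omega>. k \<in> {1..n} \<and> (ok k \<omega> \<and> (\<forall>k'\<in>{k<..n}. \<not> ok k' \<omega>)))"
    proof (intro pred_intros_logic(3) okm)
      show "Measurable.pred N (\<lambda>\<omega>. k \<in> {1..n})" by (rule measurable_const) simp
      show "Measurable.pred N (\<lambda>\<omega>. \<forall>k'\<in>{k<..n}. \<not> ok k' \<omega>)"
        by (rule pred_intros_finite(3)[OF finite_greaterThanAtMost pred_intros_logic(2)[OF okm]])
    qed
    hence "{\<omega> \<in> space N. Max {k \<in> {1..n}. ok k \<omega>} = k} \<in> sets N" unfolding iff pred_def .
    thus "(\<lambda>\<omega>. Max {k \<in> {1..n}. ok k \<omega>}) -` {k} \<inter> space N \<in> sets N"
      by (simp add: vimage_def Int_def conj_commute)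
  qed simp_all
qed

end

end

locale meta = learner +
  fixes R :: "'r measure" and A :: "'r \<Rightarrow> ('a \<times> bool) list \<Rightarrow> 'a classifier"
  assumes is_passive: "passive_algorithm R A"
begin

lemma prob_space_R: "prob_space R"
  using is_passive by (simp add: passive_algorithm_def)

lemma prob_space_iid_R: "prob_space (iid R)"
  unfolding iid_def by (intro prob_space_PiM prob_space_R)

lemma measurable_seed: "(\<lambda>\<rho>. \<rho> k) \<in> iid R \<rightarrow>\<^sub>M R"
  unfolding iid_def by (rule measurable_component_singleton) simp

abbreviation \<Omega> :: "('a, 'r) active_data measure" where
  "\<Omega> \<equiv> data_space (iid R)"

lemma active_space_eq: "active_space P R = \<Omega>"
  by (simp add: active_space_def)

lemma prob_space_\<Omega>: "prob_space \<Omega>"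
  by (intro prob_space_pair' prob_space_iid prob_space_iid_R)

lemma segment_eq_map: "segment X ys (a, r) = map (\<lambda>i\<in>{..<r}. (X (a + 1 + i), ys ! (a + i))) [0..<r]"
  unfolding segment_def prod.case by (rule nth_equalityI) (auto simp del: upt_Suc)

lemma pred_passive:
  assumes X: "X \<in> N \<rightarrow>\<^sub>M iid P" and \<rho>: "\<rho> \<in> N \<rightarrow>\<^sub>M R"
  shows "Measurable.pred (N \<Otimes>\<^sub>M P) (\<lambda>z. A (\<rho> (fst z)) (segment (X (fst z)) ys (a, r)) (snd z))"
proof -
  let ?z = "\<lambda>z. \<lambda>i\<in>{..<r}. (X (fst z) (a + 1 + i), ys ! (a + i))"
  have 1: "(\<lambda>z. \<rho> (fst z)) \<in> N \<Otimes>\<^sub>M P \<rightarrow>\<^sub>M R" by (rule measurable_compose[OF measurable_fst \<rho>])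
  have 2: "?z \<in> N \<Otimes>\<^sub>M P \<rightarrow>\<^sub>M (\<Pi>\<^sub>M i\<in>{..<r}. borel \<Otimes>\<^sub>M count_space UNIV)"
  proof (rule measurable_restrict)
    fix i
    have "(\<lambda>z. X (fst z) (a + 1 + i)) \<in> N \<Otimes>\<^sub>M P \<rightarrow>\<^sub>M borel"
      by (rule measurable_compose[OF measurable_compose[OF measurable_fst X] measurable_iid_component_borel])
    thus "(\<lambda>z. (X (fst z) (a + 1 + i), ys ! (a + i))) \<in> N \<Otimes>\<^sub>M P \<rightarrow>\<^sub>M borel \<Otimes>\<^sub>M count_space UNIV"
      by (rule measurable_Pair) simp
  qed
  have 3: "snd \<in> N \<Otimes>\<^sub>M P \<rightarrow>\<^sub>M borel" by (rule measurable_compose[OF measurable_snd measurable_ident_sets[OF sets_P]])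
  have "(\<lambda>(\<rho>, z, x). A \<rho> (map z [0..<r]) x) \<in> R \<Otimes>\<^sub>M (\<Pi>\<^sub>M i\<in>{..<r}. borel \<Otimes>\<^sub>M count_space UNIV) \<Otimes>\<^sub>M borel \<rightarrow>\<^sub>M count_space UNIV"
    using is_passive unfolding passive_algorithm_def by blast
  from measurable_compose[OF measurable_Pair[OF 1 measurable_Pair[OF 2 3]] this]
  show ?thesis unfolding segment_eq_map by simp
qed

lemma pred_hypothesis:
  assumes X: "X \<in> N \<rightarrow>\<^sub>M iid P" and \<rho>: "\<rho> \<in> N \<rightarrow>\<^sub>M R"
  shows "Measurable.pred (N \<Otimes>\<^sub>M P) (\<lambda>z. hypothesis A (X (fst z)) (\<rho> (fst z)) st k (snd z))"
proof -
  obtain segs T t ys where st: "st = (segs, T, t, ys)" by (cases st)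
  show ?thesis
  proof (cases "k - 1 < length segs")
    case True
    obtain a r where ar: "segs ! (k - 1) = (a, r)" by (cases "segs ! (k - 1)")
    show ?thesis unfolding st hypothesis_def prod.case if_P[OF True] ar by (rule pred_passive[OF X \<rho>])
  next
    case False
    have "Measurable.pred (N \<Otimes>\<^sub>M P) (\<lambda>z. A (\<rho> (fst z)) (segment (X (fst z)) ys (0, 0)) (snd z))" by (rule pred_passive[OF X \<rho>])
    thus ?thesis unfolding st hypothesis_def prod.case if_not_P[OF False] by (simp add: segment_def)
  qed
qed

definition seeds :: "('a, 'r) active_data \<Rightarrow> nat \<Rightarrow> 'r" where
  "seeds \<omega> = snd (snd (snd \<omega>))"

definition run_trace :: "nat \<Rightarrow> ('a, 'r) active_data \<Rightarrow> nat \<Rightarrow> (nat \<times> nat) list \<times> nat \<times> nat \<times> bool list" where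
  "run_trace n \<omega> k = trace n (fst \<omega>) (fst (snd \<omega>)) (fst (snd (snd \<omega>))) k"

definition candidate :: "nat \<Rightarrow> nat \<Rightarrow> ('a, 'r) active_data \<Rightarrow> 'a classifier" where
  "candidate n k \<omega> = hypothesis A (fst \<omega>) (seeds \<omega> k) (run_trace n \<omega> (d + 1)) k"

definition choice :: "nat \<Rightarrow> ('a, 'r) active_data \<Rightarrow> nat" where
  "choice n \<omega> = chosen_index (d + 1) (n div 3) (fst \<omega>) (length (final (run_trace n \<omega> (d + 1)))) (\<lambda>k. candidate n k \<omega>)"

lemma run_meta_eq: "run (\<lambda>i. f (fst \<omega> i)) (meta_algorithm C tie A n \<omega>) = candidate n (choice n \<omega>) \<omega>"
proof -
  obtain X W1 W2 \<rho> where w: "\<omega> = (X, W1, W2, \<rho>)" by (cases \<omega>)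
  show ?thesis unfolding w candidate_def choice_def run_trace_def seeds_def fst_conv snd_conv run_meta_algorithm Let_def ..
qed

lemma measurable_data [measurable]:
  "fst \<in> \<Omega> \<rightarrow>\<^sub>M iid P" "(\<lambda>\<omega>. fst (snd \<omega>)) \<in> \<Omega> \<rightarrow>\<^sub>M iid P" "(\<lambda>\<omega>. fst (snd (snd \<omega>))) \<in> \<Omega> \<rightarrow>\<^sub>M iid P"
  by simp_all

lemma measurable_seeds: "(\<lambda>\<omega>. seeds \<omega> k) \<in> \<Omega> \<rightarrow>\<^sub>M R"
  unfolding seeds_def by (rule measurable_compose[OF _ measurable_seed]) simp

lemma measurable_run_trace: "(\<lambda>\<omega>. run_trace n \<omega> k) \<in> \<Omega> \<rightarrow>\<^sub>M count_space UNIV"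
  unfolding run_trace_def by (rule measurable_trace[OF measurable_data])

lemma pred_candidate: "Measurable.pred (\<Omega> \<Otimes>\<^sub>M P) (\<lambda>z. candidate n k (fst z) (snd z))"
  unfolding candidate_def
  by (rule measurable_compose_countable[where f = "\<lambda>st z. hypothesis A (fst (fst z)) (seeds (fst z) k) st k (snd z)" and
      g = "\<lambda>z. run_trace n (fst z) (d + 1)", OF pred_hypothesis[OF measurable_data(1) measurable_seeds] measurable_compose[OF measurable_fst measurable_run_trace]])

lemma measurable_candidate_err: "(\<lambda>\<omega>. err P f (candidate n k \<omega>)) \<in> borel_measurable \<Omega>"
  by (rule measurable_hyp_err[OF measurable_data(1) pred_candidate])

lemma measurable_choice: "choice n \<in> \<Omega> \<rightarrow>\<^sub>M count_space UNIV"
proof -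
  have "(\<lambda>\<omega>. chosen_index (d + 1) (n div 3) (fst \<omega>) (length (final st)) (\<lambda>k. candidate n k \<omega>)) \<in> \<Omega> \<rightarrow>\<^sub>M count_space UNIV" for st
    by (rule measurable_chosen_index[OF measurable_data(1) pred_candidate]) simp
  from measurable_compose_countable[where f = "\<lambda>st \<omega>. chosen_index (d + 1) (n div 3) (fst \<omega>) (length (final st)) (\<lambda>k. candidate n k \<omega>)" and
      g = "\<lambda>\<omega>. run_trace n \<omega> (d + 1)", OF this measurable_run_trace]
  show ?thesis by (simp add: choice_def[abs_def])
qed

lemma measurable_output_err: "(\<lambda>\<omega>. err P f (candidate n (choice n \<omega>) \<omega>)) \<in> borel_measurable \<Omega>"
  by (rule measurable_compose_countable[where f = "\<lambda>k \<omega>. err P f (candidate n k \<omega>)", OF measurable_candidate_err measurable_choice])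

end

subsection \<open>Failure of the selection\<close>

context full_prob_space
begin

text \<open>Once the auxiliary samples and the seeds \<open>y\<close> are fixed,
  \<open>\<tau>\<close> is a stopping time of \<open>X\<close> alone and the strong Markov property
  applies to the slice; the bound is then integrated over \<open>y\<close>.\<close>

lemma measure_slice_le:
  assumes K: "prob_space K" and Q: "Measurable.pred (data_space K) Q"
    and \<tau>: "\<And>y. y \<in> space (iid M \<Otimes>\<^sub>M iid M \<Otimes>\<^sub>M K) \<Longrightarrow> (\<lambda>X. \<tau> (X, y)) \<in> iid M \<rightarrow>\<^sub>M count_space UNIV"
    and past: "\<And>X X' y. (\<And>j. j \<le> \<tau> (X, y) \<Longrightarrow> X j = X' j) \<Longrightarrow> \<tau> (X', y) = (\<tau> (X, y) :: nat)"
    and le: "\<And>X y. y \<in> space (iid M \<Otimes>\<^sub>M iid M \<Otimes>\<^sub>M K) \<Longrightarrow> outer_le (iid M) {X'. Q (restart (\<tau> (X, y)) X X', y)} \<eta>"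
  shows "measure (data_space K) {\<omega>\<in>space (data_space K). Q \<omega>} \<le> \<eta>"
proof (rule measure_pair_le2[OF prob_space_iid])
  show "prob_space (iid M \<Otimes>\<^sub>M iid M \<Otimes>\<^sub>M K)" by (intro prob_space_pair' prob_space_iid K)
  show "{\<omega>\<in>space (data_space K). Q \<omega>} \<in> sets (data_space K)" using Q by (simp add: pred_def)
  fix y assume y: "y \<in> space (iid M \<Otimes>\<^sub>M iid M \<Otimes>\<^sub>M K)"
  have "Measurable.pred (iid M) (\<lambda>X. Q (X, y))" using measurable_compose[OF measurable_Pair2'[OF y] Q] .
  hence S: "{X. Q (X, y)} \<in> sets (iid M)" by (simp add: pred_def)
  have m: "(\<lambda>X. indicator {X. Q (X, y)} X :: ennreal) \<in> borel_measurable (iid M)" using S by simp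
  have "(\<integral>\<^sup>+X. indicator {X. Q (X, y)} X \<partial>iid M) \<le> ennreal \<eta>"
  proof (rule strong_markov[OF m \<tau>[OF y]])
    show "\<tau> (X', y) = \<tau> (X, y)" if "\<forall>j\<le>\<tau> (X, y). X j = X' j" for X X' using past that by blast
    fix X
    obtain B where B: "B \<in> sets (iid M)" "{X'. Q (restart (\<tau> (X, y)) X X', y)} \<subseteq> B" "measure (iid M) B \<le> \<eta>"
      using le[OF y] unfolding outer_le_def by blast
    have "(\<integral>\<^sup>+X'. indicator {X. Q (X, y)} (restart (\<tau> (X, y)) X X') \<partial>iid M) \<le> (\<integral>\<^sup>+X'. indicator B X' \<partial>iid M)"
      using B(2) by (intro nn_integral_mono) (auto simp: indicator_def)
    also have "\<dots> \<le> ennreal \<eta>" using B by (simp add: iid.emeasure_eq_measure ennreal_leI)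
    finally show "(\<integral>\<^sup>+X'. indicator {X. Q (X, y)} (restart (\<tau> (X, y)) X X') \<partial>iid M) \<le> ennreal \<eta>" .
  qed
  hence "emeasure (iid M) {X. Q (X, y)} \<le> ennreal \<eta>" using S by simp
  moreover have "0 \<le> \<eta>" using le[OF y, of undefined] unfolding outer_le_def by (meson measure_nonneg order_trans)
  ultimately have "measure (iid M) {X. Q (X, y)} \<le> \<eta>" by (simp add: iid.emeasure_eq_measure)
  moreover have "(\<lambda>x. (x, y)) -` {\<omega> \<in> space (data_space K). Q \<omega>} = {X. Q (X, y)}"
    using y by (auto simp: space_pair_measure)
  ultimately show "measure (iid M) ((\<lambda>x. (x, y)) -` {\<omega> \<in> space (data_space K). Q \<omega>}) \<le> \<eta>" by simp
qed

text \<open>Moves \<open>W1\<close> and \<open>W2\<close> outside, because stopping times of the run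
  are defined for fixed auxiliary samples, while the seeds are averaged together with
  \<open>X\<close>.\<close>

lemma nn_integral_data_le:
  assumes K: "prob_space K" and F: "F \<in> borel_measurable (data_space K)"
    and le: "\<And>W1 W2. (\<integral>\<^sup>+X. \<integral>\<^sup>+\<rho>. F (X, W1, W2, \<rho>) \<partial>K \<partial>iid M) \<le> b"
  shows "(\<integral>\<^sup>+\<omega>. F \<omega> \<partial>data_space K) \<le> b"
proof -
  interpret K: prob_space K by fact
  interpret S2: prob_space "iid M \<Otimes>\<^sub>M K" by (intro prob_space_pair' prob_space_iid K)
  interpret S3: prob_space "iid M \<Otimes>\<^sub>M iid M \<Otimes>\<^sub>M K" by (intro prob_space_pair' prob_space_iid K)
  interpret W: prob_space "iid M \<Otimes>\<^sub>M iid M" by (intro prob_space_pair' prob_space_iid)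
  interpret XW: pair_sigma_finite "iid M" "iid M \<Otimes>\<^sub>M iid M" ..
  define G where "G = (\<lambda>z. \<integral>\<^sup>+\<rho>. F (fst z, fst (snd z), snd (snd z), \<rho>) \<partial>K)"
  have "(\<lambda>p. (fst (fst p), fst (snd (fst p)), snd (snd (fst p)), snd p)) \<in> (iid M \<Otimes>\<^sub>M iid M \<Otimes>\<^sub>M iid M) \<Otimes>\<^sub>M K \<rightarrow>\<^sub>M data_space K"
    by measurable
  from measurable_compose[OF this F]
  have F': "(\<lambda>(z, \<rho>). F (fst z, fst (snd z), snd (snd z), \<rho>)) \<in> borel_measurable ((iid M \<Otimes>\<^sub>M iid M \<Otimes>\<^sub>M iid M) \<Otimes>\<^sub>M K)"
    by (simp add: case_prod_unfold)
  have G: "G \<in> borel_measurable (iid M \<Otimes>\<^sub>M iid M \<Otimes>\<^sub>M iid M)"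
    unfolding G_def by (rule K.borel_measurable_nn_integral[OF F'])
  have F1: "(\<lambda>y. F (X, y)) \<in> borel_measurable (iid M \<Otimes>\<^sub>M iid M \<Otimes>\<^sub>M K)" for X
    by (rule measurable_compose[OF measurable_Pair1' F]) simp
  have F2: "(\<lambda>y. F (X, W1, y)) \<in> borel_measurable (iid M \<Otimes>\<^sub>M K)" for X W1
    by (rule measurable_compose[OF measurable_Pair1' F1]) simp
  have G1: "(\<lambda>y. G (X, y)) \<in> borel_measurable (iid M \<Otimes>\<^sub>M iid M)" for X
    by (rule measurable_compose[OF measurable_Pair1' G]) simp
  have "(\<integral>\<^sup>+\<omega>. F \<omega> \<partial>data_space K) = (\<integral>\<^sup>+X. \<integral>\<^sup>+y. F (X, y) \<partial>(iid M \<Otimes>\<^sub>M iid M \<Otimes>\<^sub>M K) \<partial>iid M)"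
    by (rule S3.nn_integral_fst[OF F, symmetric])
  also have "\<dots> = (\<integral>\<^sup>+X. \<integral>\<^sup>+W1. \<integral>\<^sup>+y. F (X, W1, y) \<partial>(iid M \<Otimes>\<^sub>M K) \<partial>iid M \<partial>iid M)"
    by (simp only: S2.nn_integral_fst[OF F1])
  also have "\<dots> = (\<integral>\<^sup>+X. \<integral>\<^sup>+W1. \<integral>\<^sup>+W2. \<integral>\<^sup>+\<rho>. F (X, W1, W2, \<rho>) \<partial>K \<partial>iid M \<partial>iid M \<partial>iid M)"
    by (simp only: K.nn_integral_fst[OF F2])
  also have "\<dots> = (\<integral>\<^sup>+X. \<integral>\<^sup>+W1. \<integral>\<^sup>+W2. G (X, W1, W2) \<partial>iid M \<partial>iid M \<partial>iid M)" by (simp add: G_def)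
  also have "\<dots> = (\<integral>\<^sup>+X. \<integral>\<^sup>+y. G (X, y) \<partial>(iid M \<Otimes>\<^sub>M iid M) \<partial>iid M)"
    by (simp only: iid.nn_integral_fst[OF G1])
  also have "\<dots> = (\<integral>\<^sup>+y. \<integral>\<^sup>+X. G (X, y) \<partial>iid M \<partial>(iid M \<Otimes>\<^sub>M iid M))"
    by (rule XW.Fubini'[symmetric]) (use G in \<open>simp add: case_prod_unfold\<close>)
  also have "\<dots> \<le> (\<integral>\<^sup>+y. b \<partial>(iid M \<Otimes>\<^sub>M iid M))"
    by (intro nn_integral_mono) (auto simp: G_def intro: le)
  also have "\<dots> = b" by (simp add: W.emeasure_space_1)
  finally show ?thesis .
qed

end

section \<open>Stopping times of the rounds\<close>

context learner
begin

lemma final_while_end: "take (length ys) (snd (while_end n k T X W2 ys)) = ys"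
  unfolding while_end_def using take_wsteps[where s = "(0, ys)"] by (simp del: funpow.simps)

lemma final_trace_round:
  assumes "1 \<le> k"
  shows "final (trace n X W1 W2 k) = snd ((dstep k (budget_at n X W1 W2 k) X W2 ^^ sample_size n X W1 W2 k) (while_state n X W1 W2 k))"
    and "fst (trace n X W1 W2 k) = fst (trace n X W1 W2 (k - 1)) @ [(stop_time n X W1 W2 k, sample_size n X W1 W2 k)]"
    and "length (final (trace n X W1 W2 k)) = stop_time n X W1 W2 k + sample_size n X W1 W2 k"
proof -
  obtain segs T t ys where tr: "trace n X W1 W2 (k - 1) = (segs, T, t, ys)" by (cases "trace n X W1 W2 (k - 1)")
  note u = trace_unfold[OF assms tr]
  show 1: "final (trace n X W1 W2 k) = snd ((dstep k (budget_at n X W1 W2 k) X W2 ^^ sample_size n X W1 W2 k) (while_state n X W1 W2 k))"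
    unfolding u final_def by (simp add: case_prod_unfold)
  show "fst (trace n X W1 W2 k) = fst (trace n X W1 W2 (k - 1)) @ [(stop_time n X W1 W2 k, sample_size n X W1 W2 k)]"
    unfolding u tr by simp
  show "length (final (trace n X W1 W2 k)) = stop_time n X W1 W2 k + sample_size n X W1 W2 k"
    unfolding 1 length_dsteps stop_time_def ..
qed

text \<open>Labels are only appended, never revised.\<close>

lemma final_trace_mono: "take (length (final (trace n X W1 W2 k))) (final (trace n X W1 W2 (k + j))) = final (trace n X W1 W2 k)"
proof (induction j)
  case (Suc j)
  let ?F = "\<lambda>k. final (trace n X W1 W2 k)" and ?k = "k + Suc j"
  have k: "1 \<le> ?k" "?k - 1 = k + j" by simp_all
  have "take (length (?F (k + j))) (snd (while_state n X W1 W2 ?k)) = ?F (k + j)"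
    unfolding while_state_def k(2) by (rule final_while_end)
  moreover have "take (length (snd (while_state n X W1 W2 ?k))) (?F ?k) = snd (while_state n X W1 W2 ?k)"
    unfolding final_trace_round(1)[OF k(1)] by (rule take_dsteps)
  ultimately have "take (length (?F (k + j))) (?F ?k) = ?F (k + j)" by (rule take_length_trans)
  with Suc show ?case by (rule take_length_trans)
qed simp

lemma nth_fst_trace:
  assumes "1 \<le> k" "k \<le> k'"
  shows "length (fst (trace n X W1 W2 k')) = k'" "fst (trace n X W1 W2 k') ! (k - 1) = (stop_time n X W1 W2 k, sample_size n X W1 W2 k)"
proof -
  have L: "length (fst (trace n X W1 W2 k)) = k" for k
  proof (induction k)
    case (Suc k)
    thus ?case using final_trace_round(2)[where k = "Suc k" and n = n and X = X and ?W1.0 = W1 and ?W2.0 = W2] by simp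
  qed simp
  show "length (fst (trace n X W1 W2 k')) = k'" by (rule L)
  show "fst (trace n X W1 W2 k') ! (k - 1) = (stop_time n X W1 W2 k, sample_size n X W1 W2 k)"
    using assms(2)
  proof (induction k' rule: dec_induct)
    case base
    show ?case using assms(1) by (simp add: final_trace_round(2) nth_append L)
  next
    case (step m)
    moreover have "k - 1 < m" using step(1) assms(1) by simp
    ultimately show ?case by (subst final_trace_round(2)) (simp_all add: nth_append L)
  qed
qed

lemma stop_time_le: "1 \<le> k \<Longrightarrow> k \<le> k' \<Longrightarrow> stop_time n X W1 W2 k + sample_size n X W1 W2 k \<le> length (final (trace n X W1 W2 k'))"
  using arg_cong[OF final_trace_mono[where n = n and X = X and ?W1.0 = W1 and ?W2.0 = W2 and k = k and j = "k' - k"], of length] final_trace_round(3)[of k n X W1 W2]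
  by simp

text \<open>The sample size is fixed by the estimate at the end of the while loop, before the first
  point of the sample is read. Given the past, the points of the sample are thus independent and of
  nonrandom number.\<close>

lemma stop_time_past:
  assumes "1 \<le> k" and X: "\<And>j. j \<le> stop_time n X W1 W2 k \<Longrightarrow> X j = X' j"
  shows "budget_at n X' W1 W2 k = budget_at n X W1 W2 k" "while_state n X' W1 W2 k = while_state n X W1 W2 k"
    "stop_time n X' W1 W2 k = stop_time n X W1 W2 k" "sample_size n X' W1 W2 k = sample_size n X W1 W2 k"
proof -
  have le: "length (final (trace n X W1 W2 (k - 1))) \<le> stop_time n X W1 W2 k"
    unfolding stop_time_def while_state_def by (rule length_while_end)
  have t: "trace n X' W1 W2 (k - 1) = trace n X W1 W2 (k - 1)"
    by (rule trace_past) (use X le in auto)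
  show b: "budget_at n X' W1 W2 k = budget_at n X W1 W2 k" unfolding budget_at_def t ..
  show w: "while_state n X' W1 W2 k = while_state n X W1 W2 k"
    unfolding while_state_def t b
    by (rule while_end_past) (use X in \<open>simp add: stop_time_def while_state_def\<close>)
  show s: "stop_time n X' W1 W2 k = stop_time n X W1 W2 k" unfolding stop_time_def w ..
  show "sample_size n X' W1 W2 k = sample_size n X W1 W2 k"
    unfolding sample_size_def w b by (rule do_steps_past) (use X in \<open>simp add: stop_time_def\<close>)
qed

end

lemma (in learner) chosen_index_cong:
  assumes "\<And>k. k \<in> {1..N} \<Longrightarrow> h k = h' k"
  shows "chosen_index N b X m0 h = chosen_index N b X m0 h'"
proof -
  show ?thesis unfolding chosen_index_def
    by (intro arg_cong[of _ _ Max] Collect_cong conj_cong refl ball_cong) (use assms in auto)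
qed

context meta
begin

lemma candidate_eq:
  assumes "k \<in> {1..d + 1}"
  shows "candidate n k (X, W1, W2, \<rho>) = A (\<rho> k) (segment X (final (trace n X W1 W2 (d + 1))) (stop_time n X W1 W2 k, sample_size n X W1 W2 k))"
proof -
  have k: "1 \<le> k" "k \<le> d + 1" using assms by auto
  obtain segs T t ys where tr: "trace n X W1 W2 (d + 1) = (segs, T, t, ys)" by (cases "trace n X W1 W2 (d + 1)")
  have s: "length segs = d + 1" "segs ! (k - 1) = (stop_time n X W1 W2 k, sample_size n X W1 W2 k)"
    using nth_fst_trace[OF k, of n X W1 W2] unfolding tr by simp_all
  have "k - 1 < length segs" using k s(1) by simp
  thus ?thesis unfolding candidate_def run_trace_def seeds_def fst_conv snd_conv tr hypothesis_def prod.case final_def by (simp only: if_True s(2))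
qed

lemma segment_past:
  assumes "\<And>j. j \<le> a + r \<Longrightarrow> X j = X' j"
  shows "segment X' ys (a, r) = segment X ys (a, r)"
  unfolding segment_def using assms by auto

definition selection_fails :: "nat \<Rightarrow> ('a, 'r) active_data \<Rightarrow> bool" where
  "selection_fails n \<omega> \<longleftrightarrow> (\<exists>j\<in>{1..d + 1}. 2 * err P f (candidate n j \<omega>) < err P f (candidate n (choice n \<omega>) \<omega>))"

lemma pred_selection_fails: "Measurable.pred \<Omega> (selection_fails n)"
proof -
  have "Measurable.pred \<Omega> (\<lambda>\<omega>. 2 * err P f (candidate n j \<omega>) < err P f (candidate n (choice n \<omega>) \<omega>))" for j
    using measurable_candidate_err[of n j] measurable_output_err[of n]
    by (intro borel_measurable_pred_less borel_measurable_times borel_measurable_const)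
  thus ?thesis unfolding selection_fails_def[abs_def] by (intro pred_intros_finite(4)) auto
qed

text \<open>The candidates depend on the data up to the end of the last round and on the seeds, and
  all test points come later. Restarting at that time therefore leaves the candidates fixed and
  renews the test points.\<close>

lemma measure_selection_fails_le:
  "measure \<Omega> {\<omega>\<in>space \<Omega>. selection_fails n \<omega>}
    \<le> real (d + 1) * exp (- (1 / 100) * (real (n div 3) / (real (d + 1) ^ 2 * ln (exp 1 * real (d + 1))) - 1))"
proof (rule measure_slice_le[where \<tau> = "\<lambda>\<omega>. length (final (run_trace n \<omega> (d + 1)))", OF prob_space_iid_R pred_selection_fails])
  let ?\<tau> = "\<lambda>\<omega>. length (final (run_trace n \<omega> (d + 1)))"
  have m: "?\<tau> \<in> \<Omega> \<rightarrow>\<^sub>M count_space UNIV"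
    by (rule measurable_compose[OF measurable_run_trace]) simp
  show "(\<lambda>X. ?\<tau> (X, y)) \<in> iid P \<rightarrow>\<^sub>M count_space UNIV" if "y \<in> space (iid P \<Otimes>\<^sub>M iid P \<Otimes>\<^sub>M iid R)" for y
    using measurable_compose[OF measurable_Pair2'[OF that] m] .
  have tp: "run_trace n (X', y) (d + 1) = run_trace n (X, y) (d + 1)" if "\<And>j. j \<le> ?\<tau> (X, y) \<Longrightarrow> X j = X' j" for X X' y
    using that unfolding run_trace_def fst_conv snd_conv by (rule trace_past)
  show "?\<tau> (X', y) = ?\<tau> (X, y)" if "\<And>j. j \<le> ?\<tau> (X, y) \<Longrightarrow> X j = X' j" for X X' y
    using tp[OF that] by simp
  fix X and y :: "(nat \<Rightarrow> 'a) \<times> (nat \<Rightarrow> 'a) \<times> (nat \<Rightarrow> 'r)"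
  assume y: "y \<in> space (iid P \<Otimes>\<^sub>M iid P \<Otimes>\<^sub>M iid R)"
  obtain W1 W2 \<rho> where yy: "y = (W1, W2, \<rho>)" by (cases y)
  define h where "h = (\<lambda>k. candidate n k (X, y))"
  let ?X = "\<lambda>X'. restart (?\<tau> (X, y)) X X'"
  have tr: "run_trace n (?X X', y) (d + 1) = run_trace n (X, y) (d + 1)" for X' by (rule tp) simp
  \<comment> \<open>The sample of each round ends before the restart, so neither its position nor
    its points change.\<close>
  have cand: "candidate n k (?X X', y) = h k" if k: "k \<in> {1..d + 1}" for k X'
  proof -
    have k': "1 \<le> k" "k \<le> d + 1" using k by auto
    have le: "stop_time n X W1 W2 k + sample_size n X W1 W2 k \<le> ?\<tau> (X, y)"
      using stop_time_le[OF k', of n X W1 W2] by (simp add: run_trace_def yy)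
    have p: "X j = ?X X' j" if "j \<le> stop_time n X W1 W2 k" for j using that le by simp
    have "candidate n k (?X X', y) = A (\<rho> k) (segment (?X X') (final (trace n X W1 W2 (d + 1))) (stop_time n X W1 W2 k, sample_size n X W1 W2 k))"
      unfolding yy candidate_eq[OF k] using tr[of X'] stop_time_past[OF k'(1) p] unfolding run_trace_def yy fst_conv snd_conv by simp
    also have "\<dots> = A (\<rho> k) (segment X (final (trace n X W1 W2 (d + 1))) (stop_time n X W1 W2 k, sample_size n X W1 W2 k))"
      by (subst segment_past[where X = X and X' = "?X X'"]) (use le in auto)
    finally show ?thesis unfolding h_def yy candidate_eq[OF k] .
  qed
  have hp: "Measurable.pred P (h j)" for j
  proof -
    have "(X, y) \<in> space \<Omega>" using y by (simp add: space_pair_measure)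
    thus ?thesis unfolding h_def by (rule pred_hyp_fixed[OF measurable_data(1) pred_candidate])
  qed
  have "finite {1..d + 1}" "{1..d + 1} \<noteq> {}" by auto
  from arg_min_if_finite[OF this, of "\<lambda>j. err P f (h j)"]
  obtain \<kappa> where \<kappa>: "\<kappa> \<in> {1..d + 1}" "\<And>j. j \<in> {1..d + 1} \<Longrightarrow> err P f (h \<kappa>) \<le> err P f (h j)"
    by (meson not_le)
  show "outer_le (iid P) {X'. selection_fails n (?X X', y)}
    (real (d + 1) * exp (- (1 / 100) * (real (n div 3) / (real (d + 1) ^ 2 * ln (exp 1 * real (d + 1))) - 1)))"
  proof (rule outer_le_mono[OF chosen_index_outer_le[where N = "d + 1" and h = h and \<kappa> = \<kappa> and b = "n div 3" and X = X and ?m0.0 = "?\<tau> (X, y)", OF hp \<kappa>]])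
    show "{X'. selection_fails n (?X X', y)} \<subseteq> {X'. 2 * err P f (h \<kappa>) < err P f (h (chosen_index (d + 1) (n div 3) (?X X') (?\<tau> (X, y)) h))}"
    proof (intro subsetI CollectI)
      fix X' assume "X' \<in> {X'. selection_fails n (?X X', y)}"
      then obtain j where j: "j \<in> {1..d + 1}" "2 * err P f (candidate n j (?X X', y)) < err P f (candidate n (choice n (?X X', y)) (?X X', y))"
        unfolding selection_fails_def by blast
      have eq: "chosen_index (d + 1) b X'' m0 (\<lambda>k. candidate n k (?X X', y)) = chosen_index (d + 1) b X'' m0 h" for b X'' m0
        by (rule chosen_index_cong) (rule cand)
      have c: "choice n (?X X', y) = chosen_index (d + 1) (n div 3) (?X X') (?\<tau> (X, y)) h"
        unfolding choice_def fst_conv tr eq ..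
      have "chosen_index (d + 1) (n div 3) (?X X') (?\<tau> (X, y)) h \<in> {1..d + 1}" by (rule chosen_index_in(1)) simp
      thus "2 * err P f (h \<kappa>) < err P f (h (chosen_index (d + 1) (n div 3) (?X X') (?\<tau> (X, y)) h))"
        using j \<kappa>(2)[OF j(1)] cand[OF j(1)] unfolding c by (simp only: cand)
    qed
  qed (assumption, rule order_refl)
qed

end

subsection \<open>Rounds of a good run\<close>

context realizable
begin

text \<open>For a fixed radius the polynomial factor of \<open>radius_tail\<close> is dominated by
  half of the exponent, and the tails over all later times sum geometrically.\<close>

lemma outer_le_radius:
  assumes r: "0 < r"
  obtains K c where "0 < c" "0 \<le> K"
    "\<And>i0. outer_le (iid P) {X. \<exists>m\<ge>i0. \<not> version_space m X \<subseteq> concept_ball C P f r} (K * exp (- c * real i0))"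
proof -
  \<comment> \<open>Half of the rate \<open>r * ln 2 / 2\<close>; the other half absorbs the
    polynomial.\<close>
  define c where "c = r * ln 2 / 4"
  have c: "0 < c" using r by (simp add: c_def)
  have "(\<lambda>m. (2 * real m + 1) ^ d * exp (- c * real m)) \<longlonglongrightarrow> 0" using c by real_asymp
  hence "Bseq (\<lambda>m. (2 * real m + 1) ^ d * exp (- c * real m))" by (intro convergent_imp_Bseq convergentI)
  then obtain K0 where K0: "0 < K0" "\<And>m. norm ((2 * real m + 1) ^ d * exp (- c * real m)) \<le> K0" by (rule BseqE) blast
  \<comment> \<open>The second term makes the bound trivial for the times with
    \<open>r * real m < 8\<close>, which \<open>radius_tail\<close> does not cover.\<close>
  define K where "K = max (2 * K0) (exp (c * (8 / r)))"
  have K: "0 \<le> K" by (simp add: K_def le_max_iff_disj)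
  let ?E = "\<lambda>m. {X. \<not> version_space m X \<subseteq> concept_ball C P f r}"
  have "outer_le (iid P) (?E m) (K * exp (- c * real m))" for m
  proof (cases "8 \<le> r * real m")
    case True
    from radius_tail[OF this] obtain B where B: "B \<in> sets (iid P)"
      "measure (iid P) B \<le> 2 * (real ((2 * m + 1) ^ d) * 2 powr (- (r * real m / 2)))" "\<And>X. X \<notin> B \<Longrightarrow> version_space m X \<subseteq> concept_ball C P f r"
      by blast
    have "(2::real) powr (- (r * real m / 2)) = exp (- c * real m) * exp (- c * real m)"
      unfolding exp_add[symmetric] by (simp add: powr_def c_def)
    hence "2 * (real ((2 * m + 1) ^ d) * 2 powr (- (r * real m / 2))) = 2 * ((2 * real m + 1) ^ d * exp (- c * real m)) * exp (- c * real m)"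
      by (simp add: algebra_simps)
    also have "\<dots> \<le> (2 * K0) * exp (- c * real m)"
      using K0(2)[of m] by (intro mult_right_mono) auto
    also have "\<dots> \<le> K * exp (- c * real m)" by (intro mult_right_mono) (auto simp: K_def)
    finally have "measure (iid P) B \<le> K * exp (- c * real m)" using B(2) by linarith
    thus ?thesis using B unfolding outer_le_def by blast
  next
    case False
    hence "real m \<le> 8 / r" using r by (simp add: field_simps)
    hence "c * real m \<le> c * (8 / r)" using c by (intro mult_left_mono) auto
    hence "exp (c * real m) \<le> K" unfolding K_def by (meson exp_le_cancel_iff max.coboundedI2)
    hence "exp (c * real m) * exp (- c * real m) \<le> K * exp (- c * real m)" by (intro mult_right_mono) auto
    hence "1 \<le> K * exp (- c * real m)" by (simp add: exp_minus)
    moreover have "outer_le (iid P) UNIV 1"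
      by (rule outer_leI) (use sets.top[of "iid P"] in \<open>auto\<close>)
    ultimately show ?thesis by (rule outer_le_mono[rotated 2]) auto
  qed
  hence "outer_le (iid P) (\<Union>m\<in>{i0..}. ?E m) (K / (1 - exp (- c)) * exp (- c * real i0))" for i0
    by (intro iid.outer_le_UN_exp c K)
  moreover have "(\<Union>m\<in>{i0..}. ?E m) = {X. \<exists>m\<ge>i0. \<not> version_space m X \<subseteq> concept_ball C P f r}" for i0 by auto
  ultimately show ?thesis using c K by (intro that[of c "K / (1 - exp (- c))"]) auto
qed

end

lemma (in target) region_past:
  assumes "\<And>j. j \<le> m \<Longrightarrow> X j = X' j"
  shows "region k c m X' = region k c m X"
proof -
  have "version_space m X = version_space m X'" by (rule version_space_past) (rule assms)
  thus ?thesis by (simp only: region_def ext_prob_def)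
qed

context meta
begin

lemma measurable_budget_at: "(\<lambda>\<omega>. budget_at n (fst \<omega>) (fst (snd \<omega>)) (fst (snd (snd \<omega>))) k) \<in> \<Omega> \<rightarrow>\<^sub>M count_space UNIV"
proof -
  have "(\<lambda>\<omega>. (case run_trace n \<omega> (k - 1) of (segs, T, t, ys) \<Rightarrow> T - t)) \<in> \<Omega> \<rightarrow>\<^sub>M count_space UNIV"
    by (rule measurable_compose[OF measurable_run_trace]) simp
  thus ?thesis by (simp only: budget_at_def run_trace_def)
qed

lemma measurable_stop_size:
  assumes "1 \<le> k"
  shows "(\<lambda>\<omega>. (stop_time n (fst \<omega>) (fst (snd \<omega>)) (fst (snd (snd \<omega>))) k, sample_size n (fst \<omega>) (fst (snd \<omega>)) (fst (snd (snd \<omega>))) k)) \<in> \<Omega> \<rightarrow>\<^sub>M count_space UNIV"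
proof -
  have "(\<lambda>\<omega>. fst (run_trace n \<omega> k) ! (k - 1)) \<in> \<Omega> \<rightarrow>\<^sub>M count_space UNIV"
    by (rule measurable_compose[OF measurable_run_trace]) simp
  thus ?thesis unfolding run_trace_def nth_fst_trace(2)[OF assms order_refl] .
qed

text \<open>Exactly what \<open>trace_truth\<close> and the size estimate need, in terms of true
  labels and true regions. The last conjunct is conditional on a correct while loop, so the event
  can be bounded for each round separately, before the induction establishes correctness.\<close>

definition good_round :: "nat \<Rightarrow> real \<Rightarrow> nat \<Rightarrow> nat \<Rightarrow> (nat \<Rightarrow> 'a) \<Rightarrow> (nat \<Rightarrow> 'a) \<Rightarrow> (nat \<Rightarrow> 'a) \<Rightarrow> bool" where
  "good_round k p i0 n X W1 W2 \<longleftrightarrow>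
     (\<forall>i\<ge>i0. \<not> asks k X W2 (truth X i) \<longrightarrow> guess k X W2 (truth X i) = f (X (Suc i))) \<and>
     (\<forall>m\<ge>i0. \<forall>i\<ge>m. asks k X W2 (truth X i) \<longrightarrow> X (Suc i) \<in> region k (p / 4) m X) \<and>
     (\<forall>m\<ge>i0. 0 < Delta_hat_total W1 W2 k m (version_space m X) \<and>
        Delta_hat_total W1 W2 k m (version_space m X) \<le> measure P (region k (p / 32) m X) + 3 / real m) \<and>
     (snd (while_state n X W1 W2 k) = truth X (stop_time n X W1 W2 k) \<longrightarrow> i0 \<le> stop_time n X W1 W2 k \<longrightarrow>
        real n / 8 ^ k \<le> real (budget_at n X W1 W2 k) \<longrightarrow>
        real (card {i \<in> {1..sample_size n X W1 W2 k}. X (stop_time n X W1 W2 k + i) \<in> region k (p / 4) (stop_time n X W1 W2 k) X})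
          \<le> real (budget_at n X W1 W2 k) / 2 - 2)"

end

locale meta_k = meta + order_k
begin

text \<open>Given the past, the expected number of visits to the region during the sample is at most
  a third of the budget, yet about half of the budget is reached.\<close>

definition crowded :: "nat \<Rightarrow> real \<Rightarrow> (nat \<Rightarrow> 'a) \<Rightarrow> (nat \<Rightarrow> 'a) \<Rightarrow> (nat \<Rightarrow> 'a) \<Rightarrow> bool" where
  "crowded n c X W1 W2 \<longleftrightarrow> real n / 8 ^ k \<le> real (budget_at n X W1 W2 k) \<and>
     real (sample_size n X W1 W2 k) * measure P (region k c (stop_time n X W1 W2 k) X) \<le> real (budget_at n X W1 W2 k) / 3 \<and>
     real (budget_at n X W1 W2 k) / 2 - 2
       < real (card {i \<in> {1..sample_size n X W1 W2 k}. X (stop_time n X W1 W2 k + i) \<in> region k c (stop_time n X W1 W2 k) X})"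

lemma pred_le_real:
  fixes g h :: "'w \<Rightarrow> real"
  assumes "g \<in> borel_measurable N" "h \<in> borel_measurable N"
  shows "Measurable.pred N (\<lambda>\<omega>. g \<omega> \<le> h \<omega>)"
  unfolding pred_def by (rule borel_measurable_le[OF assms])

lemma pred_crowded: "Measurable.pred \<Omega> (\<lambda>\<omega>. crowded n c (fst \<omega>) (fst (snd \<omega>)) (fst (snd (snd \<omega>))))"
proof -
  define q where "q = (\<lambda>(T, a, r) X. real n / 8 ^ k \<le> real T \<and> real r * measure P (region k c a X) \<le> real T / 3 \<and>
     real T / 2 - 2 < real (card {i \<in> {1..r}. X (a + i) \<in> region k c a X}))"
  have q: "Measurable.pred \<Omega> (\<lambda>\<omega>. q z (fst \<omega>))" for z
  proof -
    obtain T a r where z: "z = (T, a, r)" by (cases z)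
    have X: "fst \<in> \<Omega> \<rightarrow>\<^sub>M iid P" by simp
    have 1: "(\<lambda>\<omega>. measure P (region k c a (fst \<omega>))) \<in> borel_measurable \<Omega>" by (rule measurable_measure_region[OF X])
    have 2: "(\<lambda>\<omega>. card {i \<in> {1..r}. fst \<omega> (a + i) \<in> region k c a (fst \<omega>)}) \<in> \<Omega> \<rightarrow>\<^sub>M count_space UNIV"
      by (intro measurable_card_upto pred_in_region X measurable_compose[OF X measurable_iid_component])
    have 3: "(\<lambda>\<omega>. real (card {i \<in> {1..r}. fst \<omega> (a + i) \<in> region k c a (fst \<omega>)})) \<in> borel_measurable \<Omega>"
      by (rule measurable_compose[OF 2]) simp
    have 4: "Measurable.pred \<Omega> (\<lambda>\<omega>. real n / 8 ^ k \<le> real T)" by (rule measurable_const) simp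
    show ?thesis unfolding z q_def prod.case
      by (intro pred_intros_logic(3) 4 borel_measurable_pred_less pred_le_real borel_measurable_times borel_measurable_const 1 3)
  qed
  let ?s = "\<lambda>\<omega>. (stop_time n (fst \<omega>) (fst (snd \<omega>)) (fst (snd (snd \<omega>))) k, sample_size n (fst \<omega>) (fst (snd \<omega>)) (fst (snd (snd \<omega>))) k)"
  let ?b = "\<lambda>\<omega>. budget_at n (fst \<omega>) (fst (snd \<omega>)) (fst (snd (snd \<omega>))) k"
  have 1: "Measurable.pred \<Omega> (\<lambda>\<omega>. q (T, ?s \<omega>) (fst \<omega>))" for T
    by (rule measurable_compose_countable[where f = "\<lambda>z \<omega>. q (T, z) (fst \<omega>)" and g = ?s, OF q measurable_stop_size[OF k]])
  have "Measurable.pred \<Omega> (\<lambda>\<omega>. q (?b \<omega>, ?s \<omega>) (fst \<omega>))"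
    by (rule measurable_compose_countable[where f = "\<lambda>T \<omega>. q (T, ?s \<omega>) (fst \<omega>)" and g = ?b, OF 1 measurable_budget_at])
  thus ?thesis unfolding q_def prod.case crowded_def .
qed

text \<open>At the stopping time the region, the budget and the sample size are known and the
  following points are fresh, so an ordinary upper tail with weight \<open>5 / 4\<close>
  applies.\<close>

lemma measure_crowded_le:
  "measure \<Omega> {\<omega>\<in>space \<Omega>. crowded n c (fst \<omega>) (fst (snd \<omega>)) (fst (snd (snd \<omega>)))} \<le> 2 * exp (- (1 / (60 * 8 ^ k)) * real n)"
proof (rule measure_slice_le[where \<tau> = "\<lambda>\<omega>. stop_time n (fst \<omega>) (fst (snd \<omega>)) (fst (snd (snd \<omega>))) k", OF prob_space_iid_R pred_crowded])
  let ?\<tau> = "\<lambda>\<omega>. stop_time n (fst \<omega>) (fst (snd \<omega>)) (fst (snd (snd \<omega>))) k"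
  have m: "?\<tau> \<in> \<Omega> \<rightarrow>\<^sub>M count_space UNIV"
    using measurable_compose[OF measurable_stop_size[OF k], of fst "count_space UNIV" n] by simp
  show "(\<lambda>X. ?\<tau> (X, y)) \<in> iid P \<rightarrow>\<^sub>M count_space UNIV" if "y \<in> space (iid P \<Otimes>\<^sub>M iid P \<Otimes>\<^sub>M iid R)" for y
    using measurable_compose[OF measurable_Pair2'[OF that] m] .
  show "?\<tau> (X', y) = ?\<tau> (X, y)" if "\<And>j. j \<le> ?\<tau> (X, y) \<Longrightarrow> X j = X' j" for X X' and y :: "(nat \<Rightarrow> 'a) \<times> (nat \<Rightarrow> 'a) \<times> (nat \<Rightarrow> 'e)"
    using that unfolding fst_conv snd_conv by (rule stop_time_past(3)[OF k])
  fix X and y :: "(nat \<Rightarrow> 'a) \<times> (nat \<Rightarrow> 'a) \<times> (nat \<Rightarrow> 'e)"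
  obtain W1 W2 \<rho> where yy: "y = (W1, W2, \<rho>)" by (cases y)
  define \<tau> T s where "\<tau> = stop_time n X W1 W2 k" and "T = budget_at n X W1 W2 k" and "s = sample_size n X W1 W2 k"
  define D where "D = region k c \<tau> X"
  have eq: "crowded n c (restart \<tau> X X') W1 W2 \<longleftrightarrow> real n / 8 ^ k \<le> real T \<and> real s * measure P D \<le> real T / 3 \<and>
     real T / 2 - 2 < real (card {i \<in> {1..s}. X' i \<in> D})" for X'
  proof -
    have p: "X j = restart \<tau> X X' j" if "j \<le> stop_time n X W1 W2 k" for j using that by (simp add: \<tau>_def)
    have "{i \<in> {1..s}. restart \<tau> X X' (\<tau> + i) \<in> D} = {i \<in> {1..s}. X' i \<in> D}" by auto
    moreover note stop_time_past[where X = X and X' = "restart \<tau> X X'" and n = n and ?W1.0 = W1 and ?W2.0 = W2, OF k p, folded T_def s_def, folded \<tau>_def]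
    moreover have "region k c \<tau> (restart \<tau> X X') = D" unfolding D_def by (rule region_past) simp
    ultimately show ?thesis unfolding crowded_def by simp
  qed
  have goal: "{X'. crowded n c (fst (restart (?\<tau> (X, y)) X X', y)) (fst (snd (restart (?\<tau> (X, y)) X X', y))) (fst (snd (snd (restart (?\<tau> (X, y)) X X', y))))}
    = {X'. real n / 8 ^ k \<le> real T \<and> real s * measure P D \<le> real T / 3 \<and> real T / 2 - 2 < real (card {i \<in> {1..s}. X' i \<in> D})}"
    unfolding yy fst_conv snd_conv \<tau>_def[symmetric] eq ..
  show "outer_le (iid P) {X'. crowded n c (fst (restart (?\<tau> (X, y)) X X', y)) (fst (snd (restart (?\<tau> (X, y)) X X', y))) (fst (snd (snd (restart (?\<tau> (X, y)) X X', y))))}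
    (2 * exp (- (1 / (60 * 8 ^ k)) * real n))"
  proof (cases "real n / 8 ^ k \<le> real T \<and> real s * measure P D \<le> real T / 3")
    case False
    hence emp: "{X'. real n / 8 ^ k \<le> real T \<and> real s * measure P D \<le> real T / 3 \<and> real T / 2 - 2 < real (card {i \<in> {1..s}. X' i \<in> D})} = {}" by blast
    have "outer_le (iid P) {} (2 * exp (- (1 / (60 * 8 ^ k)) * real n))" by (rule outer_le_mono[OF outer_le_empty]) auto
    thus ?thesis unfolding goal emp .
  next
    case True
    define Z where "Z = (\<lambda>i (X' :: nat \<Rightarrow> 'a). 1 \<le> i \<and> X' i \<in> D)"
    define q where "q = (\<lambda>i::nat. if i = 0 then 0 else measure P D)"
    define a where "a = real T / 2 - 2"
    have D: "D \<in> sets P" unfolding D_def by (rule region_sets)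
    have Zm: "Measurable.pred (iid P) (Z i)" for i
    proof -
      have "Measurable.pred (iid P) (\<lambda>X. X i \<in> D)" by (rule measurable_compose[OF measurable_iid_component]) (use D in \<open>simp add: pred_def\<close>)
      moreover have "Measurable.pred (iid P) (\<lambda>X. 1 \<le> i)" by (rule measurable_const) simp
      ultimately show ?thesis unfolding Z_def by (intro pred_intros_logic(3))
    qed
    have "measure (iid P) {X'. (5 / 4) powr a \<le> (5 / 4) ^ card {i. i < s + 1 \<and> Z i X'}} \<le> exp ((5 / 4 - 1) * (\<Sum>i<s + 1. q i) - a * ln (5 / 4))"
    proof (rule predictable_count_tail[OF Zm])
      show "Z i X = Z i X'" if "\<forall>j\<le>i. X j = X' j" for i X X' using that by (simp add: Z_def)
      show "(5 / 4 - 1) * measure P {x. Z i (X(i := x))} \<le> (5 / 4 - 1) * q i" for i X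
        by (cases "i = 0") (simp_all add: Z_def q_def)
    qed simp
    also have "(\<Sum>i<s + 1. q i) = real s * measure P D"
      unfolding Suc_eq_plus1[symmetric] by (subst sum.lessThan_Suc_shift) (simp add: q_def)
    \<comment> \<open>A mean of at most \<open>T / 3\<close> contributes \<open>T / 12\<close>, the
      threshold subtracts at least \<open>T / 10 - 1 / 2\<close>. The difference
      \<open>- T / 60\<close> and the bound \<open>n / 8 ^ k \<le> T\<close> give the rate.\<close>
    also have "exp ((5 / 4 - 1) * (real s * measure P D) - a * ln (5 / 4)) \<le> exp (1 / 2 + - (1 / (60 * 8 ^ k)) * real n)"
    proof -
      have l: "1 / 5 \<le> ln (5 / 4 :: real)" using ln_ge_iff[of "5 / 4" "1 / 5"] ln_add_one_self_le_self2[of "- 1 / 5"]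
        by (simp add: ln_div)
      have l2: "ln (5 / 4 :: real) \<le> 1 / 4" using ln_le_minus_one[of "5 / 4 :: real"] by simp
      have "real T / 2 * (1 / 5) \<le> real T / 2 * ln (5 / 4)" using l by (intro mult_left_mono) auto
      hence "real T / 10 - 1 / 2 \<le> a * ln (5 / 4)" using l2 by (simp add: a_def algebra_simps)
      moreover have "(5 / 4 - 1) * (real s * measure P D) \<le> real T / 12" using True by simp
      moreover have "1 / (60 * 8 ^ k) * real n \<le> real T / 60" using True by (simp add: field_simps)
      ultimately show ?thesis by simp
    qed
    also have "\<dots> = exp (1 / 2) * exp (- (1 / (60 * 8 ^ k)) * real n)" by (rule exp_add)
    also have "\<dots> \<le> 2 * exp (- (1 / (60 * 8 ^ k)) * real n)"
      using exp_bound_half[of "1 / 2 :: real"] by (intro mult_right_mono) auto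
    finally have le: "measure (iid P) {X'. (5 / 4) powr a \<le> (5 / 4) ^ card {i. i < s + 1 \<and> Z i X'}} \<le> 2 * exp (- (1 / (60 * 8 ^ k)) * real n)" .
    have cm: "(\<lambda>X'. card {i. i < s + 1 \<and> Z i X'}) \<in> iid P \<rightarrow>\<^sub>M count_space UNIV"
    proof (rule measurable_card)
      show "{X' \<in> space (iid P). i \<in> {i. i < s + 1 \<and> Z i X'}} \<in> sets (iid P)" for i
        using Zm[of i] by (cases "i < s + 1") (auto simp: pred_def)
    qed
    have "{X'. (5 / 4) powr a \<le> (5 / 4) ^ card {i. i < s + 1 \<and> Z i X'}} \<in> sets (iid P)"
    proof -
      have "Measurable.pred (iid P) (\<lambda>X'. (5 / 4) powr a \<le> (5 / 4 :: real) ^ card {i. i < s + 1 \<and> Z i X'})"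
        by (rule measurable_compose[OF cm]) simp
      thus ?thesis by (simp add: pred_def)
    qed
    from outer_leI[OF this le] show ?thesis unfolding goal
    proof (rule outer_le_mono)
      show "{X'. real n / 8 ^ k \<le> real T \<and> real s * measure P D \<le> real T / 3 \<and> real T / 2 - 2 < real (card {i \<in> {1..s}. X' i \<in> D})}
        \<subseteq> {X'. (5 / 4) powr a \<le> (5 / 4) ^ card {i. i < s + 1 \<and> Z i X'}}"
      proof (intro subsetI CollectI)
        fix X' assume "X' \<in> {X'. real n / 8 ^ k \<le> real T \<and> real s * measure P D \<le> real T / 3 \<and> real T / 2 - 2 < real (card {i \<in> {1..s}. X' i \<in> D})}"
        moreover have "{i. i < s + 1 \<and> Z i X'} = {i \<in> {1..s}. X' i \<in> D}" by (auto simp: Z_def)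
        ultimately have "a \<le> real (card {i. i < s + 1 \<and> Z i X'})" by (simp add: a_def)
        hence "(5 / 4 :: real) powr a \<le> (5 / 4) powr real (card {i. i < s + 1 \<and> Z i X'})" by (intro powr_mono) auto
        thus "(5 / 4) powr a \<le> (5 / 4 :: real) ^ card {i. i < s + 1 \<and> Z i X'}" by (simp add: powr_realpow)
      qed
    qed simp
  qed
qed

text \<open>The premise on the mean in \<open>crowded\<close> holds by design: the sample size is at
  most the budget divided by three times an estimate that dominates the measure of the
  region.\<close>

lemma good_roundI:
  assumes i0: "1 \<le> i0" and cs: "core_shattered X W2"
    and acc: "\<And>m. i0 \<le> m \<Longrightarrow> \<not> inaccurate m X W1 W2" and V: "\<And>m. i0 \<le> m \<Longrightarrow> version_space m X \<subseteq> ball_at r0"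
    and nc: "\<not> crowded n (p / 4) X W1 W2"
  shows "good_round k p i0 n X W1 W2"
proof -
  note a = acc[unfolded inaccurate_def not_not]
  have asks: "asks k X W2 (truth X i) \<longleftrightarrow> 1 / 2 \<le> Delta_hat W2 k (Suc i) (X (Suc i)) (version_space i X)" for i
    unfolding asks_def consistent_truth length_truth ..
  have tot: "measure P (region k (p / 4) m X) + 1 / real m \<le> Delta_hat_total W1 W2 k m (version_space m X)"
    "Delta_hat_total W1 W2 k m (version_space m X) \<le> measure P (region k (p / 32) m X) + 3 / real m" if "i0 \<le> m" for m
    using Delta_hat_total_bounds[OF _ cs V[OF that], of W1] a[OF that] that i0 by auto
  have pos: "0 < Delta_hat_total W1 W2 k m (version_space m X)" if "i0 \<le> m" for m
  proof -
    have "0 < 1 / real m" using that i0 by simp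
    thus ?thesis using tot(1)[OF that] measure_nonneg[of P "region k (p / 4) m X"] by linarith
  qed
  show ?thesis unfolding good_round_def
  proof (intro conjI allI impI)
    fix i assume i: "i0 \<le> i" "\<not> asks k X W2 (truth X i)"
    thus "guess k X W2 (truth X i) = f (X (Suc i))"
      unfolding guess_def consistent_truth length_truth
      using infer_correct[of "Suc i" X W2] cs V[of i] a[of "Suc i"] by (simp add: asks not_le)
  next
    fix m i assume i: "i0 \<le> m" "m \<le> i" "asks k X W2 (truth X i)"
    have "X (Suc i) \<in> region k (p / 4) i X"
      using request_imp_region[of "Suc i" X W2] cs V[of i] a[of "Suc i"] i by (simp add: asks)
    thus "X (Suc i) \<in> region k (p / 4) m X" using region_antimono[OF i(2)] by blast
  next
    assume w: "snd (while_state n X W1 W2 k) = truth X (stop_time n X W1 W2 k)" and \<tau>: "i0 \<le> stop_time n X W1 W2 k"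
      and T: "real n / 8 ^ k \<le> real (budget_at n X W1 W2 k)"
    let ?\<Delta> = "Delta_hat_total W1 W2 k (stop_time n X W1 W2 k) (version_space (stop_time n X W1 W2 k) X)"
    let ?T = "real (budget_at n X W1 W2 k)" and ?s = "sample_size n X W1 W2 k" and ?m = "measure P (region k (p / 4) (stop_time n X W1 W2 k) X)"
    have s: "?s = nat \<lfloor>?T / (3 * ?\<Delta>)\<rfloor>" unfolding sample_size_def do_steps_def w consistent_truth length_truth ..
    have "real ?s \<le> ?T / (3 * ?\<Delta>)" unfolding s using pos[OF \<tau>] by (intro of_nat_floor) simp
    hence "real ?s * (3 * ?\<Delta>) \<le> ?T" using pos[OF \<tau>] by (simp add: pos_le_divide_eq)
    moreover have "?m \<le> ?\<Delta>" using tot(1)[OF \<tau>] divide_nonneg_nonneg[of 1 "real (stop_time n X W1 W2 k)"] by linarith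
    hence "real ?s * (3 * ?m) \<le> real ?s * (3 * ?\<Delta>)" by (intro mult_left_mono) auto
    ultimately have "real ?s * ?m \<le> ?T / 3" by simp
    thus "real (card {i \<in> {1..?s}. X (stop_time n X W1 W2 k + i) \<in> region k (p / 4) (stop_time n X W1 W2 k) X}) \<le> ?T / 2 - 2"
      using nc T unfolding crowded_def by simp
  qed (use pos tot in auto)
qed

text \<open>Inaccurate estimates and a version space outside the ball have probabilities decaying in
  \<open>i0\<close>, crowding has one decaying in \<open>n\<close>, and losing core tuples has
  probability 0.\<close>

lemma outer_le_not_good_round:
  obtains K c where "0 < c" "0 \<le> K"
    "\<And>i0 n. 1 \<le> i0 \<Longrightarrow> outer_le \<Omega> {\<omega>\<in>space \<Omega>. \<not> good_round k p i0 n (fst \<omega>) (fst (snd \<omega>)) (fst (snd (snd \<omega>)))} (K * (exp (- c * real i0) + exp (- c * real n)))"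
proof -
  interpret O: prob_space \<Omega> by (rule prob_space_\<Omega>)
  define c0 where "c0 = (p / 16)\<^sup>2 / 8"
  define c1 where "c1 = min (c0 / 2) (1 / 8)"
  have c0: "0 < c0" using p_pos by (simp add: c0_def)
  have c1: "0 < c1" using c0 by (simp add: c1_def)
  have Ki: "0 \<le> 10 + 4 / c0" using c0 by simp
  define K1 where "K1 = (10 + 4 / c0) / (1 - exp (- c1))"
  have K1: "0 \<le> K1" using Ki c1 by (simp add: K1_def)
  obtain K2 c2 where c2: "0 < c2" "0 \<le> K2"
    and R: "\<And>i0. outer_le (iid P) {X. \<exists>m\<ge>i0. \<not> version_space m X \<subseteq> ball_at r0} (K2 * exp (- c2 * real i0))"
    using outer_le_radius[OF r0(1)] by blast
  define c3 :: real where "c3 = 1 / (60 * 8 ^ k)"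
  have c3: "0 < c3" by (simp add: c3_def)
  define c where "c = min c1 (min c2 c3)"
  have c: "0 < c" "c \<le> c1" "c \<le> c2" "c \<le> c3" using c1 c2 c3 by (auto simp: c_def)
  let ?I = "\<lambda>m. {\<omega>\<in>space \<Omega>. inaccurate m (fst \<omega>) (fst (snd \<omega>)) (fst (snd (snd \<omega>)))}"
  let ?S = "{\<omega>\<in>space \<Omega>. \<not> core_shattered (fst \<omega>) (fst (snd (snd \<omega>)))}"
  let ?V = "\<lambda>i0. {\<omega>\<in>space \<Omega>. fst \<omega> \<in> {X. \<exists>m\<ge>i0. \<not> version_space m X \<subseteq> ball_at r0}}"
  let ?G = "\<lambda>n. {\<omega>\<in>space \<Omega>. crowded n (p / 4) (fst \<omega>) (fst (snd \<omega>)) (fst (snd (snd \<omega>)))}"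
  show ?thesis
  proof (rule that[of c "K1 + K2 + 2"])
    fix i0 n :: nat assume i0: "1 \<le> i0"
    have a: "outer_le \<Omega> (\<Union>m\<in>{i0..}. ?I m) (K1 * exp (- c1 * real i0))" unfolding K1_def
    proof (rule O.outer_le_UN_exp[OF _ c1 Ki])
      show "outer_le \<Omega> (?I m) ((10 + 4 / c0) * exp (- c1 * real m))" if "i0 \<le> m" for m
        using inaccurate_outer_le[OF prob_space_iid_R, of m] that i0 unfolding c1_def c0_def by simp
    qed
    have b: "outer_le \<Omega> ?S 0" by (rule AE_core_shattered[OF prob_space_iid_R])
    have cc: "outer_le \<Omega> (?V i0) (K2 * exp (- c2 * real i0))" by (rule outer_le_X[OF prob_space_iid_R R])
    have dd: "outer_le \<Omega> (?G n) (2 * exp (- c3 * real n))"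
      by (rule outer_leI) (use pred_crowded measure_crowded_le in \<open>auto simp: pred_def c3_def\<close>)
    have U: "outer_le \<Omega> (((\<Union>m\<in>{i0..}. ?I m) \<union> ?S) \<union> (?V i0 \<union> ?G n)) ((K1 * exp (- c1 * real i0) + 0) + (K2 * exp (- c2 * real i0) + 2 * exp (- c3 * real n)))"
      by (intro O.outer_le_Un a b cc dd)
    show "outer_le \<Omega> {\<omega>\<in>space \<Omega>. \<not> good_round k p i0 n (fst \<omega>) (fst (snd \<omega>)) (fst (snd (snd \<omega>)))} ((K1 + K2 + 2) * (exp (- c * real i0) + exp (- c * real n)))"
    proof (rule outer_le_mono[OF U])
      show "{\<omega>\<in>space \<Omega>. \<not> good_round k p i0 n (fst \<omega>) (fst (snd \<omega>)) (fst (snd (snd \<omega>)))} \<subseteq> (((\<Union>m\<in>{i0..}. ?I m) \<union> ?S) \<union> (?V i0 \<union> ?G n))"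
      proof
        fix \<omega> assume w: "\<omega> \<in> {\<omega>\<in>space \<Omega>. \<not> good_round k p i0 n (fst \<omega>) (fst (snd \<omega>)) (fst (snd (snd \<omega>)))}"
        show "\<omega> \<in> (((\<Union>m\<in>{i0..}. ?I m) \<union> ?S) \<union> (?V i0 \<union> ?G n))"
        proof (rule ccontr)
          assume n: "\<omega> \<notin> (((\<Union>m\<in>{i0..}. ?I m) \<union> ?S) \<union> (?V i0 \<union> ?G n))"
          have "good_round k p i0 n (fst \<omega>) (fst (snd \<omega>)) (fst (snd (snd \<omega>)))"
            by (rule good_roundI[OF i0]) (use w n in blast)+
          thus False using w by blast
        qed
      qed
      have e: "exp (- c1 * real i0) \<le> exp (- c * real i0)" "exp (- c2 * real i0) \<le> exp (- c * real i0)" "exp (- c3 * real n) \<le> exp (- c * real n)"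
        using c by (simp_all add: mult_right_mono)
      have "K1 * exp (- c1 * real i0) \<le> K1 * exp (- c * real i0)" "K2 * exp (- c2 * real i0) \<le> K2 * exp (- c * real i0)"
        by (intro mult_left_mono e K1 c2)+
      moreover have "0 \<le> K1 * exp (- c * real n)" "0 \<le> K2 * exp (- c * real n)" "0 \<le> 2 * exp (- c * real i0)" using K1 c2 by auto
      ultimately show "K1 * exp (- c1 * real i0) + 0 + (K2 * exp (- c2 * real i0) + 2 * exp (- c3 * real n)) \<le> (K1 + K2 + 2) * (exp (- c * real i0) + exp (- c * real n))"
        using e(3) unfolding distrib_left distrib_right by linarith
    qed
  qed (use c K1 c2 in auto)
qed

end

subsection \<open>The passive algorithm on the collected sample\<close>

context meta
begin

text \<open>True labels are used whether or not the run inferred them, and short samples count as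
  error 0. This gives a quantity whose mean can be bounded without conditioning on a good
  run.\<close>

definition passive_err :: "nat \<Rightarrow> nat \<Rightarrow> nat \<Rightarrow> ('a, 'r) active_data \<Rightarrow> real" where
  "passive_err n k l \<omega> =
     (let a = stop_time n (fst \<omega>) (fst (snd \<omega>)) (fst (snd (snd \<omega>))) k; r = sample_size n (fst \<omega>) (fst (snd \<omega>)) (fst (snd (snd \<omega>))) k
      in if l \<le> r then err P f (A (seeds \<omega> k) (sample f (\<lambda>i. fst \<omega> (a + i)) r)) else 0)"

context
  fixes l :: nat and e :: real
  assumes ach: "\<And>m. l \<le> m \<Longrightarrow> expectation_le (iid P \<Otimes>\<^sub>M R) (\<lambda>(X, \<rho>). err P f (A \<rho> (sample f X m))) e"
begin

lemma measurable_passive_err: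
  assumes k: "1 \<le> k"
  shows "passive_err n k l \<in> borel_measurable \<Omega>"
proof -
  define q where "q = (\<lambda>(a, r) \<omega>. if l \<le> r then err P f (A (seeds \<omega> k) (sample f (\<lambda>i. fst \<omega> (a + i)) r)) else 0)"
  have q: "q z \<in> borel_measurable \<Omega>" for z
  proof -
    obtain a r where z: "z = (a, r)" by (cases z)
    show ?thesis
    proof (cases "l \<le> r")
      case True
      have m: "(\<lambda>(X, \<rho>). err P f (A \<rho> (sample f X r))) \<in> borel_measurable (iid P \<Otimes>\<^sub>M R)"
        using ach[OF True] unfolding expectation_le_def by (blast intro: borel_measurable_integrable)
      have "(\<lambda>\<omega>. (\<lambda>i. fst \<omega> (a + i))) \<in> \<Omega> \<rightarrow>\<^sub>M iid P"
        by (intro measurable_iidI measurable_compose[OF measurable_data(1) measurable_iid_component])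
      from measurable_compose[OF measurable_Pair[OF this measurable_seeds[of k]] m] True show ?thesis
        unfolding q_def z by simp
    next
      case False
      thus ?thesis unfolding q_def z by simp
    qed
  qed
  let ?s = "\<lambda>\<omega>. (stop_time n (fst \<omega>) (fst (snd \<omega>)) (fst (snd (snd \<omega>))) k, sample_size n (fst \<omega>) (fst (snd \<omega>)) (fst (snd (snd \<omega>))) k)"
  have "(\<lambda>\<omega>. q (?s \<omega>) \<omega>) \<in> borel_measurable \<Omega>"
    by (rule measurable_compose_countable[where f = q and g = ?s, OF q measurable_stop_size[OF k]])
  thus ?thesis unfolding q_def prod.case passive_err_def[abs_def] Let_def .
qed

lemma nn_integral_seed:
  assumes g: "g \<in> borel_measurable R"
  shows "(\<integral>\<^sup>+\<rho>. g (\<rho> k) \<partial>iid R) = (\<integral>\<^sup>+r. g r \<partial>R)"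
proof -
  have "distr (iid R) R (\<lambda>\<rho>. \<rho> k) = R"
    unfolding iid_def by (rule distr_PiM_component) (auto intro: prob_space_R)
  moreover have "integral\<^sup>N (distr (iid R) R (\<lambda>\<rho>. \<rho> k)) g = (\<integral>\<^sup>+\<rho>. g (\<rho> k) \<partial>iid R)"
    by (rule nn_integral_distr[OF measurable_seed]) (use g in simp)
  ultimately show ?thesis by simp
qed

text \<open>After restarting at the stopping time, start and size of the sample are constants, the
  points are independent of the past, and the seed \<open>\<rho> k\<close> has law \<open>R\<close>.
  So the hypothesis on the passive algorithm applies for each fixed past.\<close>

lemma nn_integral_passive_err_le:
  assumes k: "1 \<le> k" and e: "0 \<le> e"
  shows "(\<integral>\<^sup>+\<omega>. ennreal (passive_err n k l \<omega>) \<partial>\<Omega>) \<le> ennreal e"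
proof (rule nn_integral_data_le[OF prob_space_iid_R])
  interpret R: prob_space R by (rule prob_space_R)
  interpret IR: prob_space "iid R" by (rule prob_space_iid_R)
  show F: "(\<lambda>\<omega>. ennreal (passive_err n k l \<omega>)) \<in> borel_measurable \<Omega>"
    by (rule measurable_compose[OF measurable_passive_err[OF k] measurable_ennreal])
  fix W1 W2 :: "nat \<Rightarrow> 'a"
  have "(\<lambda>z. (fst z, W1, W2, snd z)) \<in> iid P \<Otimes>\<^sub>M iid R \<rightarrow>\<^sub>M \<Omega>"
    by (intro measurable_Pair measurable_fst measurable_snd measurable_const) simp_all
  from measurable_compose[OF this F]
  have F': "(\<lambda>(X, \<rho>). ennreal (passive_err n k l (X, W1, W2, \<rho>))) \<in> borel_measurable (iid P \<Otimes>\<^sub>M iid R)"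
    by (simp add: case_prod_unfold)
  have m: "(\<lambda>\<omega>. stop_time n (fst \<omega>) (fst (snd \<omega>)) (fst (snd (snd \<omega>))) k) \<in> \<Omega> \<rightarrow>\<^sub>M count_space UNIV"
    using measurable_compose[OF measurable_stop_size[OF k], of fst "count_space UNIV" n] by simp
  show "(\<integral>\<^sup>+X. \<integral>\<^sup>+\<rho>. ennreal (passive_err n k l (X, W1, W2, \<rho>)) \<partial>iid R \<partial>iid P) \<le> ennreal e"
  proof (rule strong_markov[where \<tau> = "\<lambda>X. stop_time n X W1 W2 k"])
    show "(\<lambda>X. \<integral>\<^sup>+\<rho>. ennreal (passive_err n k l (X, W1, W2, \<rho>)) \<partial>iid R) \<in> borel_measurable (iid P)"
      by (rule IR.borel_measurable_nn_integral[OF F'])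
    obtain \<rho>0 where "\<rho>0 \<in> space (iid R)" using IR.not_empty by blast
    hence "(W1, W2, \<rho>0) \<in> space (iid P \<Otimes>\<^sub>M iid P \<Otimes>\<^sub>M iid R)" by (simp add: space_pair_measure)
    from measurable_compose[OF measurable_Pair2'[OF this] m]
    show "(\<lambda>X. stop_time n X W1 W2 k) \<in> iid P \<rightarrow>\<^sub>M count_space UNIV" by simp
    show "stop_time n X' W1 W2 k = stop_time n X W1 W2 k" if "\<forall>j\<le>stop_time n X W1 W2 k. X j = X' j" for X X'
      using that by (intro stop_time_past(3)[OF k]) blast
    fix X :: "nat \<Rightarrow> 'a"
    define a r where "a = stop_time n X W1 W2 k" and "r = sample_size n X W1 W2 k"
    have st: "stop_time n (restart a X X') W1 W2 k = a" "sample_size n (restart a X X') W1 W2 k = r" for X'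
      using stop_time_past(3,4)[where X = X and X' = "restart a X X'" and n = n and ?W1.0 = W1 and ?W2.0 = W2, OF k] unfolding a_def r_def by simp_all
    have s: "sample f (\<lambda>i. restart a X X' (a + i)) r = sample f X' r" for X'
      unfolding sample_def by (rule map_cong[OF refl]) auto
    have eq: "passive_err n k l (restart a X X', W1, W2, \<rho>) = (if l \<le> r then err P f (A (\<rho> k) (sample f X' r)) else 0)" for X' \<rho>
      unfolding passive_err_def Let_def fst_conv snd_conv seeds_def st s ..
    show "(\<integral>\<^sup>+X'. \<integral>\<^sup>+\<rho>. ennreal (passive_err n k l (restart (stop_time n X W1 W2 k) X X', W1, W2, \<rho>)) \<partial>iid R \<partial>iid P) \<le> ennreal e"
    proof (cases "l \<le> r")
      case False
      thus ?thesis unfolding a_def[symmetric] eq by simp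
    next
      case True
      let ?g = "\<lambda>X' \<rho>. err P f (A \<rho> (sample f X' r))"
      have int: "integrable (iid P \<Otimes>\<^sub>M R) (\<lambda>(X', \<rho>). ?g X' \<rho>)" "(\<integral>z. (case z of (X', \<rho>) \<Rightarrow> ?g X' \<rho>) \<partial>(iid P \<Otimes>\<^sub>M R)) \<le> e"
        using ach[OF True] unfolding expectation_le_def by blast+
      have gm: "(\<lambda>(X', \<rho>). ennreal (?g X' \<rho>)) \<in> borel_measurable (iid P \<Otimes>\<^sub>M R)"
        using measurable_compose[OF borel_measurable_integrable[OF int(1)] measurable_ennreal] by (simp add: case_prod_unfold)
      have gm1: "(\<lambda>\<rho>. ennreal (?g X' \<rho>)) \<in> borel_measurable R" for X'
        using measurable_compose[OF measurable_Pair1' gm, of X'] by simp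
      have "(\<integral>\<^sup>+X'. \<integral>\<^sup>+\<rho>. ennreal (passive_err n k l (restart a X X', W1, W2, \<rho>)) \<partial>iid R \<partial>iid P)
        = (\<integral>\<^sup>+X'. \<integral>\<^sup>+\<rho>. ennreal (?g X' (\<rho> k)) \<partial>iid R \<partial>iid P)" unfolding eq using True by simp
      also have "\<dots> = (\<integral>\<^sup>+X'. \<integral>\<^sup>+\<rho>. ennreal (?g X' \<rho>) \<partial>R \<partial>iid P)"
        by (simp only: nn_integral_seed[OF gm1])
      also have "\<dots> = (\<integral>\<^sup>+z. (case z of (X', \<rho>) \<Rightarrow> ennreal (?g X' \<rho>)) \<partial>(iid P \<Otimes>\<^sub>M R))"
        using R.nn_integral_fst[OF gm] by simp
      also have "\<dots> = (\<integral>\<^sup>+z. ennreal (case z of (X', \<rho>) \<Rightarrow> ?g X' \<rho>) \<partial>(iid P \<Otimes>\<^sub>M R))"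
        by (simp add: case_prod_unfold)
      also have "\<dots> = ennreal (\<integral>z. (case z of (X', \<rho>) \<Rightarrow> ?g X' \<rho>) \<partial>(iid P \<Otimes>\<^sub>M R))"
        by (rule nn_integral_eq_integral[OF int(1)]) (simp add: case_prod_unfold err_def)
      also have "\<dots> \<le> ennreal e" by (rule ennreal_leI[OF int(2)])
      finally show ?thesis unfolding a_def .
    qed
  qed
qed

end

text \<open>Later rounds do not alter the labels of round \<open>k\<close>, so the candidate was
  trained on the correctly labelled sample that \<open>passive_err\<close> refers to.\<close>

lemma candidate_truth:
  assumes k: "k \<in> {1..d + 1}"
    and fin: "final (trace n X W1 W2 k) = truth X (stop_time n X W1 W2 k + sample_size n X W1 W2 k)"
    and l: "l \<le> sample_size n X W1 W2 k"
  shows "passive_err n k l (X, W1, W2, \<rho>) = err P f (candidate n k (X, W1, W2, \<rho>))"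
proof -
  let ?a = "stop_time n X W1 W2 k" and ?r = "sample_size n X W1 W2 k"
  have k': "1 \<le> k" "k \<le> d + 1" using k by auto
  have t: "take (length (final (trace n X W1 W2 k))) (final (trace n X W1 W2 (d + 1))) = final (trace n X W1 W2 k)"
    using final_trace_mono[where n = n and X = X and ?W1.0 = W1 and ?W2.0 = W2 and k = k and j = "d + 1 - k"] k'(2) by (simp del: One_nat_def)
  have "segment X (final (trace n X W1 W2 (d + 1))) (?a, ?r) = segment X (final (trace n X W1 W2 k)) (?a, ?r)"
    by (rule segment_cong[OF t]) (simp add: final_trace_round(3)[OF k'(1)])
  also have "\<dots> = sample f (\<lambda>i. X (?a + i)) ?r"
    unfolding fin segment_def sample_def prod.case truth_def
    by (rule nth_equalityI) (auto simp del: upt_Suc)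
  finally show ?thesis unfolding candidate_eq[OF k] passive_err_def Let_def fst_conv snd_conv seeds_def using l by simp
qed

end

subsection \<open>The bad events\<close>

context target
begin

lemma measure_shatter_core: "measure (\<Pi>\<^sub>M j\<in>{..<k}. P) (shatter_core C P f k) = block_prob k core"
  unfolding shatter_core_eq block_prob_def ..

lemma block_prob_core_0: "block_prob 0 core = 1"
proof -
  have c: "core []"
    unfolding core_def shatters_Nil using f_in_ball by (metis empty_iff less_imp_le)
  interpret B: prob_space "\<Pi>\<^sub>M j\<in>{..<(0::nat)}. P" by (rule prob_space_PiM_const)
  show ?thesis unfolding block_prob_def using c B.prob_space by simp
qed

lemma block_prob_core_Suc: "block_prob (d + 1) core = 0"
proof -
  have "\<not> core S" if "length S = d + 1" for S
  proof
    assume "core S"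
    hence "shatters (ball_at 1) S" by (simp add: core_def)
    hence "shatters C S" by (rule shatters_mono) (auto simp: concept_ball_def)
    from length_le_vc_dim[OF this vc_dim] that show False by simp
  qed
  hence "{x \<in> space (\<Pi>\<^sub>M j\<in>{..<d + 1}. P). core (map x [0..<d + 1])} = {}" by (auto simp del: upt_Suc)
  thus ?thesis unfolding block_prob_def by (simp only: measure_empty)
qed

text \<open>The core of order 0 has probability 1 because every ball contains the target, and no
  tuple of \<open>d + 1\<close> points is shattered.\<close>

lemma d_tilde_bounds: "1 \<le> d_tilde C P f" "d_tilde C P f \<le> d + 1"
proof -
  let ?Q = "\<lambda>k. measure (\<Pi>\<^sub>M j\<in>{..<k}. P) (shatter_core C P f k) = 0"
  have Q: "?Q (d + 1)" unfolding measure_shatter_core by (rule block_prob_core_Suc)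
  show "d_tilde C P f \<le> d + 1" unfolding d_tilde_def by (rule Least_le[of ?Q, OF Q])
  have "?Q (d_tilde C P f)" unfolding d_tilde_def by (rule LeastI[of ?Q, OF Q])
  hence "d_tilde C P f \<noteq> 0" unfolding measure_shatter_core using block_prob_core_0 by (intro notI) simp
  thus "1 \<le> d_tilde C P f" by simp
qed

lemma block_prob_core_pos:
  assumes "k < d_tilde C P f" shows "0 < block_prob k core"
proof -
  have "block_prob k core \<noteq> 0"
    using not_less_Least[OF assms[unfolded d_tilde_def]] unfolding measure_shatter_core .
  thus ?thesis by (metis block_prob_nonneg less_le)
qed

text \<open>With this radius the exponent is at least \<open>(d + 3) * L\<close>, as
  \<open>ln 2\<close> is at least \<open>2 / 3\<close>. Of it, \<open>d * L\<close> pays for the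
  polynomial factor, \<open>L\<close> for the union over the \<open>l\<close> times, and
  \<open>2 * L\<close> remains.\<close>

lemma outer_le_radius_upto:
  assumes L: "1 \<le> L" and l: "real l \<le> exp L"
  shows "outer_le (iid P) {X. \<exists>m\<in>{1..l}. \<not> version_space m X \<subseteq> ball_at (3 * real (d + 3) * L / real m)} (2 * 3 ^ d * exp (- 2 * L))"
proof -
  have E: "outer_le (iid P) {X. \<not> version_space m X \<subseteq> ball_at (3 * real (d + 3) * L / real m)} (2 * 3 ^ d * exp (- 3 * L))" if m: "m \<in> {1..l}" for m
  proof -
    let ?r = "3 * real (d + 3) * L / real m"
    have rm: "?r * real m = 3 * real (d + 3) * L" using m by simp
    have "9 * 1 \<le> (3 * real (d + 3)) * L" using L by (intro mult_mono) auto
    hence r8: "8 \<le> ?r * real m" unfolding rm by linarith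
    from radius_tail[OF r8] obtain B where B: "B \<in> sets (iid P)"
      "measure (iid P) B \<le> 2 * (real ((2 * m + 1) ^ d) * 2 powr (- (?r * real m / 2)))" "\<And>X. X \<notin> B \<Longrightarrow> version_space m X \<subseteq> ball_at ?r"
      by blast
    define y where "y = real (d + 3) * L"
    have y: "3 * real (d + 3) * L / 2 = 3 / 2 * y" by (simp add: y_def)
    have "(2 / 3) * (3 / 2 * y) \<le> ln 2 * (3 / 2 * y)"
      using ln2_ge_two_thirds L by (intro mult_right_mono) (auto simp: y_def)
    hence "real (d + 3) * L \<le> 3 * real (d + 3) * L / 2 * ln 2" unfolding y by (simp add: y_def mult.commute)
    hence "(2::real) powr (- (3 * real (d + 3) * L / 2)) \<le> exp (- (real (d + 3) * L))"
      unfolding powr_def by simp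
    also have "\<dots> = exp (- (real d * L)) * exp (- 3 * L)" unfolding exp_add[symmetric] by (simp add: algebra_simps)
    finally have p: "(2::real) powr (- (?r * real m / 2)) \<le> exp (- (real d * L)) * exp (- 3 * L)" unfolding rm .
    have "real (2 * m + 1) \<le> 3 * exp L" using m l by auto
    hence "real (2 * m + 1) ^ d \<le> (3 * exp L) ^ d" by (intro power_mono) auto
    hence q: "real ((2 * m + 1) ^ d) \<le> 3 ^ d * exp (real d * L)" unfolding of_nat_power by (simp add: power_mult_distrib exp_of_nat_mult)
    have "real ((2 * m + 1) ^ d) * 2 powr (- (?r * real m / 2)) \<le> (3 ^ d * exp (real d * L)) * (exp (- (real d * L)) * exp (- 3 * L))"
      by (intro mult_mono q p) auto
    also have "\<dots> = 3 ^ d * exp (- 3 * L)" by (simp add: exp_minus)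
    finally have "measure (iid P) B \<le> 2 * 3 ^ d * exp (- 3 * L)" using B(2) by simp
    thus ?thesis using B unfolding outer_le_def by blast
  qed
  have U: "outer_le (iid P) (\<Union>m\<in>{1..l}. {X. \<not> version_space m X \<subseteq> ball_at (3 * real (d + 3) * L / real m)}) (\<Sum>m\<in>{1..l}. 2 * 3 ^ d * exp (- 3 * L))"
    by (rule iid.outer_le_UN_finite[OF _ E]) auto
  have S: "(\<Sum>m\<in>{1..l}. 2 * 3 ^ d * exp (- 3 * L)) \<le> 2 * 3 ^ d * exp (- 2 * L)"
  proof -
    have "(\<Sum>m\<in>{1..l}. 2 * 3 ^ d * exp (- 3 * L)) = 2 * 3 ^ d * (real l * exp (- 3 * L))" by simp
    also have "\<dots> \<le> 2 * 3 ^ d * (exp L * exp (- 3 * L))" using l by (intro mult_left_mono mult_right_mono) auto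
    also have "exp L * exp (- 3 * L) = exp (- 2 * L)" unfolding exp_add[symmetric] by simp
    finally show ?thesis .
  qed
  show ?thesis by (rule outer_le_mono[OF U _ S]) auto
qed

end

context order_k
begin

text \<open>Whether the region at time \<open>i - 1\<close> is small is known before point
  \<open>i\<close> is read. Putting this into the counted event bounds its conditional probability
  by \<open>Q / (i - 1)\<close> for all data, without conditioning on a good run. The sum of these
  bounds is harmonic, and the weight is 2.\<close>

lemma outer_le_region_count:
  assumes i0: "1 \<le> i0" and Q: "0 \<le> Q" and l: "1 \<le> l"
  shows "outer_le (iid P) {X. a \<le> real (card {i \<in> {i0<..l}. X i \<in> region k c (i - 1) X \<and> measure P (region k c (i - 1) X) \<le> Q / real (i - 1)})}
    (exp (Q * (1 + ln (real l)) - a * ln 2))"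
proof -
  define Z where "Z = (\<lambda>i X. i0 < i \<and> X i \<in> region k c (i - 1) X \<and> measure P (region k c (i - 1) X) \<le> Q / real (i - 1))"
  define q where "q = (\<lambda>i. if i \<le> i0 then 0 else Q / real (i - 1))"
  have Zm: "Measurable.pred (iid P) (Z i)" for i
  proof -
    have id: "(\<lambda>X. X) \<in> iid P \<rightarrow>\<^sub>M iid P" by (rule measurable_ident_sets[OF refl])
    have "Measurable.pred (iid P) (\<lambda>X. measure P (region k c (i - 1) X) \<le> Q / real (i - 1))"
      unfolding pred_def by (rule borel_measurable_le[OF measurable_measure_region[OF id] borel_measurable_const])
    moreover have "Measurable.pred (iid P) (\<lambda>X. i0 < i)" by (rule measurable_const) simp
    ultimately show ?thesis unfolding Z_def by (intro pred_intros_logic(3) pred_in_region id measurable_iid_component)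
  qed
  have "measure (iid P) {X. 2 powr a \<le> 2 ^ card {i. i < l + 1 \<and> Z i X}} \<le> exp ((2 - 1) * (\<Sum>i<l + 1. q i) - a * ln 2)"
  proof (rule predictable_count_tail[OF Zm])
    show "Z i X = Z i X'" if "\<forall>j\<le>i. X j = X' j" for i X X'
    proof -
      have "region k c (i - 1) X' = region k c (i - 1) X" by (rule region_past) (use that in auto)
      thus ?thesis using that by (simp add: Z_def)
    qed
    fix i and X :: "nat \<Rightarrow> 'a"
    have "measure P {x. Z i (X(i := x))} \<le> q i"
    proof (cases "i0 < i")
      case True
      have r: "region k c (i - 1) (X(i := x)) = region k c (i - 1) X" for x
        by (rule region_past) (use True in auto)
      have "{x. Z i (X(i := x))} = (if measure P (region k c (i - 1) X) \<le> Q / real (i - 1) then region k c (i - 1) X else {})"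
        unfolding Z_def r using True by auto
      thus ?thesis using True Q by (auto simp: q_def)
    qed (simp add: Z_def q_def)
    thus "(2 - 1) * measure P {x. Z i (X(i := x))} \<le> (2 - 1) * q i" by simp
  qed simp
  also have "exp ((2 - 1) * (\<Sum>i<l + 1. q i) - a * ln 2) \<le> exp (Q * (1 + ln (real l)) - a * ln 2)"
  proof -
    have "(\<Sum>i<l + 1. q i) = (\<Sum>i<l. q (Suc i))"
      unfolding Suc_eq_plus1[symmetric] by (subst sum.lessThan_Suc_shift) (simp add: q_def)
    \<comment> \<open>The term for \<open>i = 0\<close> is \<open>q 1\<close>, which vanishes
      because \<open>i0\<close> is at least 1; this avoids the division by 0.\<close>
    also have "\<dots> \<le> (\<Sum>i<l. if i = 0 then 0 else Q * (1 / real i))"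
      using i0 Q by (intro sum_mono) (auto simp: q_def)
    also have "\<dots> \<le> (\<Sum>i<Suc l. if i = 0 then 0 else Q * (1 / real i))" using Q by (intro sum_mono2) auto
    also have "\<dots> = (\<Sum>i\<in>{1..l}. Q * (1 / real i))"
      by (rule sum.mono_neutral_cong_right) auto
    also have "\<dots> = Q * (\<Sum>i\<in>{1..l}. 1 / real i)" by (simp add: sum_distrib_left)
    also have "\<dots> \<le> Q * (1 + ln (real l))" by (rule mult_left_mono[OF sum_inverse_le_ln[OF l] Q])
    finally show ?thesis by simp
  qed
  finally have le: "measure (iid P) {X. 2 powr a \<le> 2 ^ card {i. i < l + 1 \<and> Z i X}} \<le> exp (Q * (1 + ln (real l)) - a * ln 2)" .
  have cm: "(\<lambda>X. card {i. i < l + 1 \<and> Z i X}) \<in> iid P \<rightarrow>\<^sub>M count_space UNIV"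
  proof (rule measurable_card)
    show "{X \<in> space (iid P). i \<in> {i. i < l + 1 \<and> Z i X}} \<in> sets (iid P)" for i
      using Zm[of i] by (cases "i < l + 1") (auto simp: pred_def)
  qed
  have "{X. (2::real) powr a \<le> 2 ^ card {i. i < l + 1 \<and> Z i X}} \<in> sets (iid P)"
  proof -
    have "Measurable.pred (iid P) (\<lambda>X. (2::real) powr a \<le> 2 ^ card {i. i < l + 1 \<and> Z i X})"
      by (rule measurable_compose[OF cm]) simp
    thus ?thesis by (simp add: pred_def)
  qed
  from outer_leI[OF this le] show ?thesis
  proof (rule outer_le_mono)
    show "{X. a \<le> real (card {i \<in> {i0<..l}. X i \<in> region k c (i - 1) X \<and> measure P (region k c (i - 1) X) \<le> Q / real (i - 1)})}
      \<subseteq> {X. (2::real) powr a \<le> 2 ^ card {i. i < l + 1 \<and> Z i X}}"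
    proof (intro subsetI CollectI)
      fix X assume "X \<in> {X. a \<le> real (card {i \<in> {i0<..l}. X i \<in> region k c (i - 1) X \<and> measure P (region k c (i - 1) X) \<le> Q / real (i - 1)})}"
      moreover have "{i \<in> {i0<..l}. X i \<in> region k c (i - 1) X \<and> measure P (region k c (i - 1) X) \<le> Q / real (i - 1)} = {i. i < l + 1 \<and> Z i X}"
        unfolding Z_def by auto
      ultimately have "a \<le> real (card {i. i < l + 1 \<and> Z i X})" by simp
      hence "(2 :: real) powr a \<le> 2 powr real (card {i. i < l + 1 \<and> Z i X})" by (intro powr_mono) auto
      thus "(2::real) powr a \<le> 2 ^ card {i. i < l + 1 \<and> Z i X}" by (simp add: powr_realpow)
    qed
  qed simp
qed

end

context meta
begin

definition core_prob :: "nat \<Rightarrow> real" where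
  "core_prob k = block_prob (k - 1) core"

lemma obtain_meta_k:
  assumes k: "k \<in> {1..d_tilde C P f}"
  obtains r0 where "meta_k P C f d tie R A k (core_prob k) r0"
proof -
  have pos: "0 < core_prob k" unfolding core_prob_def by (rule block_prob_core_pos) (use k in auto)
  hence "block_prob (k - 1) core < 17 / 16 * core_prob k" by (simp add: core_prob_def)
  from block_prob_ball_near_core[OF this] obtain r0 where r0: "0 < r0" "block_prob (k - 1) (shatters (ball_at r0)) < 17 / 16 * core_prob k" .
  have "meta_k P C f d tie R A k (core_prob k) r0"
    by unfold_locales (use k pos r0 in \<open>auto simp: core_prob_def\<close>)
  thus ?thesis by (rule that)
qed

text \<open>Rate and constant depend on the order through \<open>p\<close> and \<open>r0\<close>;
  only finitely many orders occur, so the smallest rate and the sum of the constants serve for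
  all.\<close>

lemma outer_le_some_round_bad:
  assumes "K \<le> d_tilde C P f"
  shows "\<exists>Kc c. 0 < c \<and> 0 \<le> Kc \<and> (\<forall>i0 n. 1 \<le> i0 \<longrightarrow>
    outer_le \<Omega> {\<omega>\<in>space \<Omega>. \<exists>k\<in>{1..K}. \<not> good_round k (core_prob k) i0 n (fst \<omega>) (fst (snd \<omega>)) (fst (snd (snd \<omega>)))}
      (Kc * (exp (- c * real i0) + exp (- c * real n))))"
  using assms
proof (induction K)
  case 0
  have "outer_le \<Omega> {\<omega>\<in>space \<Omega>. \<exists>k\<in>{1..0}. \<not> good_round k (core_prob k) i0 n (fst \<omega>) (fst (snd \<omega>)) (fst (snd (snd \<omega>)))}
      (0 * (exp (- 1 * real i0) + exp (- 1 * real n)))" for i0 n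
    by (rule outer_le_mono[OF outer_le_empty]) auto
  thus ?case by (intro exI[of _ 0] exI[of _ 1]) auto
next
  case (Suc K)
  interpret O: prob_space \<Omega> by (rule prob_space_\<Omega>)
  let ?b = "\<lambda>k i0 n. {\<omega>\<in>space \<Omega>. \<not> good_round k (core_prob k) i0 n (fst \<omega>) (fst (snd \<omega>)) (fst (snd (snd \<omega>)))}"
  let ?B = "\<lambda>K i0 n. {\<omega>\<in>space \<Omega>. \<exists>k\<in>{1..K}. \<not> good_round k (core_prob k) i0 n (fst \<omega>) (fst (snd \<omega>)) (fst (snd (snd \<omega>)))}"
  obtain K1 c1 where 1: "0 < c1" "0 \<le> K1" "\<And>i0 n. 1 \<le> i0 \<Longrightarrow> outer_le \<Omega> (?B K i0 n) (K1 * (exp (- c1 * real i0) + exp (- c1 * real n)))"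
    using Suc.IH Suc.prems by (meson Suc_leD)
  have "Suc K \<in> {1..d_tilde C P f}" using Suc.prems by simp
  from obtain_meta_k[OF this] obtain r0 where M: "meta_k P C f d tie R A (Suc K) (core_prob (Suc K)) r0" .
  obtain K2 c2 where 2: "0 < c2" "0 \<le> K2" "\<And>i0 n. 1 \<le> i0 \<Longrightarrow> outer_le \<Omega> (?b (Suc K) i0 n) (K2 * (exp (- c2 * real i0) + exp (- c2 * real n)))"
    by (rule meta_k.outer_le_not_good_round[OF M]) blast
  define c where "c = min c1 c2"
  have c: "0 < c" "c \<le> c1" "c \<le> c2" using 1 2 by (auto simp: c_def)
  have "outer_le \<Omega> (?B (Suc K) i0 n) ((K1 + K2) * (exp (- c * real i0) + exp (- c * real n)))" if i0: "1 \<le> i0" for i0 n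
  proof (rule outer_le_mono[OF O.outer_le_Un[OF 1(3)[OF i0] 2(3)[OF i0]]])
    show "?B (Suc K) i0 n \<subseteq> ?B K i0 n \<union> ?b (Suc K) i0 n"
      by (auto simp: atLeastAtMostSuc_conv simp del: One_nat_def)
    have e: "exp (- c1 * x) + exp (- c1 * y) \<le> exp (- c * x) + exp (- c * y)" "exp (- c2 * x) + exp (- c2 * y) \<le> exp (- c * x) + exp (- c * y)"
      if "0 \<le> x" "0 \<le> y" for x y
      using c that by (auto intro!: add_mono mult_right_mono)
    show "K1 * (exp (- c1 * real i0) + exp (- c1 * real n)) + K2 * (exp (- c2 * real i0) + exp (- c2 * real n))
      \<le> (K1 + K2) * (exp (- c * real i0) + exp (- c * real n))"
      unfolding distrib_right by (intro add_mono mult_left_mono e 1 2) auto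
  qed
  thus ?case using c(1) 1(2) 2(2) by (intro exI[of _ "K1 + K2"] exI[of _ c]) auto
qed

end

subsection \<open>Size of the sample collected in the decisive round\<close>

context meta
begin

lemma block_prob_version_space_le:
  assumes th: "theta C P f k (1 / real l) = ereal \<theta>" and l: "1 \<le> l" and r: "1 / real l < r" and V: "version_space m X \<subseteq> ball_at r"
  shows "block_prob k (shatters (version_space m X)) \<le> \<theta> * r"
proof -
  have "0 < 1 / real l" using l by simp
  hence r0: "0 < r" using r by linarith
  have "block_prob k (shatters (version_space m X)) \<le> block_prob k (shatters (ball_at r))"
    by (rule block_prob_mono[OF block_pred_shatters[OF ball_meas[OF r0]]]) (erule shatters_mono, rule V)
  also have "\<dots> \<le> \<theta> * r" by (rule block_prob_ball_le_theta[OF \<open>0 < 1 / real l\<close> r th])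
  finally show ?thesis .
qed

text \<open>A while loop that stopped before \<open>l\<close> points would have made at least
  \<open>T / 4\<close> requests, more than the burn-in and the small regions allow. So it reads at
  least \<open>l\<close> points, the region is then of order \<open>\<theta> * B * L / l\<close>,
  and dividing the budget by it yields at least \<open>l\<close> points.\<close>

lemma sample_size_ge:
  fixes B L \<theta> p a :: real
  assumes K: "1 \<le> K" and good: "\<And>k. k \<in> {1..K} \<Longrightarrow> good_round k (core_prob k) i0 n X W1 W2"
    and V: "\<And>m. m \<in> {1..l} \<Longrightarrow> version_space m X \<subseteq> ball_at (B * L / real m)"
    and p: "p = core_prob K" "0 < p"
    and cnt: "real (card {i \<in> {i0<..l}. X i \<in> region K (p / 4) (i - 1) X \<and>
        measure P (region K (p / 4) (i - 1) X) \<le> (4 / p * \<theta> * B * L) / real (i - 1)}) < real n / 8 ^ (K + 1)"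
    and th: "theta C P f K (1 / real l) = ereal \<theta>" and l: "1 \<le> l" "l \<le> 2 ^ n" and BL: "1 < B * L"
    and i0: "1 \<le> i0" "real i0 \<le> real n / (32 * 8 ^ K)" and n: "8 * 8 ^ K \<le> real n"
    and big: "9 + 96 / p * \<theta> * B * L \<le> real n / 8 ^ K"
  shows "l \<le> sample_size n X W1 W2 K \<and> final (trace n X W1 W2 K) = truth X (stop_time n X W1 W2 K + sample_size n X W1 W2 K)"
proof -
  define N where "N = real n / 8 ^ K"
  have N: "8 \<le> N" using n by (simp add: N_def pos_le_divide_eq)
  have i0n: "real i0 \<le> real n / 32"
  proof -
    have "(1::real) \<le> 8 ^ K" by simp
    hence "real n / (32 * 8 ^ K) \<le> real n / 32" by (intro divide_left_mono) auto
    thus ?thesis using i0(2) by linarith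
  qed
  have scale: "M \<le> (c / p) * y" if "p / c * M \<le> y" "0 < c" for M c y :: real
    using mult_left_mono[OF that(1), of "c / p"] that(2) p(2) by simp
  let ?T = "budget_at n X W1 W2 K" and ?\<tau> = "stop_time n X W1 W2 K" and ?s = "sample_size n X W1 W2 K"
  let ?c = "\<lambda>m. card {i \<in> {m<..?\<tau>}. asks K X W2 (truth X (i - 1))}"
  have "real n / 8 ^ K \<le> real ?T \<and> i0 \<le> ?\<tau> \<and> snd (while_state n X W1 W2 K) = truth X ?\<tau> \<and>
    final (trace n X W1 W2 K) = truth X (?\<tau> + ?s) \<and>
    (\<exists>m \<le> ?\<tau>. (let c = ?c m; u = nat \<lceil>real ?T / 4\<rceil> in c \<le> u \<and> (c = u \<or> K * 2 ^ n < ?\<tau>)) \<and> (K = 1 \<or> i0 \<le> m)) \<and>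
    (case trace n X W1 W2 K of (segs, T, t, ys) \<Rightarrow> T = ?T \<and> t \<le> nat \<lfloor>3 * real T / 4\<rfloor>)"
  proof (rule trace_truth[where D = "\<lambda>k m. region k (core_prob k / 4) m X" and ?i0.0 = i0 and K = K])
    fix k i assume k: "1 \<le> k" "k \<le> K"
    hence g: "good_round k (core_prob k) i0 n X W1 W2" using good by simp
    show "guess k X W2 (truth X i) = f (X (Suc i))" if "i0 \<le> i" "\<not> asks k X W2 (truth X i)"
      using g that unfolding good_round_def by blast
    show "X (Suc i) \<in> region k (core_prob k / 4) m X" if "i0 \<le> m" "m \<le> i" "asks k X W2 (truth X i)" for m
      using g that unfolding good_round_def by blast
  next
    fix k assume k: "1 \<le> k" "k \<le> K"
    hence g: "good_round k (core_prob k) i0 n X W1 W2" using good by simp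
    assume "snd (while_state n X W1 W2 k) = truth X (stop_time n X W1 W2 k)" "i0 \<le> stop_time n X W1 W2 k" "real n / 8 ^ k \<le> real (budget_at n X W1 W2 k)"
    thus "real (card {i \<in> {1..sample_size n X W1 W2 k}. X (stop_time n X W1 W2 k + i) \<in> region k (core_prob k / 4) (stop_time n X W1 W2 k) X})
      \<le> real (budget_at n X W1 W2 k) / 2 - 2"
      using g unfolding good_round_def by blast
  qed (use K n i0n in auto)
  then obtain m where T: "N \<le> real ?T" and \<tau>: "i0 \<le> ?\<tau>" and w: "snd (while_state n X W1 W2 K) = truth X ?\<tau>"
    and fin: "final (trace n X W1 W2 K) = truth X (?\<tau> + ?s)" and m: "?c m = nat \<lceil>real ?T / 4\<rceil> \<or> K * 2 ^ n < ?\<tau>"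
    unfolding Let_def N_def by blast
  have g: "good_round K p i0 n X W1 W2" using good[of K] K p by simp
  \<comment> \<open>With \<open>N = n / 8 ^ K\<close>, the requests would number at least
    \<open>N / 4\<close>, but the burn-in and the later points provide fewer than
    \<open>N / 32 + N / 8\<close>.\<close>
  have \<tau>l: "l \<le> ?\<tau>"
  proof (rule ccontr)
    assume "\<not> l \<le> ?\<tau>"
    hence lt: "?\<tau> < l" by simp
    have "1 * 2 ^ n \<le> K * 2 ^ n" using K by (intro mult_right_mono) auto
    hence "?c m = nat \<lceil>real ?T / 4\<rceil>" using m lt l by linarith
    hence "real ?T / 4 \<le> real (?c m)" by linarith
    let ?S = "{i \<in> {i0<..l}. X i \<in> region K (p / 4) (i - 1) X \<and>
        measure P (region K (p / 4) (i - 1) X) \<le> (4 / p * \<theta> * B * L) / real (i - 1)}"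
    have sub: "{i \<in> {m<..?\<tau>}. asks K X W2 (truth X (i - 1))} \<subseteq> {1..i0} \<union> ?S"
    proof
      fix i assume i: "i \<in> {i \<in> {m<..?\<tau>}. asks K X W2 (truth X (i - 1))}"
      show "i \<in> {1..i0} \<union> ?S"
      proof (cases "i \<le> i0")
        case True
        thus ?thesis using i by auto
      next
        case False
        hence i': "i0 \<le> i - 1" "Suc (i - 1) = i" "1 \<le> i - 1" "i - 1 \<le> l" using i i0 lt by auto
        have r: "X i \<in> region K (p / 4) (i - 1) X"
          using g i i'(1,2) unfolding good_round_def by fastforce
        let ?r = "B * L / real (i - 1)"
        have "1 / real l \<le> 1 / real (i - 1)" using i' by (intro divide_left_mono) auto
        also have "\<dots> < ?r" using BL i' by (intro divide_strict_right_mono) auto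
        finally have lr: "1 / real l < ?r" .
        have "p / 4 * measure P (region K (p / 4) (i - 1) X) \<le> block_prob K (shatters (version_space (i - 1) X))"
          by (rule measure_region_le) (use K p in auto)
        also have "\<dots> \<le> \<theta> * ?r"
          by (rule block_prob_version_space_le[OF th l(1) lr V]) (use i' in auto)
        finally have "measure P (region K (p / 4) (i - 1) X) \<le> (4 / p) * (\<theta> * ?r)" by (rule scale) simp
        hence "measure P (region K (p / 4) (i - 1) X) \<le> (4 / p * \<theta> * B * L) / real (i - 1)" by (simp add: mult.assoc)
        thus ?thesis using r False i lt by auto
      qed
    qed
    have "?c m \<le> card ({1..i0} \<union> ?S)" by (rule card_mono[OF _ sub]) auto
    also have "\<dots> \<le> i0 + card ?S" using card_Un_le[of "{1..i0}" ?S] by simp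
    finally have "real (?c m) < real i0 + real n / 8 ^ (K + 1)" using cnt by linarith
    moreover have "real n / 8 ^ (K + 1) = N / 8" "real n / (32 * 8 ^ K) = N / 32" by (simp_all add: N_def)
    ultimately show False using \<open>real ?T / 4 \<le> real (?c m)\<close> T i0(2) N by linarith
  qed
  \<comment> \<open>Since at least \<open>l\<close> points were read, the radius at time
    \<open>l\<close> bounds the version space, and \<open>3 / real ?\<tau>\<close> is at most
    \<open>3 / real l\<close>. Three times the resulting numerator is the constant in
    \<open>big\<close>.\<close>
  let ?\<Delta> = "Delta_hat_total W1 W2 K ?\<tau> (version_space ?\<tau> X)"
  have \<Delta>: "0 < ?\<Delta>" "?\<Delta> \<le> measure P (region K (p / 32) ?\<tau> X) + 3 / real ?\<tau>"
    using g \<tau> unfolding good_round_def by blast+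
  have s: "?s = nat \<lfloor>real ?T / (3 * ?\<Delta>)\<rfloor>" unfolding sample_size_def do_steps_def w consistent_truth length_truth ..
  let ?r = "B * L / real l"
  have lr: "1 / real l < ?r" using BL l by (intro divide_strict_right_mono) auto
  have "p / 32 * measure P (region K (p / 32) ?\<tau> X) \<le> block_prob K (shatters (version_space ?\<tau> X))"
    by (rule measure_region_le) (use K p in auto)
  also have "\<dots> \<le> \<theta> * ?r"
    by (rule block_prob_version_space_le[OF th l(1) lr]) (use V[of l] l version_space_antimono[OF \<tau>l, of X] in auto)
  finally have "measure P (region K (p / 32) ?\<tau> X) \<le> (32 / p) * (\<theta> * ?r)" by (rule scale) simp
  hence "measure P (region K (p / 32) ?\<tau> X) \<le> (32 / p * \<theta> * B * L) / real l" by (simp add: mult.assoc)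
  moreover have "3 / real ?\<tau> \<le> 3 / real l" using \<tau>l l by (intro divide_left_mono) auto
  ultimately have "?\<Delta> \<le> (32 / p * \<theta> * B * L + 3) / real l" using \<Delta>(2) unfolding add_divide_distrib by linarith
  hence "?\<Delta> * real l \<le> 32 / p * \<theta> * B * L + 3" using l by (simp add: pos_le_divide_eq)
  moreover have "96 / p * \<theta> * B * L = 3 * (32 / p * \<theta> * B * L)" by simp
  moreover have "real l * (3 * ?\<Delta>) = 3 * (?\<Delta> * real l)" by simp
  ultimately have "real l * (3 * ?\<Delta>) \<le> real ?T" using big T unfolding N_def by linarith
  hence "real l \<le> real ?T / (3 * ?\<Delta>)" using \<Delta>(1) by (simp add: pos_le_divide_eq)
  hence "l \<le> ?s" unfolding s by (rule le_nat_floor)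
  thus ?thesis using fin by blast
qed

text \<open>Radii above \<open>1 / real l\<close> give quotients of at most \<open>l\<close>, so the
  supremum is finite.\<close>

lemma theta_real:
  assumes l: "1 \<le> l"
  obtains \<theta> where "theta C P f k (1 / real l) = ereal \<theta>" "1 \<le> \<theta>"
proof -
  have "theta C P f k (1 / real l) \<le> ereal (real l)"
    unfolding theta_def shattered_tuples_eq
  proof (intro max.boundedI SUP_least)
    show "(1::ereal) \<le> ereal (real l)" using l by (simp add: one_ereal_def)
    fix r assume "r \<in> {1 / real l<..}"
    hence r: "1 / real l < r" by simp
    moreover have "0 < 1 / real l" using l by simp
    ultimately have "0 < r" by linarith
    have "block_prob k (shatters (ball_at r)) / r \<le> 1 / r" using \<open>0 < r\<close> by (intro divide_right_mono) auto
    also have "\<dots> \<le> real l" using r l \<open>0 < r\<close> by (simp add: field_simps)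
    finally show "ereal (block_prob k (shatters (ball_at r)) / r) \<le> ereal (real l)" by simp
  qed
  moreover have "1 \<le> theta C P f k (1 / real l)" unfolding theta_def by simp
  ultimately show ?thesis using that by (cases "theta C P f k (1 / real l)") (auto simp: one_ereal_def)
qed

text \<open>Off the bad set the output errs at most twice as much as candidate \<open>K\<close>,
  whose error is \<open>passive_err\<close>; on it errors are at most 1. Both terms have
  unconditional bounds, so conditional expectations given a good run do not occur.\<close>

lemma expectation_output_le:
  fixes e L \<theta> b1 b2 b3 b4 :: real
  assumes ach: "\<And>m. l \<le> m \<Longrightarrow> expectation_le (iid P \<Otimes>\<^sub>M R) (\<lambda>(X, \<rho>). err P f (A \<rho> (sample f X m))) e" and e: "0 \<le> e"
    and K: "K = d_tilde C P f" and p: "p = core_prob K"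
    and L: "1 \<le> L" "real l \<le> exp L"
    and b1: "outer_le \<Omega> {\<omega>\<in>space \<Omega>. \<exists>k\<in>{1..K}. \<not> good_round k (core_prob k) i0 n (fst \<omega>) (fst (snd \<omega>)) (fst (snd (snd \<omega>)))} b1"
    and b2: "measure \<Omega> {\<omega>\<in>space \<Omega>. selection_fails n \<omega>} \<le> b2"
    and b4: "exp (4 / p * \<theta> * (3 * real (d + 3)) * L * (1 + ln (real l)) - real n / 8 ^ (K + 1) * ln 2) \<le> b4"
    and th: "theta C P f K (1 / real l) = ereal \<theta>" "1 \<le> \<theta>" and l: "1 \<le> l" "l \<le> 2 ^ n"
    and i0: "1 \<le> i0" "real i0 \<le> real n / (32 * 8 ^ K)" and n: "8 * 8 ^ K \<le> real n"
    and big: "9 + 96 / p * \<theta> * (3 * real (d + 3)) * L \<le> real n / 8 ^ K"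
  shows "expectation_le \<Omega> (\<lambda>\<omega>. err P f (candidate n (choice n \<omega>) \<omega>)) (2 * e + (b1 + b2 + (2 * 3 ^ d * exp (- 2 * L) + b4)))"
proof -
  interpret O: prob_space \<Omega> by (rule prob_space_\<Omega>)
  let ?B = "3 * real (d + 3)"
  have K1: "1 \<le> K" "K \<le> d + 1" using d_tilde_bounds K by auto
  have "K \<in> {1..d_tilde C P f}" using K1 K by simp
  from obtain_meta_k[OF this] obtain r0 where M: "meta_k P C f d tie R A K (core_prob K) r0" .
  interpret M: meta_k P C f d tie R A K "core_prob K" r0 by (rule M)
  have p0: "0 < p" using M.p_pos p by simp
  have BL: "1 < ?B * L"
  proof -
    have "9 * 1 \<le> ?B * L" using L by (intro mult_mono) auto
    thus ?thesis by linarith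
  qed
  let ?E1 = "{\<omega>\<in>space \<Omega>. \<exists>k\<in>{1..K}. \<not> good_round k (core_prob k) i0 n (fst \<omega>) (fst (snd \<omega>)) (fst (snd (snd \<omega>)))}"
  let ?E2 = "{\<omega>\<in>space \<Omega>. selection_fails n \<omega>}"
  let ?Q = "4 / p * \<theta> * ?B * L"
  let ?V = "{X. \<exists>m\<in>{1..l}. \<not> version_space m X \<subseteq> ball_at (?B * L / real m)}"
  let ?N = "{X. real n / 8 ^ (K + 1) \<le> real (card {i \<in> {i0<..l}. X i \<in> region K (p / 4) (i - 1) X \<and> measure P (region K (p / 4) (i - 1) X) \<le> ?Q / real (i - 1)})}"
  have Q: "0 \<le> ?Q" using p0 th(2) L by simp
  have o2: "outer_le \<Omega> ?E2 b2" by (rule outer_leI) (use pred_selection_fails b2 in \<open>auto simp: pred_def\<close>)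
  have o3: "outer_le \<Omega> {\<omega>\<in>space \<Omega>. fst \<omega> \<in> ?V} (2 * 3 ^ d * exp (- 2 * L))"
    by (rule outer_le_X[OF prob_space_iid_R outer_le_radius_upto[OF L]])
  have o4: "outer_le \<Omega> {\<omega>\<in>space \<Omega>. fst \<omega> \<in> ?N} b4"
    by (rule outer_le_X[OF prob_space_iid_R outer_le_mono[OF M.outer_le_region_count[OF i0(1) Q l(1)] order_refl b4]])
  have "outer_le \<Omega> ((?E1 \<union> ?E2) \<union> ({\<omega>\<in>space \<Omega>. fst \<omega> \<in> ?V} \<union> {\<omega>\<in>space \<Omega>. fst \<omega> \<in> ?N})) (b1 + b2 + (2 * 3 ^ d * exp (- 2 * L) + b4))"
    by (intro O.outer_le_Un b1 o2 o3 o4)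
  then obtain Bad where Bad: "Bad \<in> sets \<Omega>" "(?E1 \<union> ?E2) \<union> ({\<omega>\<in>space \<Omega>. fst \<omega> \<in> ?V} \<union> {\<omega>\<in>space \<Omega>. fst \<omega> \<in> ?N}) \<subseteq> Bad"
    "measure \<Omega> Bad \<le> b1 + b2 + (2 * 3 ^ d * exp (- 2 * L) + b4)" unfolding outer_le_def by blast
  let ?out = "\<lambda>\<omega>. err P f (candidate n (choice n \<omega>) \<omega>)"
  \<comment> \<open>A pointwise bound allows the bad event to be replaced by its measurable superset
    \<open>Bad\<close>.\<close>
  have pw: "?out \<omega> \<le> 2 * passive_err n K l \<omega> + indicator Bad \<omega>" if w: "\<omega> \<in> space \<Omega>" for \<omega>
  proof (cases "\<omega> \<in> Bad")
    case True
    have "?out \<omega> \<le> 1" by (simp add: err_def)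
    moreover have "0 \<le> passive_err n K l \<omega>" by (simp add: passive_err_def Let_def err_def)
    ultimately show ?thesis using True by simp
  next
    case False
    obtain X W1 W2 \<rho> where ww: "\<omega> = (X, W1, W2, \<rho>)" by (cases \<omega>)
    have un: "\<omega> \<notin> (?E1 \<union> ?E2) \<union> ({\<omega>\<in>space \<Omega>. fst \<omega> \<in> ?V} \<union> {\<omega>\<in>space \<Omega>. fst \<omega> \<in> ?N})"
      by (rule contra_subsetD[OF Bad(2) False])
    have nE: "\<omega> \<notin> ?E1" "\<omega> \<notin> ?E2" using un by (meson UnI1 UnI2)+
    have "fst \<omega> \<notin> ?V" by (rule contrapos_nn[OF un], rule UnI2, rule UnI1, rule CollectI, rule conjI[OF w])
    hence nV: "X \<notin> ?V" unfolding ww fst_conv .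
    have "fst \<omega> \<notin> ?N" by (rule contrapos_nn[OF un], rule UnI2, rule UnI2, rule CollectI, rule conjI[OF w])
    hence nN: "X \<notin> ?N" unfolding ww fst_conv .
    have "l \<le> sample_size n X W1 W2 K \<and> final (trace n X W1 W2 K) = truth X (stop_time n X W1 W2 K + sample_size n X W1 W2 K)"
    proof (rule sample_size_ge[where B = ?B and L = L and \<theta> = \<theta> and p = p])
      show "good_round k (core_prob k) i0 n X W1 W2" if "k \<in> {1..K}" for k
        using nE(1) w that unfolding ww by auto
      show "version_space m X \<subseteq> ball_at (?B * L / real m)" if "m \<in> {1..l}" for m
        using nV that by blast
      show "real (card {i \<in> {i0<..l}. X i \<in> region K (p / 4) (i - 1) X \<and> measure P (region K (p / 4) (i - 1) X) \<le> ?Q / real (i - 1)}) < real n / 8 ^ (K + 1)"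
        using nN unfolding mem_Collect_eq not_le .
    qed (fact K1 p p0 th l BL i0 n big)+
    hence "passive_err n K l \<omega> = err P f (candidate n K \<omega>)" unfolding ww using K1 by (intro candidate_truth) auto
    moreover have "\<not> selection_fails n \<omega>" using nE(2) w by blast
    hence "?out \<omega> \<le> 2 * err P f (candidate n K \<omega>)" using K1 unfolding selection_fails_def by (auto simp: not_less)
    ultimately show ?thesis using False by simp
  qed
  have pm: "passive_err n K l \<in> borel_measurable \<Omega>" by (rule measurable_passive_err[OF ach K1(1)])
  have pe: "0 \<le> passive_err n K l \<omega>" "passive_err n K l \<omega> \<le> 1" for \<omega> by (simp_all add: passive_err_def Let_def err_def)
  have pi: "integrable \<Omega> (passive_err n K l)"
    by (rule O.integrable_const_bound[where B = 1]) (use pm pe in auto)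
  have oi: "integrable \<Omega> ?out"
    by (rule O.integrable_const_bound[where B = 1]) (use measurable_output_err[of n] in \<open>auto simp: err_def\<close>)
  have bi: "integrable \<Omega> (indicator Bad :: _ \<Rightarrow> real)"
    by (rule O.integrable_const_bound[where B = 1]) (use Bad(1) in \<open>auto simp: indicator_def\<close>)
  have im: "(\<integral>\<omega>. indicator Bad \<omega> \<partial>\<Omega>) = measure \<Omega> Bad"
    using Bad(1) sets.sets_into_space[OF Bad(1)] by (simp add: Int_absorb2)
  have "ennreal (\<integral>\<omega>. passive_err n K l \<omega> \<partial>\<Omega>) = (\<integral>\<^sup>+\<omega>. ennreal (passive_err n K l \<omega>) \<partial>\<Omega>)"
    by (rule nn_integral_eq_integral[OF pi, symmetric]) (simp add: pe)
  also have "\<dots> \<le> ennreal e" by (rule nn_integral_passive_err_le[OF ach K1(1) e])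
  finally have pl: "(\<integral>\<omega>. passive_err n K l \<omega> \<partial>\<Omega>) \<le> e" using e by (simp add: ennreal_le_iff)
  have "(\<integral>\<omega>. ?out \<omega> \<partial>\<Omega>) \<le> (\<integral>\<omega>. 2 * passive_err n K l \<omega> + indicator Bad \<omega> \<partial>\<Omega>)"
    by (rule integral_mono[OF oi]) (use pi bi pw in auto)
  also have "\<dots> = 2 * (\<integral>\<omega>. passive_err n K l \<omega> \<partial>\<Omega>) + measure \<Omega> Bad"
    by (simp only: Bochner_Integration.integral_add[OF integrable_mult_right[OF pi] bi] im integral_mult_right_zero)
  also have "\<dots> \<le> 2 * e + (b1 + b2 + (2 * 3 ^ d * exp (- 2 * L) + b4))" using pl Bad(3) by simp
  finally show ?thesis unfolding expectation_le_def using oi by blast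
qed

end

section \<open>Choice of the constants\<close>

context meta
begin

text \<open>With \<open>L = ln (l / e)\<close> every failure term is at most a constant times
  \<open>exp (- 2 * L)\<close>, and \<open>exp (- L) = e / l\<close> is at most \<open>e\<close>.
  The failures thus cost at most \<open>C0 * e * e\<close>, which is at most \<open>e / 2\<close>
  below \<open>e0\<close>, while the passive algorithm contributes
  \<open>2 * (e / 4)\<close>.\<close>

lemma eventually_expectation_le:
  obtains c e0 :: real where "0 < e0" "e0 < 1" "0 \<le> c"
    "\<And>e l \<theta> n. 0 < e \<Longrightarrow> e < e0 \<Longrightarrow> 1 \<le> l \<Longrightarrow>
       (\<And>m. l \<le> m \<Longrightarrow> expectation_le (iid P \<Otimes>\<^sub>M R) (\<lambda>(X, \<rho>). err P f (A \<rho> (sample f X m))) (e / 4)) \<Longrightarrow>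
       theta_tilde C P f (1 / real l) = ereal \<theta> \<Longrightarrow> 1 \<le> \<theta> \<Longrightarrow> c * (\<theta> * (ln (real l / e))\<^sup>2) \<le> real n \<Longrightarrow>
       expectation_le \<Omega> (\<lambda>\<omega>. err P f (candidate n (choice n \<omega>) \<omega>)) e"
proof -
  define K where "K = d_tilde C P f"
  define p where "p = core_prob K"
  have K: "1 \<le> K" "K \<le> d + 1" using d_tilde_bounds by (auto simp: K_def)
  have p: "0 < p" unfolding p_def core_prob_def by (rule block_prob_core_pos) (use K in \<open>auto simp: K_def\<close>)
  obtain Kc c1 where c1: "0 < c1" "0 \<le> Kc" and bad: "\<And>i0 n. 1 \<le> i0 \<Longrightarrow>
    outer_le \<Omega> {\<omega>\<in>space \<Omega>. \<exists>k\<in>{1..K}. \<not> good_round k (core_prob k) i0 n (fst \<omega>) (fst (snd \<omega>)) (fst (snd (snd \<omega>)))}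
      (Kc * (exp (- c1 * real i0) + exp (- c1 * real n)))"
    using outer_le_some_round_bad[of K] unfolding K_def by blast
  \<comment> \<open>The burn-in is a fraction \<open>1 / M\<close> of the budget; \<open>M\<close>
    dominates \<open>32 * 8 ^ K\<close> for every possible \<open>K\<close>, as
    \<open>sample_size_ge\<close> demands.\<close>
  define M :: nat where "M = 32 * 8 ^ (d + 1)"
  define D where "D = real (d + 1) ^ 2 * ln (exp 1 * real (d + 1))"
  define B where "B = 3 * real (d + 3)"
  have M0: "0 < M" by (simp add: M_def)
  hence M: "1 \<le> real M" "0 < M" by linarith+
  have D: "1 \<le> D"
  proof -
    have "1 \<le> ln (exp 1 * real (d + 1))" by (simp add: ln_mult)
    moreover have "(1::real) \<le> real (d + 1) ^ 2" by (rule one_le_power) simp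
    ultimately have "1 * 1 \<le> D" unfolding D_def by (intro mult_mono) auto
    thus ?thesis by simp
  qed
  have B: "0 \<le> B" by (simp add: B_def)
  \<comment> \<open>\<open>A3\<close> serves the count of small regions, where
    \<open>12 * 8 ^ K\<close> is \<open>8 ^ (K + 1)\<close> divided by the lower bound
    \<open>2 / 3\<close> of \<open>ln 2\<close>; \<open>A5\<close> serves the sample size.\<close>
  define A3 A5 where "A3 = 12 * 8 ^ K * (8 * B / p + 2)" and "A5 = 8 ^ K * (9 + 96 / p * B)"
  \<comment> \<open>A sum rather than a maximum, so that each requirement on \<open>n\<close>
    follows from one summand: burn-in, selection with \<open>600 = 2 * 100 * 3\<close>, small
    regions, \<open>l \<le> 2 ^ n\<close>, sample size, and \<open>1 \<le> i0\<close>.\<close>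
  define c where "c = 2 * real M / c1 + 600 * D + A3 + 2 + A5 + real M"
  have nn: "0 \<le> 2 * real M / c1" "0 \<le> 600 * D" "0 \<le> A3" "0 \<le> A5" using c1 D B p by (auto simp: A3_def A5_def)
  define C0 where "C0 = Kc * (exp c1 + 1) + real (d + 1) * exp 1 + (2 * 3 ^ d + 1)"
  have "0 \<le> Kc * (exp c1 + 1)" using c1 by simp
  moreover have "0 \<le> real (d + 1) * exp 1" by simp
  moreover have "(0::real) < 2 * 3 ^ d" by simp
  ultimately have C0: "0 < C0" unfolding C0_def by linarith
  \<comment> \<open>The first term ensures \<open>1 \<le> L\<close>, the second
    \<open>C0 * e \<le> 1 / 2\<close>.\<close>
  define e0 where "e0 = min (exp (- 1)) (1 / (2 * C0))"
  have e0: "0 < e0" using C0 by (simp add: e0_def)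
  have e01: "e0 < 1" using exp_less_one_iff[of "- 1 :: real"] unfolding e0_def by linarith
  show ?thesis
  proof (rule that[of e0 c])
    fix e :: real and l n :: nat and \<theta> :: real
    assume e: "0 < e" "e < e0" and l: "1 \<le> l"
      and ach: "\<And>m. l \<le> m \<Longrightarrow> expectation_le (iid P \<Otimes>\<^sub>M R) (\<lambda>(X, \<rho>). err P f (A \<rho> (sample f X m))) (e / 4)"
      and th: "theta_tilde C P f (1 / real l) = ereal \<theta>" "1 \<le> \<theta>" and n: "c * (\<theta> * (ln (real l / e))\<^sup>2) \<le> real n"
    define L where "L = ln (real l / e)"
    have le0: "0 < real l / e" using e l by simp
    have eL: "exp L = real l / e" unfolding L_def using le0 by simp
    have e1: "e < exp (- 1)" "e < 1 / (2 * C0)" "e < 1" using e e01 by (auto simp: e0_def)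
    have "exp 1 * e \<le> exp 1 * exp (- 1)" using e1 by (intro mult_left_mono) auto
    also have "\<dots> = (1::real)" unfolding exp_add[symmetric] by simp
    finally have "exp 1 * e \<le> real l" using l by linarith
    hence "exp 1 \<le> exp L" unfolding eL using e by (simp add: pos_le_divide_eq)
    hence L: "1 \<le> L" by simp
    have "real l * e \<le> real l * 1" using e1 by (intro mult_left_mono) auto
    hence lL: "real l \<le> exp L" unfolding eL using e by (simp add: pos_le_divide_eq)
    have "ln (real l) \<le> ln (exp L)" using lL l by (subst ln_le_cancel_iff) auto
    hence lnl: "ln (real l) \<le> L" by simp
    define X where "X = \<theta> * L\<^sup>2"
    have "1 * L \<le> \<theta> * L" using th L by (intro mult_right_mono) auto
    hence X1: "L \<le> \<theta> * L" by simp
    have "\<theta> * L * 1 \<le> \<theta> * L * L" using th L by (intro mult_left_mono) auto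
    hence X2: "\<theta> * L \<le> X" by (simp add: X_def power2_eq_square mult.assoc)
    have X: "L \<le> X" "1 \<le> X" using X1 X2 L by linarith+
    have nX: "a * X \<le> real n" if "a \<le> c" for a
      using n mult_right_mono[OF that, of X] X unfolding X_def L_def by linarith
    have n1: "2 * real M / c1 * X \<le> real n" "600 * D * X \<le> real n" "A3 * X \<le> real n" "2 * X \<le> real n" "A5 * X \<le> real n" "real M * X \<le> real n"
      by (rule nX, use nn M in \<open>simp add: c_def\<close>)+
    define i0 where "i0 = n div M"
    have "real M * 1 \<le> real M * X" using X by (intro mult_left_mono) auto
    hence "real M \<le> real n" using n1 by simp
    hence i1: "1 \<le> i0" unfolding i0_def using M by (simp add: div_greater_zero_iff Suc_le_eq)
    have i2: "real i0 \<le> real n / real M" unfolding i0_def by (rule of_nat_div_le_of_nat)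
    have div_ge: "real n / real m - 1 \<le> real (n div m)" if "0 < m" for m
    proof -
      have "real n = real m * real (n div m) + real (n mod m)"
        unfolding of_nat_mult[symmetric] of_nat_add[symmetric] by simp
      moreover have "real (n mod m) \<le> real m" using that by simp
      ultimately show ?thesis using that by (simp add: pos_divide_le_eq algebra_simps)
    qed
    have i3: "real n / real M - 1 \<le> real i0" unfolding i0_def by (rule div_ge[OF M(2)])
    have "(8::real) ^ K \<le> 8 ^ (d + 1)" using K by (intro power_increasing) auto
    hence "(32::real) * 8 ^ K \<le> real M" by (simp add: M_def)
    hence "real n / real M \<le> real n / (32 * 8 ^ K)" by (intro divide_left_mono) (use M in auto)
    hence i4: "real i0 \<le> real n / (32 * 8 ^ K)" using i2 by linarith
    have "2 * real M / c1 * L \<le> real n" using n1(1) mult_left_mono[OF X(1) nn(1)] by linarith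
    hence "2 * real M * L \<le> c1 * real n" using c1 by (simp add: field_simps)
    hence cn: "2 * L \<le> c1 * (real n / real M)" using M by (simp add: field_simps)
    have "c1 * (real n / real M - 1) \<le> c1 * real i0" using i3 c1 by (intro mult_left_mono) auto
    hence "- c1 * real i0 \<le> c1 + (- 2 * L)" using cn by (simp add: algebra_simps)
    hence x1: "exp (- c1 * real i0) \<le> exp c1 * exp (- 2 * L)" unfolding exp_add[symmetric] by simp
    have "real n / real M \<le> real n / 1" using M by (intro divide_left_mono) auto
    hence "c1 * (real n / real M) \<le> c1 * real n" using c1 by (intro mult_left_mono) auto
    hence x2: "exp (- c1 * real n) \<le> exp (- 2 * L)" using cn by simp
    have b1: "Kc * (exp (- c1 * real i0) + exp (- c1 * real n)) \<le> Kc * (exp c1 + 1) * exp (- 2 * L)"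
      using mult_left_mono[OF add_mono[OF x1 x2] c1(2)] by (simp add: algebra_simps)
    have "real n / 3 - 1 \<le> real (n div 3)" using div_ge[of 3] by simp
    hence "(real n / 3 - 1) / D \<le> real (n div 3) / D" using D by (intro divide_right_mono) auto
    moreover have "1 / D \<le> 1" using D by simp
    moreover have "600 * D * L \<le> real n" using n1(2) mult_left_mono[OF X(1) nn(2)] by linarith
    hence "200 * L \<le> real n / 3 / D" using D by (simp add: field_simps)
    moreover have "- (1 / 100) * (u - 1) \<le> 1 + (- 2 * L)" if "v - w \<le> u" "w \<le> 1" "200 * L \<le> v" for u v w :: real
    proof -
      define z where "z = u / 100 - 1 / 100"
      have u: "u = 100 * z + 1" unfolding z_def right_diff_distrib by simp
      have "200 * L \<le> 100 * z + 1 + 1" using that unfolding u by linarith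
      hence "- z \<le> 1 + (- 2 * L)" by linarith
      thus ?thesis unfolding u by simp
    qed
    ultimately have "- (1 / 100) * (real (n div 3) / D - 1) \<le> 1 + (- 2 * L)" unfolding diff_divide_distrib by blast
    hence "exp (- (1 / 100) * (real (n div 3) / D - 1)) \<le> exp 1 * exp (- 2 * L)" unfolding exp_add[symmetric] by simp
    hence b2: "real (d + 1) * exp (- (1 / 100) * (real (n div 3) / D - 1)) \<le> real (d + 1) * exp 1 * exp (- 2 * L)"
      unfolding mult.assoc by (intro mult_left_mono) auto
    have b4: "exp (4 / p * \<theta> * B * L * (1 + ln (real l)) - real n / 8 ^ (K + 1) * ln 2) \<le> exp (- 2 * L)"
    proof -
      have "4 / p * \<theta> * B * L * (1 + ln (real l)) \<le> 4 / p * \<theta> * B * L * (2 * L)"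
        using lnl L p th B by (intro mult_left_mono) auto
      also have "\<dots> = 8 * B / p * X" by (simp add: X_def power2_eq_square)
      finally have 1: "4 / p * \<theta> * B * L * (1 + ln (real l)) \<le> 8 * B / p * X" .
      have "real n / 8 ^ (K + 1) * (2 / 3) \<le> real n / 8 ^ (K + 1) * ln 2" using ln2_ge_two_thirds by (intro mult_left_mono) auto
      moreover have "8 * B / p * X + 2 * X \<le> real n / 8 ^ (K + 1) * (2 / 3)"
      proof -
        have "12 * 8 ^ K * (8 * B / p * X + 2 * X) \<le> real n" using n1(3) by (simp add: A3_def algebra_simps)
        hence "8 * B / p * X + 2 * X \<le> real n / (12 * 8 ^ K)" by (simp add: pos_le_divide_eq mult.commute)
        thus ?thesis by simp
      qed
      ultimately show ?thesis using 1 X by simp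
    qed
    have lt: "l \<le> 2 ^ n"
    proof -
      have "L \<le> real n * (2 / 3)" using n1(4) X L by linarith
      also have "\<dots> \<le> real n * ln 2" using ln2_ge_two_thirds by (intro mult_left_mono) auto
      finally have "exp L \<le> exp (real n * ln 2)" by simp
      also have "\<dots> = 2 ^ n" unfolding exp_of_nat_mult by simp
      finally have "real l \<le> 2 ^ n" using lL by linarith
      hence "real l \<le> real (2 ^ n)" by (simp only: of_nat_power of_nat_numeral)
      thus ?thesis by (simp only: of_nat_le_iff)
    qed
    have "9 + 96 / p * \<theta> * B * L \<le> (9 + 96 / p * B) * X"
    proof -
      have "96 / p * B * (\<theta> * L) \<le> 96 / p * B * X" using X2 p B by (intro mult_left_mono) auto
      thus ?thesis using X by (simp add: algebra_simps)
    qed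
    moreover have "8 ^ K * ((9 + 96 / p * B) * X) \<le> real n" using n1(5) by (simp add: A5_def mult.assoc)
    hence "(9 + 96 / p * B) * X \<le> real n / 8 ^ K" by (simp add: pos_le_divide_eq mult.commute)
    ultimately have big: "9 + 96 / p * \<theta> * B * L \<le> real n / 8 ^ K" by linarith
    have "0 \<le> 96 / p * \<theta> * B * L" using p th B L by simp
    hence "8 \<le> real n / 8 ^ K" using big by linarith
    hence n8: "8 * 8 ^ K \<le> real n" by (simp add: pos_le_divide_eq)
    let ?b = "Kc * (exp (- c1 * real i0) + exp (- c1 * real n)) + real (d + 1) * exp (- (1 / 100) * (real (n div 3) / D - 1)) + (2 * 3 ^ d * exp (- 2 * L) + exp (- 2 * L))"
    have E: "expectation_le \<Omega> (\<lambda>\<omega>. err P f (candidate n (choice n \<omega>) \<omega>)) (2 * (e / 4) + ?b)"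
    proof (rule expectation_output_le[OF ach _ K_def p_def L lL bad[OF i1] _ b4[unfolded B_def] th(1)[unfolded theta_tilde_def, folded K_def] th(2) l lt i1 i4 n8 big[unfolded B_def]])
      show "measure \<Omega> {\<omega> \<in> space \<Omega>. selection_fails n \<omega>} \<le> real (d + 1) * exp (- (1 / 100) * (real (n div 3) / D - 1))"
        unfolding D_def by (rule measure_selection_fails_le)
    qed (use e in auto)
    have "?b \<le> C0 * exp (- 2 * L)" using b1 b2 unfolding C0_def distrib_right by linarith
    also have "\<dots> \<le> C0 * (e * e)"
    proof -
      have "exp (- L) = e / real l" unfolding exp_minus eL by (simp add: field_simps)
      also have "\<dots> \<le> e / 1" using e l by (intro divide_left_mono) auto
      finally have "exp (- L) * exp (- L) \<le> e * e" using e by (intro mult_mono) auto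
      moreover have "exp (- 2 * L) = exp (- L) * exp (- L)" unfolding exp_add[symmetric] by simp
      ultimately show ?thesis using C0 by (intro mult_left_mono) auto
    qed
    also have "\<dots> \<le> e / 2"
    proof -
      have "C0 * e \<le> 1 / 2" using e1(2) C0 by (simp add: field_simps)
      hence "C0 * e * e \<le> 1 / 2 * e" using e by (intro mult_right_mono) auto
      thus ?thesis by (simp add: mult.assoc)
    qed
    finally have "2 * (e / 4) + ?b \<le> e" by linarith
    thus "expectation_le \<Omega> (\<lambda>\<omega>. err P f (candidate n (choice n \<omega>) \<omega>)) e"
      using E unfolding expectation_le_def by linarith
  qed (use e0 e01 nn in \<open>auto simp: c_def\<close>)
qed

end

theorem theorem16:
  fixes C :: "('a::polish_space) classifier set"
    and R :: "'r measure"
    and A\<^sub>p :: "'r \<Rightarrow> ('a \<times> bool) list \<Rightarrow> 'a classifier"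
    and tie :: "nat \<Rightarrow> 'a classifier"
    and \<Lambda>\<^sub>p :: "'a label_complexity"
  assumes "vc_class C"
    and "class_measurable C"
    and "passive_algorithm R A\<^sub>p"
    and "passive_achieves C R A\<^sub>p \<Lambda>\<^sub>p"
    and "\<And>m. tie m \<in> classifiers"
  shows "\<exists>\<Lambda>\<^sub>a :: 'a label_complexity.
     active_achieves C R (meta_algorithm C tie A\<^sub>p) \<Lambda>\<^sub>a \<and>
     (\<forall>P. distribution P \<longrightarrow> (\<forall>f\<in>C.
        (\<forall>r>0. class_measurable (concept_ball C P f r)) \<longrightarrow>
        (\<exists>c::real. \<forall>\<^sub>F \<epsilon> in at_right 0. \<forall>l::nat. \<Lambda>\<^sub>p (\<epsilon> / 4) f P = enat l \<longrightarrow>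
           ereal_of_enat (\<Lambda>\<^sub>a \<epsilon> f P)
             \<le> ereal c * theta_tilde C P f (1 / real l) * ereal ((ln (real l / \<epsilon>))\<^sup>2))))"
proof -
  define Q where "Q = (\<lambda>\<epsilon> f P N. 1 \<le> N \<and> (\<forall>n\<ge>N. expectation_le (active_space P R)
     (\<lambda>\<omega>. err P f (run (\<lambda>i. f (fst \<omega> i)) (meta_algorithm C tie A\<^sub>p n \<omega>))) \<epsilon>))"
  \<comment> \<open>The smallest budget from which on the accuracy is kept. It is achieved by
    definition, even where no bound is available, and any sufficient budget bounds it; so one
    function serves all targets and distributions although the constants differ.\<close>
  define \<Lambda> :: "'a label_complexity" where "\<Lambda> = (\<lambda>\<epsilon> f P. if \<exists>N. Q \<epsilon> f P N then enat (LEAST N. Q \<epsilon> f P N) else \<infinity>)"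
  have \<Lambda>: "\<Lambda> \<epsilon> f P = \<infinity> \<or> (\<exists>N. \<Lambda> \<epsilon> f P = enat N \<and> Q \<epsilon> f P N)" for \<epsilon> f P
    unfolding \<Lambda>_def by (auto intro: LeastI)
  have \<Lambda>_le: "\<Lambda> \<epsilon> f P \<le> enat N" if "Q \<epsilon> f P N" for \<epsilon> f P N
    using that Least_le[of "Q \<epsilon> f P" N] unfolding \<Lambda>_def by auto
  have "active_achieves C R (meta_algorithm C tie A\<^sub>p) \<Lambda>"
    unfolding active_achieves_def
  proof (intro conjI ballI allI impI)
    show "active_algorithm (meta_algorithm C tie A\<^sub>p)" by (rule active_algorithm_meta)
    fix f P \<epsilon>
    show "1 \<le> \<Lambda> \<epsilon> f P" using \<Lambda>[of \<epsilon> f P] unfolding Q_def by (auto simp: one_enat_def)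
    show "expectation_le (active_space P R) (\<lambda>\<omega>. err P f (run (\<lambda>i. f (fst \<omega> i)) (meta_algorithm C tie A\<^sub>p n \<omega>))) \<epsilon>"
      if "\<Lambda> \<epsilon> f P \<le> enat n" for n
      using \<Lambda>[of \<epsilon> f P] that unfolding Q_def by auto
  qed
  moreover have "\<exists>c::real. \<forall>\<^sub>F \<epsilon> in at_right 0. \<forall>l::nat. \<Lambda>\<^sub>p (\<epsilon> / 4) f P = enat l \<longrightarrow>
      ereal_of_enat (\<Lambda> \<epsilon> f P) \<le> ereal c * theta_tilde C P f (1 / real l) * ereal ((ln (real l / \<epsilon>))\<^sup>2)"
    if P: "distribution P" and f: "f \<in> C" and ball: "\<forall>r>0. class_measurable (concept_ball C P f r)" for P f
  proof -
    obtain d where d: "vc_dim C = enat d" using assms(1) unfolding vc_class_def by (auto simp: less_infinityE)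
    have sP: "sets P = sets borel" "prob_space P" using P by (auto simp: distribution_def)
    interpret P: prob_space P by (rule sP(2))
    have uP: "space P = UNIV" using sets_eq_imp_space_eq[OF sP(1)] by simp
    interpret meta P C f d tie R A\<^sub>p
    proof unfold_locales
      show "space P = UNIV" by (rule uP)
      show "sets P = sets borel" by (rule sP(1))
      show "C \<subseteq> classifiers" using assms(1) by (simp add: vc_class_def)
      show "class_measurable (concept_ball C P f r)" if "0 < r" for r using ball that by blast
    qed (fact d f assms)+
    obtain c e0 where e0: "0 < e0" "e0 < 1" and c: "0 \<le> c" and main: "\<And>e l \<theta> n. 0 < e \<Longrightarrow> e < e0 \<Longrightarrow> 1 \<le> l \<Longrightarrow>
       (\<And>m. l \<le> m \<Longrightarrow> expectation_le (iid P \<Otimes>\<^sub>M R) (\<lambda>(X, \<rho>). err P f (A\<^sub>p \<rho> (sample f X m))) (e / 4)) \<Longrightarrow>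
       theta_tilde C P f (1 / real l) = ereal \<theta> \<Longrightarrow> 1 \<le> \<theta> \<Longrightarrow> c * (\<theta> * (ln (real l / e))\<^sup>2) \<le> real n \<Longrightarrow>
       expectation_le \<Omega> (\<lambda>\<omega>. err P f (candidate n (choice n \<omega>) \<omega>)) e"
      by (rule eventually_expectation_le) blast
    have "ereal_of_enat (\<Lambda> e f P) \<le> ereal (c + 1) * theta_tilde C P f (1 / real l) * ereal ((ln (real l / e))\<^sup>2)"
      if e: "0 < e" "e < min e0 (exp (- 1))" and l: "\<Lambda>\<^sub>p (e / 4) f P = enat l" for e l
    proof -
      have "e / 4 \<in> {0<..<1}" using e e0 by auto
      hence pa: "1 \<le> \<Lambda>\<^sub>p (e / 4) f P" "\<And>n. \<Lambda>\<^sub>p (e / 4) f P \<le> enat n \<Longrightarrow>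
           expectation_le (iid P \<Otimes>\<^sub>M R) (\<lambda>(X, \<rho>). err P f (A\<^sub>p \<rho> (sample f X n))) (e / 4)"
        using assms(4) f P unfolding passive_achieves_def by blast+
      have l1: "1 \<le> l" using pa(1) unfolding l by (simp add: one_enat_def)
      obtain \<theta> where \<theta>: "theta_tilde C P f (1 / real l) = ereal \<theta>" "1 \<le> \<theta>"
        unfolding theta_tilde_def using theta_real[OF l1] by blast
      define x where "x = \<theta> * (ln (real l / e))\<^sup>2"
      \<comment> \<open>Below \<open>exp (- 1)\<close> the logarithm is at least 1, hence so is
        \<open>x\<close>; the rounding of \<open>c * x\<close> to an integer is then covered by
        \<open>c + 1\<close>.\<close>
      have "exp 1 * e \<le> exp 1 * exp (- 1)" using e by (intro mult_left_mono) auto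
      also have "\<dots> = (1::real)" unfolding exp_add[symmetric] by simp
      finally have "exp 1 \<le> real l / e" using l1 e by (simp add: pos_le_divide_eq)
      hence "1 \<le> ln (real l / e)" using l1 e by (subst ln_ge_iff) auto
      hence "1 \<le> (ln (real l / e))\<^sup>2" by (rule one_le_power)
      hence "1 * 1 \<le> x" unfolding x_def using \<theta> by (intro mult_mono) auto
      define N where "N = max 1 (nat \<lceil>c * x\<rceil>)"
      have "Q e f P N" unfolding Q_def active_space_eq run_meta_eq
      proof (intro conjI allI impI)
        show "1 \<le> N" by (simp add: N_def)
        fix n assume "N \<le> n"
        hence "c * x \<le> real n" unfolding N_def by linarith
        thus "expectation_le \<Omega> (\<lambda>\<omega>. err P f (candidate n (choice n \<omega>) \<omega>)) e"
          using main[OF e(1) _ l1 _ \<theta>] pa(2) e(2) unfolding l x_def by simp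
      qed
      from \<Lambda>_le[OF this] have "ereal_of_enat (\<Lambda> e f P) \<le> ereal (real N)"
        by (metis ereal_of_enat_le_iff ereal_of_enat_simps(1))
      also have "real N \<le> (c + 1) * x"
      proof -
        have "0 \<le> c * x" using c \<open>1 * 1 \<le> x\<close> by simp
        hence "real N \<le> c * x + 1" unfolding N_def by linarith
        thus ?thesis using \<open>1 * 1 \<le> x\<close> by (simp add: algebra_simps)
      qed
      finally show ?thesis by (simp add: \<theta>(1) x_def mult.assoc)
    qed
    moreover have "\<forall>\<^sub>F e in at_right 0. e \<in> {0<..<min e0 (exp (- 1))}"
      by (rule eventually_at_right_real) (use e0 in simp)
    ultimately have "\<forall>\<^sub>F e in at_right 0. \<forall>l::nat. \<Lambda>\<^sub>p (e / 4) f P = enat l \<longrightarrow>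
      ereal_of_enat (\<Lambda> e f P) \<le> ereal (c + 1) * theta_tilde C P f (1 / real l) * ereal ((ln (real l / e))\<^sup>2)"
      by (elim eventually_mono) auto
    thus ?thesis by blast
  qed
  ultimately show ?thesis by blast
qed

end
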